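(* Let $A,B$ be Artin algebras and ${}_AM_B$ a bimodule with $M_B$ projective. Then $\mathscr S(A,M,B)$ is a Frobenius category (with the canonical exact structure) if and only if both $A$ and $B$ are selfinjective algebras and ${}_AM$ is projective.
   Context: All algebras are Artin algebras over a commutative artinian ring $R$ (bimodules are such that $\Lambda=\begin{bmatrix}A&M\\0&B\end{bmatrix}$ is again an Artin $R$-algebra); all modules are finitely generated; subcategories are full and closed under isomorphisms. Left $\Lambda$-modules are identified with triples $\begin{bmatrix}X\\ Y\end{bmatrix}_\phi$, with $X\in A\text{-mod}$, $Y\in B\text{-mod}$ and $\phi:M\otimes_BY\to X$ an $A$-map; a morphism is a pair $(f_1,f_2)$ of an $A$-map and a $B$-map with $f_1\phi_1=\phi_2(1\otimes f_2)$. $\mathscr S(A,M,B)$ is the subcategory of $\Lambda\text{-mod}$ of all $\begin{bmatrix}X\\ Y\end{bmatrix}_\phi$ with $\phi$ monic; it is extension-closed, and its canonical exact structure consists of the short exact sequences of $\Lambda$-modules with all terms in $\mathscr S(A,M,B)$. A Frobenius category is an exact category with enough projective objects and enough injective objects in which projective and injective objects coincide. *)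

theory Defs
  imports "HOL-Algebra.Free_Abelian_Groups" "HOL-Algebra.Ideal" "HOL-Algebra.Module"
begin

section \<open>Modules over a not necessarily commutative ring\<close>

text \<open>
  The locale \<^locale>\<open>module\<close> requires a commutative base ring, so left modules are
  introduced here, reusing the record type of that theory. As usual for module records, the
  fields \<open>mult\<close> and \<open>one\<close> of \<open>X\<close> play no role.
\<close>

locale left_module = A: ring A + X: abelian_group X
  for A :: "('a, 'k) ring_scheme" and X :: "('a, 'x, 'l) module_scheme" +
  assumes smult_closed:
      "\<lbrakk>a \<in> carrier A; x \<in> carrier X\<rbrakk> \<Longrightarrow> a \<odot>\<^bsub>X\<^esub> x \<in> carrier X"
    and smult_l_distr:
      "\<lbrakk>a \<in> carrier A; b \<in> carrier A; x \<in> carrier X\<rbrakk> \<Longrightarrow>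
        (a \<oplus>\<^bsub>A\<^esub> b) \<odot>\<^bsub>X\<^esub> x = a \<odot>\<^bsub>X\<^esub> x \<oplus>\<^bsub>X\<^esub> b \<odot>\<^bsub>X\<^esub> x"
    and smult_r_distr:
      "\<lbrakk>a \<in> carrier A; x \<in> carrier X; y \<in> carrier X\<rbrakk> \<Longrightarrow>
        a \<odot>\<^bsub>X\<^esub> (x \<oplus>\<^bsub>X\<^esub> y) = a \<odot>\<^bsub>X\<^esub> x \<oplus>\<^bsub>X\<^esub> a \<odot>\<^bsub>X\<^esub> y"
    and smult_assoc1:
      "\<lbrakk>a \<in> carrier A; b \<in> carrier A; x \<in> carrier X\<rbrakk> \<Longrightarrow>
        (a \<otimes>\<^bsub>A\<^esub> b) \<odot>\<^bsub>X\<^esub> x = a \<odot>\<^bsub>X\<^esub> (b \<odot>\<^bsub>X\<^esub> x)"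
    and smult_one: "x \<in> carrier X \<Longrightarrow> \<one>\<^bsub>A\<^esub> \<odot>\<^bsub>X\<^esub> x = x"

definition finitely_generated ::
    "('a, 'k) ring_scheme \<Rightarrow> ('a, 'x, 'l) module_scheme \<Rightarrow> bool" where
  "finitely_generated A X \<longleftrightarrow>
     (\<exists>S. finite S \<and> S \<subseteq> carrier X \<and> (\<forall>H. submodule H A X \<and> S \<subseteq> H \<longrightarrow> H = carrier X))"

definition fg_module :: "('a, 'k) ring_scheme \<Rightarrow> ('a, 'x, 'l) module_scheme \<Rightarrow> bool" where
  "fg_module A X \<longleftrightarrow> left_module A X \<and> finitely_generated A X"

text \<open>Module homomorphisms are extensional, so that equal homomorphisms are equal functions.\<close>

definition mod_hom ::
    "('a, 'k) ring_scheme \<Rightarrow> ('a, 'x, 'l) module_scheme \<Rightarrow> ('a, 'y, 'm) module_scheme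
      \<Rightarrow> ('x \<Rightarrow> 'y) set" where
  "mod_hom A X Y =
     {f \<in> carrier X \<rightarrow>\<^sub>E carrier Y.
        (\<forall>x \<in> carrier X. \<forall>x' \<in> carrier X. f (x \<oplus>\<^bsub>X\<^esub> x') = f x \<oplus>\<^bsub>Y\<^esub> f x') \<and>
        (\<forall>a \<in> carrier A. \<forall>x \<in> carrier X. f (a \<odot>\<^bsub>X\<^esub> x) = a \<odot>\<^bsub>Y\<^esub> f x)}"

text \<open>
  HOL cannot quantify over modules on all types. Every finitely generated \<open>A\<close>-module is a
  quotient of some \<open>A\<^sup>n\<close>, and the elements of such a quotient are sets of functions
  from \<open>nat\<close> to the type of elements of \<open>A\<close>. The modules with carrier in this type thus
  represent all isomorphism classes of finitely generated modules; the lemma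
  \<open>fg_module_representative\<close> below makes this precise.
\<close>

type_synonym 'a fgmod = "('a, (nat \<Rightarrow> 'a) set) module"

lemma fg_module_transport:
  assumes X: "fg_module A X" and g: "\<And>x. x \<in> carrier X \<Longrightarrow> g (f x) = x"
  defines "Y \<equiv> \<lparr>carrier = f ` carrier X, mult = undefined, one = undefined, zero = f \<zero>\<^bsub>X\<^esub>,
    add = (\<lambda>u v. f (g u \<oplus>\<^bsub>X\<^esub> g v)), smult = (\<lambda>a u. f (a \<odot>\<^bsub>X\<^esub> g u))\<rparr>"
  shows "fg_module A Y"
proof -
  interpret X: left_module A X using X by (simp add: fg_module_def)
  have "abelian_group Y"
  proof (rule abelian_groupI)
    fix u assume "u \<in> carrier Y"
    then obtain x where "x \<in> carrier X" "u = f x" by (auto simp: Y_def)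
    then have "f (\<ominus>\<^bsub>X\<^esub> x) \<in> carrier Y \<and> f (\<ominus>\<^bsub>X\<^esub> x) \<oplus>\<^bsub>Y\<^esub> u = \<zero>\<^bsub>Y\<^esub>"
      by (auto simp: Y_def g X.X.l_neg)
    then show "\<exists>v \<in> carrier Y. v \<oplus>\<^bsub>Y\<^esub> u = \<zero>\<^bsub>Y\<^esub>" by blast
  qed (auto simp: Y_def g X.X.a_ac)
  then have mod: "left_module A Y"
    by (intro left_module.intro left_module_axioms.intro X.A.ring_axioms)
      (auto simp: Y_def g X.smult_closed X.smult_l_distr X.smult_r_distr X.smult_assoc1 X.smult_one)
  obtain S where S: "finite S" "S \<subseteq> carrier X"
      "\<And>H. submodule H A X \<Longrightarrow> S \<subseteq> H \<Longrightarrow> H = carrier X"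
    using X by (auto simp: fg_module_def finitely_generated_def)
  interpret Y: left_module A Y by (rule mod)
  have "H = carrier Y" if H: "submodule H A Y" and SH: "f ` S \<subseteq> H" for H
  proof -
    interpret H: submodule H A Y by (rule H)
    have sub: "H \<subseteq> f ` carrier X" using H.subset by (simp add: Y_def)
    have neg: "f (\<ominus>\<^bsub>X\<^esub> x) = \<ominus>\<^bsub>Y\<^esub> f x" if "x \<in> carrier X" for x
    proof -
      have "f (\<ominus>\<^bsub>X\<^esub> x) \<oplus>\<^bsub>Y\<^esub> f x = \<zero>\<^bsub>Y\<^esub>" using that by (simp add: Y_def g X.X.l_neg)
      then show ?thesis using that Y.X.minus_equality[of "f (\<ominus>\<^bsub>X\<^esub> x)" "f x"]
        by (simp add: Y_def)
    qed
    have "submodule {x \<in> carrier X. f x \<in> H} A X"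
    proof (intro submodule.intro subgroup.intro submodule_axioms.intro)
      fix x y assume "x \<in> {x \<in> carrier X. f x \<in> H}" "y \<in> {x \<in> carrier X. f x \<in> H}"
      then show "x \<otimes>\<^bsub>add_monoid X\<^esub> y \<in> {x \<in> carrier X. f x \<in> H}"
        using H.m_closed[of "f x" "f y"] by (auto simp: Y_def g)
    next
      show "\<one>\<^bsub>add_monoid X\<^esub> \<in> {x \<in> carrier X. f x \<in> H}"
        using H.one_closed by (simp add: Y_def)
    next
      fix x assume x: "x \<in> {x \<in> carrier X. f x \<in> H}"
      then have "\<ominus>\<^bsub>Y\<^esub> f x \<in> H" using H.m_inv_closed[of "f x"] by (simp add: a_inv_def)
      with x show "inv\<^bsub>add_monoid X\<^esub> x \<in> {x \<in> carrier X. f x \<in> H}"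
        using neg[of x] by (simp add: a_inv_def[symmetric])
    next
      fix a x assume "a \<in> carrier A" "x \<in> {x \<in> carrier X. f x \<in> H}"
      then show "a \<odot>\<^bsub>X\<^esub> x \<in> {x \<in> carrier X. f x \<in> H}"
        using H.smult_closed[of a "f x"] by (auto simp: Y_def g X.smult_closed)
    qed auto
    moreover have "S \<subseteq> {x \<in> carrier X. f x \<in> H}" using S SH by auto
    ultimately have "{x \<in> carrier X. f x \<in> H} = carrier X" by (rule S(3))
    then show ?thesis using sub by (auto simp: Y_def)
  qed
  moreover have "finite (f ` S)" "f ` S \<subseteq> carrier Y" using S by (auto simp: Y_def)
  ultimately show ?thesis using mod unfolding fg_module_def finitely_generated_def by blast
qed

fun lin_comb :: "('a, 'x, 'l) module_scheme \<Rightarrow> 'x list \<Rightarrow> (nat \<Rightarrow> 'a) \<Rightarrow> 'x" where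
  "lin_comb X [] c = \<zero>\<^bsub>X\<^esub>"
| "lin_comb X (x # xs) c = c 0 \<odot>\<^bsub>X\<^esub> x \<oplus>\<^bsub>X\<^esub> lin_comb X xs (\<lambda>n. c (Suc n))"

lemma (in left_module) submodule_lin_comb:
  assumes "set xs \<subseteq> carrier X"
  shows "submodule (lin_comb X xs ` (UNIV \<rightarrow> carrier A)) A X"
    and "set xs \<subseteq> lin_comb X xs ` (UNIV \<rightarrow> carrier A)"
proof -
  have zero: "\<zero>\<^bsub>A\<^esub> \<odot>\<^bsub>X\<^esub> x = \<zero>\<^bsub>X\<^esub>" if "x \<in> carrier X" for x
    using that smult_l_distr[of "\<zero>\<^bsub>A\<^esub>" "\<zero>\<^bsub>A\<^esub>" x] smult_closed[of "\<zero>\<^bsub>A\<^esub>" x]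
      X.add.l_cancel_one'[of "\<zero>\<^bsub>A\<^esub> \<odot>\<^bsub>X\<^esub> x" "\<zero>\<^bsub>A\<^esub> \<odot>\<^bsub>X\<^esub> x"] by simp
  have zero': "a \<odot>\<^bsub>X\<^esub> \<zero>\<^bsub>X\<^esub> = \<zero>\<^bsub>X\<^esub>" if "a \<in> carrier A" for a
    using that smult_r_distr[of a "\<zero>\<^bsub>X\<^esub>" "\<zero>\<^bsub>X\<^esub>"] smult_closed[of a "\<zero>\<^bsub>X\<^esub>"]
      X.add.l_cancel_one'[of "a \<odot>\<^bsub>X\<^esub> \<zero>\<^bsub>X\<^esub>" "a \<odot>\<^bsub>X\<^esub> \<zero>\<^bsub>X\<^esub>"] by simp
  have neg: "(\<ominus>\<^bsub>A\<^esub> \<one>\<^bsub>A\<^esub>) \<odot>\<^bsub>X\<^esub> x = \<ominus>\<^bsub>X\<^esub> x" if "x \<in> carrier X" for x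
    using that smult_l_distr[of "\<ominus>\<^bsub>A\<^esub> \<one>\<^bsub>A\<^esub>" "\<one>\<^bsub>A\<^esub>" x] zero[OF that]
      smult_closed[of "\<ominus>\<^bsub>A\<^esub> \<one>\<^bsub>A\<^esub>" x] X.minus_equality[of "(\<ominus>\<^bsub>A\<^esub> \<one>\<^bsub>A\<^esub>) \<odot>\<^bsub>X\<^esub> x" x]
    by (simp add: A.l_neg smult_one)
  have closed: "lin_comb X xs c \<in> carrier X"
    if "set xs \<subseteq> carrier X" "c \<in> UNIV \<rightarrow> carrier A" for xs c
    using that by (induction xs arbitrary: c) (auto simp: Pi_iff smult_closed)
  have add: "lin_comb X xs (\<lambda>n. c n \<oplus>\<^bsub>A\<^esub> d n) = lin_comb X xs c \<oplus>\<^bsub>X\<^esub> lin_comb X xs d"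
    if "set xs \<subseteq> carrier X" "c \<in> UNIV \<rightarrow> carrier A" "d \<in> UNIV \<rightarrow> carrier A" for xs c d
    using that
  proof (induction xs arbitrary: c d)
    case (Cons x xs)
    then have "(\<lambda>n. c (Suc n)) \<in> UNIV \<rightarrow> carrier A" "(\<lambda>n. d (Suc n)) \<in> UNIV \<rightarrow> carrier A"
      by auto
    with Cons closed[of xs "\<lambda>n. c (Suc n)"] closed[of xs "\<lambda>n. d (Suc n)"] show ?case
      by (simp add: Pi_iff smult_l_distr smult_closed X.a_ac)
  qed simp
  have smult: "lin_comb X xs (\<lambda>n. a \<otimes>\<^bsub>A\<^esub> c n) = a \<odot>\<^bsub>X\<^esub> lin_comb X xs c"
    if "set xs \<subseteq> carrier X" "c \<in> UNIV \<rightarrow> carrier A" "a \<in> carrier A" for xs c a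
    using that
  proof (induction xs arbitrary: c)
    case (Cons x xs)
    then have "(\<lambda>n. c (Suc n)) \<in> UNIV \<rightarrow> carrier A" by auto
    with Cons closed[of xs "\<lambda>n. c (Suc n)"] show ?case
      by (simp add: Pi_iff smult_assoc1 smult_r_distr smult_closed)
  qed (simp add: zero')
  have null: "lin_comb X xs (\<lambda>n. \<zero>\<^bsub>A\<^esub>) = \<zero>\<^bsub>X\<^esub>" if "set xs \<subseteq> carrier X" for xs
    using that by (induction xs) (auto simp: zero)
  let ?H = "lin_comb X xs ` (UNIV \<rightarrow> carrier A)"
  have H_smult: "a \<odot>\<^bsub>X\<^esub> h \<in> ?H" if "a \<in> carrier A" "h \<in> ?H" for a h
  proof -
    from that obtain c where c: "c \<in> UNIV \<rightarrow> carrier A" "h = lin_comb X xs c" by blast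
    then have "a \<odot>\<^bsub>X\<^esub> h = lin_comb X xs (\<lambda>n. a \<otimes>\<^bsub>A\<^esub> c n)" using smult assms that by simp
    moreover have "(\<lambda>n. a \<otimes>\<^bsub>A\<^esub> c n) \<in> UNIV \<rightarrow> carrier A" using c that by auto
    ultimately show ?thesis by blast
  qed
  have H_sub: "?H \<subseteq> carrier X" using closed assms by blast
  show "submodule ?H A X"
  proof (intro submodule.intro subgroup.intro submodule_axioms.intro)
    fix x y assume "x \<in> ?H" "y \<in> ?H"
    then obtain c d where cd: "c \<in> UNIV \<rightarrow> carrier A" "x = lin_comb X xs c"
      "d \<in> UNIV \<rightarrow> carrier A" "y = lin_comb X xs d" by blast
    then have "x \<oplus>\<^bsub>X\<^esub> y = lin_comb X xs (\<lambda>n. c n \<oplus>\<^bsub>A\<^esub> d n)" using add assms by simp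
    moreover have "(\<lambda>n. c n \<oplus>\<^bsub>A\<^esub> d n) \<in> UNIV \<rightarrow> carrier A" using cd by auto
    ultimately show "x \<otimes>\<^bsub>add_monoid X\<^esub> y \<in> ?H" by simp
  next
    have "(\<lambda>n. \<zero>\<^bsub>A\<^esub>) \<in> (UNIV :: nat set) \<rightarrow> carrier A" by auto
    then show "\<one>\<^bsub>add_monoid X\<^esub> \<in> ?H" using null[OF assms] by (metis image_eqI monoid.simps(2))
  next
    fix x assume x: "x \<in> ?H"
    then have "(\<ominus>\<^bsub>A\<^esub> \<one>\<^bsub>A\<^esub>) \<odot>\<^bsub>X\<^esub> x \<in> ?H" by (intro H_smult) auto
    then show "inv\<^bsub>add_monoid X\<^esub> x \<in> ?H" using neg x H_sub by (auto simp: a_inv_def[symmetric])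
  qed (use H_sub H_smult in auto)
  show "set xs \<subseteq> ?H"
    using assms
  proof (induction xs)
    case (Cons x xs)
    let ?H' = "lin_comb X xs ` (UNIV \<rightarrow> carrier A)"
    have x: "x = lin_comb X (x # xs) (\<lambda>n. if n = 0 then \<one>\<^bsub>A\<^esub> else \<zero>\<^bsub>A\<^esub>)"
      using Cons.prems by (simp add: smult_one null)
    have "x \<in> lin_comb X (x # xs) ` (UNIV \<rightarrow> carrier A)"
      by (rule image_eqI[where f = "lin_comb X (x # xs)", OF x]) auto
    moreover have "y \<in> lin_comb X (x # xs) ` (UNIV \<rightarrow> carrier A)" if "y \<in> ?H'" for y
    proof -
      from that obtain c where c: "c \<in> UNIV \<rightarrow> carrier A" "y = lin_comb X xs c" by blast
      then have "y = lin_comb X (x # xs) (case_nat \<zero>\<^bsub>A\<^esub> c)"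
        using Cons.prems closed[of xs c] by (simp add: zero)
      moreover have "case_nat \<zero>\<^bsub>A\<^esub> c \<in> UNIV \<rightarrow> carrier A"
        using c by (auto simp: Pi_iff split: nat.split)
      ultimately show ?thesis by blast
    qed
    ultimately show ?case using Cons by auto
  qed simp
qed

lemma fg_module_representative:
  fixes A :: "('a, 'k) ring_scheme" and X :: "('a, 'x, 'l) module_scheme"
  assumes "fg_module A X"
  obtains Y :: "'a fgmod" and f
  where "fg_module A Y" "f \<in> mod_hom A X Y" "bij_betw f (carrier X) (carrier Y)"
proof -
  interpret left_module A X using assms by (simp add: fg_module_def)
  obtain S where S: "finite S" "S \<subseteq> carrier X"
      "\<And>H. submodule H A X \<Longrightarrow> S \<subseteq> H \<Longrightarrow> H = carrier X"
    using assms by (auto simp: fg_module_def finitely_generated_def)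
  obtain xs where xs: "set xs = S" using finite_list[OF S(1)] by blast
  have surj: "lin_comb X xs ` (UNIV \<rightarrow> carrier A) = carrier X"
    by (rule S(3)) (use submodule_lin_comb[of xs] xs S in auto)
  define f where "f = (\<lambda>x. {c \<in> UNIV \<rightarrow> carrier A. lin_comb X xs c = x})"
  define g where "g = inv_into (carrier X) f"
  have inj: "inj_on f (carrier X)"
  proof (rule inj_onI)
    fix x y assume xy: "x \<in> carrier X" "f x = f y"
    then have "x \<in> lin_comb X xs ` (UNIV \<rightarrow> carrier A)" by (simp add: surj)
    then obtain c where "c \<in> f x" unfolding f_def by blast
    moreover from this have "c \<in> f y" by (simp only: xy(2))
    ultimately show "x = y" unfolding f_def by simp
  qed
  then have g: "g (f x) = x" if "x \<in> carrier X" for x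
    using that by (simp add: g_def)
  define Y :: "'a fgmod" where "Y = \<lparr>carrier = f ` carrier X, mult = undefined, one = undefined,
    zero = f \<zero>\<^bsub>X\<^esub>, add = (\<lambda>u v. f (g u \<oplus>\<^bsub>X\<^esub> g v)), smult = (\<lambda>a u. f (a \<odot>\<^bsub>X\<^esub> g u))\<rparr>"
  have "fg_module A Y"
    unfolding Y_def by (rule fg_module_transport[where f = f and g = g, OF assms g])
  moreover have "restrict f (carrier X) \<in> mod_hom A X Y"
    by (auto simp: mod_hom_def Y_def g smult_closed)
  moreover have "bij_betw (restrict f (carrier X)) (carrier X) (carrier Y)"
    using inj by (auto simp: bij_betw_def Y_def inj_on_def)
  ultimately show thesis by (rule that)
qed

definition projective_module ::
    "('a, 'k) ring_scheme \<Rightarrow> ('a, 'x, 'l) module_scheme \<Rightarrow> bool" where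
  "projective_module A P \<longleftrightarrow> fg_module A P \<and>
     (\<forall>(X :: 'a fgmod) (Y :: 'a fgmod). fg_module A X \<and> fg_module A Y \<longrightarrow>
        (\<forall>g \<in> mod_hom A X Y. \<forall>h \<in> mod_hom A P Y. g ` carrier X = carrier Y \<longrightarrow>
           (\<exists>k \<in> mod_hom A P X. \<forall>p \<in> carrier P. g (k p) = h p)))"

definition injective_module ::
    "('a, 'k) ring_scheme \<Rightarrow> ('a, 'x, 'l) module_scheme \<Rightarrow> bool" where
  "injective_module A E \<longleftrightarrow> fg_module A E \<and>
     (\<forall>(X :: 'a fgmod) (Y :: 'a fgmod). fg_module A X \<and> fg_module A Y \<longrightarrow>
        (\<forall>i \<in> mod_hom A X Y. \<forall>h \<in> mod_hom A X E. inj_on i (carrier X) \<longrightarrow>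
           (\<exists>k \<in> mod_hom A Y E. \<forall>x \<in> carrier X. k (i x) = h x)))"

definition regular_module :: "('a, 'k) ring_scheme \<Rightarrow> ('a, 'a) module" where
  "regular_module A =
     \<lparr>carrier = carrier A, mult = mult A, one = one A, zero = zero A, add = add A,
      smult = mult A\<rparr>"

text \<open>
  Injectivity of the regular left module. For Artin algebras this is equivalent to injectivity of
  the regular right module.
\<close>

definition selfinjective :: "('a, 'k) ring_scheme \<Rightarrow> bool" where
  "selfinjective A \<longleftrightarrow> injective_module A (regular_module A)"


section \<open>Artin algebras\<close>

locale artinian_cring = cring R for R (structure) +
  assumes descending_chain_condition:
    "\<lbrakk>\<And>n. ideal (I n) R; \<And>n. I (Suc n) \<subseteq> I n\<rbrakk> \<Longrightarrow> \<exists>n. \<forall>k \<ge> n. I k = I n"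

text \<open>
  An \<open>R\<close>-algebra is a record of type \<open>module\<close> over \<open>R\<close> whose multiplication is
  significant, as in \<^locale>\<open>algebra\<close>, which only covers the commutative case.
\<close>

locale artin_algebra = R: artinian_cring R + A: ring A + mod: module R A
  for R :: "('r, 'k) ring_scheme" and A :: "('r, 'a, 'l) module_scheme" +
  assumes smult_mult_left:
      "\<lbrakk>r \<in> carrier R; a \<in> carrier A; b \<in> carrier A\<rbrakk> \<Longrightarrow>
        (r \<odot>\<^bsub>A\<^esub> a) \<otimes>\<^bsub>A\<^esub> b = r \<odot>\<^bsub>A\<^esub> (a \<otimes>\<^bsub>A\<^esub> b)"
    and smult_mult_right:
      "\<lbrakk>r \<in> carrier R; a \<in> carrier A; b \<in> carrier A\<rbrakk> \<Longrightarrow>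
        a \<otimes>\<^bsub>A\<^esub> (r \<odot>\<^bsub>A\<^esub> b) = r \<odot>\<^bsub>A\<^esub> (a \<otimes>\<^bsub>A\<^esub> b)"
    and finitely_generated: "finitely_generated R A"


section \<open>Bimodules, the triangular matrix algebra and tensor products\<close>

record ('a, 'm, 'b) bimodule = "('a, 'm) module" +
  rsmult :: "'m \<Rightarrow> 'b \<Rightarrow> 'm" (infixl \<open>\<odot>\<^sub>r\<index>\<close> 70)

definition opposite_ring :: "('b, 'k) ring_scheme \<Rightarrow> ('b, 'k) ring_scheme" where
  "opposite_ring B = B\<lparr>mult := \<lambda>x y. y \<otimes>\<^bsub>B\<^esub> x\<rparr>"

text \<open>The right module underlying a bimodule, as a left module over the opposite ring.\<close>

definition right_module_of :: "('a, 'm, 'b) bimodule \<Rightarrow> ('b, 'm) module" where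
  "right_module_of M =
     \<lparr>carrier = carrier M, mult = mult M, one = one M, zero = zero M, add = add M,
      smult = (\<lambda>b m. m \<odot>\<^sub>r\<^bsub>M\<^esub> b)\<rparr>"

locale bimodule = left: left_module A M + right: left_module "opposite_ring B" "right_module_of M"
  for A :: "('a, 'k) ring_scheme" and M :: "('a, 'm, 'b) bimodule"
    and B :: "('b, 'l) ring_scheme" +
  assumes actions_commute:
    "\<lbrakk>a \<in> carrier A; m \<in> carrier M; b \<in> carrier B\<rbrakk> \<Longrightarrow>
      (a \<odot>\<^bsub>M\<^esub> m) \<odot>\<^sub>r\<^bsub>M\<^esub> b = a \<odot>\<^bsub>M\<^esub> (m \<odot>\<^sub>r\<^bsub>M\<^esub> b)"

text \<open>
  The triple \<open>(a, m, b)\<close> stands for the matrix with rows \<open>a m\<close> and \<open>0 b\<close>. A scalar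
  \<open>r\<close> acts on \<open>M\<close> through \<open>A\<close>; for the result to be an \<open>R\<close>-algebra it must
  act in the same way through \<open>B\<close>.
\<close>

definition triangular_algebra ::
    "('r, 'a) module \<Rightarrow> ('a, 'm, 'b) bimodule \<Rightarrow> ('r, 'b) module \<Rightarrow> ('r, 'a \<times> 'm \<times> 'b) module"
  where
  "triangular_algebra A M B =
     \<lparr>carrier = carrier A \<times> carrier M \<times> carrier B,
      mult = (\<lambda>(a, m, b) (a', m', b').
        (a \<otimes>\<^bsub>A\<^esub> a', a \<odot>\<^bsub>M\<^esub> m' \<oplus>\<^bsub>M\<^esub> m \<odot>\<^sub>r\<^bsub>M\<^esub> b', b \<otimes>\<^bsub>B\<^esub> b')),
      one = (\<one>\<^bsub>A\<^esub>, \<zero>\<^bsub>M\<^esub>, \<one>\<^bsub>B\<^esub>),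
      zero = (\<zero>\<^bsub>A\<^esub>, \<zero>\<^bsub>M\<^esub>, \<zero>\<^bsub>B\<^esub>),
      add = (\<lambda>(a, m, b) (a', m', b'). (a \<oplus>\<^bsub>A\<^esub> a', m \<oplus>\<^bsub>M\<^esub> m', b \<oplus>\<^bsub>B\<^esub> b')),
      smult = (\<lambda>r (a, m, b). (r \<odot>\<^bsub>A\<^esub> a, (r \<odot>\<^bsub>A\<^esub> \<one>\<^bsub>A\<^esub>) \<odot>\<^bsub>M\<^esub> m, r \<odot>\<^bsub>B\<^esub> b))\<rparr>"

text \<open>
  The tensor product of \<open>M\<close> and \<open>Y\<close> over \<open>B\<close>: the free abelian group on the pairs
  \<open>(m, y)\<close> modulo the subgroup generated by the usual relations. Its elements are cosets.
\<close>

definition tensor_free ::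
    "('a, 'm, 'b) bimodule \<Rightarrow> ('b, 'y) module \<Rightarrow> (('m \<times> 'y) \<Rightarrow>\<^sub>0 int) monoid" where
  "tensor_free M Y = free_Abelian_group (carrier M \<times> carrier Y)"

definition tensor_relators ::
    "('a, 'm, 'b) bimodule \<Rightarrow> ('b, 'k) ring_scheme \<Rightarrow> ('b, 'y) module
      \<Rightarrow> (('m \<times> 'y) \<Rightarrow>\<^sub>0 int) set" where
  "tensor_relators M B Y =
     {frag_of (m \<oplus>\<^bsub>M\<^esub> m', y) - frag_of (m, y) - frag_of (m', y) | m m' y.
        m \<in> carrier M \<and> m' \<in> carrier M \<and> y \<in> carrier Y} \<union>
     {frag_of (m, y \<oplus>\<^bsub>Y\<^esub> y') - frag_of (m, y) - frag_of (m, y') | m y y'.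
        m \<in> carrier M \<and> y \<in> carrier Y \<and> y' \<in> carrier Y} \<union>
     {frag_of (m \<odot>\<^sub>r\<^bsub>M\<^esub> b, y) - frag_of (m, b \<odot>\<^bsub>Y\<^esub> y) | m b y.
        m \<in> carrier M \<and> b \<in> carrier B \<and> y \<in> carrier Y}"

definition tensor_null ::
    "('a, 'm, 'b) bimodule \<Rightarrow> ('b, 'k) ring_scheme \<Rightarrow> ('b, 'y) module
      \<Rightarrow> (('m \<times> 'y) \<Rightarrow>\<^sub>0 int) set" where
  "tensor_null M B Y = generate (tensor_free M Y) (tensor_relators M B Y)"

text \<open>
  If an additive map \<open>h\<close> of free abelian groups sends the subgroup \<open>K\<close> into \<open>K'\<close>, the
  induced map of the quotients sends a coset \<open>C\<close> to \<open>K' + h(C)\<close>. This is used for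
  the action \<open>a (m \<otimes> y) = (a m) \<otimes> y\<close> and for \<open>1 \<otimes> f\<close>.
\<close>

definition tensor ::
    "('a, 'm, 'b) bimodule \<Rightarrow> ('b, 'k) ring_scheme \<Rightarrow> ('b, 'y) module
      \<Rightarrow> ('a, (('m \<times> 'y) \<Rightarrow>\<^sub>0 int) set) module" where
  "tensor M B Y =
     \<lparr>carrier = carrier (tensor_free M Y Mod tensor_null M B Y),
      mult = undefined, one = undefined,
      zero = one (tensor_free M Y Mod tensor_null M B Y),
      add = mult (tensor_free M Y Mod tensor_null M B Y),
      smult = (\<lambda>a C. tensor_null M B Y <#>\<^bsub>tensor_free M Y\<^esub>
                 frag_extend (\<lambda>(m, y). frag_of (a \<odot>\<^bsub>M\<^esub> m, y)) ` C)\<rparr>"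

definition tensor_map ::
    "('a, 'm, 'b) bimodule \<Rightarrow> ('b, 'k) ring_scheme \<Rightarrow> ('b, 'y) module \<Rightarrow> ('b, 'z) module
      \<Rightarrow> ('y \<Rightarrow> 'z) \<Rightarrow> (('m \<times> 'y) \<Rightarrow>\<^sub>0 int) set \<Rightarrow> (('m \<times> 'z) \<Rightarrow>\<^sub>0 int) set" where
  "tensor_map M B Y Z f =
     (\<lambda>C \<in> carrier (tensor M B Y). tensor_null M B Z <#>\<^bsub>tensor_free M Z\<^esub>
        frag_extend (\<lambda>(m, y). frag_of (m, f y)) ` C)"


section \<open>Exact categories and Frobenius categories\<close>

text \<open>
  \<open>Hom X Y\<close> is the abelian group of morphisms from \<open>X\<close> to \<open>Y\<close>, written
  multiplicatively: \<open>\<otimes>\<close> is the sum and \<open>\<one>\<close> the zero morphism.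
  \<open>Comp X Y Z g f\<close> is the composite of \<open>f\<close> from \<open>X\<close> to \<open>Y\<close> and
  \<open>g\<close> from \<open>Y\<close> to \<open>Z\<close>.
\<close>

locale preadditive_category =
  fixes Ob :: "'o set"
    and Hom :: "'o \<Rightarrow> 'o \<Rightarrow> 'f monoid"
    and Comp :: "'o \<Rightarrow> 'o \<Rightarrow> 'o \<Rightarrow> 'f \<Rightarrow> 'f \<Rightarrow> 'f"
    and Id :: "'o \<Rightarrow> 'f"
  assumes hom_group: "\<lbrakk>X \<in> Ob; Y \<in> Ob\<rbrakk> \<Longrightarrow> comm_group (Hom X Y)"
    and id_closed: "X \<in> Ob \<Longrightarrow> Id X \<in> carrier (Hom X X)"
    and comp_closed:
      "\<lbrakk>X \<in> Ob; Y \<in> Ob; Z \<in> Ob; f \<in> carrier (Hom X Y); g \<in> carrier (Hom Y Z)\<rbrakk> \<Longrightarrow>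
        Comp X Y Z g f \<in> carrier (Hom X Z)"
    and comp_id_right:
      "\<lbrakk>X \<in> Ob; Y \<in> Ob; f \<in> carrier (Hom X Y)\<rbrakk> \<Longrightarrow> Comp X X Y f (Id X) = f"
    and comp_id_left:
      "\<lbrakk>X \<in> Ob; Y \<in> Ob; f \<in> carrier (Hom X Y)\<rbrakk> \<Longrightarrow> Comp X Y Y (Id Y) f = f"
    and comp_assoc:
      "\<lbrakk>W \<in> Ob; X \<in> Ob; Y \<in> Ob; Z \<in> Ob;
        f \<in> carrier (Hom W X); g \<in> carrier (Hom X Y); h \<in> carrier (Hom Y Z)\<rbrakk> \<Longrightarrow>
        Comp W Y Z h (Comp W X Y g f) = Comp W X Z (Comp X Y Z h g) f"
    and comp_add_left:
      "\<lbrakk>X \<in> Ob; Y \<in> Ob; Z \<in> Ob;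
        f \<in> carrier (Hom X Y); g \<in> carrier (Hom Y Z); g' \<in> carrier (Hom Y Z)\<rbrakk> \<Longrightarrow>
        Comp X Y Z (g \<otimes>\<^bsub>Hom Y Z\<^esub> g') f = Comp X Y Z g f \<otimes>\<^bsub>Hom X Z\<^esub> Comp X Y Z g' f"
    and comp_add_right:
      "\<lbrakk>X \<in> Ob; Y \<in> Ob; Z \<in> Ob;
        f \<in> carrier (Hom X Y); f' \<in> carrier (Hom X Y); g \<in> carrier (Hom Y Z)\<rbrakk> \<Longrightarrow>
        Comp X Y Z g (f \<otimes>\<^bsub>Hom X Y\<^esub> f') = Comp X Y Z g f \<otimes>\<^bsub>Hom X Z\<^esub> Comp X Y Z g f'"
begin

definition iso :: "'o \<Rightarrow> 'o \<Rightarrow> 'f \<Rightarrow> bool" where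
  "iso X Y f \<longleftrightarrow> f \<in> carrier (Hom X Y) \<and>
     (\<exists>g \<in> carrier (Hom Y X). Comp X Y X g f = Id X \<and> Comp Y X Y f g = Id Y)"

definition is_kernel :: "'o \<Rightarrow> 'f \<Rightarrow> 'o \<Rightarrow> 'f \<Rightarrow> 'o \<Rightarrow> bool" where
  "is_kernel X i Y p Z \<longleftrightarrow> Comp X Y Z p i = \<one>\<^bsub>Hom X Z\<^esub> \<and>
     (\<forall>W \<in> Ob. \<forall>f \<in> carrier (Hom W Y). Comp W Y Z p f = \<one>\<^bsub>Hom W Z\<^esub> \<longrightarrow>
        (\<exists>!g. g \<in> carrier (Hom W X) \<and> Comp W X Y i g = f))"

definition is_cokernel :: "'o \<Rightarrow> 'f \<Rightarrow> 'o \<Rightarrow> 'f \<Rightarrow> 'o \<Rightarrow> bool" where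
  "is_cokernel X i Y p Z \<longleftrightarrow> Comp X Y Z p i = \<one>\<^bsub>Hom X Z\<^esub> \<and>
     (\<forall>W \<in> Ob. \<forall>f \<in> carrier (Hom Y W). Comp X Y W f i = \<one>\<^bsub>Hom X W\<^esub> \<longrightarrow>
        (\<exists>!g. g \<in> carrier (Hom Z W) \<and> Comp Y Z W g p = f))"

text \<open>The square \<open>X \<rightarrow> Y \<rightarrow> Q\<close>, \<open>X \<rightarrow> X' \<rightarrow> Q\<close> with maps \<open>i\<close>, \<open>u\<close> and \<open>f\<close>, \<open>j\<close>.\<close>

definition is_pushout :: "'o \<Rightarrow> 'o \<Rightarrow> 'o \<Rightarrow> 'o \<Rightarrow> 'f \<Rightarrow> 'f \<Rightarrow> 'f \<Rightarrow> 'f \<Rightarrow> bool" where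
  "is_pushout X Y X' Q i f u j \<longleftrightarrow>
     u \<in> carrier (Hom Y Q) \<and> j \<in> carrier (Hom X' Q) \<and> Comp X Y Q u i = Comp X X' Q j f \<and>
     (\<forall>W \<in> Ob. \<forall>v \<in> carrier (Hom Y W). \<forall>w \<in> carrier (Hom X' W).
        Comp X Y W v i = Comp X X' W w f \<longrightarrow>
        (\<exists>!h. h \<in> carrier (Hom Q W) \<and> Comp Y Q W h u = v \<and> Comp X' Q W h j = w))"

text \<open>The square \<open>Q \<rightarrow> Y \<rightarrow> Z\<close>, \<open>Q \<rightarrow> Z' \<rightarrow> Z\<close> with maps \<open>u\<close>, \<open>p\<close> and \<open>q\<close>, \<open>f\<close>.\<close>

definition is_pullback :: "'o \<Rightarrow> 'o \<Rightarrow> 'o \<Rightarrow> 'o \<Rightarrow> 'f \<Rightarrow> 'f \<Rightarrow> 'f \<Rightarrow> 'f \<Rightarrow> bool" where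
  "is_pullback Y Z Z' Q p f u q \<longleftrightarrow>
     u \<in> carrier (Hom Q Y) \<and> q \<in> carrier (Hom Q Z') \<and> Comp Q Y Z p u = Comp Q Z' Z f q \<and>
     (\<forall>W \<in> Ob. \<forall>v \<in> carrier (Hom W Y). \<forall>w \<in> carrier (Hom W Z').
        Comp W Y Z p v = Comp W Z' Z f w \<longrightarrow>
        (\<exists>!h. h \<in> carrier (Hom W Q) \<and> Comp W Q Y u h = v \<and> Comp W Q Z' q h = w))"

end

locale additive_category = preadditive_category Ob Hom Comp Id
  for Ob :: "'o set" and Hom :: "'o \<Rightarrow> 'o \<Rightarrow> 'f monoid" and Comp Id +
  assumes zero_object:
      "\<exists>Z \<in> Ob. \<forall>X \<in> Ob. (\<exists>!f. f \<in> carrier (Hom X Z)) \<and> (\<exists>!f. f \<in> carrier (Hom Z X))"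
    and biproducts:
      "\<lbrakk>X \<in> Ob; Y \<in> Ob\<rbrakk> \<Longrightarrow>
        \<exists>P \<in> Ob. \<exists>i \<in> carrier (Hom X P). \<exists>j \<in> carrier (Hom Y P).
          \<exists>p \<in> carrier (Hom P X). \<exists>q \<in> carrier (Hom P Y).
            Comp X P X p i = Id X \<and> Comp Y P Y q j = Id Y \<and>
            Comp X P Y q i = \<one>\<^bsub>Hom X Y\<^esub> \<and> Comp Y P X p j = \<one>\<^bsub>Hom Y X\<^esub> \<and>
            Comp P X P i p \<otimes>\<^bsub>Hom P P\<^esub> Comp P Y P j q = Id P"

text \<open>
  \<open>Confl X i Y p Z\<close> says that the sequence of \<open>i\<close> from \<open>X\<close> to \<open>Y\<close> and \<open>p\<close>
  from \<open>Y\<close> to \<open>Z\<close> is a conflation (admissible short exact sequence).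
\<close>

locale category_with_conflations = additive_category Ob Hom Comp Id
  for Ob :: "'o set" and Hom :: "'o \<Rightarrow> 'o \<Rightarrow> 'f monoid" and Comp Id +
  fixes Confl :: "'o \<Rightarrow> 'f \<Rightarrow> 'o \<Rightarrow> 'f \<Rightarrow> 'o \<Rightarrow> bool"
begin

definition inflation :: "'o \<Rightarrow> 'o \<Rightarrow> 'f \<Rightarrow> bool" where
  "inflation X Y i \<longleftrightarrow> (\<exists>p Z. Confl X i Y p Z)"

definition deflation :: "'o \<Rightarrow> 'o \<Rightarrow> 'f \<Rightarrow> bool" where
  "deflation Y Z p \<longleftrightarrow> (\<exists>X i. Confl X i Y p Z)"

definition projective_object :: "'o \<Rightarrow> bool" where
  "projective_object P \<longleftrightarrow> P \<in> Ob \<and>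
     (\<forall>Y Z p. deflation Y Z p \<longrightarrow>
        (\<forall>h \<in> carrier (Hom P Z). \<exists>k \<in> carrier (Hom P Y). Comp P Y Z p k = h))"

definition injective_object :: "'o \<Rightarrow> bool" where
  "injective_object E \<longleftrightarrow> E \<in> Ob \<and>
     (\<forall>X Y i. inflation X Y i \<longrightarrow>
        (\<forall>h \<in> carrier (Hom X E). \<exists>k \<in> carrier (Hom Y E). Comp X Y E k i = h))"

end

text \<open>Quillen's axioms, in the formulation of Keller and Buehler.\<close>

locale exact_category = category_with_conflations Ob Hom Comp Id Confl
  for Ob :: "'o set" and Hom :: "'o \<Rightarrow> 'o \<Rightarrow> 'f monoid" and Comp Id Confl +
  assumes confl_kernel_cokernel:
      "Confl X i Y p Z \<Longrightarrow>
        X \<in> Ob \<and> Y \<in> Ob \<and> Z \<in> Ob \<and> i \<in> carrier (Hom X Y) \<and> p \<in> carrier (Hom Y Z) \<and>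
        is_kernel X i Y p Z \<and> is_cokernel X i Y p Z"
    and confl_iso:
      "\<lbrakk>Confl X i Y p Z; X' \<in> Ob; Y' \<in> Ob; Z' \<in> Ob; iso X X' a; iso Y Y' b; iso Z Z' c;
        i' \<in> carrier (Hom X' Y'); p' \<in> carrier (Hom Y' Z');
        Comp X X' Y' i' a = Comp X Y Y' b i; Comp Y Y' Z' p' b = Comp Y Z Z' c p\<rbrakk> \<Longrightarrow>
        Confl X' i' Y' p' Z'"
    and inflation_id: "X \<in> Ob \<Longrightarrow> inflation X X (Id X)"
    and deflation_id: "X \<in> Ob \<Longrightarrow> deflation X X (Id X)"
    and inflation_comp:
      "\<lbrakk>inflation X Y i; inflation Y Z j\<rbrakk> \<Longrightarrow> inflation X Z (Comp X Y Z j i)"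
    and deflation_comp:
      "\<lbrakk>deflation X Y p; deflation Y Z q\<rbrakk> \<Longrightarrow> deflation X Z (Comp X Y Z q p)"
    and inflation_pushout:
      "\<lbrakk>inflation X Y i; X' \<in> Ob; f \<in> carrier (Hom X X')\<rbrakk> \<Longrightarrow>
        \<exists>Q \<in> Ob. \<exists>u j. is_pushout X Y X' Q i f u j \<and> inflation X' Q j"
    and deflation_pullback:
      "\<lbrakk>deflation Y Z p; Z' \<in> Ob; f \<in> carrier (Hom Z' Z)\<rbrakk> \<Longrightarrow>
        \<exists>Q \<in> Ob. \<exists>u q. is_pullback Y Z Z' Q p f u q \<and> deflation Q Z' q"

locale frobenius_category = exact_category Ob Hom Comp Id Confl
  for Ob :: "'o set" and Hom :: "'o \<Rightarrow> 'o \<Rightarrow> 'f monoid" and Comp Id Confl +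
  assumes enough_projectives: "X \<in> Ob \<Longrightarrow> \<exists>P p. projective_object P \<and> deflation P X p"
    and enough_injectives: "X \<in> Ob \<Longrightarrow> \<exists>E i. injective_object E \<and> inflation X E i"
    and projective_iff_injective: "projective_object X \<longleftrightarrow> injective_object X"


section \<open>The monomorphism category\<close>

record ('a, 'm, 'b) triple =
  upper :: "'a fgmod"
  lower :: "'b fgmod"
  struct :: "(('m \<times> (nat \<Rightarrow> 'b) set) \<Rightarrow>\<^sub>0 int) set \<Rightarrow> (nat \<Rightarrow> 'a) set"

type_synonym ('a, 'b) triple_mor =
  "((nat \<Rightarrow> 'a) set \<Rightarrow> (nat \<Rightarrow> 'a) set) \<times> ((nat \<Rightarrow> 'b) set \<Rightarrow> (nat \<Rightarrow> 'b) set)"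

definition mono_objects ::
    "('a, 'k) ring_scheme \<Rightarrow> ('a, 'm, 'b) bimodule \<Rightarrow> ('b, 'l) ring_scheme
      \<Rightarrow> ('a, 'm, 'b) triple set" where
  "mono_objects A M B =
     {T. fg_module A (upper T) \<and> fg_module B (lower T) \<and>
         struct T \<in> mod_hom A (tensor M B (lower T)) (upper T) \<and>
         inj_on (struct T) (carrier (tensor M B (lower T)))}"

definition triple_hom ::
    "('a, 'k) ring_scheme \<Rightarrow> ('a, 'm, 'b) bimodule \<Rightarrow> ('b, 'l) ring_scheme
      \<Rightarrow> ('a, 'm, 'b) triple \<Rightarrow> ('a, 'm, 'b) triple \<Rightarrow> ('a, 'b) triple_mor monoid" where
  "triple_hom A M B T T' =
     \<lparr>carrier =
        {(f1, f2). f1 \<in> mod_hom A (upper T) (upper T') \<and> f2 \<in> mod_hom B (lower T) (lower T') \<and>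
           (\<forall>t \<in> carrier (tensor M B (lower T)).
              f1 (struct T t) = struct T' (tensor_map M B (lower T) (lower T') f2 t))},
      mult = (\<lambda>(f1, f2) (g1, g2).
        (\<lambda>x \<in> carrier (upper T). f1 x \<oplus>\<^bsub>upper T'\<^esub> g1 x,
         \<lambda>y \<in> carrier (lower T). f2 y \<oplus>\<^bsub>lower T'\<^esub> g2 y)),
      one = (\<lambda>x \<in> carrier (upper T). \<zero>\<^bsub>upper T'\<^esub>, \<lambda>y \<in> carrier (lower T). \<zero>\<^bsub>lower T'\<^esub>)\<rparr>"

definition triple_comp ::
    "('a, 'm, 'b) triple \<Rightarrow> ('a, 'm, 'b) triple \<Rightarrow> ('a, 'm, 'b) triple
      \<Rightarrow> ('a, 'b) triple_mor \<Rightarrow> ('a, 'b) triple_mor \<Rightarrow> ('a, 'b) triple_mor" where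
  "triple_comp T T' T'' g f =
     (compose (carrier (upper T)) (fst g) (fst f), compose (carrier (lower T)) (snd g) (snd f))"

definition triple_id :: "('a, 'm, 'b) triple \<Rightarrow> ('a, 'b) triple_mor" where
  "triple_id T = (\<lambda>x \<in> carrier (upper T). x, \<lambda>y \<in> carrier (lower T). y)"

definition short_exact ::
    "('a, 'x, 'k) module_scheme \<Rightarrow> ('x \<Rightarrow> 'y) \<Rightarrow> ('a, 'y, 'l) module_scheme \<Rightarrow> ('y \<Rightarrow> 'z)
      \<Rightarrow> ('a, 'z, 'm) module_scheme \<Rightarrow> bool" where
  "short_exact X f Y g Z \<longleftrightarrow>
     inj_on f (carrier X) \<and> g ` carrier Y = carrier Z \<and>
     f ` carrier X = {y \<in> carrier Y. g y = \<zero>\<^bsub>Z\<^esub>}"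

text \<open>
  The module over the triangular algebra given by a triple has the direct sum of the upper and
  the lower component as underlying group, so exactness is tested componentwise.
\<close>

definition mono_conflation ::
    "('a, 'k) ring_scheme \<Rightarrow> ('a, 'm, 'b) bimodule \<Rightarrow> ('b, 'l) ring_scheme
      \<Rightarrow> ('a, 'm, 'b) triple \<Rightarrow> ('a, 'b) triple_mor \<Rightarrow> ('a, 'm, 'b) triple
      \<Rightarrow> ('a, 'b) triple_mor \<Rightarrow> ('a, 'm, 'b) triple \<Rightarrow> bool" where
  "mono_conflation A M B T f T' g T'' \<longleftrightarrow>
     T \<in> mono_objects A M B \<and> T' \<in> mono_objects A M B \<and> T'' \<in> mono_objects A M B \<and>
     f \<in> carrier (triple_hom A M B T T') \<and> g \<in> carrier (triple_hom A M B T' T'') \<and>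
     short_exact (upper T) (fst f) (upper T') (fst g) (upper T'') \<and>
     short_exact (lower T) (snd f) (lower T') (snd g) (lower T'')"

end

theory Submission
  imports Defs
begin

text \<open>
  A dual basis of \<open>M\<^sub>B\<close> gives coordinates on \<open>M \<otimes> Y\<close>, from which the functor \<open>M \<otimes> -\<close> is exact and
  the monomorphism category is exact: its deflations are the componentwise surjective morphisms,
  and a componentwise injective \<open>(f, g) : (X, Y) \<rightarrow> (X', Y')\<close> is an inflation iff the elements of
  \<open>M \<otimes> Y'\<close> that are mapped into \<open>f X\<close> come from \<open>M \<otimes> Y\<close>.

  If \<open>A\<close> and \<open>B\<close> are self-injective and \<open>\<^sub>AM\<close> is projective, then an object is injective as soon
  as both components are, so finite sums of \<open>(A, 0)\<close> and \<open>(M \<otimes> B, B)\<close> are both projective and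
  injective. Every object is a quotient of such a sum, and it also admits an inflation into one
  because a self-injective Artin algebra is a cogenerator; by splitting, projective and injective
  objects coincide.

  Conversely, \<open>(A, 0)\<close> and \<open>(M \<otimes> B, B)\<close> are always projective. Their injectivity forces that of
  \<open>A\<close>, \<open>B\<close> and \<open>M\<close>; then \<open>(M, 0)\<close> is injective, hence projective, and so is \<open>M\<close>.

  The definition of self-injectivity concerns left modules only. That every simple left module
  embeds in \<open>A\<close> is obtained by counting annihilators of simple modules, without using the duality
  between left and right modules.
\<close>

section \<open>Modules and their homomorphisms\<close>

context left_module
begin

lemmas smult_closed [simp, intro] and smult_one [simp]

lemma smult_zero_left [simp]:
  assumes "x \<in> carrier X" shows "\<zero>\<^bsub>A\<^esub> \<odot>\<^bsub>X\<^esub> x = \<zero>\<^bsub>X\<^esub>"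
  using assms smult_l_distr[of "\<zero>\<^bsub>A\<^esub>" "\<zero>\<^bsub>A\<^esub>" x] X.add.l_cancel_one'[of "\<zero>\<^bsub>A\<^esub> \<odot>\<^bsub>X\<^esub> x" "\<zero>\<^bsub>A\<^esub> \<odot>\<^bsub>X\<^esub> x"]
  by simp

lemma smult_zero_right [simp]:
  assumes "a \<in> carrier A" shows "a \<odot>\<^bsub>X\<^esub> \<zero>\<^bsub>X\<^esub> = \<zero>\<^bsub>X\<^esub>"
  using assms smult_r_distr[of a "\<zero>\<^bsub>X\<^esub>" "\<zero>\<^bsub>X\<^esub>"] X.add.l_cancel_one'[of "a \<odot>\<^bsub>X\<^esub> \<zero>\<^bsub>X\<^esub>" "a \<odot>\<^bsub>X\<^esub> \<zero>\<^bsub>X\<^esub>"]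
  by simp

lemma smult_uminus_left:
  assumes "a \<in> carrier A" "x \<in> carrier X" shows "(\<ominus>\<^bsub>A\<^esub> a) \<odot>\<^bsub>X\<^esub> x = \<ominus>\<^bsub>X\<^esub> (a \<odot>\<^bsub>X\<^esub> x)"
  using assms smult_l_distr[of "\<ominus>\<^bsub>A\<^esub> a" a x] X.minus_equality[of "(\<ominus>\<^bsub>A\<^esub> a) \<odot>\<^bsub>X\<^esub> x" "a \<odot>\<^bsub>X\<^esub> x"]
  by (simp add: A.l_neg)

lemma smult_uminus_right:
  assumes "a \<in> carrier A" "x \<in> carrier X" shows "a \<odot>\<^bsub>X\<^esub> (\<ominus>\<^bsub>X\<^esub> x) = \<ominus>\<^bsub>X\<^esub> (a \<odot>\<^bsub>X\<^esub> x)"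
  using assms smult_r_distr[of a "\<ominus>\<^bsub>X\<^esub> x" x] X.minus_equality[of "a \<odot>\<^bsub>X\<^esub> (\<ominus>\<^bsub>X\<^esub> x)" "a \<odot>\<^bsub>X\<^esub> x"]
  by (simp add: X.l_neg)

lemma smult_minus_right:
  assumes "a \<in> carrier A" "x \<in> carrier X" "y \<in> carrier X"
  shows "a \<odot>\<^bsub>X\<^esub> (x \<ominus>\<^bsub>X\<^esub> y) = a \<odot>\<^bsub>X\<^esub> x \<ominus>\<^bsub>X\<^esub> a \<odot>\<^bsub>X\<^esub> y"
  using assms by (simp add: a_minus_def smult_r_distr smult_uminus_right)

lemma submoduleI:
  assumes "H \<subseteq> carrier X" "\<zero>\<^bsub>X\<^esub> \<in> H"
    and "\<And>x y. x \<in> H \<Longrightarrow> y \<in> H \<Longrightarrow> x \<oplus>\<^bsub>X\<^esub> y \<in> H"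
    and "\<And>a x. a \<in> carrier A \<Longrightarrow> x \<in> H \<Longrightarrow> a \<odot>\<^bsub>X\<^esub> x \<in> H"
  shows "submodule H A X"
proof (intro submodule.intro subgroup.intro submodule_axioms.intro)
  fix x assume x: "x \<in> H"
  then have "(\<ominus>\<^bsub>A\<^esub> \<one>\<^bsub>A\<^esub>) \<odot>\<^bsub>X\<^esub> x \<in> H" by (intro assms(4)) auto
  moreover have "x \<in> carrier X" using x assms(1) by blast
  ultimately show "inv\<^bsub>add_monoid X\<^esub> x \<in> H"
    by (simp add: smult_uminus_left a_inv_def[symmetric])
qed (use assms in auto)

lemma submodule_carrier: "submodule (carrier X) A X"
  by (rule submoduleI) auto

lemma submodule_zero: "submodule {\<zero>\<^bsub>X\<^esub>} A X"
  by (rule submoduleI) auto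

end

lemma (in abelian_group) minus_eq_zero_iff:
  assumes "x \<in> carrier G" "y \<in> carrier G" shows "x \<ominus> y = \<zero> \<longleftrightarrow> x = y"
proof
  assume "x \<ominus> y = \<zero>"
  then have "x \<oplus> \<ominus> y = \<zero>" by (simp add: a_minus_def)
  then have "\<ominus> (\<ominus> y) = x" using assms by (intro minus_equality) auto
  then show "x = y" using assms by simp
qed (use assms in \<open>simp add: a_minus_def r_neg\<close>)

lemma (in abelian_group) add_minus_cancel:
  assumes "x \<in> carrier G" "y \<in> carrier G"
  shows "x \<oplus> y \<ominus> x = y" "x \<ominus> y \<oplus> y = x" "y \<oplus> (x \<ominus> y) = x"
  using assms a_comm[of x y] a_comm[of y "x \<ominus> y"] by (simp_all add: a_minus_def a_assoc l_neg r_neg)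

lemma submoduleD:
  assumes "submodule H A X"
  shows submodule_subset: "H \<subseteq> carrier X" and submodule_zero_mem: "\<zero>\<^bsub>X\<^esub> \<in> H"
    and submodule_add: "\<lbrakk>x \<in> H; y \<in> H\<rbrakk> \<Longrightarrow> x \<oplus>\<^bsub>X\<^esub> y \<in> H"
    and submodule_smult: "\<lbrakk>a \<in> carrier A; x \<in> H\<rbrakk> \<Longrightarrow> a \<odot>\<^bsub>X\<^esub> x \<in> H"
    and submodule_uminus: "x \<in> H \<Longrightarrow> \<ominus>\<^bsub>X\<^esub> x \<in> H"
    and submodule_minus: "\<lbrakk>x \<in> H; y \<in> H\<rbrakk> \<Longrightarrow> x \<ominus>\<^bsub>X\<^esub> y \<in> H"
proof -
  interpret H: submodule H A X by (rule assms)
  show "H \<subseteq> carrier X" "\<zero>\<^bsub>X\<^esub> \<in> H" using H.subset H.one_closed by auto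
  show add: "x \<oplus>\<^bsub>X\<^esub> y \<in> H" if "x \<in> H" "y \<in> H" for x y using H.m_closed that by auto
  show "a \<odot>\<^bsub>X\<^esub> x \<in> H" if "a \<in> carrier A" "x \<in> H" using H.smult_closed that by auto
  show neg: "\<ominus>\<^bsub>X\<^esub> x \<in> H" if "x \<in> H" for x using H.m_inv_closed that by (auto simp: a_inv_def)
  show "x \<ominus>\<^bsub>X\<^esub> y \<in> H" if "x \<in> H" "y \<in> H" using add neg that by (simp add: a_minus_def)
qed

lemma submodule_iff:
  assumes "left_module A X"
  shows "submodule H A X \<longleftrightarrow> H \<subseteq> carrier X \<and> \<zero>\<^bsub>X\<^esub> \<in> H \<and> (\<forall>x \<in> H. \<forall>y \<in> H. x \<oplus>\<^bsub>X\<^esub> y \<in> H) \<and>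
    (\<forall>a \<in> carrier A. \<forall>x \<in> H. a \<odot>\<^bsub>X\<^esub> x \<in> H)"
proof -
  interpret left_module A X by (rule assms)
  show ?thesis
    using submoduleI[of H] submoduleD[of H A X] by blast
qed

lemma submodule_Int:
  assumes "left_module A X" "submodule H A X" "submodule K A X"
  shows "submodule (H \<inter> K) A X"
  using assms(2,3) unfolding submodule_iff[OF assms(1)] by auto

lemma mod_homI:
  assumes "left_module A X" "\<And>x. x \<in> carrier X \<Longrightarrow> f x \<in> carrier Y"
    and "\<And>x x'. \<lbrakk>x \<in> carrier X; x' \<in> carrier X\<rbrakk> \<Longrightarrow> f (x \<oplus>\<^bsub>X\<^esub> x') = f x \<oplus>\<^bsub>Y\<^esub> f x'"
    and "\<And>a x. \<lbrakk>a \<in> carrier A; x \<in> carrier X\<rbrakk> \<Longrightarrow> f (a \<odot>\<^bsub>X\<^esub> x) = a \<odot>\<^bsub>Y\<^esub> f x"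
  shows "restrict f (carrier X) \<in> mod_hom A X Y"
proof -
  interpret left_module A X by (rule assms)
  show ?thesis using assms(2-) by (auto simp: mod_hom_def)
qed

lemma mod_homD:
  assumes "f \<in> mod_hom A X Y"
  shows mod_hom_closed: "x \<in> carrier X \<Longrightarrow> f x \<in> carrier Y"
    and mod_hom_add: "\<lbrakk>x \<in> carrier X; x' \<in> carrier X\<rbrakk> \<Longrightarrow> f (x \<oplus>\<^bsub>X\<^esub> x') = f x \<oplus>\<^bsub>Y\<^esub> f x'"
    and mod_hom_smult: "\<lbrakk>a \<in> carrier A; x \<in> carrier X\<rbrakk> \<Longrightarrow> f (a \<odot>\<^bsub>X\<^esub> x) = a \<odot>\<^bsub>Y\<^esub> f x"
    and mod_hom_ext: "f \<in> extensional (carrier X)"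
  using assms by (auto simp: mod_hom_def PiE_def)

lemma mod_hom_eqI:
  assumes "f \<in> mod_hom A X Y" "g \<in> mod_hom A X Y'" "\<And>x. x \<in> carrier X \<Longrightarrow> f x = g x"
  shows "f = g"
  using mod_hom_ext[OF assms(1)] mod_hom_ext[OF assms(2)] assms(3) by (rule extensionalityI)

lemma mod_hom_group:
  assumes "left_module A X" "left_module A Y" "f \<in> mod_hom A X Y"
  shows mod_hom_zero: "f \<zero>\<^bsub>X\<^esub> = \<zero>\<^bsub>Y\<^esub>"
    and mod_hom_uminus: "x \<in> carrier X \<Longrightarrow> f (\<ominus>\<^bsub>X\<^esub> x) = \<ominus>\<^bsub>Y\<^esub> f x"
    and mod_hom_minus: "\<lbrakk>x \<in> carrier X; x' \<in> carrier X\<rbrakk> \<Longrightarrow> f (x \<ominus>\<^bsub>X\<^esub> x') = f x \<ominus>\<^bsub>Y\<^esub> f x'"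
proof -
  interpret X: left_module A X by (rule assms)
  interpret Y: left_module A Y by (rule assms)
  note f = mod_homD[OF assms(3)]
  show z: "f \<zero>\<^bsub>X\<^esub> = \<zero>\<^bsub>Y\<^esub>"
    using f(3)[of "\<zero>\<^bsub>A\<^esub>" "\<zero>\<^bsub>X\<^esub>"] f(1)[of "\<zero>\<^bsub>X\<^esub>"] by simp
  show n: "f (\<ominus>\<^bsub>X\<^esub> x) = \<ominus>\<^bsub>Y\<^esub> f x" if "x \<in> carrier X" for x
    using f(2)[of "\<ominus>\<^bsub>X\<^esub> x" x] f(1)[of x] f(1)[of "\<ominus>\<^bsub>X\<^esub> x"] z that
      Y.X.minus_equality[of "f (\<ominus>\<^bsub>X\<^esub> x)" "f x"]
    by (simp add: X.X.l_neg)
  show "f (x \<ominus>\<^bsub>X\<^esub> x') = f x \<ominus>\<^bsub>Y\<^esub> f x'" if "x \<in> carrier X" "x' \<in> carrier X"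
    using that f n by (simp add: a_minus_def)
qed

lemma mod_hom_inj_iff:
  assumes "left_module A X" "left_module A Y" "f \<in> mod_hom A X Y"
  shows "inj_on f (carrier X) \<longleftrightarrow> (\<forall>x \<in> carrier X. f x = \<zero>\<^bsub>Y\<^esub> \<longrightarrow> x = \<zero>\<^bsub>X\<^esub>)"
proof -
  interpret X: left_module A X by (rule assms)
  interpret Y: left_module A Y by (rule assms)
  have "f x = f y \<longleftrightarrow> f (x \<ominus>\<^bsub>X\<^esub> y) = \<zero>\<^bsub>Y\<^esub>" "x = y \<longleftrightarrow> x \<ominus>\<^bsub>X\<^esub> y = \<zero>\<^bsub>X\<^esub>"
    if "x \<in> carrier X" "y \<in> carrier X" for x y
    using that mod_hom_closed[OF assms(3)]
    by (simp_all add: mod_hom_minus[OF assms] X.X.minus_eq_zero_iff Y.X.minus_eq_zero_iff)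
  then show ?thesis unfolding inj_on_def
    by (metis X.X.minus_closed X.X.zero_closed mod_hom_zero[OF assms])
qed

lemma mod_hom_compose:
  assumes "left_module A X" "f \<in> mod_hom A X Y" "g \<in> mod_hom A Y Z"
  shows "compose (carrier X) g f \<in> mod_hom A X Z"
  unfolding compose_def
  by (rule mod_homI[OF assms(1)]) (use mod_homD[OF assms(2)] mod_homD[OF assms(3)] in auto)

lemma mod_hom_id: "left_module A X \<Longrightarrow> (\<lambda>x \<in> carrier X. x) \<in> mod_hom A X X"
  by (rule mod_homI) auto

lemma mod_hom_plus:
  assumes "left_module A X" "left_module A Y" "f \<in> mod_hom A X Y" "g \<in> mod_hom A X Y"
  shows "(\<lambda>x \<in> carrier X. f x \<oplus>\<^bsub>Y\<^esub> g x) \<in> mod_hom A X Y"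
proof -
  interpret Y: left_module A Y by (rule assms)
  show ?thesis
    by (rule mod_homI[OF assms(1)])
      (use mod_homD[OF assms(3)] mod_homD[OF assms(4)] in \<open>auto simp: Y.smult_r_distr Y.X.a_ac\<close>)
qed

lemma mod_hom_const_zero:
  assumes "left_module A X" "left_module A Y"
  shows "(\<lambda>x \<in> carrier X. \<zero>\<^bsub>Y\<^esub>) \<in> mod_hom A X Y"
proof -
  interpret Y: left_module A Y by (rule assms)
  show ?thesis by (rule mod_homI[OF assms(1)]) auto
qed

lemma mod_hom_neg:
  assumes "left_module A X" "left_module A Y" "f \<in> mod_hom A X Y"
  shows "(\<lambda>x \<in> carrier X. \<ominus>\<^bsub>Y\<^esub> f x) \<in> mod_hom A X Y"
proof -
  interpret X: left_module A X by (rule assms)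
  interpret Y: left_module A Y by (rule assms)
  show ?thesis
    by (rule mod_homI[OF assms(1)])
      (use mod_homD[OF assms(3)] in \<open>auto simp: Y.X.minus_add Y.X.a_comm Y.smult_uminus_right\<close>)
qed

lemma mod_hom_finsum:
  assumes "left_module A X" "left_module A Y" "f \<in> mod_hom A X Y" "finite I" "g \<in> I \<rightarrow> carrier X"
  shows "f (finsum X g I) = finsum Y (\<lambda>i. f (g i)) I"
proof -
  interpret X: left_module A X by (rule assms)
  interpret Y: left_module A Y by (rule assms)
  note f = mod_homD[OF assms(3)] mod_hom_zero[OF assms(1-3)]
  show ?thesis
    using assms(4,5)
    by (induction I rule: finite_induct) (auto simp: f Pi_iff X.X.finsum_insert Y.X.finsum_insert)
qed

lemma (in left_module) mod_hom_scale_right: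
  assumes "x \<in> carrier X"
  shows "(\<lambda>a \<in> carrier A. a \<odot>\<^bsub>X\<^esub> x) \<in> mod_hom A (regular_module A) X"
  using assms by (auto simp: mod_hom_def regular_module_def smult_l_distr smult_assoc1)

lemma image_submodule:
  assumes "left_module A X" "left_module A Y" "f \<in> mod_hom A X Y" "submodule H A X"
  shows "submodule (f ` H) A Y"
proof -
  interpret Y: left_module A Y by (rule assms)
  note f = mod_homD[OF assms(3)] and H = submoduleD[OF assms(4)]
  show ?thesis
  proof (rule Y.submoduleI)
    show "f ` H \<subseteq> carrier Y" using f H by auto
    show "\<zero>\<^bsub>Y\<^esub> \<in> f ` H" using mod_hom_zero[OF assms(1-3)] H(2) by force
    fix y y' assume "y \<in> f ` H" "y' \<in> f ` H"
    then obtain x x' where "x \<in> H" "x' \<in> H" "y = f x" "y' = f x'" by auto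
    then have "y \<oplus>\<^bsub>Y\<^esub> y' = f (x \<oplus>\<^bsub>X\<^esub> x')" "x \<oplus>\<^bsub>X\<^esub> x' \<in> H" using f H by (auto simp: subset_iff)
    then show "y \<oplus>\<^bsub>Y\<^esub> y' \<in> f ` H" by blast
  next
    fix a y assume "a \<in> carrier A" "y \<in> f ` H"
    then obtain x where "x \<in> H" "y = f x" by auto
    then have "a \<odot>\<^bsub>Y\<^esub> y = f (a \<odot>\<^bsub>X\<^esub> x)" "a \<odot>\<^bsub>X\<^esub> x \<in> H"
      using f H \<open>a \<in> carrier A\<close> by (auto simp: subset_iff)
    then show "a \<odot>\<^bsub>Y\<^esub> y \<in> f ` H" by blast
  qed
qed

lemma vimage_submodule:
  assumes "left_module A X" "left_module A Y" "f \<in> mod_hom A X Y" "submodule K A Y"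
  shows "submodule {x \<in> carrier X. f x \<in> K} A X"
proof -
  interpret X: left_module A X by (rule assms)
  note f = mod_homD[OF assms(3)] mod_hom_zero[OF assms(1-3)] and K = submoduleD[OF assms(4)]
  show ?thesis by (rule X.submoduleI) (auto simp: f K)
qed

lemma kernel_submodule:
  assumes "left_module A X" "left_module A Y" "f \<in> mod_hom A X Y"
  shows "submodule {x \<in> carrier X. f x = \<zero>\<^bsub>Y\<^esub>} A X"
  using vimage_submodule[OF assms left_module.submodule_zero[OF assms(2)]] by simp

lemma submodule_left_module:
  assumes "left_module A X" "submodule K A X"
  shows "left_module A (X\<lparr>carrier := K\<rparr>)"
proof -
  interpret X: left_module A X by (rule assms)
  note K = submoduleD[OF assms(2)]
  have KX: "x \<in> carrier X" if "x \<in> K" for x using K(1) that by blast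
  have "abelian_group (X\<lparr>carrier := K\<rparr>)"
  proof (rule abelian_groupI)
    fix x assume "x \<in> carrier (X\<lparr>carrier := K\<rparr>)"
    then have "\<ominus>\<^bsub>X\<^esub> x \<in> K" "\<ominus>\<^bsub>X\<^esub> x \<oplus>\<^bsub>X\<^esub> x = \<zero>\<^bsub>X\<^esub>" using K KX by (auto simp: X.X.l_neg)
    then show "\<exists>y \<in> carrier (X\<lparr>carrier := K\<rparr>). y \<oplus>\<^bsub>X\<lparr>carrier := K\<rparr>\<^esub> x = \<zero>\<^bsub>X\<lparr>carrier := K\<rparr>\<^esub>" by auto
  qed (auto simp: K KX X.X.a_ac)
  then show ?thesis
    by (intro left_module.intro left_module_axioms.intro X.A.ring_axioms)
      (auto simp: K KX X.smult_l_distr X.smult_r_distr X.smult_assoc1)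
qed

lemma submodule_of_submodule:
  assumes "left_module A X" "submodule K A X"
  shows "submodule H A (X\<lparr>carrier := K\<rparr>) \<longleftrightarrow> submodule H A X \<and> H \<subseteq> K"
  unfolding submodule_iff[OF submodule_left_module[OF assms]] submodule_iff[OF assms(1)]
  using submodule_subset[OF assms(2)] by auto

lemma submodule_inclusion:
  assumes "left_module A X" "submodule K A X"
  shows "(\<lambda>x \<in> K. x) \<in> mod_hom A (X\<lparr>carrier := K\<rparr>) X"
  using mod_homI[OF submodule_left_module[OF assms], of "\<lambda>x. x" X] submodule_subset[OF assms(2)] by auto

lemma mod_hom_restrict:
  assumes "left_module A X" "submodule K A X" "f \<in> mod_hom A X Y"
  shows "restrict f K \<in> mod_hom A (X\<lparr>carrier := K\<rparr>) Y"
  using mod_homI[OF submodule_left_module[OF assms(1,2)], of f Y] mod_homD[OF assms(3)]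
    submodule_subset[OF assms(2)] by (auto simp: subset_iff)

lemma mod_hom_corestrict:
  assumes "f \<in> mod_hom A X Y" "f ` carrier X \<subseteq> K"
  shows "f \<in> mod_hom A X (Y\<lparr>carrier := K\<rparr>)"
  using assms by (auto simp: mod_hom_def PiE_def)

lemma factor_through_surj:
  assumes mods: "left_module A X" "left_module A Y" "left_module A Z"
    and p: "p \<in> mod_hom A X Y" "p ` carrier X = carrier Y" and h: "h \<in> mod_hom A X Z"
    and ker: "\<And>x. \<lbrakk>x \<in> carrier X; p x = \<zero>\<^bsub>Y\<^esub>\<rbrakk> \<Longrightarrow> h x = \<zero>\<^bsub>Z\<^esub>"
  obtains k where "k \<in> mod_hom A Y Z" "\<And>x. x \<in> carrier X \<Longrightarrow> k (p x) = h x"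
proof -
  interpret X: left_module A X by (rule mods)
  interpret Y: left_module A Y by (rule mods)
  interpret Z: left_module A Z by (rule mods)
  define s where "s = inv_into (carrier X) p"
  have s: "s y \<in> carrier X" "p (s y) = y" if "y \<in> carrier Y" for y
    using that inv_into_into[of y p "carrier X"] f_inv_into_f[of y p "carrier X"] p(2)
    by (auto simp: s_def)
  note pD = mod_homD[OF p(1)] and hD = mod_homD[OF h]
  have eq: "h x = h x'" if "x \<in> carrier X" "x' \<in> carrier X" "p x = p x'" for x x'
  proof -
    have "h (x \<ominus>\<^bsub>X\<^esub> x') = \<zero>\<^bsub>Z\<^esub>"
      using that pD by (intro ker) (auto simp: mod_hom_minus[OF mods(1,2) p(1)] Y.X.minus_eq_zero_iff)
    then show ?thesis using that hD by (simp add: mod_hom_minus[OF mods(1,3) h] Z.X.minus_eq_zero_iff)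
  qed
  have key: "h (s (p x)) = h x" if "x \<in> carrier X" for x
    by (rule eq) (use that s pD in auto)
  have "(\<lambda>y \<in> carrier Y. h (s y)) \<in> mod_hom A Y Z"
  proof (rule mod_homI[OF mods(2)])
    fix y y' assume y: "y \<in> carrier Y" "y' \<in> carrier Y"
    have "h (s (y \<oplus>\<^bsub>Y\<^esub> y')) = h (s y \<oplus>\<^bsub>X\<^esub> s y')"
      by (rule eq) (use y s pD in auto)
    then show "h (s (y \<oplus>\<^bsub>Y\<^esub> y')) = h (s y) \<oplus>\<^bsub>Z\<^esub> h (s y')" using y s hD by simp
  next
    fix a y assume y: "a \<in> carrier A" "y \<in> carrier Y"
    have "h (s (a \<odot>\<^bsub>Y\<^esub> y)) = h (a \<odot>\<^bsub>X\<^esub> s y)"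
      by (rule eq) (use y s pD in auto)
    then show "h (s (a \<odot>\<^bsub>Y\<^esub> y)) = a \<odot>\<^bsub>Z\<^esub> h (s y)" using y s hD by simp
  qed (use s hD in auto)
  then show thesis by (rule that) (use key pD in auto)
qed

lemma factor_through_inj:
  assumes mods: "left_module A W" "left_module A X" "left_module A Y"
    and i: "i \<in> mod_hom A X Y" "inj_on i (carrier X)" and f: "f \<in> mod_hom A W Y"
    and im: "f ` carrier W \<subseteq> i ` carrier X"
  obtains k where "k \<in> mod_hom A W X" "\<And>w. w \<in> carrier W \<Longrightarrow> i (k w) = f w"
proof -
  interpret W: left_module A W by (rule mods)
  interpret X: left_module A X by (rule mods)
  define s where "s w = inv_into (carrier X) i (f w)" for w
  have s: "s w \<in> carrier X" "i (s w) = f w" if "w \<in> carrier W" for w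
    using that im inv_into_into[of "f w" i "carrier X"] f_inv_into_f[of "f w" i "carrier X"]
    by (auto simp: s_def)
  note iD = mod_homD[OF i(1)] and fD = mod_homD[OF f]
  have "(\<lambda>w \<in> carrier W. s w) \<in> mod_hom A W X"
  proof (rule mod_homI[OF mods(1)])
    fix y y' assume y: "y \<in> carrier W" "y' \<in> carrier W"
    show "s (y \<oplus>\<^bsub>W\<^esub> y') = s y \<oplus>\<^bsub>X\<^esub> s y'"
      by (rule inj_onD[OF i(2)]) (use y s iD fD in auto)
  next
    fix a y assume y: "a \<in> carrier A" "y \<in> carrier W"
    show "s (a \<odot>\<^bsub>W\<^esub> y) = a \<odot>\<^bsub>X\<^esub> s y"
      by (rule inj_onD[OF i(2)]) (use y s iD fD in auto)
  qed (use s in auto)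
  then show thesis by (rule that) (use s in auto)
qed

lemma mod_hom_inverse:
  assumes "left_module A X" "left_module A Y" "f \<in> mod_hom A X Y" "bij_betw f (carrier X) (carrier Y)"
  obtains g where "g \<in> mod_hom A Y X" "\<And>x. x \<in> carrier X \<Longrightarrow> g (f x) = x"
    "\<And>y. y \<in> carrier Y \<Longrightarrow> f (g y) = y"
proof -
  have f: "inj_on f (carrier X)" "f ` carrier X = carrier Y" using assms(4) by (auto simp: bij_betw_def)
  obtain g where g: "g \<in> mod_hom A Y X" "\<And>y. y \<in> carrier Y \<Longrightarrow> f (g y) = (\<lambda>y \<in> carrier Y. y) y"
    by (rule factor_through_inj[OF assms(2,1,2,3) f(1) mod_hom_id[OF assms(2)]]) (auto simp: f)
  have "g (f x) = x" if "x \<in> carrier X" for x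
    by (rule inj_onD[OF f(1)]) (use that g mod_hom_closed[OF g(1)] mod_hom_closed[OF assms(3)] in auto)
  then show thesis using g by (intro that) auto
qed

section \<open>Finitely generated modules\<close>

lemma fg_moduleD: "fg_module A X \<Longrightarrow> left_module A X"
  by (simp add: fg_module_def)

lemma fg_moduleE:
  assumes "fg_module A X"
  obtains S where "finite S" "S \<subseteq> carrier X" "\<And>H. \<lbrakk>submodule H A X; S \<subseteq> H\<rbrakk> \<Longrightarrow> H = carrier X"
  using assms by (auto simp: fg_module_def finitely_generated_def)

lemma fg_moduleI:
  assumes "left_module A X" "finite S" "S \<subseteq> carrier X"
    and "\<And>H. \<lbrakk>submodule H A X; S \<subseteq> H\<rbrakk> \<Longrightarrow> carrier X \<subseteq> H"
  shows "fg_module A X"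
  unfolding fg_module_def finitely_generated_def
  using assms submodule_subset by (metis subset_antisym)

lemma fg_module_image:
  assumes "fg_module A X" "left_module A Y" "f \<in> mod_hom A X Y" "f ` carrier X = carrier Y"
  shows "fg_module A Y"
proof -
  obtain S where S: "finite S" "S \<subseteq> carrier X" "\<And>H. \<lbrakk>submodule H A X; S \<subseteq> H\<rbrakk> \<Longrightarrow> H = carrier X"
    using fg_moduleE[OF assms(1)] by blast
  show ?thesis
  proof (rule fg_moduleI[OF assms(2), of "f ` S"])
    fix H assume H: "submodule H A Y" "f ` S \<subseteq> H"
    have "{x \<in> carrier X. f x \<in> H} = carrier X"
      by (rule S(3)[OF vimage_submodule[OF fg_moduleD[OF assms(1)] assms(2,3) H(1)]]) (use S H in auto)
    then have "f x \<in> H" if "x \<in> carrier X" for x using that by blast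
    then show "carrier Y \<subseteq> H" unfolding assms(4)[symmetric] by (rule image_subsetI)
  qed (use S assms(4) in auto)
qed

lemma fg_module_rep:
  fixes A :: "('a, 'k) ring_scheme" and X :: "('a, 'x, 'l) module_scheme"
  assumes "fg_module A X"
  obtains Y :: "'a fgmod" and f g
  where "fg_module A Y" "f \<in> mod_hom A X Y" "g \<in> mod_hom A Y X"
    "\<And>x. x \<in> carrier X \<Longrightarrow> g (f x) = x" "\<And>y. y \<in> carrier Y \<Longrightarrow> f (g y) = y"
proof -
  obtain Y :: "'a fgmod" and f where Y: "fg_module A Y" "f \<in> mod_hom A X Y"
      "bij_betw f (carrier X) (carrier Y)"
    by (rule fg_module_representative[OF assms])
  obtain g where "g \<in> mod_hom A Y X" "\<And>x. x \<in> carrier X \<Longrightarrow> g (f x) = x"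
      "\<And>y. y \<in> carrier Y \<Longrightarrow> f (g y) = y"
    using mod_hom_inverse[OF fg_moduleD[OF assms] fg_moduleD[OF Y(1)] Y(2,3)] by blast
  with Y show thesis by (intro that)
qed

definition zero_module :: "'x \<Rightarrow> ('a, 'x) module" where
  "zero_module z = \<lparr>carrier = {z}, mult = undefined, one = undefined, zero = z, add = (\<lambda>_ _. z),
     smult = (\<lambda>_ _. z)\<rparr>"

lemma zero_module_simps [simp]:
  "carrier (zero_module z) = {z}" "\<zero>\<^bsub>zero_module z\<^esub> = z" "x \<oplus>\<^bsub>zero_module z\<^esub> y = z"
  "a \<odot>\<^bsub>zero_module z\<^esub> x = z"
  by (auto simp: zero_module_def)

lemma fg_zero_module:
  assumes "ring A" shows "fg_module A (zero_module z)"
proof -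
  have "abelian_group (zero_module z)"
    by (rule abelian_groupI) auto
  then have "left_module A (zero_module z)"
    using assms by (intro left_module.intro left_module_axioms.intro) auto
  then show ?thesis
    by (rule fg_moduleI[of _ _ "{z}"]) auto
qed

lemma fg_regular_module:
  assumes "ring A" shows "fg_module A (regular_module A)"
proof -
  interpret ring A by (rule assms)
  have "abelian_group (regular_module A)"
  proof (rule abelian_groupI)
    fix x assume "x \<in> carrier (regular_module A)"
    then show "\<exists>y \<in> carrier (regular_module A). y \<oplus>\<^bsub>regular_module A\<^esub> x = \<zero>\<^bsub>regular_module A\<^esub>"
      by (intro bexI[of _ "\<ominus>\<^bsub>A\<^esub> x"]) (auto simp: regular_module_def l_neg)
  qed (auto simp: regular_module_def a_ac)
  then have mod: "left_module A (regular_module A)"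
    using assms by (intro left_module.intro left_module_axioms.intro)
      (auto simp: regular_module_def l_distr r_distr m_assoc)
  show ?thesis
  proof (rule fg_moduleI[OF mod, of "{\<one>\<^bsub>A\<^esub>}"])
    fix H assume H: "submodule H A (regular_module A)" "{\<one>\<^bsub>A\<^esub>} \<subseteq> H"
    then have "a \<otimes>\<^bsub>A\<^esub> \<one>\<^bsub>A\<^esub> \<in> H" if "a \<in> carrier A" for a
      using submodule_smult[OF H(1), of a "\<one>\<^bsub>A\<^esub>"] that by (auto simp: regular_module_def)
    then show "carrier (regular_module A) \<subseteq> H" by (auto simp: regular_module_def)
  qed (auto simp: regular_module_def)
qed

definition dsum :: "('a, 'x, 'k) module_scheme \<Rightarrow> ('a, 'y, 'l) module_scheme \<Rightarrow> ('a, 'x \<times> 'y) module" where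
  "dsum X Y = \<lparr>carrier = carrier X \<times> carrier Y, mult = undefined, one = undefined,
     zero = (\<zero>\<^bsub>X\<^esub>, \<zero>\<^bsub>Y\<^esub>), add = (\<lambda>(x, y) (x', y'). (x \<oplus>\<^bsub>X\<^esub> x', y \<oplus>\<^bsub>Y\<^esub> y')),
     smult = (\<lambda>a (x, y). (a \<odot>\<^bsub>X\<^esub> x, a \<odot>\<^bsub>Y\<^esub> y))\<rparr>"

lemma dsum_simps [simp]:
  "carrier (dsum X Y) = carrier X \<times> carrier Y" "\<zero>\<^bsub>dsum X Y\<^esub> = (\<zero>\<^bsub>X\<^esub>, \<zero>\<^bsub>Y\<^esub>)"
  "(x, y) \<oplus>\<^bsub>dsum X Y\<^esub> (x', y') = (x \<oplus>\<^bsub>X\<^esub> x', y \<oplus>\<^bsub>Y\<^esub> y')"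
  "a \<odot>\<^bsub>dsum X Y\<^esub> (x, y) = (a \<odot>\<^bsub>X\<^esub> x, a \<odot>\<^bsub>Y\<^esub> y)"
  by (auto simp: dsum_def)

lemma fg_dsum:
  assumes "fg_module A X" "fg_module A Y"
  shows "fg_module A (dsum X Y)"
proof -
  interpret X: left_module A X by (rule fg_moduleD[OF assms(1)])
  interpret Y: left_module A Y by (rule fg_moduleD[OF assms(2)])
  have "abelian_group (dsum X Y)"
  proof (rule abelian_groupI)
    fix z assume "z \<in> carrier (dsum X Y)"
    then show "\<exists>w \<in> carrier (dsum X Y). w \<oplus>\<^bsub>dsum X Y\<^esub> z = \<zero>\<^bsub>dsum X Y\<^esub>"
      by (intro bexI[of _ "(\<ominus>\<^bsub>X\<^esub> fst z, \<ominus>\<^bsub>Y\<^esub> snd z)"]) (auto simp: X.X.l_neg Y.X.l_neg)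
  qed (auto simp: X.X.a_ac Y.X.a_ac)
  then have mod: "left_module A (dsum X Y)"
    by (intro left_module.intro left_module_axioms.intro X.A.ring_axioms)
      (auto simp: X.smult_l_distr X.smult_r_distr X.smult_assoc1
        Y.smult_l_distr Y.smult_r_distr Y.smult_assoc1)
  obtain S where S: "finite S" "S \<subseteq> carrier X" "\<And>H. \<lbrakk>submodule H A X; S \<subseteq> H\<rbrakk> \<Longrightarrow> H = carrier X"
    using fg_moduleE[OF assms(1)] by blast
  obtain T where T: "finite T" "T \<subseteq> carrier Y" "\<And>H. \<lbrakk>submodule H A Y; T \<subseteq> H\<rbrakk> \<Longrightarrow> H = carrier Y"
    using fg_moduleE[OF assms(2)] by blast
  show ?thesis
  proof (rule fg_moduleI[OF mod, of "(\<lambda>x. (x, \<zero>\<^bsub>Y\<^esub>)) ` S \<union> Pair \<zero>\<^bsub>X\<^esub> ` T"])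
    fix H assume H: "submodule H A (dsum X Y)" "(\<lambda>x. (x, \<zero>\<^bsub>Y\<^esub>)) ` S \<union> Pair \<zero>\<^bsub>X\<^esub> ` T \<subseteq> H"
    note HD = submoduleD[OF H(1)]
    have "submodule {x \<in> carrier X. (x, \<zero>\<^bsub>Y\<^esub>) \<in> H} A X"
    proof (rule X.submoduleI)
      fix x x' assume "x \<in> {x \<in> carrier X. (x, \<zero>\<^bsub>Y\<^esub>) \<in> H}" "x' \<in> {x \<in> carrier X. (x, \<zero>\<^bsub>Y\<^esub>) \<in> H}"
      then show "x \<oplus>\<^bsub>X\<^esub> x' \<in> {x \<in> carrier X. (x, \<zero>\<^bsub>Y\<^esub>) \<in> H}"
        using HD(3)[of "(x, \<zero>\<^bsub>Y\<^esub>)" "(x', \<zero>\<^bsub>Y\<^esub>)"] by simp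
    next
      fix a x assume "a \<in> carrier A" "x \<in> {x \<in> carrier X. (x, \<zero>\<^bsub>Y\<^esub>) \<in> H}"
      then show "a \<odot>\<^bsub>X\<^esub> x \<in> {x \<in> carrier X. (x, \<zero>\<^bsub>Y\<^esub>) \<in> H}"
        using HD(4)[of a "(x, \<zero>\<^bsub>Y\<^esub>)"] by simp
    qed (use HD in auto)
    then have 1: "{x \<in> carrier X. (x, \<zero>\<^bsub>Y\<^esub>) \<in> H} = carrier X" by (rule S(3)) (use S H in auto)
    have "submodule {y \<in> carrier Y. (\<zero>\<^bsub>X\<^esub>, y) \<in> H} A Y"
    proof (rule Y.submoduleI)
      fix x x' assume "x \<in> {y \<in> carrier Y. (\<zero>\<^bsub>X\<^esub>, y) \<in> H}" "x' \<in> {y \<in> carrier Y. (\<zero>\<^bsub>X\<^esub>, y) \<in> H}"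
      then show "x \<oplus>\<^bsub>Y\<^esub> x' \<in> {y \<in> carrier Y. (\<zero>\<^bsub>X\<^esub>, y) \<in> H}"
        using HD(3)[of "(\<zero>\<^bsub>X\<^esub>, x)" "(\<zero>\<^bsub>X\<^esub>, x')"] by simp
    next
      fix a x assume "a \<in> carrier A" "x \<in> {y \<in> carrier Y. (\<zero>\<^bsub>X\<^esub>, y) \<in> H}"
      then show "a \<odot>\<^bsub>Y\<^esub> x \<in> {y \<in> carrier Y. (\<zero>\<^bsub>X\<^esub>, y) \<in> H}"
        using HD(4)[of a "(\<zero>\<^bsub>X\<^esub>, x)"] by simp
    qed (use HD in auto)
    then have 2: "{y \<in> carrier Y. (\<zero>\<^bsub>X\<^esub>, y) \<in> H} = carrier Y" by (rule T(3)) (use T H in auto)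
    show "carrier (dsum X Y) \<subseteq> H"
    proof
      fix z assume z: "z \<in> carrier (dsum X Y)"
      then have "(fst z, \<zero>\<^bsub>Y\<^esub>) \<in> H" "(\<zero>\<^bsub>X\<^esub>, snd z) \<in> H" using 1 2 by auto
      then have "(fst z, \<zero>\<^bsub>Y\<^esub>) \<oplus>\<^bsub>dsum X Y\<^esub> (\<zero>\<^bsub>X\<^esub>, snd z) \<in> H" by (rule HD(3))
      then show "z \<in> H" using z by auto
    qed
  qed (use S T in auto)
qed

lemma fg_biproduct:
  fixes A :: "('a, 'k) ring_scheme"
    and X :: "('a, 'x, 'l) module_scheme" and Y :: "('a, 'y, 'm) module_scheme"
  assumes "fg_module A X" "fg_module A Y"
  obtains P :: "'a fgmod" and i j p q
  where "fg_module A P" "i \<in> mod_hom A X P" "j \<in> mod_hom A Y P" "p \<in> mod_hom A P X" "q \<in> mod_hom A P Y"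
    "\<And>x. x \<in> carrier X \<Longrightarrow> p (i x) = x" "\<And>y. y \<in> carrier Y \<Longrightarrow> q (j y) = y"
    "\<And>x. x \<in> carrier X \<Longrightarrow> q (i x) = \<zero>\<^bsub>Y\<^esub>" "\<And>y. y \<in> carrier Y \<Longrightarrow> p (j y) = \<zero>\<^bsub>X\<^esub>"
    "\<And>z. z \<in> carrier P \<Longrightarrow> i (p z) \<oplus>\<^bsub>P\<^esub> j (q z) = z"
proof -
  interpret X: left_module A X by (rule fg_moduleD[OF assms(1)])
  interpret Y: left_module A Y by (rule fg_moduleD[OF assms(2)])
  note fg = fg_dsum[OF assms]
  interpret D: left_module A "dsum X Y" by (rule fg_moduleD[OF fg])
  obtain P :: "'a fgmod" and f g where P: "fg_module A P" "f \<in> mod_hom A (dsum X Y) P"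
      "g \<in> mod_hom A P (dsum X Y)" "\<And>x. x \<in> carrier (dsum X Y) \<Longrightarrow> g (f x) = x"
      "\<And>y. y \<in> carrier P \<Longrightarrow> f (g y) = y"
    using fg_module_rep[OF fg] by metis
  have 1: "(\<lambda>x \<in> carrier X. (x, \<zero>\<^bsub>Y\<^esub>)) \<in> mod_hom A X (dsum X Y)"
    by (rule mod_homI) (auto intro: X.left_module_axioms)
  have 2: "(\<lambda>y \<in> carrier Y. (\<zero>\<^bsub>X\<^esub>, y)) \<in> mod_hom A Y (dsum X Y)"
    by (rule mod_homI) (auto intro: Y.left_module_axioms)
  have 3: "(\<lambda>z \<in> carrier (dsum X Y). fst z) \<in> mod_hom A (dsum X Y) X"
    by (rule mod_homI) (auto intro: D.left_module_axioms)
  have 4: "(\<lambda>z \<in> carrier (dsum X Y). snd z) \<in> mod_hom A (dsum X Y) Y"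
    by (rule mod_homI) (auto intro: D.left_module_axioms)
  note PD = fg_moduleD[OF P(1)]
  note g = mod_hom_closed[OF P(3), simplified]
  show thesis
  proof (rule that[OF P(1) mod_hom_compose[OF X.left_module_axioms 1 P(2)]
        mod_hom_compose[OF Y.left_module_axioms 2 P(2)] mod_hom_compose[OF PD P(3) 3]
        mod_hom_compose[OF PD P(3) 4]])
    fix z assume z: "z \<in> carrier P"
    have "f (fst (g z), \<zero>\<^bsub>Y\<^esub>) \<oplus>\<^bsub>P\<^esub> f (\<zero>\<^bsub>X\<^esub>, snd (g z)) = f (g z)"
      using g[OF z] mod_hom_add[OF P(2), of "(fst (g z), \<zero>\<^bsub>Y\<^esub>)" "(\<zero>\<^bsub>X\<^esub>, snd (g z))"]
      by (cases "g z") auto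
    then show "compose (carrier X) f (\<lambda>x\<in>carrier X. (x, \<zero>\<^bsub>Y\<^esub>)) (compose (carrier P) (\<lambda>z\<in>carrier (dsum X Y). fst z) g z)
      \<oplus>\<^bsub>P\<^esub> compose (carrier Y) f (\<lambda>y\<in>carrier Y. (\<zero>\<^bsub>X\<^esub>, y)) (compose (carrier P) (\<lambda>z\<in>carrier (dsum X Y). snd z) g z) = z"
      using z g[OF z] P(5) by (auto simp: compose_def mem_Times_iff)
  qed (use mod_hom_closed[OF P(2)] P(4) in \<open>auto simp: compose_def\<close>)
qed

text \<open>
  The quotient module is built on a system of representatives of the cosets, which keeps the
  type of the carrier.
\<close>

lemma quotient_module:
  fixes X :: "('a, 'x) module"
  assumes "fg_module A X" "submodule K A X"
  obtains Q :: "('a, 'x) module" and p where "fg_module A Q" "p \<in> mod_hom A X Q"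
    "p ` carrier X = carrier Q" "\<And>x. x \<in> carrier X \<Longrightarrow> p x = \<zero>\<^bsub>Q\<^esub> \<longleftrightarrow> x \<in> K"
proof -
  interpret X: left_module A X by (rule fg_moduleD[OF assms(1)])
  note K = submoduleD[OF assms(2)]
  have KX: "x \<in> carrier X" if "x \<in> K" for x using K(1) that by blast
  define r where "r x = (SOME y. y \<in> carrier X \<and> y \<ominus>\<^bsub>X\<^esub> x \<in> K)" for x
  have r: "r x \<in> carrier X \<and> r x \<ominus>\<^bsub>X\<^esub> x \<in> K" if "x \<in> carrier X" for x
    unfolding r_def by (rule someI[of _ x]) (use that K in \<open>simp add: a_minus_def X.X.r_neg\<close>)
  have rX: "r x \<in> carrier X" if "x \<in> carrier X" for x using r that by blast
  have eq1: "(\<exists>k \<in> K. x = y \<oplus>\<^bsub>X\<^esub> k) \<longleftrightarrow> x \<ominus>\<^bsub>X\<^esub> y \<in> K" if "x \<in> carrier X" "y \<in> carrier X" for x y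
  proof
    assume "\<exists>k \<in> K. x = y \<oplus>\<^bsub>X\<^esub> k"
    then obtain k where k: "k \<in> K" "x = y \<oplus>\<^bsub>X\<^esub> k" by blast
    then have "x \<ominus>\<^bsub>X\<^esub> y = k" using that KX[OF k(1)]
      by (simp add: a_minus_def X.X.a_ac X.X.r_neg X.X.r_neg1 X.X.r_neg2)
    then show "x \<ominus>\<^bsub>X\<^esub> y \<in> K" using k by simp
  next
    assume "x \<ominus>\<^bsub>X\<^esub> y \<in> K"
    moreover have "x = y \<oplus>\<^bsub>X\<^esub> (x \<ominus>\<^bsub>X\<^esub> y)" using that
      by (simp add: a_minus_def X.X.a_ac X.X.r_neg X.X.r_neg1 X.X.r_neg2)
    ultimately show "\<exists>k \<in> K. x = y \<oplus>\<^bsub>X\<^esub> k" by blast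
  qed
  have rE: "\<exists>k \<in> K. r x = x \<oplus>\<^bsub>X\<^esub> k" if "x \<in> carrier X" for x
    using r[OF that] eq1[of "r x" x] that by blast
  have r_eq: "r x = r y" if xy: "x \<in> carrier X" "y \<in> carrier X" "\<exists>k \<in> K. x = y \<oplus>\<^bsub>X\<^esub> k" for x y
  proof -
    have "z \<ominus>\<^bsub>X\<^esub> x \<in> K \<longleftrightarrow> z \<ominus>\<^bsub>X\<^esub> y \<in> K" if z: "z \<in> carrier X" for z
    proof -
      obtain k where k: "k \<in> K" "x = y \<oplus>\<^bsub>X\<^esub> k" using xy by blast
      have "(\<exists>l \<in> K. z = x \<oplus>\<^bsub>X\<^esub> l) \<longleftrightarrow> (\<exists>l \<in> K. z = y \<oplus>\<^bsub>X\<^esub> l)"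
      proof (intro iffI; elim bexE)
        fix l assume "l \<in> K" "z = x \<oplus>\<^bsub>X\<^esub> l"
        then show "\<exists>l \<in> K. z = y \<oplus>\<^bsub>X\<^esub> l"
          using k K KX xy by (intro bexI[of _ "k \<oplus>\<^bsub>X\<^esub> l"]) (auto simp: X.X.a_assoc)
      next
        fix l assume "l \<in> K" "z = y \<oplus>\<^bsub>X\<^esub> l"
        then show "\<exists>l \<in> K. z = x \<oplus>\<^bsub>X\<^esub> l"
          using k K KX xy
          by (intro bexI[of _ "\<ominus>\<^bsub>X\<^esub> k \<oplus>\<^bsub>X\<^esub> l"]) (auto simp: X.X.a_assoc X.X.r_neg1 X.X.r_neg2)
      qed
      then show ?thesis using eq1 xy z by simp
    qed
    then have "(\<lambda>z. z \<in> carrier X \<and> z \<ominus>\<^bsub>X\<^esub> x \<in> K) = (\<lambda>z. z \<in> carrier X \<and> z \<ominus>\<^bsub>X\<^esub> y \<in> K)" by blast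
    then show ?thesis unfolding r_def by simp
  qed
  have r1: "r (r x \<oplus>\<^bsub>X\<^esub> y) = r (x \<oplus>\<^bsub>X\<^esub> y)" if xy: "x \<in> carrier X" "y \<in> carrier X" for x y
  proof (rule r_eq)
    obtain k where "k \<in> K" "r x = x \<oplus>\<^bsub>X\<^esub> k" using rE xy by blast
    then show "\<exists>k \<in> K. r x \<oplus>\<^bsub>X\<^esub> y = x \<oplus>\<^bsub>X\<^esub> y \<oplus>\<^bsub>X\<^esub> k"
      using xy KX by (intro bexI[of _ k]) (auto simp: X.X.a_ac)
  qed (use xy rX in auto)
  have r2: "r (y \<oplus>\<^bsub>X\<^esub> r x) = r (y \<oplus>\<^bsub>X\<^esub> x)" if xy: "x \<in> carrier X" "y \<in> carrier X" for x y
    using r1[OF xy] xy rX by (simp add: X.X.a_comm)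
  have r3: "r (a \<odot>\<^bsub>X\<^esub> r x) = r (a \<odot>\<^bsub>X\<^esub> x)" if xy: "a \<in> carrier A" "x \<in> carrier X" for a x
  proof (rule r_eq)
    obtain k where "k \<in> K" "r x = x \<oplus>\<^bsub>X\<^esub> k" using rE xy by blast
    then show "\<exists>k \<in> K. a \<odot>\<^bsub>X\<^esub> r x = a \<odot>\<^bsub>X\<^esub> x \<oplus>\<^bsub>X\<^esub> k"
      using xy KX K by (intro bexI[of _ "a \<odot>\<^bsub>X\<^esub> k"]) (auto simp: X.smult_r_distr)
  qed (use xy rX in auto)
  have r5: "r (a \<odot>\<^bsub>X\<^esub> r x \<oplus>\<^bsub>X\<^esub> b \<odot>\<^bsub>X\<^esub> r y) = r (a \<odot>\<^bsub>X\<^esub> x \<oplus>\<^bsub>X\<^esub> b \<odot>\<^bsub>X\<^esub> y)"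
    if "a \<in> carrier A" "x \<in> carrier X" "b \<in> carrier A" "y \<in> carrier X" for a x b y
    using that rX r1[of "a \<odot>\<^bsub>X\<^esub> r x" "b \<odot>\<^bsub>X\<^esub> r y"] r1[of "a \<odot>\<^bsub>X\<^esub> x" "b \<odot>\<^bsub>X\<^esub> r y"]
      r2[of "b \<odot>\<^bsub>X\<^esub> r y" "a \<odot>\<^bsub>X\<^esub> x"] r2[of "b \<odot>\<^bsub>X\<^esub> y" "a \<odot>\<^bsub>X\<^esub> x"] r3[of a x] r3[of b y] by simp
  have r6: "r (a \<odot>\<^bsub>X\<^esub> (b \<odot>\<^bsub>X\<^esub> r x)) = r (a \<odot>\<^bsub>X\<^esub> (b \<odot>\<^bsub>X\<^esub> x))"
    if "a \<in> carrier A" "b \<in> carrier A" "x \<in> carrier X" for a b x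
    using that rX r3[of "a \<otimes>\<^bsub>A\<^esub> b" x] by (simp add: X.smult_assoc1)
  have r4: "r (r x) = r x" if "x \<in> carrier X" for x
    by (rule r_eq) (use that rX rE in auto)
  define Q :: "('a, 'x) module" where "Q = \<lparr>carrier = r ` carrier X, mult = undefined, one = undefined,
    zero = r \<zero>\<^bsub>X\<^esub>, add = (\<lambda>x y. r (x \<oplus>\<^bsub>X\<^esub> y)), smult = (\<lambda>a x. r (a \<odot>\<^bsub>X\<^esub> x))\<rparr>"
  have "abelian_group Q"
  proof (rule abelian_groupI)
    fix u assume "u \<in> carrier Q"
    then obtain x where "x \<in> carrier X" "u = r x" by (auto simp: Q_def)
    then show "\<exists>v \<in> carrier Q. v \<oplus>\<^bsub>Q\<^esub> u = \<zero>\<^bsub>Q\<^esub>"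
      by (intro bexI[of _ "r (\<ominus>\<^bsub>X\<^esub> x)"]) (auto simp: Q_def rX r1 r2 X.X.l_neg)
  next
    fix u v assume "u \<in> carrier Q" "v \<in> carrier Q"
    then show "u \<oplus>\<^bsub>Q\<^esub> v = v \<oplus>\<^bsub>Q\<^esub> u" by (auto simp: Q_def rX X.X.a_comm)
  next
    fix u v w assume "u \<in> carrier Q" "v \<in> carrier Q" "w \<in> carrier Q"
    then obtain x y z where "x \<in> carrier X" "y \<in> carrier X" "z \<in> carrier X" "u = r x" "v = r y" "w = r z"
      by (auto simp: Q_def)
    then show "u \<oplus>\<^bsub>Q\<^esub> v \<oplus>\<^bsub>Q\<^esub> w = u \<oplus>\<^bsub>Q\<^esub> (v \<oplus>\<^bsub>Q\<^esub> w)"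
      by (simp add: Q_def rX r1 r2) (simp add: X.X.a_assoc[symmetric] r2 rX)
  qed (auto simp: Q_def rX r1 r2 r4)
  then have mod: "left_module A Q"
    by (intro left_module.intro left_module_axioms.intro X.A.ring_axioms)
      (auto simp: Q_def rX r1 r2 r3 r4 r5 r6 X.smult_l_distr X.smult_r_distr X.smult_assoc1)
  have hom: "restrict r (carrier X) \<in> mod_hom A X Q"
    by (rule mod_homI) (auto simp: Q_def rX r1 r2 r3 r4 X.left_module_axioms)
  have surj: "restrict r (carrier X) ` carrier X = carrier Q" by (auto simp: Q_def)
  have "restrict r (carrier X) x = \<zero>\<^bsub>Q\<^esub> \<longleftrightarrow> x \<in> K" if x: "x \<in> carrier X" for x
  proof
    assume "x \<in> K"
    then have "r x = r \<zero>\<^bsub>X\<^esub>" by (intro r_eq) (use x in \<open>auto intro: bexI[of _ x]\<close>)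
    then show "restrict r (carrier X) x = \<zero>\<^bsub>Q\<^esub>" using x by (simp add: Q_def)
  next
    assume "restrict r (carrier X) x = \<zero>\<^bsub>Q\<^esub>"
    then have "r x = r \<zero>\<^bsub>X\<^esub>" using x by (simp add: Q_def)
    then obtain k l where kl: "k \<in> K" "l \<in> K" "x \<oplus>\<^bsub>X\<^esub> k = \<zero>\<^bsub>X\<^esub> \<oplus>\<^bsub>X\<^esub> l" using rE x by (metis X.X.zero_closed)
    then have "x = l \<ominus>\<^bsub>X\<^esub> k" using x KX[OF kl(1)] KX[OF kl(2)]
      by (simp add: a_minus_def X.X.add.inv_solve_right)
    then show "x \<in> K" using K kl by simp
  qed
  then show thesis using that fg_module_image[OF assms(1) mod hom surj] hom surj by blast
qed

section \<open>Chain conditions\<close>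

lemma submodule_Union_chain:
  assumes "left_module A X" "\<C> \<noteq> {}" "\<And>H. H \<in> \<C> \<Longrightarrow> submodule H A X"
    and "\<And>H K. \<lbrakk>H \<in> \<C>; K \<in> \<C>\<rbrakk> \<Longrightarrow> H \<subseteq> K \<or> K \<subseteq> H"
  shows "submodule (\<Union>\<C>) A X"
proof -
  interpret X: left_module A X by (rule assms)
  note D = submoduleD[OF assms(3)]
  show ?thesis
  proof (rule X.submoduleI)
    fix x y assume "x \<in> \<Union>\<C>" "y \<in> \<Union>\<C>"
    then obtain H K where HK: "H \<in> \<C>" "x \<in> H" "K \<in> \<C>" "y \<in> K" by blast
    then consider "x \<in> K" | "y \<in> H" using assms(4) by blast
    then show "x \<oplus>\<^bsub>X\<^esub> y \<in> \<Union>\<C>" by cases (use HK D(3) in blast)+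
  next
    show "\<Union>\<C> \<subseteq> carrier X" using D(1) by blast
    obtain H where "H \<in> \<C>" using assms(2) by blast
    then show "\<zero>\<^bsub>X\<^esub> \<in> \<Union>\<C>" using D(2) by blast
  next
    fix a x assume a: "a \<in> carrier A" and "x \<in> \<Union>\<C>"
    then obtain H where "H \<in> \<C>" "x \<in> H" by blast
    then show "a \<odot>\<^bsub>X\<^esub> x \<in> \<Union>\<C>" using D(4)[OF _ a] by blast
  qed
qed

definition adjoin :: "('a, 'k) ring_scheme \<Rightarrow> ('a, 'x, 'l) module_scheme \<Rightarrow> 'x set \<Rightarrow> 'x \<Rightarrow> 'x set" where
  "adjoin A X H x = {h \<oplus>\<^bsub>X\<^esub> a \<odot>\<^bsub>X\<^esub> x | h a. h \<in> H \<and> a \<in> carrier A}"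

lemma submodule_adjoin:
  assumes "left_module A X" "submodule H A X" "x \<in> carrier X"
  shows "submodule (adjoin A X H x) A X" "H \<subseteq> adjoin A X H x" "x \<in> adjoin A X H x"
proof -
  interpret X: left_module A X by (rule assms)
  note H = submoduleD[OF assms(2)]
  have HX: "h \<in> carrier X" if "h \<in> H" for h using H(1) that by blast
  have mem: "h \<oplus>\<^bsub>X\<^esub> a \<odot>\<^bsub>X\<^esub> x \<in> adjoin A X H x" if "h \<in> H" "a \<in> carrier A" for h a
    using that by (auto simp: adjoin_def)
  show sub: "H \<subseteq> adjoin A X H x"
  proof
    fix h assume "h \<in> H"
    then show "h \<in> adjoin A X H x" using mem[of h "\<zero>\<^bsub>A\<^esub>"] HX assms(3) by simp
  qed
  show "x \<in> adjoin A X H x" using mem[of "\<zero>\<^bsub>X\<^esub>" "\<one>\<^bsub>A\<^esub>"] H assms(3) by simp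
  show "submodule (adjoin A X H x) A X"
  proof (rule X.submoduleI)
    fix y z assume "y \<in> adjoin A X H x" "z \<in> adjoin A X H x"
    then obtain h a k b where e: "h \<in> H" "a \<in> carrier A" "y = h \<oplus>\<^bsub>X\<^esub> a \<odot>\<^bsub>X\<^esub> x"
        "k \<in> H" "b \<in> carrier A" "z = k \<oplus>\<^bsub>X\<^esub> b \<odot>\<^bsub>X\<^esub> x" unfolding adjoin_def by blast
    then have "y \<oplus>\<^bsub>X\<^esub> z = (h \<oplus>\<^bsub>X\<^esub> k) \<oplus>\<^bsub>X\<^esub> (a \<oplus>\<^bsub>A\<^esub> b) \<odot>\<^bsub>X\<^esub> x"
      using HX assms(3) by (simp add: X.smult_l_distr X.X.a_ac)
    then show "y \<oplus>\<^bsub>X\<^esub> z \<in> adjoin A X H x" using mem e H by simp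
  next
    fix c y assume c: "c \<in> carrier A" "y \<in> adjoin A X H x"
    then obtain h a where e: "h \<in> H" "a \<in> carrier A" "y = h \<oplus>\<^bsub>X\<^esub> a \<odot>\<^bsub>X\<^esub> x" unfolding adjoin_def by blast
    then have "c \<odot>\<^bsub>X\<^esub> y = c \<odot>\<^bsub>X\<^esub> h \<oplus>\<^bsub>X\<^esub> (c \<otimes>\<^bsub>A\<^esub> a) \<odot>\<^bsub>X\<^esub> x"
      using HX assms(3) c by (simp add: X.smult_r_distr X.smult_assoc1)
    then show "c \<odot>\<^bsub>X\<^esub> y \<in> adjoin A X H x" using mem e H c by simp
  qed (use HX assms(3) sub H in \<open>auto simp: adjoin_def\<close>)
qed

definition chains_stop :: "('a, 'k) ring_scheme \<Rightarrow> ('a, 'x, 'l) module_scheme \<Rightarrow> 'x set \<Rightarrow> bool" where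
  "chains_stop A X H \<longleftrightarrow> (\<forall>C. (\<forall>n. submodule (C n) A X \<and> C (Suc n) \<subseteq> C n) \<longrightarrow>
     (\<exists>n. \<forall>k \<ge> n. C k \<inter> H = C n \<inter> H))"

lemma chains_stop_adjoin:
  assumes "artinian_cring R" "left_module R X" "submodule H R X" "x \<in> carrier X" "chains_stop R X H"
  shows "chains_stop R X (adjoin R X H x)"
  unfolding chains_stop_def
proof (intro allI impI)
  fix C assume C: "\<forall>n::nat. submodule (C n) R X \<and> C (Suc n) \<subseteq> C n"
  interpret R: artinian_cring R by (rule assms)
  interpret X: left_module R X by (rule assms)
  note CD = submoduleD[OF conjunct1[OF spec[OF C]]] and H = submoduleD[OF assms(3)]
  have CX: "y \<in> carrier X" if "y \<in> C n" for y n using CD(1) that by blast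
  have HX: "h \<in> carrier X" if "h \<in> H" for h using H(1) that by blast
  have desc: "C m \<subseteq> C n" if "n \<le> m" for m n
    by (rule lift_Suc_antimono_le[OF _ that]) (use C in simp)
  define I where "I n = {r \<in> carrier R. \<exists>h \<in> H. h \<oplus>\<^bsub>X\<^esub> r \<odot>\<^bsub>X\<^esub> x \<in> C n}" for n
  have "ideal (I n) R" for n
  proof (rule idealI)
    show "subgroup (I n) (add_monoid R)"
    proof (rule subgroup.intro)
      show "I n \<subseteq> carrier (add_monoid R)" by (auto simp: I_def)
      show "\<one>\<^bsub>add_monoid R\<^esub> \<in> I n"
        using CD H assms(4) by (auto simp: I_def intro!: bexI[of _ "\<zero>\<^bsub>X\<^esub>"])
      fix a b assume "a \<in> I n" "b \<in> I n"
      then obtain h k where e: "a \<in> carrier R" "h \<in> H" "h \<oplus>\<^bsub>X\<^esub> a \<odot>\<^bsub>X\<^esub> x \<in> C n"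
          "b \<in> carrier R" "k \<in> H" "k \<oplus>\<^bsub>X\<^esub> b \<odot>\<^bsub>X\<^esub> x \<in> C n" unfolding I_def by blast
      have "(h \<oplus>\<^bsub>X\<^esub> a \<odot>\<^bsub>X\<^esub> x) \<oplus>\<^bsub>X\<^esub> (k \<oplus>\<^bsub>X\<^esub> b \<odot>\<^bsub>X\<^esub> x) \<in> C n" by (rule CD(3)) (rule e(3), rule e(6))
      also have "(h \<oplus>\<^bsub>X\<^esub> a \<odot>\<^bsub>X\<^esub> x) \<oplus>\<^bsub>X\<^esub> (k \<oplus>\<^bsub>X\<^esub> b \<odot>\<^bsub>X\<^esub> x) = (h \<oplus>\<^bsub>X\<^esub> k) \<oplus>\<^bsub>X\<^esub> (a \<oplus>\<^bsub>R\<^esub> b) \<odot>\<^bsub>X\<^esub> x"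
        using e HX assms(4) by (simp add: X.smult_l_distr X.X.a_ac)
      finally show "a \<otimes>\<^bsub>add_monoid R\<^esub> b \<in> I n" using e H by (auto simp: I_def)
    next
      fix a assume "a \<in> I n"
      then obtain h where e: "a \<in> carrier R" "h \<in> H" "h \<oplus>\<^bsub>X\<^esub> a \<odot>\<^bsub>X\<^esub> x \<in> C n" unfolding I_def by blast
      have "\<ominus>\<^bsub>X\<^esub> (h \<oplus>\<^bsub>X\<^esub> a \<odot>\<^bsub>X\<^esub> x) \<in> C n" by (rule CD(5)) (rule e(3))
      also have "\<ominus>\<^bsub>X\<^esub> (h \<oplus>\<^bsub>X\<^esub> a \<odot>\<^bsub>X\<^esub> x) = \<ominus>\<^bsub>X\<^esub> h \<oplus>\<^bsub>X\<^esub> (\<ominus>\<^bsub>R\<^esub> a) \<odot>\<^bsub>X\<^esub> x"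
        using e HX assms(4) by (simp add: X.smult_uminus_left X.X.minus_add)
      finally show "inv\<^bsub>add_monoid R\<^esub> a \<in> I n" using e H by (auto simp: I_def a_inv_def[symmetric])
    qed
    fix a c assume a: "a \<in> I n" and c: "c \<in> carrier R"
    then obtain h where e: "a \<in> carrier R" "h \<in> H" "h \<oplus>\<^bsub>X\<^esub> a \<odot>\<^bsub>X\<^esub> x \<in> C n" unfolding I_def by blast
    have "c \<odot>\<^bsub>X\<^esub> (h \<oplus>\<^bsub>X\<^esub> a \<odot>\<^bsub>X\<^esub> x) \<in> C n" by (rule CD(4)) (rule c, rule e(3))
    also have "c \<odot>\<^bsub>X\<^esub> (h \<oplus>\<^bsub>X\<^esub> a \<odot>\<^bsub>X\<^esub> x) = c \<odot>\<^bsub>X\<^esub> h \<oplus>\<^bsub>X\<^esub> (c \<otimes>\<^bsub>R\<^esub> a) \<odot>\<^bsub>X\<^esub> x"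
      using e HX c assms(4) by (simp add: X.smult_r_distr X.smult_assoc1)
    finally show "c \<otimes>\<^bsub>R\<^esub> a \<in> I n" using e H c by (auto simp: I_def)
    then show "a \<otimes>\<^bsub>R\<^esub> c \<in> I n" using c e by (simp add: R.m_comm)
  qed (rule R.ring_axioms)
  moreover have "I (Suc n) \<subseteq> I n" for n using C by (auto simp: I_def)
  ultimately have "\<exists>n. \<forall>k \<ge> n. I k = I n" by (rule R.descending_chain_condition)
  then obtain n1 where n1: "\<forall>k \<ge> n1. I k = I n1" by blast
  obtain n2 where n2: "\<forall>k \<ge> n2. C k \<inter> H = C n2 \<inter> H"
    using assms(5) C unfolding chains_stop_def by blast
  define n where "n = max n1 n2"
  have "C n \<inter> adjoin R X H x \<subseteq> C k" if k: "k \<ge> n" for k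
  proof
    fix y assume y: "y \<in> C n \<inter> adjoin R X H x"
    then obtain h a where e: "h \<in> H" "a \<in> carrier R" "y = h \<oplus>\<^bsub>X\<^esub> a \<odot>\<^bsub>X\<^esub> x" unfolding adjoin_def by blast
    then have "a \<in> I n" using y by (auto simp: I_def)
    then have "a \<in> I k" using n1[rule_format, of k] n1[rule_format, of n] k by (auto simp: n_def)
    then obtain h' where h': "h' \<in> H" "h' \<oplus>\<^bsub>X\<^esub> a \<odot>\<^bsub>X\<^esub> x \<in> C k" by (auto simp: I_def)
    have "y \<ominus>\<^bsub>X\<^esub> (h' \<oplus>\<^bsub>X\<^esub> a \<odot>\<^bsub>X\<^esub> x) \<in> C n" by (rule CD(6)) (use y h' desc[OF k] in auto)
    also have "y \<ominus>\<^bsub>X\<^esub> (h' \<oplus>\<^bsub>X\<^esub> a \<odot>\<^bsub>X\<^esub> x) = h \<ominus>\<^bsub>X\<^esub> h'"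
      using e h' HX assms(4)
      by (simp add: a_minus_def X.X.minus_add X.X.a_assoc) (simp add: X.X.a_ac X.X.r_neg2 X.X.r_neg)
    finally have "h \<ominus>\<^bsub>X\<^esub> h' \<in> C n \<inter> H" using e(1) h'(1) H(6) by simp
    then have "h \<ominus>\<^bsub>X\<^esub> h' \<in> C k" using n2[rule_format, of n] n2[rule_format, of k] k by (auto simp: n_def)
    then have "(h \<ominus>\<^bsub>X\<^esub> h') \<oplus>\<^bsub>X\<^esub> (h' \<oplus>\<^bsub>X\<^esub> a \<odot>\<^bsub>X\<^esub> x) \<in> C k" by (rule CD(3)) (rule h'(2))
    also have "(h \<ominus>\<^bsub>X\<^esub> h') \<oplus>\<^bsub>X\<^esub> (h' \<oplus>\<^bsub>X\<^esub> a \<odot>\<^bsub>X\<^esub> x) = y"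
      using e h' HX assms(4) by (simp add: a_minus_def X.X.a_assoc X.X.r_neg1)
    finally show "y \<in> C k" .
  qed
  then show "\<exists>n. \<forall>k \<ge> n. C k \<inter> adjoin R X H x = C n \<inter> adjoin R X H x"
    using desc by blast
qed

lemma chains_stop_fg:
  assumes "artinian_cring R" "fg_module R X"
  shows "chains_stop R X (carrier X)"
proof -
  interpret X: left_module R X by (rule fg_moduleD[OF assms(2)])
  obtain S where S: "finite S" "S \<subseteq> carrier X" "\<And>H. \<lbrakk>submodule H R X; S \<subseteq> H\<rbrakk> \<Longrightarrow> H = carrier X"
    using fg_moduleE[OF assms(2)] by blast
  have "\<exists>H. submodule H R X \<and> S \<subseteq> H \<and> chains_stop R X H"
    using S(1,2)
  proof (induction S rule: finite_induct)
    case empty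
    have "chains_stop R X {\<zero>\<^bsub>X\<^esub>}"
      unfolding chains_stop_def using submodule_zero_mem by blast
    then show ?case using X.submodule_zero by blast
  next
    case (insert x S)
    then obtain H where H: "submodule H R X" "S \<subseteq> H" "chains_stop R X H" by auto
    have x: "x \<in> carrier X" using insert by simp
    show ?case
      using submodule_adjoin[OF X.left_module_axioms H(1) x] H(2)
        chains_stop_adjoin[OF assms(1) X.left_module_axioms H(1) x H(3)]
      by (intro exI[of _ "adjoin R X H x"]) auto
  qed
  then show ?thesis using S(3) by metis
qed

lemma minimal_submodule:
  assumes "artinian_cring R" "fg_module R X" "\<F> \<noteq> {}" "\<And>H. H \<in> \<F> \<Longrightarrow> submodule H R X"
  shows "\<exists>K \<in> \<F>. \<forall>H \<in> \<F>. H \<subseteq> K \<longrightarrow> H = K"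
proof (rule ccontr)
  assume "\<not> ?thesis"
  then have "\<forall>K \<in> \<F>. \<exists>H. H \<in> \<F> \<and> H \<subset> K" by blast
  then obtain g where g: "\<And>K. K \<in> \<F> \<Longrightarrow> g K \<in> \<F> \<and> g K \<subset> K" by metis
  obtain K where K: "K \<in> \<F>" using assms(3) by blast
  have C: "(g ^^ n) K \<in> \<F>" for n by (induction n) (use K g in auto)
  have d: "(g ^^ Suc n) K \<subset> (g ^^ n) K" for n using g[OF C[of n]] by simp
  then have "\<forall>n. submodule ((g ^^ n) K) R X \<and> (g ^^ Suc n) K \<subseteq> (g ^^ n) K"
    using C assms(4) by blast
  then obtain n where "\<forall>k \<ge> n. (g ^^ k) K \<inter> carrier X = (g ^^ n) K \<inter> carrier X"
    using chains_stop_fg[OF assms(1,2), unfolded chains_stop_def, THEN spec, of "\<lambda>n. (g ^^ n) K"]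
    by blast
  from this[rule_format, of "Suc n"] have "(g ^^ Suc n) K \<inter> carrier X = (g ^^ n) K \<inter> carrier X" by simp
  moreover have "(g ^^ m) K \<inter> carrier X = (g ^^ m) K" for m
    using submodule_subset[OF assms(4)[OF C[of m]]] by blast
  ultimately have "(g ^^ Suc n) K = (g ^^ n) K" by metis
  then show False using d[of n] by simp
qed

text \<open>
  A minimal submodule \<open>N\<close> that is not finitely generated satisfies \<open>r N = N\<close> or \<open>r N = 0\<close>
  for every scalar \<open>r\<close>, so it is a vector space over a residue field. A subspace of \<open>N\<close> that is
  maximal among those missing a given nonzero vector is a complement of the line spanned by it,
  so \<open>N\<close> is finitely generated after all.
\<close>

lemma artinian_submodule_fg:
  assumes "artinian_cring R" "fg_module R X" "submodule N R X"
  shows "\<exists>S. finite S \<and> S \<subseteq> N \<and> (\<forall>H. submodule H R X \<and> S \<subseteq> H \<longrightarrow> N \<subseteq> H)"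
proof (rule ccontr)
  define fin where "fin N \<longleftrightarrow> (\<exists>S. finite S \<and> S \<subseteq> N \<and> (\<forall>H. submodule H R X \<and> S \<subseteq> H \<longrightarrow> N \<subseteq> H))" for N
  assume "\<not> ?thesis"
  then have nofin: "\<not> fin N" by (simp add: fin_def)
  interpret R: artinian_cring R by (rule assms)
  interpret X: left_module R X by (rule fg_moduleD[OF assms(2)])
  have "\<exists>N \<in> {N. submodule N R X \<and> \<not> fin N}. \<forall>H \<in> {N. submodule N R X \<and> \<not> fin N}. H \<subseteq> N \<longrightarrow> H = N"
    by (rule minimal_submodule[OF assms(1,2)]) (use assms(3) nofin in auto)
  then obtain N where N: "submodule N R X" "\<not> fin N"
      and min: "\<And>H. \<lbrakk>submodule H R X; \<not> fin H; H \<subseteq> N\<rbrakk> \<Longrightarrow> H = N"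
    by auto
  note ND = submoduleD[OF N(1)]
  have NX: "x \<in> carrier X" if "x \<in> N" for x using ND(1) that by blast
  let ?N = "X\<lparr>carrier := N\<rparr>"
  have Nmod: "left_module R ?N" by (rule submodule_left_module[OF X.left_module_axioms N(1)])
  have fin0: "fin {\<zero>\<^bsub>X\<^esub>}" unfolding fin_def using submodule_zero_mem by blast
  have hom: "(\<lambda>x \<in> N. r \<odot>\<^bsub>X\<^esub> x) \<in> mod_hom R ?N X" if r: "r \<in> carrier R" for r
    using mod_homI[OF Nmod, of "\<lambda>x. r \<odot>\<^bsub>X\<^esub> x" X] r NX
    by (simp add: X.smult_r_distr X.smult_assoc1[symmetric] R.m_comm)
  have dich: "(\<lambda>x. r \<odot>\<^bsub>X\<^esub> x) ` N = N \<or> (\<forall>x \<in> N. r \<odot>\<^bsub>X\<^esub> x = \<zero>\<^bsub>X\<^esub>)" if r: "r \<in> carrier R" for r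
  proof (rule ccontr)
    assume contra: "\<not> ?thesis"
    have im: "submodule ((\<lambda>x. r \<odot>\<^bsub>X\<^esub> x) ` N) R X"
      using image_submodule[OF Nmod X.left_module_axioms hom[OF r] left_module.submodule_carrier[OF Nmod]]
      by simp
    have "{x \<in> carrier ?N. (\<lambda>x \<in> N. r \<odot>\<^bsub>X\<^esub> x) x = \<zero>\<^bsub>X\<^esub>} = {x \<in> N. r \<odot>\<^bsub>X\<^esub> x = \<zero>\<^bsub>X\<^esub>}" by auto
    then have ker: "submodule {x \<in> N. r \<odot>\<^bsub>X\<^esub> x = \<zero>\<^bsub>X\<^esub>} R X"
      using kernel_submodule[OF Nmod X.left_module_axioms hom[OF r]]
      unfolding submodule_of_submodule[OF X.left_module_axioms N(1)] by metis
    have "fin ((\<lambda>x. r \<odot>\<^bsub>X\<^esub> x) ` N)"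
    proof (rule ccontr)
      assume nf: "\<not> fin ((\<lambda>x. r \<odot>\<^bsub>X\<^esub> x) ` N)"
      have "(\<lambda>x. r \<odot>\<^bsub>X\<^esub> x) ` N = N" by (rule min[OF im nf]) (use ND(4)[OF r] in auto)
      then show False using contra by simp
    qed
    then obtain S where S: "finite S" "S \<subseteq> (\<lambda>x. r \<odot>\<^bsub>X\<^esub> x) ` N"
        "\<forall>H. submodule H R X \<and> S \<subseteq> H \<longrightarrow> (\<lambda>x. r \<odot>\<^bsub>X\<^esub> x) ` N \<subseteq> H" unfolding fin_def by blast
    note S = S(1,2) S(3)[rule_format, OF conjI]
    have "fin {x \<in> N. r \<odot>\<^bsub>X\<^esub> x = \<zero>\<^bsub>X\<^esub>}"
    proof (rule ccontr)
      assume nf: "\<not> fin {x \<in> N. r \<odot>\<^bsub>X\<^esub> x = \<zero>\<^bsub>X\<^esub>}"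
      have "{x \<in> N. r \<odot>\<^bsub>X\<^esub> x = \<zero>\<^bsub>X\<^esub>} = N" by (rule min[OF ker nf]) auto
      then show False using contra by blast
    qed
    then obtain T where T: "finite T" "T \<subseteq> {x \<in> N. r \<odot>\<^bsub>X\<^esub> x = \<zero>\<^bsub>X\<^esub>}"
        "\<forall>H. submodule H R X \<and> T \<subseteq> H \<longrightarrow> {x \<in> N. r \<odot>\<^bsub>X\<^esub> x = \<zero>\<^bsub>X\<^esub>} \<subseteq> H" unfolding fin_def by blast
    note T = T(1,2) T(3)[rule_format, OF conjI]
    obtain S' where S': "S' \<subseteq> N" "finite S'" "S = (\<lambda>x. r \<odot>\<^bsub>X\<^esub> x) ` S'"
      using finite_subset_image[OF S(1,2)] by blast
    have "N \<subseteq> H" if H: "submodule H R X" "S' \<union> T \<subseteq> H" for H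
    proof
      fix y assume y: "y \<in> N"
      have HN: "submodule (H \<inter> N) R X" by (rule submodule_Int[OF X.left_module_axioms H(1) N(1)])
      then have "submodule ((\<lambda>x \<in> N. r \<odot>\<^bsub>X\<^esub> x) ` (H \<inter> N)) R X"
        by (intro image_submodule[OF Nmod X.left_module_axioms hom[OF r]])
          (auto simp: submodule_of_submodule[OF X.left_module_axioms N(1)])
      moreover have "S \<subseteq> (\<lambda>x \<in> N. r \<odot>\<^bsub>X\<^esub> x) ` (H \<inter> N)" using S' H by force
      ultimately have "(\<lambda>x. r \<odot>\<^bsub>X\<^esub> x) ` N \<subseteq> (\<lambda>x \<in> N. r \<odot>\<^bsub>X\<^esub> x) ` (H \<inter> N)" by (rule S(3))
      then have "r \<odot>\<^bsub>X\<^esub> y \<in> (\<lambda>x \<in> N. r \<odot>\<^bsub>X\<^esub> x) ` (H \<inter> N)" using y by blast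
      then obtain h where h: "h \<in> H" "h \<in> N" "r \<odot>\<^bsub>X\<^esub> y = r \<odot>\<^bsub>X\<^esub> h" by auto
      have "r \<odot>\<^bsub>X\<^esub> (y \<ominus>\<^bsub>X\<^esub> h) = \<zero>\<^bsub>X\<^esub>"
        using h y NX[OF y] NX[OF h(2)] by (simp add: r X.smult_minus_right X.X.minus_eq_zero_iff)
      then have "y \<ominus>\<^bsub>X\<^esub> h \<in> H" using T(3)[OF H(1)] H(2) ND(6)[OF y h(2)] by auto
      then have "(y \<ominus>\<^bsub>X\<^esub> h) \<oplus>\<^bsub>X\<^esub> h \<in> H" by (rule submodule_add[OF H(1)]) (rule h(1))
      then show "y \<in> H" using NX y h by (simp add: a_minus_def X.X.a_assoc X.X.l_neg)
    qed
    then have "fin N" unfolding fin_def using S' T by (intro exI[of _ "S' \<union> T"]) auto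
    then show False using N by blast
  qed
  have inv: "\<exists>s \<in> carrier R. \<forall>x \<in> N. s \<odot>\<^bsub>X\<^esub> (r \<odot>\<^bsub>X\<^esub> x) = x"
    if r: "r \<in> carrier R" "\<not> (\<forall>x \<in> N. r \<odot>\<^bsub>X\<^esub> x = \<zero>\<^bsub>X\<^esub>)" for r
  proof -
    have rN: "(\<lambda>x. r \<odot>\<^bsub>X\<^esub> x) ` N = N" using dich r by blast
    have le: "PIdl\<^bsub>R\<^esub> (r [^]\<^bsub>R\<^esub> Suc n) \<subseteq> PIdl\<^bsub>R\<^esub> (r [^]\<^bsub>R\<^esub> n)" for n :: nat
    proof
      fix y assume "y \<in> PIdl\<^bsub>R\<^esub> (r [^]\<^bsub>R\<^esub> Suc n)"
      then obtain a where "a \<in> carrier R" "y = a \<otimes>\<^bsub>R\<^esub> r [^]\<^bsub>R\<^esub> Suc n" by (auto simp: cgenideal_def)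
      then show "y \<in> PIdl\<^bsub>R\<^esub> (r [^]\<^bsub>R\<^esub> n)" using r unfolding cgenideal_def
        by (intro CollectI exI[of _ "a \<otimes>\<^bsub>R\<^esub> r"]) (auto simp: R.m_ac)
    qed
    have "\<exists>n::nat. \<forall>k \<ge> n. PIdl\<^bsub>R\<^esub> (r [^]\<^bsub>R\<^esub> k) = PIdl\<^bsub>R\<^esub> (r [^]\<^bsub>R\<^esub> n)"
      by (rule R.descending_chain_condition[where I = "\<lambda>n. PIdl\<^bsub>R\<^esub> (r [^]\<^bsub>R\<^esub> n)", OF R.cgenideal_ideal le]) (use r in auto)
    then obtain n :: nat where n: "\<forall>k \<ge> n. PIdl\<^bsub>R\<^esub> (r [^]\<^bsub>R\<^esub> k) = PIdl\<^bsub>R\<^esub> (r [^]\<^bsub>R\<^esub> n)" by blast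
    have "r [^]\<^bsub>R\<^esub> n \<in> PIdl\<^bsub>R\<^esub> (r [^]\<^bsub>R\<^esub> Suc n)"
      using R.cgenideal_self[of "r [^]\<^bsub>R\<^esub> n"] n[rule_format, of "Suc n"] r by simp
    then obtain s where s: "s \<in> carrier R" "r [^]\<^bsub>R\<^esub> n = s \<otimes>\<^bsub>R\<^esub> r [^]\<^bsub>R\<^esub> Suc n" by (auto simp: cgenideal_def)
    let ?c = "\<one>\<^bsub>R\<^esub> \<ominus>\<^bsub>R\<^esub> s \<otimes>\<^bsub>R\<^esub> r"
    have c: "?c \<in> carrier R" using r s by simp
    have "s \<otimes>\<^bsub>R\<^esub> r \<otimes>\<^bsub>R\<^esub> r [^]\<^bsub>R\<^esub> n = r [^]\<^bsub>R\<^esub> n" using s r by (simp add: R.m_ac)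
    then have c0: "?c \<otimes>\<^bsub>R\<^esub> r [^]\<^bsub>R\<^esub> n = \<zero>\<^bsub>R\<^esub>" using s(1) r
      by (simp add: a_minus_def R.l_distr R.l_minus R.r_neg)
    have rn: "(\<lambda>x. r [^]\<^bsub>R\<^esub> m \<odot>\<^bsub>X\<^esub> x) ` N = N" for m :: nat
    proof (induction m)
      case (Suc m)
      have "(\<lambda>x. r [^]\<^bsub>R\<^esub> Suc m \<odot>\<^bsub>X\<^esub> x) ` N = (\<lambda>x. r [^]\<^bsub>R\<^esub> m \<odot>\<^bsub>X\<^esub> x) ` ((\<lambda>x. r \<odot>\<^bsub>X\<^esub> x) ` N)"
        unfolding image_image using r NX by (intro image_cong) (auto simp: X.smult_assoc1)
      then show ?case using rN Suc by simp
    next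
      case 0
      have "(\<lambda>x. r [^]\<^bsub>R\<^esub> (0::nat) \<odot>\<^bsub>X\<^esub> x) ` N = (\<lambda>x. x) ` N"
        by (rule image_cong) (use NX in auto)
      then show ?case by simp
    qed
    have "\<forall>x \<in> N. ?c \<odot>\<^bsub>X\<^esub> x = \<zero>\<^bsub>X\<^esub>"
    proof (rule ccontr)
      assume contra: "\<not> ?thesis"
      then have cN: "(\<lambda>x. ?c \<odot>\<^bsub>X\<^esub> x) ` N = N" using dich[OF c] by blast
      have "x = \<zero>\<^bsub>X\<^esub>" if "x \<in> N" for x
      proof -
        have "x \<in> (\<lambda>x. ?c \<odot>\<^bsub>X\<^esub> x) ` N" unfolding cN by (rule that)
        then obtain y where y: "y \<in> N" "x = ?c \<odot>\<^bsub>X\<^esub> y" by blast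
        have "y \<in> (\<lambda>x. r [^]\<^bsub>R\<^esub> n \<odot>\<^bsub>X\<^esub> x) ` N" unfolding rn by (rule y)
        then obtain z where z: "z \<in> N" "y = r [^]\<^bsub>R\<^esub> n \<odot>\<^bsub>X\<^esub> z" by blast
        have "x = (?c \<otimes>\<^bsub>R\<^esub> r [^]\<^bsub>R\<^esub> n) \<odot>\<^bsub>X\<^esub> z"
          using X.smult_assoc1[OF c, of "r [^]\<^bsub>R\<^esub> n" z] y z NX r by simp
        then show ?thesis using c0 z NX by simp
      qed
      then have "?c \<odot>\<^bsub>X\<^esub> x = \<zero>\<^bsub>X\<^esub>" if "x \<in> N" for x using X.smult_zero_right[OF c] that by metis
      then show False using contra by simp
    qed
    then have "s \<odot>\<^bsub>X\<^esub> (r \<odot>\<^bsub>X\<^esub> x) = x" if "x \<in> N" for x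
    proof -
      have "x \<ominus>\<^bsub>X\<^esub> s \<odot>\<^bsub>X\<^esub> (r \<odot>\<^bsub>X\<^esub> x) = ?c \<odot>\<^bsub>X\<^esub> x"
        using that NX r s
        by (simp add: a_minus_def X.smult_l_distr X.smult_uminus_left X.smult_assoc1)
      then have "x \<ominus>\<^bsub>X\<^esub> s \<odot>\<^bsub>X\<^esub> (r \<odot>\<^bsub>X\<^esub> x) = \<zero>\<^bsub>X\<^esub>" using \<open>\<forall>x \<in> N. ?c \<odot>\<^bsub>X\<^esub> x = \<zero>\<^bsub>X\<^esub>\<close> that by simp
      then show ?thesis using that NX r s by (simp add: X.X.minus_eq_zero_iff)
    qed
    then show ?thesis using s by blast
  qed
  have "\<exists>x \<in> N. x \<noteq> \<zero>\<^bsub>X\<^esub>"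
  proof (rule ccontr)
    assume "\<not> ?thesis"
    then have "N = {\<zero>\<^bsub>X\<^esub>}" using ND by blast
    then show False using fin0 N by simp
  qed
  then obtain x where x: "x \<in> N" "x \<noteq> \<zero>\<^bsub>X\<^esub>" by blast
  define \<W> where "\<W> = {W. submodule W R X \<and> W \<subseteq> N \<and> x \<notin> W}"
  have "\<exists>W \<in> \<W>. \<forall>H \<in> \<W>. W \<subseteq> H \<longrightarrow> H = W"
  proof (rule subset_Zorn_nonempty)
    show "\<W> \<noteq> {}" using X.submodule_zero x ND by (auto simp: \<W>_def)
    fix \<C> assume C: "\<C> \<noteq> {}" "subset.chain \<W> \<C>"
    then have CW: "\<C> \<subseteq> \<W>" and "\<And>H K. \<lbrakk>H \<in> \<C>; K \<in> \<C>\<rbrakk> \<Longrightarrow> H \<subseteq> K \<or> K \<subseteq> H"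
      by (auto simp: subset_chain_def)
    then have "submodule (\<Union>\<C>) R X"
      by (intro submodule_Union_chain[OF X.left_module_axioms C(1)]) (auto simp: \<W>_def)
    then show "\<Union>\<C> \<in> \<W>" using CW by (auto simp: \<W>_def)
  qed
  then obtain W where W: "submodule W R X" "W \<subseteq> N" "x \<notin> W"
      and max: "\<And>H. \<lbrakk>submodule H R X; H \<subseteq> N; x \<notin> H; W \<subseteq> H\<rbrakk> \<Longrightarrow> H = W" by (auto simp: \<W>_def)
  note WD = submoduleD[OF W(1)]
  have WX: "w \<in> carrier X" if "w \<in> W" for w using WD(1) that by blast
  have span: "N \<subseteq> adjoin R X W x"
  proof
    fix y assume y: "y \<in> N"
    show "y \<in> adjoin R X W x"
    proof (cases "y \<in> W")
      case True
      then show ?thesis using submodule_adjoin(2)[OF X.left_module_axioms W(1) NX[OF x(1)]] by blast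
    next
      case False
      note ad = submodule_adjoin[OF X.left_module_axioms W(1) NX[OF y]]
      have "adjoin R X W y \<subseteq> N" using W y ND by (auto simp: adjoin_def)
      then have "x \<in> adjoin R X W y" using max[OF ad(1) _ _ ad(2)] ad(3) False by metis
      then obtain w r where w: "w \<in> W" "r \<in> carrier R" "x = w \<oplus>\<^bsub>X\<^esub> r \<odot>\<^bsub>X\<^esub> y" by (auto simp: adjoin_def)
      have "\<not> (\<forall>x \<in> N. r \<odot>\<^bsub>X\<^esub> x = \<zero>\<^bsub>X\<^esub>)"
      proof
        assume "\<forall>x \<in> N. r \<odot>\<^bsub>X\<^esub> x = \<zero>\<^bsub>X\<^esub>"
        then have "x = w" using w WX[OF w(1)] y by simp
        then show False using w W(3) by simp
      qed
      then obtain s where s: "s \<in> carrier R" "\<forall>x \<in> N. s \<odot>\<^bsub>X\<^esub> (r \<odot>\<^bsub>X\<^esub> x) = x"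
        using inv[OF w(2)] by blast
      have "(\<ominus>\<^bsub>R\<^esub> s) \<odot>\<^bsub>X\<^esub> w \<oplus>\<^bsub>X\<^esub> s \<odot>\<^bsub>X\<^esub> x = y"
        using s w WX NX[OF y] y
        by (simp add: X.smult_r_distr X.smult_uminus_left X.X.r_neg1)
      moreover have "(\<ominus>\<^bsub>R\<^esub> s) \<odot>\<^bsub>X\<^esub> w \<in> W" using WD s w by simp
      ultimately show ?thesis using s by (auto simp: adjoin_def)
    qed
  qed
  have "fin W"
  proof (rule ccontr)
    assume nf: "\<not> fin W"
    have "W = N" by (rule min[OF W(1) nf W(2)])
    then show False using W x by simp
  qed
  then obtain S where S: "finite S" "S \<subseteq> W" "\<forall>H. submodule H R X \<and> S \<subseteq> H \<longrightarrow> W \<subseteq> H"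
    unfolding fin_def by blast
  note S = S(1,2) S(3)[rule_format, OF conjI]
  have "N \<subseteq> H" if H: "submodule H R X" "insert x S \<subseteq> H" for H
  proof -
    have "W \<subseteq> H" using S(3) H by blast
    then have "adjoin R X W x \<subseteq> H" using submoduleD[OF H(1)] H(2) by (auto simp: adjoin_def)
    then show ?thesis using span by blast
  qed
  then have "fin N" unfolding fin_def using S W x by (intro exI[of _ "insert x S"]) auto
  then show False using N by blast
qed

definition restrict_scalars ::
    "('r, 'a, 'l) module_scheme \<Rightarrow> ('a, 'x, 'k) module_scheme \<Rightarrow> ('r, 'x) module" where
  "restrict_scalars A X = \<lparr>carrier = carrier X, mult = undefined, one = undefined, zero = \<zero>\<^bsub>X\<^esub>,
     add = add X, smult = (\<lambda>r x. (r \<odot>\<^bsub>A\<^esub> \<one>\<^bsub>A\<^esub>) \<odot>\<^bsub>X\<^esub> x)\<rparr>"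

lemma restrict_scalars_simps [simp]:
  "carrier (restrict_scalars A X) = carrier X" "\<zero>\<^bsub>restrict_scalars A X\<^esub> = \<zero>\<^bsub>X\<^esub>"
  "x \<oplus>\<^bsub>restrict_scalars A X\<^esub> y = x \<oplus>\<^bsub>X\<^esub> y" "r \<odot>\<^bsub>restrict_scalars A X\<^esub> x = (r \<odot>\<^bsub>A\<^esub> \<one>\<^bsub>A\<^esub>) \<odot>\<^bsub>X\<^esub> x"
  by (auto simp: restrict_scalars_def)

context artin_algebra
begin

lemma left_module_over_base: "left_module R A"
  by (intro left_module.intro left_module_axioms.intro R.ring_axioms module.axioms(2)[OF mod.module_axioms])
    (auto simp: mod.smult_l_distr mod.smult_r_distr mod.smult_assoc1)

lemma restrict_scalars_left_module:
  assumes "left_module A X"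
  shows "left_module R (restrict_scalars A X)"
proof -
  interpret X: left_module A X by (rule assms)
  have "abelian_group (restrict_scalars A X)"
  proof (rule abelian_groupI)
    fix x assume "x \<in> carrier (restrict_scalars A X)"
    then show "\<exists>y \<in> carrier (restrict_scalars A X). y \<oplus>\<^bsub>restrict_scalars A X\<^esub> x = \<zero>\<^bsub>restrict_scalars A X\<^esub>"
      by (intro bexI[of _ "\<ominus>\<^bsub>X\<^esub> x"]) (auto simp: X.X.l_neg)
  qed (auto simp: X.X.a_ac)
  moreover have "(r \<otimes>\<^bsub>R\<^esub> s) \<odot>\<^bsub>A\<^esub> \<one>\<^bsub>A\<^esub> = (r \<odot>\<^bsub>A\<^esub> \<one>\<^bsub>A\<^esub>) \<otimes>\<^bsub>A\<^esub> (s \<odot>\<^bsub>A\<^esub> \<one>\<^bsub>A\<^esub>)"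
    if "r \<in> carrier R" "s \<in> carrier R" for r s
    using that by (simp add: smult_mult_left mod.smult_assoc1)
  ultimately show ?thesis
    by (intro left_module.intro left_module_axioms.intro R.ring_axioms)
      (auto simp: X.smult_l_distr X.smult_r_distr X.smult_assoc1 mod.smult_l_distr)
qed

lemma submodule_restrict_scalars:
  assumes "left_module A X" "submodule H A X"
  shows "submodule H R (restrict_scalars A X)"
  unfolding submodule_iff[OF restrict_scalars_left_module[OF assms(1)]]
  using submoduleD[OF assms(2)] by auto

lemma restrict_scalars_fg:
  assumes "fg_module A X"
  shows "fg_module R (restrict_scalars A X)"
proof -
  interpret X: left_module A X by (rule fg_moduleD[OF assms])
  note mod = restrict_scalars_left_module[OF X.left_module_axioms]
  obtain S where S: "finite S" "S \<subseteq> carrier X" "\<And>H. \<lbrakk>submodule H A X; S \<subseteq> H\<rbrakk> \<Longrightarrow> H = carrier X"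
    using fg_moduleE[OF assms] by blast
  obtain T where T: "finite T" "T \<subseteq> carrier A" "\<forall>H. submodule H R A \<and> T \<subseteq> H \<longrightarrow> H = carrier A"
    using finitely_generated unfolding finitely_generated_def by blast
  note T = T(1,2) T(3)[rule_format, OF conjI]
  have alg: "(r \<odot>\<^bsub>A\<^esub> \<one>\<^bsub>A\<^esub>) \<otimes>\<^bsub>A\<^esub> a = r \<odot>\<^bsub>A\<^esub> a" "a \<otimes>\<^bsub>A\<^esub> (r \<odot>\<^bsub>A\<^esub> \<one>\<^bsub>A\<^esub>) = r \<odot>\<^bsub>A\<^esub> a"
    if "r \<in> carrier R" "a \<in> carrier A" for r a
    using that by (simp_all add: smult_mult_left smult_mult_right)
  interpret Alg: left_module R A by (rule left_module_over_base)
  show ?thesis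
  proof (rule fg_moduleI[OF mod, of "(\<lambda>(a, x). a \<odot>\<^bsub>X\<^esub> x) ` (T \<times> S)"])
    fix H assume H: "submodule H R (restrict_scalars A X)" "(\<lambda>(a, x). a \<odot>\<^bsub>X\<^esub> x) ` (T \<times> S) \<subseteq> H"
    note HD = submoduleD[OF H(1), simplified]
    have TX: "a \<odot>\<^bsub>X\<^esub> x \<in> H" if "a \<in> carrier A" "x \<in> S" for a x
    proof -
      have xX: "x \<in> carrier X" using that S by blast
      have "submodule {a \<in> carrier A. a \<odot>\<^bsub>X\<^esub> x \<in> H} R A"
      proof (rule Alg.submoduleI)
        fix r b assume rb: "r \<in> carrier R" "b \<in> {a \<in> carrier A. a \<odot>\<^bsub>X\<^esub> x \<in> H}"
        then have "(r \<odot>\<^bsub>A\<^esub> \<one>\<^bsub>A\<^esub>) \<odot>\<^bsub>X\<^esub> (b \<odot>\<^bsub>X\<^esub> x) \<in> H" using HD(4) by simp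
        then show "r \<odot>\<^bsub>A\<^esub> b \<in> {a \<in> carrier A. a \<odot>\<^bsub>X\<^esub> x \<in> H}"
          using rb xX alg(1)[of r b] by (simp add: X.smult_assoc1[symmetric])
      qed (use HD xX in \<open>auto simp: X.smult_l_distr\<close>)
      then have "{a \<in> carrier A. a \<odot>\<^bsub>X\<^esub> x \<in> H} = carrier A" by (rule T(3)) (use T H that in auto)
      then show ?thesis using that by blast
    qed
    have "submodule {x \<in> carrier X. \<forall>a \<in> carrier A. a \<odot>\<^bsub>X\<^esub> x \<in> H} A X"
      by (rule X.submoduleI) (use HD in \<open>auto simp: X.smult_r_distr X.smult_assoc1[symmetric]\<close>)
    then have "{x \<in> carrier X. \<forall>a \<in> carrier A. a \<odot>\<^bsub>X\<^esub> x \<in> H} = carrier X"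
      by (rule S(3)) (use S TX in auto)
    then have "\<one>\<^bsub>A\<^esub> \<odot>\<^bsub>X\<^esub> x \<in> H" if "x \<in> carrier X" for x using that A.one_closed by blast
    then show "carrier (restrict_scalars A X) \<subseteq> H" by auto
  qed (use S T in auto)
qed

lemma minimal_submodule_artin:
  assumes "fg_module A X" "\<F> \<noteq> {}" "\<And>H. H \<in> \<F> \<Longrightarrow> submodule H A X"
  shows "\<exists>K \<in> \<F>. \<forall>H \<in> \<F>. H \<subseteq> K \<longrightarrow> H = K"
  using minimal_submodule[OF R.artinian_cring_axioms restrict_scalars_fg[OF assms(1)] assms(2)
    submodule_restrict_scalars[OF fg_moduleD[OF assms(1)] assms(3)]] .

lemma submodule_fg:
  assumes "fg_module A X" "submodule N A X"
  shows "fg_module A (X\<lparr>carrier := N\<rparr>)"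
proof -
  note X = fg_moduleD[OF assms(1)]
  obtain S where S: "finite S" "S \<subseteq> N" "\<forall>H. submodule H R (restrict_scalars A X) \<and> S \<subseteq> H \<longrightarrow> N \<subseteq> H"
    using artinian_submodule_fg[OF R.artinian_cring_axioms restrict_scalars_fg[OF assms(1)]
        submodule_restrict_scalars[OF X assms(2)]] by blast
  show ?thesis
    by (rule fg_moduleI[OF submodule_left_module[OF X assms(2)], of S])
      (use S submodule_restrict_scalars[OF X] submodule_of_submodule[OF X assms(2)] in auto)
qed

end

section \<open>Injective modules and self-injective algebras\<close>

lemma regular_module_simps [simp]:
  "carrier (regular_module A) = carrier A" "\<zero>\<^bsub>regular_module A\<^esub> = \<zero>\<^bsub>A\<^esub>"
  "x \<oplus>\<^bsub>regular_module A\<^esub> y = x \<oplus>\<^bsub>A\<^esub> y" "a \<odot>\<^bsub>regular_module A\<^esub> x = a \<otimes>\<^bsub>A\<^esub> x"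
  by (auto simp: regular_module_def)

lemma injective_moduleD:
  fixes X Y :: "'a fgmod"
  assumes "injective_module A E" "fg_module A X" "fg_module A Y" "i \<in> mod_hom A X Y"
    "inj_on i (carrier X)" "h \<in> mod_hom A X E"
  shows "\<exists>k \<in> mod_hom A Y E. \<forall>x \<in> carrier X. k (i x) = h x"
  using assms unfolding injective_module_def by blast

lemma injective_extend:
  fixes A :: "('a, 'k) ring_scheme"
  assumes X: "fg_module A X" and Y: "fg_module A Y" and E: "injective_module A E"
    and f: "f \<in> mod_hom A X Y" and h: "h \<in> mod_hom A X E"
    and ker: "\<And>x. \<lbrakk>x \<in> carrier X; f x = \<zero>\<^bsub>Y\<^esub>\<rbrakk> \<Longrightarrow> h x = \<zero>\<^bsub>E\<^esub>"
  shows "\<exists>k \<in> mod_hom A Y E. \<forall>x \<in> carrier X. k (f x) = h x"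
proof -
  note XM = fg_moduleD[OF X] and YM = fg_moduleD[OF Y]
  have EM: "left_module A E" using E by (simp add: injective_module_def fg_module_def)
  obtain Z :: "'a fgmod" and s t where Z: "fg_module A Z" "s \<in> mod_hom A Y Z" "t \<in> mod_hom A Z Y"
      "\<And>y. y \<in> carrier Y \<Longrightarrow> t (s y) = y" "\<And>z. z \<in> carrier Z \<Longrightarrow> s (t z) = z"
    using fg_module_rep[OF Y] by metis
  note ZM = fg_moduleD[OF Z(1)]
  define p where "p = compose (carrier X) s f"
  define D where "D = p ` carrier X"
  have p: "p \<in> mod_hom A X Z" unfolding p_def by (rule mod_hom_compose[OF XM f Z(2)])
  have Dsub: "submodule D A Z"
    unfolding D_def by (rule image_submodule[OF XM ZM p left_module.submodule_carrier[OF XM]])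
  have DM: "left_module A (Z\<lparr>carrier := D\<rparr>)" by (rule submodule_left_module[OF ZM Dsub])
  have pD: "p \<in> mod_hom A X (Z\<lparr>carrier := D\<rparr>)" by (rule mod_hom_corestrict[OF p]) (simp add: D_def)
  have Dfg: "fg_module A (Z\<lparr>carrier := D\<rparr>)"
    by (rule fg_module_image[OF X DM pD]) (simp add: D_def)
  have pker: "h x = \<zero>\<^bsub>E\<^esub>" if "x \<in> carrier X" "p x = \<zero>\<^bsub>Z\<lparr>carrier := D\<rparr>\<^esub>" for x
  proof (rule ker[OF that(1)])
    have "s (f x) = \<zero>\<^bsub>Z\<^esub>" using that by (simp add: p_def compose_def)
    then have "t (s (f x)) = \<zero>\<^bsub>Y\<^esub>" using mod_hom_zero[OF ZM YM Z(3)] by simp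
    then show "f x = \<zero>\<^bsub>Y\<^esub>" using Z(4)[OF mod_hom_closed[OF f that(1)]] by simp
  qed
  obtain g where g: "g \<in> mod_hom A (Z\<lparr>carrier := D\<rparr>) E" "\<And>x. x \<in> carrier X \<Longrightarrow> g (p x) = h x"
    by (rule factor_through_surj[OF XM DM EM pD _ h pker]) (auto simp: D_def)
  have inc: "(\<lambda>x \<in> D. x) \<in> mod_hom A (Z\<lparr>carrier := D\<rparr>) Z" by (rule submodule_inclusion[OF ZM Dsub])
  have "\<exists>k \<in> mod_hom A Z E. \<forall>x \<in> carrier (Z\<lparr>carrier := D\<rparr>). k ((\<lambda>x \<in> D. x) x) = g x"
    by (rule injective_moduleD[OF E Dfg Z(1) inc _ g(1)]) (simp add: inj_on_def)
  then obtain k where k: "k \<in> mod_hom A Z E" "\<forall>x \<in> D. k x = g x" by auto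
  show ?thesis
  proof (intro bexI ballI)
    show "compose (carrier Y) k s \<in> mod_hom A Y E" by (rule mod_hom_compose[OF YM Z(2) k(1)])
    fix x assume x: "x \<in> carrier X"
    then show "compose (carrier Y) k s (f x) = h x"
      using k(2) g(2)[OF x] mod_hom_closed[OF f x] by (auto simp: compose_def p_def D_def)
  qed
qed

lemma injective_module_retract:
  assumes E: "injective_module A E" and F: "fg_module A F"
    and f: "f \<in> mod_hom A E F" and g: "g \<in> mod_hom A F E" and fg: "\<And>y. y \<in> carrier F \<Longrightarrow> f (g y) = y"
  shows "injective_module A F"
  unfolding injective_module_def
proof (intro conjI allI impI ballI F)
  note FM = fg_moduleD[OF F]
  fix X Y :: "'a fgmod" and i h
  assume XY: "fg_module A X \<and> fg_module A Y" and i: "i \<in> mod_hom A X Y" and h: "h \<in> mod_hom A X F"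
    and inj: "inj_on i (carrier X)"
  note XM = fg_moduleD[OF conjunct1[OF XY]] and YM = fg_moduleD[OF conjunct2[OF XY]]
  have "compose (carrier X) g h \<in> mod_hom A X E" by (rule mod_hom_compose[OF XM h g])
  then obtain k where k: "k \<in> mod_hom A Y E" "\<forall>x \<in> carrier X. k (i x) = compose (carrier X) g h x"
    using E XY i inj unfolding injective_module_def by blast
  show "\<exists>k \<in> mod_hom A Y F. \<forall>x \<in> carrier X. k (i x) = h x"
  proof (intro bexI ballI)
    show "compose (carrier Y) f k \<in> mod_hom A Y F" by (rule mod_hom_compose[OF YM k(1) f])
    fix x assume "x \<in> carrier X"
    then show "compose (carrier Y) f k (i x) = h x"
      using k(2) mod_hom_closed[OF i] mod_hom_closed[OF h] fg by (simp add: compose_def)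
  qed
qed

lemma regular_hom_eq:
  assumes "ring A" "f \<in> mod_hom A (regular_module A) X" "a \<in> carrier A"
  shows "f a = a \<odot>\<^bsub>X\<^esub> f \<one>\<^bsub>A\<^esub>"
proof -
  interpret ring A by (rule assms)
  show ?thesis using mod_hom_smult[OF assms(2), of a "\<one>\<^bsub>A\<^esub>"] assms(3) by simp
qed

abbreviation left_ideal :: "'a set \<Rightarrow> ('a, 'k) ring_scheme \<Rightarrow> bool" where
  "left_ideal L A \<equiv> submodule L A (regular_module A)"

definition max_left_ideal :: "('a, 'k) ring_scheme \<Rightarrow> 'a set \<Rightarrow> bool" where
  "max_left_ideal A m \<longleftrightarrow> left_ideal m A \<and> \<one>\<^bsub>A\<^esub> \<notin> m \<and>
     (\<forall>L. left_ideal L A \<and> m \<subseteq> L \<and> \<one>\<^bsub>A\<^esub> \<notin> L \<longrightarrow> L = m)"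

text \<open>The annihilator of the class of \<open>x\<close> in \<open>A / L\<close>.\<close>

definition residual :: "('a, 'k) ring_scheme \<Rightarrow> 'a set \<Rightarrow> 'a \<Rightarrow> 'a set" where
  "residual A L x = {a \<in> carrier A. a \<otimes>\<^bsub>A\<^esub> x \<in> L}"

text \<open>The annihilator of \<open>A / L\<close>.\<close>

definition core :: "('a, 'k) ring_scheme \<Rightarrow> 'a set \<Rightarrow> 'a set" where
  "core A L = {a \<in> carrier A. \<forall>b \<in> carrier A. a \<otimes>\<^bsub>A\<^esub> b \<in> L}"

text \<open>For maximal left ideals this says that \<open>A / m\<close> and \<open>A / n\<close> are isomorphic.\<close>

definition similar :: "('a, 'k) ring_scheme \<Rightarrow> 'a set \<Rightarrow> 'a set \<Rightarrow> bool" where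
  "similar A m n \<longleftrightarrow> (\<exists>x \<in> carrier A - m. \<exists>y \<in> carrier A - n. residual A m x = residual A n y)"

context ring
begin

lemma regular_left_module: "left_module R (regular_module R)"
  by (rule fg_moduleD[OF fg_regular_module]) (rule ring_axioms)

lemmas left_ideal_iff = submodule_iff[OF regular_left_module, simplified]

lemma left_ideal_residual:
  assumes "left_ideal L R" "x \<in> carrier R"
  shows "left_ideal (residual R L x) R"
  using assms(2) submoduleD[OF assms(1)] unfolding left_ideal_iff residual_def
  by (auto simp: l_distr m_assoc)

lemma left_ideal_minus:
  assumes "left_ideal L R" "a \<in> L" "b \<in> L" shows "a \<ominus> b \<in> L"
proof -
  have "(\<ominus> \<one>) \<otimes> b \<in> L" using submodule_smult[OF assms(1), of "\<ominus> \<one>" b] assms(3) by simp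
  moreover have "a \<in> carrier R" "b \<in> carrier R" using submodule_subset[OF assms(1)] assms by auto
  ultimately have "a \<oplus> (\<ominus> \<one>) \<otimes> b \<in> L" using submodule_add[OF assms(1,2)] by simp
  then show ?thesis using \<open>a \<in> carrier R\<close> \<open>b \<in> carrier R\<close> by (simp add: a_minus_def l_minus)
qed

lemma max_left_ideal_sum:
  assumes m: "max_left_ideal R m" and x: "x \<in> carrier R" "x \<notin> m"
  obtains c u where "c \<in> carrier R" "u \<in> m" "\<one> = c \<otimes> x \<oplus> u"
proof -
  have mI: "left_ideal m R" using m by (simp add: max_left_ideal_def)
  have xr: "x \<in> carrier (regular_module R)" using x by simp
  note ad = submodule_adjoin[OF regular_left_module mI xr]
  have "\<one> \<in> adjoin R (regular_module R) m x"
  proof (rule ccontr)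
    assume "\<one> \<notin> adjoin R (regular_module R) m x"
    then have "adjoin R (regular_module R) m x = m" using m ad(1,2) unfolding max_left_ideal_def by metis
    then show False using ad(3) x(2) by simp
  qed
  then obtain u c where "u \<in> m" "c \<in> carrier R" "\<one> = u \<oplus> c \<otimes> x" by (auto simp: adjoin_def)
  moreover have "u \<in> carrier R" using submodule_subset[OF mI] \<open>u \<in> m\<close> by auto
  ultimately show thesis using x by (intro that[of c u]) (auto simp: a_comm)
qed

lemma max_left_ideal_residual:
  assumes m: "max_left_ideal R m" and x: "x \<in> carrier R" "x \<notin> m"
  shows "max_left_ideal R (residual R m x)"
proof -
  have mI: "left_ideal m R" using m by (simp add: max_left_ideal_def)
  have "L = residual R m x" if L: "left_ideal L R" "residual R m x \<subseteq> L" "\<one> \<notin> L" for L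
  proof (rule ccontr)
    assume "L \<noteq> residual R m x"
    then obtain a where a: "a \<in> L" "a \<notin> residual R m x" using L by blast
    have aR: "a \<in> carrier R" using submodule_subset[OF L(1)] a by auto
    have "a \<otimes> x \<in> carrier R" "a \<otimes> x \<notin> m" using a aR x by (auto simp: residual_def)
    then obtain c u where c: "c \<in> carrier R" "u \<in> m" "\<one> = c \<otimes> (a \<otimes> x) \<oplus> u"
      by (rule max_left_ideal_sum[OF m])
    have uR: "u \<in> carrier R" using submodule_subset[OF mI] c by auto
    have "x = x \<otimes> (c \<otimes> (a \<otimes> x) \<oplus> u)" using x(1) by (simp add: c(3)[symmetric])
    then have "x = (x \<otimes> c \<otimes> a) \<otimes> x \<oplus> x \<otimes> u" using c x aR uR by (simp add: r_distr m_assoc)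
    moreover have "(\<one> \<ominus> x \<otimes> c \<otimes> a) \<otimes> x = x \<ominus> (x \<otimes> c \<otimes> a) \<otimes> x" using c(1) x aR
      by (simp add: a_minus_def l_distr l_minus)
    ultimately have "(\<one> \<ominus> x \<otimes> c \<otimes> a) \<otimes> x = x \<otimes> u"
      using add_minus_cancel(1)[of "(x \<otimes> c \<otimes> a) \<otimes> x" "x \<otimes> u"] c(1) x aR uR by simp
    moreover have "x \<otimes> u \<in> m" using submodule_smult[OF mI x(1) c(2)] by simp
    ultimately have "\<one> \<ominus> x \<otimes> c \<otimes> a \<in> L" using L(2) x c(1) aR by (auto simp: residual_def)
    moreover have "x \<otimes> c \<otimes> a \<in> L" using submodule_smult[OF L(1), of "x \<otimes> c" a] x c(1) a by simp
    ultimately have "(\<one> \<ominus> x \<otimes> c \<otimes> a) \<oplus> x \<otimes> c \<otimes> a \<in> L" using submodule_add[OF L(1)] by simp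
    moreover have "(\<one> \<ominus> x \<otimes> c \<otimes> a) \<oplus> x \<otimes> c \<otimes> a = \<one>" using x c(1) aR
      by (intro add_minus_cancel(2)) auto
    ultimately show False using L(3) by simp
  qed
  moreover have "left_ideal (residual R m x) R" by (rule left_ideal_residual[OF mI x(1)])
  moreover have "\<one> \<notin> residual R m x" using x by (simp add: residual_def)
  ultimately show ?thesis unfolding max_left_ideal_def by blast
qed

lemma core_residual:
  assumes m: "max_left_ideal R m" and x: "x \<in> carrier R" "x \<notin> m"
  shows "core R (residual R m x) = core R m"
proof -
  have mI: "left_ideal m R" using m by (simp add: max_left_ideal_def)
  obtain c u where c: "c \<in> carrier R" "u \<in> m" "\<one> = c \<otimes> x \<oplus> u" by (rule max_left_ideal_sum[OF m x])
  have uR: "u \<in> carrier R" using submodule_subset[OF mI] c by auto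
  show ?thesis
  proof (intro equalityI subsetI)
    fix a assume "a \<in> core R (residual R m x)"
    then have a: "a \<in> carrier R" "\<And>b. b \<in> carrier R \<Longrightarrow> (a \<otimes> b) \<otimes> x \<in> m"
      by (auto simp: core_def residual_def)
    have "a \<otimes> d \<in> m" if d: "d \<in> carrier R" for d
    proof -
      have "a \<otimes> d = a \<otimes> d \<otimes> (c \<otimes> x \<oplus> u)" using a(1) d by (simp add: c(3)[symmetric])
      also have "\<dots> = (a \<otimes> (d \<otimes> c)) \<otimes> x \<oplus> (a \<otimes> d) \<otimes> u"
        using a(1) d c(1) x uR by (simp add: r_distr m_assoc)
      also have "\<dots> \<in> m" using a(2)[of "d \<otimes> c"] submodule_smult[OF mI, of "a \<otimes> d" u] a(1) c d
          submodule_add[OF mI] by simp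
      finally show ?thesis .
    qed
    then show "a \<in> core R m" using a by (simp add: core_def)
  next
    fix a assume "a \<in> core R m"
    then show "a \<in> core R (residual R m x)" using x by (auto simp: core_def residual_def m_assoc)
  qed
qed

lemma core_similar:
  assumes "max_left_ideal R m" "max_left_ideal R n" "similar R m n"
  shows "core R m = core R n"
  using assms(3) core_residual[OF assms(1)] core_residual[OF assms(2)] unfolding similar_def
  by (metis DiffE)

lemma core_subset: "core R m \<subseteq> m"
proof
  fix a assume "a \<in> core R m"
  then have "a \<in> carrier R" "a \<otimes> \<one> \<in> m" unfolding core_def by blast+
  then show "a \<in> m" by simp
qed

text \<open>
  The intersection of the \<open>n \<in> F\<close> being contained in \<open>m\<close>, the simple module \<open>A / m\<close> is a
  composition factor of the direct sum of the \<open>A / n\<close>.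
\<close>

lemma Inter_max_left_ideals:
  assumes "finite F" "\<And>n. n \<in> F \<Longrightarrow> max_left_ideal R n" and m: "max_left_ideal R m"
    and "left_ideal L R" "\<not> L \<subseteq> m" "L \<inter> \<Inter>F \<subseteq> m"
  shows "\<exists>n \<in> F. similar R n m"
  using assms(1,2,4-6)
proof (induction F arbitrary: L rule: finite_induct)
  case (insert n F)
  have n: "max_left_ideal R n" using insert by simp
  then have nI: "left_ideal n R" by (simp add: max_left_ideal_def)
  have mI: "left_ideal m R" using m by (simp add: max_left_ideal_def)
  note L = submoduleD[OF insert.prems(2), simplified]
  show ?case
  proof (cases "L \<inter> n \<subseteq> m")
    case False
    have "left_ideal (L \<inter> n) R" by (rule submodule_Int[OF regular_left_module insert.prems(2) nI])
    moreover have "(L \<inter> n) \<inter> \<Inter>F \<subseteq> m" using insert.prems by auto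
    ultimately have "\<exists>n \<in> F. similar R n m" using insert.IH insert.prems(1) False by simp
    then show ?thesis by simp
  next
    case True
    obtain x where x: "x \<in> L" "x \<notin> m" using insert.prems by blast
    have xR: "x \<in> carrier R" using x L by auto
    have xn: "x \<notin> n" using True x by blast
    have "a \<otimes> x \<in> n" if a: "a \<in> carrier R" "a \<otimes> x \<in> m" for a
    proof (rule ccontr)
      assume contra: "a \<otimes> x \<notin> n"
      have "a \<otimes> x \<in> carrier R" using a xR by simp
      then obtain c u where c: "c \<in> carrier R" "u \<in> n" "\<one> = c \<otimes> (a \<otimes> x) \<oplus> u"
        by (rule max_left_ideal_sum[OF n _ contra])
      have uR: "u \<in> carrier R" using submodule_subset[OF nI] c by auto
      have "x = x \<otimes> (c \<otimes> (a \<otimes> x) \<oplus> u)" using xR by (simp add: c(3)[symmetric])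
      then have e: "x = (x \<otimes> c) \<otimes> (a \<otimes> x) \<oplus> x \<otimes> u" using c(1) a(1) xR uR by (simp add: r_distr m_assoc)
      have "(x \<otimes> c) \<otimes> (a \<otimes> x) \<in> L" using L(4)[of "x \<otimes> c \<otimes> a" x] x xR a c by (simp add: m_assoc)
      moreover have "x \<otimes> u = x \<ominus> (x \<otimes> c) \<otimes> (a \<otimes> x)"
        using add_minus_cancel(1)[of "(x \<otimes> c) \<otimes> (a \<otimes> x)" "x \<otimes> u"] e c(1) xR a uR by simp
      ultimately have "x \<otimes> u \<in> L" using left_ideal_minus[OF insert.prems(2) x(1)] by simp
      moreover have "x \<otimes> u \<in> n" using submodule_smult[OF nI xR c(2)] by simp
      ultimately have "x \<otimes> u \<in> m" using True by blast
      moreover have "(x \<otimes> c) \<otimes> (a \<otimes> x) \<in> m" using submodule_smult[OF mI, of "x \<otimes> c"] a c xR by simp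
      ultimately have "(x \<otimes> c) \<otimes> (a \<otimes> x) \<oplus> x \<otimes> u \<in> m" using submodule_add[OF mI] by simp
      then have "x \<in> m" unfolding e[symmetric] .
      then show False using x by simp
    qed
    moreover have "a \<otimes> x \<in> m" if "a \<in> carrier R" "a \<otimes> x \<in> n" for a
      using True that L(4)[of a x] x by auto
    ultimately have "residual R n x = residual R m x" by (auto simp: residual_def)
    then show ?thesis using x xn xR by (auto simp: similar_def)
  qed
qed simp

lemma residual_residual:
  assumes "x \<in> carrier R" "y \<in> carrier R"
  shows "residual R (residual R m x) y = residual R m (y \<otimes> x)"
  using assms by (auto simp: residual_def m_assoc)

end

context artin_algebra
begin

lemma left_ideal_minimal:
  assumes "\<F> \<noteq> {}" "\<And>L. L \<in> \<F> \<Longrightarrow> left_ideal L A"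
  shows "\<exists>K \<in> \<F>. \<forall>L \<in> \<F>. L \<subseteq> K \<longrightarrow> L = K"
  by (rule minimal_submodule_artin[OF fg_regular_module assms]) (rule A.ring_axioms)

lemma left_ideal_fg:
  assumes "left_ideal L A"
  shows "fg_module A (regular_module A\<lparr>carrier := L\<rparr>)"
  by (rule submodule_fg[OF fg_regular_module assms]) (rule A.ring_axioms)

lemma left_ideal_Inter:
  assumes "\<And>L. L \<in> F \<Longrightarrow> left_ideal L A"
  shows "left_ideal (carrier A \<inter> \<Inter>F) A"
  using assms unfolding A.left_ideal_iff by blast

lemma ex_max_left_ideal:
  assumes L: "left_ideal L A" "\<one>\<^bsub>A\<^esub> \<notin> L"
  obtains m where "max_left_ideal A m" "L \<subseteq> m"
proof -
  define \<S> where "\<S> = {H. left_ideal H A \<and> L \<subseteq> H \<and> \<one>\<^bsub>A\<^esub> \<notin> H}"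
  have "\<exists>m \<in> \<S>. \<forall>H \<in> \<S>. m \<subseteq> H \<longrightarrow> H = m"
  proof (rule subset_Zorn_nonempty)
    show "\<S> \<noteq> {}" using L by (auto simp: \<S>_def)
    fix \<C> assume C: "\<C> \<noteq> {}" "subset.chain \<S> \<C>"
    then have CS: "\<C> \<subseteq> \<S>" and "\<And>H K. \<lbrakk>H \<in> \<C>; K \<in> \<C>\<rbrakk> \<Longrightarrow> H \<subseteq> K \<or> K \<subseteq> H"
      by (auto simp: subset_chain_def)
    then have "left_ideal (\<Union>\<C>) A"
      by (intro submodule_Union_chain[OF A.regular_left_module C(1)]) (auto simp: \<S>_def)
    then show "\<Union>\<C> \<in> \<S>" using CS C(1) by (auto simp: \<S>_def)
  qed
  then obtain m where m: "m \<in> \<S>" "\<forall>H \<in> \<S>. m \<subseteq> H \<longrightarrow> H = m" by blast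
  then have "max_left_ideal A m" "L \<subseteq> m" unfolding max_left_ideal_def \<S>_def by auto
  then show thesis by (rule that)
qed

lemma similar_of_core_subset:
  assumes m: "max_left_ideal A m" and n: "max_left_ideal A n" and sub: "core A m \<subseteq> n"
  shows "similar A m n"
proof -
  have mI: "left_ideal m A" using m by (simp add: max_left_ideal_def)
  define K where "K F = carrier A \<inter> \<Inter>(residual A m ` F)" for F
  define \<F> where "\<F> = K ` {F. finite F \<and> F \<subseteq> carrier A - m}"
  have KI: "left_ideal (K F) A" if "F \<subseteq> carrier A - m" for F
    unfolding K_def by (rule left_ideal_Inter) (use that A.left_ideal_residual[OF mI] in auto)
  have "\<exists>K \<in> \<F>. \<forall>L \<in> \<F>. L \<subseteq> K \<longrightarrow> L = K"
    by (rule left_ideal_minimal) (use KI in \<open>auto simp: \<F>_def\<close>)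
  then obtain F where F: "finite F" "F \<subseteq> carrier A - m" "\<forall>L \<in> \<F>. L \<subseteq> K F \<longrightarrow> L = K F"
    by (auto simp: \<F>_def)
  have "a \<otimes>\<^bsub>A\<^esub> b \<in> m" if a: "a \<in> K F" and b: "b \<in> carrier A" for a b
  proof (cases "b \<in> m")
    case True
    then show ?thesis using submodule_smult[OF mI, of a b] a by (simp add: K_def)
  next
    case False
    then have "K (insert b F) \<in> \<F>" using F b by (auto simp: \<F>_def)
    moreover have "K (insert b F) \<subseteq> K F" by (auto simp: K_def)
    ultimately have "K (insert b F) = K F" by (rule F(3)[rule_format])
    then have "a \<in> residual A m b" using a by (auto simp: K_def)
    then show ?thesis by (simp add: residual_def)
  qed
  then have "K F \<subseteq> core A m" by (auto simp: core_def K_def)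
  then have Kn: "carrier A \<inter> \<Inter>(residual A m ` F) \<subseteq> n" using sub by (auto simp: K_def)
  have "\<exists>r \<in> residual A m ` F. similar A r n"
  proof (rule A.Inter_max_left_ideals[OF _ _ n _ _ Kn])
    show "left_ideal (carrier A) A" using left_module.submodule_carrier[OF A.regular_left_module] by simp
    show "\<not> carrier A \<subseteq> n" using n by (auto simp: max_left_ideal_def)
    show "max_left_ideal A r" if "r \<in> residual A m ` F" for r
      using that F A.max_left_ideal_residual[OF m] by auto
  qed (use F in auto)
  then obtain x y z where x: "x \<in> F" and y: "y \<in> carrier A - residual A m x" "z \<in> carrier A - n"
      "residual A (residual A m x) y = residual A n z" by (auto simp: similar_def)
  have xA: "x \<in> carrier A" using x F by auto
  then have "y \<otimes>\<^bsub>A\<^esub> x \<in> carrier A - m" using y(1) by (auto simp: residual_def)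
  moreover have "residual A m (y \<otimes>\<^bsub>A\<^esub> x) = residual A n z"
    using y A.residual_residual[OF xA, of y m] by simp
  ultimately show ?thesis unfolding similar_def using y(2) by blast
qed

lemma finite_cores: "finite (core A ` {m. max_left_ideal A m})"
proof -
  define K where "K F = carrier A \<inter> \<Inter>F" for F
  define \<F> where "\<F> = K ` {F. finite F \<and> (\<forall>n \<in> F. max_left_ideal A n)}"
  have KI: "left_ideal (K F) A" if "\<forall>n \<in> F. max_left_ideal A n" for F
    unfolding K_def by (rule left_ideal_Inter) (use that in \<open>auto simp: max_left_ideal_def\<close>)
  have "\<exists>K \<in> \<F>. \<forall>L \<in> \<F>. L \<subseteq> K \<longrightarrow> L = K"
    by (rule left_ideal_minimal) (use KI in \<open>auto simp: \<F>_def\<close>)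
  then obtain F where F: "finite F" "\<forall>n \<in> F. max_left_ideal A n" "\<forall>L \<in> \<F>. L \<subseteq> K F \<longrightarrow> L = K F"
    by (auto simp: \<F>_def)
  have "core A m \<in> core A ` F" if m: "max_left_ideal A m" for m
  proof -
    have "K (insert m F) \<in> \<F>" using F m by (auto simp: \<F>_def)
    moreover have "K (insert m F) \<subseteq> K F" by (auto simp: K_def)
    ultimately have "K (insert m F) = K F" by (rule F(3)[rule_format])
    then have "carrier A \<inter> \<Inter>F \<subseteq> m" by (auto simp: K_def)
    moreover have "left_ideal (carrier A) A"
      using left_module.submodule_carrier[OF A.regular_left_module] by simp
    moreover have "\<not> carrier A \<subseteq> m" using m by (auto simp: max_left_ideal_def)
    ultimately have "\<exists>n \<in> F. similar A n m"
      using A.Inter_max_left_ideals[OF F(1) _ m, of "carrier A"] F(2) by auto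
    then show ?thesis using A.core_similar[OF _ m] F(2) by (metis image_eqI)
  qed
  then have "core A ` {m. max_left_ideal A m} \<subseteq> core A ` F" by auto
  then show ?thesis by (rule finite_subset) (use F(1) in simp)
qed

lemma selfinjective_hom_mult:
  assumes A: "selfinjective A" and S: "finite S" "S \<subseteq> J" and J: "J \<subseteq> carrier A" "\<zero>\<^bsub>A\<^esub> \<in> J"
    "\<And>a b. \<lbrakk>a \<in> J; b \<in> J\<rbrakk> \<Longrightarrow> a \<oplus>\<^bsub>A\<^esub> b \<in> J" "\<And>a b. \<lbrakk>a \<in> J; b \<in> carrier A\<rbrakk> \<Longrightarrow> a \<otimes>\<^bsub>A\<^esub> b \<in> J"
    and "left_ideal L A" "h \<in> mod_hom A (regular_module A\<lparr>carrier := L\<rparr>) (regular_module A)"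
    and "\<And>x. \<lbrakk>x \<in> L; \<forall>s \<in> S. x \<otimes>\<^bsub>A\<^esub> s = \<zero>\<^bsub>A\<^esub>\<rbrakk> \<Longrightarrow> h x = \<zero>\<^bsub>A\<^esub>"
  shows "\<exists>j \<in> J. \<forall>x \<in> L. h x = x \<otimes>\<^bsub>A\<^esub> j"
  using S assms(8-10)
proof (induction S arbitrary: L h rule: finite_induct)
  case empty
  then have "h x = x \<otimes>\<^bsub>A\<^esub> \<zero>\<^bsub>A\<^esub>" if "x \<in> L" for x using submodule_subset[of L A] that by fastforce
  then show ?case using J(2) by blast
next
  case (insert s S)
  note L = insert.prems(2) and h = insert.prems(3)
  note reg = A.regular_left_module
  have sJ: "s \<in> J" "s \<in> carrier A" using insert J by auto
  define K where "K = {x \<in> L. x \<otimes>\<^bsub>A\<^esub> s = \<zero>\<^bsub>A\<^esub>}"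
  have LA: "x \<in> carrier A" if "x \<in> L" for x using submodule_subset[OF L] that by auto
  have K: "left_ideal K A" using L sJ unfolding A.left_ideal_iff K_def
    by (auto simp: A.l_distr A.m_assoc subset_iff)
  have LM: "left_module A (regular_module A\<lparr>carrier := L\<rparr>)" by (rule submodule_left_module[OF reg L])
  have KL: "submodule K A (regular_module A\<lparr>carrier := L\<rparr>)"
    unfolding submodule_of_submodule[OF reg L] using K by (auto simp: K_def)
  have hK: "restrict h K \<in> mod_hom A (regular_module A\<lparr>carrier := K\<rparr>) (regular_module A)"
    using mod_hom_restrict[OF LM KL h] by simp
  have "\<exists>j \<in> J. \<forall>x \<in> K. restrict h K x = x \<otimes>\<^bsub>A\<^esub> j"
  proof (rule insert.IH[OF _ K hK])
    show "S \<subseteq> J" using insert.prems by simp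
    fix x assume "x \<in> K" "\<forall>s \<in> S. x \<otimes>\<^bsub>A\<^esub> s = \<zero>\<^bsub>A\<^esub>"
    then show "restrict h K x = \<zero>\<^bsub>A\<^esub>" using insert.prems(4)[of x] by (simp add: K_def)
  qed
  then obtain j where j: "j \<in> J" "\<forall>x \<in> K. h x = x \<otimes>\<^bsub>A\<^esub> j" by auto
  have jA: "j \<in> carrier A" using j J by auto
  have hA: "h x \<in> carrier A" if "x \<in> L" for x using mod_hom_closed[OF h] that by simp
  let ?g = "\<lambda>x \<in> L. h x \<ominus>\<^bsub>A\<^esub> x \<otimes>\<^bsub>A\<^esub> j" and ?f = "\<lambda>x \<in> L. x \<otimes>\<^bsub>A\<^esub> s"
  have add: "h (x \<oplus>\<^bsub>A\<^esub> y) = h x \<oplus>\<^bsub>A\<^esub> h y" if "x \<in> L" "y \<in> L" for x y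
    using mod_hom_add[OF h, of x y] that by simp
  have mult: "h (a \<otimes>\<^bsub>A\<^esub> x) = a \<otimes>\<^bsub>A\<^esub> h x" if "a \<in> carrier A" "x \<in> L" for a x
    using mod_hom_smult[OF h, of a x] that by simp
  have g: "?g \<in> mod_hom A (regular_module A\<lparr>carrier := L\<rparr>) (regular_module A)"
    using mod_homI[OF LM, of "\<lambda>x. h x \<ominus>\<^bsub>A\<^esub> x \<otimes>\<^bsub>A\<^esub> j" "regular_module A"] LA hA jA add mult
    by (simp add: a_minus_def A.l_distr A.r_distr A.minus_add A.a_ac A.r_minus A.m_assoc)
  have f: "?f \<in> mod_hom A (regular_module A\<lparr>carrier := L\<rparr>) (regular_module A)"
    using mod_homI[OF LM, of "\<lambda>x. x \<otimes>\<^bsub>A\<^esub> s" "regular_module A"] LA sJ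
    by (simp add: A.l_distr A.m_assoc)
  have inj: "injective_module A (regular_module A)" using A by (simp add: selfinjective_def)
  have "\<exists>k \<in> mod_hom A (regular_module A) (regular_module A).
      \<forall>x \<in> carrier (regular_module A\<lparr>carrier := L\<rparr>). k (?f x) = ?g x"
  proof (rule injective_extend[OF left_ideal_fg[OF L] fg_regular_module[OF A.ring_axioms] inj f g])
    fix x assume "x \<in> carrier (regular_module A\<lparr>carrier := L\<rparr>)" "?f x = \<zero>\<^bsub>regular_module A\<^esub>"
    then have "x \<in> L" "x \<in> K" by (auto simp: K_def)
    then show "?g x = \<zero>\<^bsub>regular_module A\<^esub>" using j jA hA LA
      by (auto simp: A.minus_eq_zero_iff)
  qed
  then obtain k where k: "k \<in> mod_hom A (regular_module A) (regular_module A)"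
      "\<forall>x \<in> L. k (x \<otimes>\<^bsub>A\<^esub> s) = h x \<ominus>\<^bsub>A\<^esub> x \<otimes>\<^bsub>A\<^esub> j" by auto
  have k1: "k \<one>\<^bsub>A\<^esub> \<in> carrier A" using mod_hom_closed[OF k(1), of "\<one>\<^bsub>A\<^esub>"] by simp
  have "h x = x \<otimes>\<^bsub>A\<^esub> (j \<oplus>\<^bsub>A\<^esub> s \<otimes>\<^bsub>A\<^esub> k \<one>\<^bsub>A\<^esub>)" if x: "x \<in> L" for x
  proof -
    have "k (x \<otimes>\<^bsub>A\<^esub> s) = x \<otimes>\<^bsub>A\<^esub> s \<otimes>\<^bsub>A\<^esub> k \<one>\<^bsub>A\<^esub>"
      using regular_hom_eq[OF A.ring_axioms k(1), of "x \<otimes>\<^bsub>A\<^esub> s"] LA[OF x] sJ by simp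
    then have "h x \<ominus>\<^bsub>A\<^esub> x \<otimes>\<^bsub>A\<^esub> j = x \<otimes>\<^bsub>A\<^esub> s \<otimes>\<^bsub>A\<^esub> k \<one>\<^bsub>A\<^esub>" using k x by simp
    then have "h x = x \<otimes>\<^bsub>A\<^esub> s \<otimes>\<^bsub>A\<^esub> k \<one>\<^bsub>A\<^esub> \<oplus>\<^bsub>A\<^esub> x \<otimes>\<^bsub>A\<^esub> j"
      using A.add_minus_cancel(2)[of "h x" "x \<otimes>\<^bsub>A\<^esub> j"] hA[OF x] LA[OF x] jA by simp
    then show ?thesis using LA[OF x] jA sJ k1 by (simp add: A.r_distr A.m_assoc A.a_comm)
  qed
  moreover have "j \<oplus>\<^bsub>A\<^esub> s \<otimes>\<^bsub>A\<^esub> k \<one>\<^bsub>A\<^esub> \<in> J" using j sJ k1 J by simp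
  ultimately show ?case by blast
qed

end

context artin_algebra
begin

lemma ex_annihilated_by_core:
  assumes A: "selfinjective A" and m: "max_left_ideal A m"
  shows "\<exists>t \<in> carrier A. t \<noteq> \<zero>\<^bsub>A\<^esub> \<and> (\<forall>a \<in> core A m. t \<otimes>\<^bsub>A\<^esub> a = \<zero>\<^bsub>A\<^esub>) \<and> max_left_ideal A (residual A {\<zero>\<^bsub>A\<^esub>} t)"
proof -
  note reg = A.regular_left_module
  have zeroI: "left_ideal {\<zero>\<^bsub>A\<^esub>} A" using left_module.submodule_zero[OF reg] by simp
  have mI: "left_ideal m A" using m by (simp add: max_left_ideal_def)
  have coreA: "a \<in> carrier A" if "a \<in> core A m" for a using that by (simp add: core_def)
  define K where "K S = {t \<in> carrier A. \<forall>a \<in> S. t \<otimes>\<^bsub>A\<^esub> a = \<zero>\<^bsub>A\<^esub>}" for S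
  have KI: "left_ideal (K S) A" if "S \<subseteq> carrier A" for S
    using that unfolding A.left_ideal_iff K_def by (auto simp: A.l_distr A.m_assoc subset_iff)
  define \<F> where "\<F> = K ` {S. finite S \<and> S \<subseteq> core A m}"
  have "\<exists>K \<in> \<F>. \<forall>L \<in> \<F>. L \<subseteq> K \<longrightarrow> L = K"
  proof (rule left_ideal_minimal)
    show "left_ideal L A" if "L \<in> \<F>" for L
      using that coreA by (auto simp: \<F>_def intro!: KI)
  qed (auto simp: \<F>_def)
  then obtain S where S: "finite S" "S \<subseteq> core A m" "\<forall>L \<in> \<F>. L \<subseteq> K S \<longrightarrow> L = K S"
    by (auto simp: \<F>_def)
  have KT: "K S \<subseteq> K (core A m)"
  proof
    fix t assume t: "t \<in> K S"
    have "t \<otimes>\<^bsub>A\<^esub> a = \<zero>\<^bsub>A\<^esub>" if a: "a \<in> core A m" for a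
    proof -
      have "K (insert a S) \<in> \<F>" using S a by (auto simp: \<F>_def)
      moreover have "K (insert a S) \<subseteq> K S" by (auto simp: K_def)
      ultimately have "K (insert a S) = K S" by (rule S(3)[rule_format])
      then have "t \<in> K (insert a S)" using t by simp
      then show ?thesis by (simp add: K_def)
    qed
    then show "t \<in> K (core A m)" using t by (simp add: K_def)
  qed
  have "\<exists>t \<in> K (core A m). t \<noteq> \<zero>\<^bsub>A\<^esub>"
  proof (rule ccontr)
    assume "\<not> ?thesis"
    then have K0: "t = \<zero>\<^bsub>A\<^esub>" if "t \<in> K S" for t using KT that by blast
    let ?h = "\<lambda>x \<in> carrier A. x"
    have h: "?h \<in> mod_hom A (regular_module A\<lparr>carrier := carrier A\<rparr>) (regular_module A)"
      using submodule_inclusion[OF reg left_module.submodule_carrier[OF reg]] by simp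
    have cl: "a \<oplus>\<^bsub>A\<^esub> b \<in> core A m" "a \<otimes>\<^bsub>A\<^esub> c \<in> core A m"
      if "a \<in> core A m" "b \<in> core A m" "c \<in> carrier A" for a b c
      using that submodule_add[OF mI] by (auto simp: core_def A.l_distr A.m_assoc)
    have z: "\<zero>\<^bsub>A\<^esub> \<in> core A m" using submodule_zero_mem[OF mI] by (auto simp: core_def)
    have "\<exists>j \<in> core A m. \<forall>x \<in> carrier A. ?h x = x \<otimes>\<^bsub>A\<^esub> j"
    proof (rule selfinjective_hom_mult[OF A S(1,2) _ z _ _ _ h])
      show "left_ideal (carrier A) A" using left_module.submodule_carrier[OF reg] by simp
      show "?h x = \<zero>\<^bsub>A\<^esub>" if "x \<in> carrier A" "\<forall>s \<in> S. x \<otimes>\<^bsub>A\<^esub> s = \<zero>\<^bsub>A\<^esub>" for x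
        using that K0[of x] by (simp add: K_def)
    qed (use cl coreA z in auto)
    then obtain j where j: "j \<in> core A m" "\<forall>x \<in> carrier A. x = x \<otimes>\<^bsub>A\<^esub> j" by auto
    then have "\<one>\<^bsub>A\<^esub> = j" using coreA[OF j(1)] by (metis A.l_one A.one_closed)
    then have "\<one>\<^bsub>A\<^esub> \<in> m" using A.core_subset j by auto
    then show False using m by (simp add: max_left_ideal_def)
  qed
  then have ne: "{t \<in> K (core A m). t \<noteq> \<zero>\<^bsub>A\<^esub>} \<noteq> {}" by blast
  define P where "P t = (\<lambda>c. c \<otimes>\<^bsub>A\<^esub> t) ` carrier A" for t
  have PI: "left_ideal (P t) A" if "t \<in> carrier A" for t
  proof -
    have "(\<lambda>a \<in> carrier A. a \<otimes>\<^bsub>A\<^esub> t) \<in> mod_hom A (regular_module A) (regular_module A)"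
      using left_module.mod_hom_scale_right[OF reg, of t] that by simp
    from image_submodule[OF reg reg this left_module.submodule_carrier[OF reg]]
    show ?thesis by (simp add: P_def)
  qed
  let ?\<G> = "P ` {t \<in> K (core A m). t \<noteq> \<zero>\<^bsub>A\<^esub>}"
  have "\<exists>L \<in> ?\<G>. \<forall>H \<in> ?\<G>. H \<subseteq> L \<longrightarrow> H = L"
  proof (rule left_ideal_minimal)
    show "left_ideal L A" if "L \<in> ?\<G>" for L using that PI by (auto simp: K_def)
  qed (use ne in blast)
  then obtain t where t: "t \<in> K (core A m)" "t \<noteq> \<zero>\<^bsub>A\<^esub>" "\<forall>H \<in> ?\<G>. H \<subseteq> P t \<longrightarrow> H = P t"
    by auto
  have tA: "t \<in> carrier A" using t by (simp add: K_def)
  have "max_left_ideal A (residual A {\<zero>\<^bsub>A\<^esub>} t)"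
    unfolding max_left_ideal_def
  proof (intro conjI allI impI)
    show "left_ideal (residual A {\<zero>\<^bsub>A\<^esub>} t) A" by (rule A.left_ideal_residual[OF zeroI tA])
    show "\<one>\<^bsub>A\<^esub> \<notin> residual A {\<zero>\<^bsub>A\<^esub>} t" using t tA by (simp add: residual_def)
    fix L assume L: "left_ideal L A \<and> residual A {\<zero>\<^bsub>A\<^esub>} t \<subseteq> L \<and> \<one>\<^bsub>A\<^esub> \<notin> L"
    then have LI: "left_ideal L A" by simp
    have "L \<subseteq> residual A {\<zero>\<^bsub>A\<^esub>} t"
    proof
      fix a assume a: "a \<in> L"
      have aA: "a \<in> carrier A" using submodule_subset[OF LI] a by auto
      show "a \<in> residual A {\<zero>\<^bsub>A\<^esub>} t"
      proof (rule ccontr)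
        assume "a \<notin> residual A {\<zero>\<^bsub>A\<^esub>} t"
        then have at: "a \<otimes>\<^bsub>A\<^esub> t \<noteq> \<zero>\<^bsub>A\<^esub>" using aA by (simp add: residual_def)
        have "left_ideal (K (core A m)) A" by (rule KI) (use coreA in auto)
        then have "a \<otimes>\<^bsub>A\<^esub> t \<in> K (core A m)" using submodule_smult[OF _ aA t(1)] by fastforce
        then have "P (a \<otimes>\<^bsub>A\<^esub> t) \<in> ?\<G>" using at by blast
        moreover have "P (a \<otimes>\<^bsub>A\<^esub> t) \<subseteq> P t"
          using aA tA by (auto simp: P_def A.m_assoc[symmetric])
        ultimately have Pe: "P (a \<otimes>\<^bsub>A\<^esub> t) = P t" using t(3) by blast
        have "\<one>\<^bsub>A\<^esub> \<otimes>\<^bsub>A\<^esub> t \<in> P t" unfolding P_def by (rule imageI) simp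
        then have "t \<in> P (a \<otimes>\<^bsub>A\<^esub> t)" using tA Pe by simp
        then obtain c where c: "c \<in> carrier A" "t = c \<otimes>\<^bsub>A\<^esub> (a \<otimes>\<^bsub>A\<^esub> t)" by (auto simp: P_def)
        have "(\<one>\<^bsub>A\<^esub> \<ominus>\<^bsub>A\<^esub> c \<otimes>\<^bsub>A\<^esub> a) \<otimes>\<^bsub>A\<^esub> t = t \<ominus>\<^bsub>A\<^esub> c \<otimes>\<^bsub>A\<^esub> (a \<otimes>\<^bsub>A\<^esub> t)"
          using c(1) aA tA by (simp add: a_minus_def A.l_distr A.l_minus A.m_assoc)
        also have "\<dots> = \<zero>\<^bsub>A\<^esub>" using c(2)[symmetric] tA by (simp add: a_minus_def A.r_neg)
        finally have "\<one>\<^bsub>A\<^esub> \<ominus>\<^bsub>A\<^esub> c \<otimes>\<^bsub>A\<^esub> a \<in> residual A {\<zero>\<^bsub>A\<^esub>} t" using c(1) aA by (simp add: residual_def)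
        then have "\<one>\<^bsub>A\<^esub> \<ominus>\<^bsub>A\<^esub> c \<otimes>\<^bsub>A\<^esub> a \<in> L" using L by blast
        moreover have "c \<otimes>\<^bsub>A\<^esub> a \<in> L" using submodule_smult[OF LI c(1) a] by simp
        ultimately have "\<one>\<^bsub>A\<^esub> \<ominus>\<^bsub>A\<^esub> c \<otimes>\<^bsub>A\<^esub> a \<oplus>\<^bsub>A\<^esub> c \<otimes>\<^bsub>A\<^esub> a \<in> L" using submodule_add[OF LI] by simp
        then show False using L c(1) aA A.add_minus_cancel(2)[of "\<one>\<^bsub>A\<^esub>" "c \<otimes>\<^bsub>A\<^esub> a"] by simp
      qed
    qed
    then show "L = residual A {\<zero>\<^bsub>A\<^esub>} t" using L by blast
  qed
  then show ?thesis using t tA by (auto simp: K_def)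
qed

lemma core_eq_of_common_annihilator:
  assumes m: "max_left_ideal A m" and n: "max_left_ideal A n"
    and u: "u \<in> carrier A" "u \<noteq> \<zero>\<^bsub>A\<^esub>" "\<forall>a \<in> core A m. u \<otimes>\<^bsub>A\<^esub> a = \<zero>\<^bsub>A\<^esub>" "\<forall>a \<in> core A n. u \<otimes>\<^bsub>A\<^esub> a = \<zero>\<^bsub>A\<^esub>"
  shows "core A m = core A n"
proof -
  have mI: "left_ideal m A" and nI: "left_ideal n A" using m n by (simp_all add: max_left_ideal_def)
  define K where "K = {a \<oplus>\<^bsub>A\<^esub> b | a b. a \<in> core A m \<and> b \<in> core A n}"
  have core_props: "a \<in> carrier A" "a \<oplus>\<^bsub>A\<^esub> b \<in> core A k" "c \<otimes>\<^bsub>A\<^esub> a \<in> core A k" "\<zero>\<^bsub>A\<^esub> \<in> core A k"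
    if "left_ideal k A" "a \<in> core A k" "b \<in> core A k" "c \<in> carrier A" for k a b c
    using that submoduleD[OF that(1), simplified] by (auto simp: core_def A.l_distr A.m_assoc)
  have z: "\<zero>\<^bsub>A\<^esub> \<in> core A m" "\<zero>\<^bsub>A\<^esub> \<in> core A n"
    using submodule_zero_mem[OF mI] submodule_zero_mem[OF nI] by (auto simp: core_def)
  have "\<one>\<^bsub>A\<^esub> \<notin> K"
  proof
    assume "\<one>\<^bsub>A\<^esub> \<in> K"
    then obtain a b where ab: "a \<in> core A m" "b \<in> core A n" "\<one>\<^bsub>A\<^esub> = a \<oplus>\<^bsub>A\<^esub> b" by (auto simp: K_def)
    then have "u \<otimes>\<^bsub>A\<^esub> (a \<oplus>\<^bsub>A\<^esub> b) = \<zero>\<^bsub>A\<^esub>"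
      using u by (simp add: A.r_distr core_def)
    then show False using ab(3)[symmetric] u by simp
  qed
  moreover have "left_ideal K A"
    unfolding A.left_ideal_iff
  proof (intro conjI ballI)
    show "K \<subseteq> carrier A" by (auto simp: K_def core_def)
    show "\<zero>\<^bsub>A\<^esub> \<in> K" using z unfolding K_def by force
    fix x assume "x \<in> K"
    then obtain a b where ab: "a \<in> core A m" "b \<in> core A n" "x = a \<oplus>\<^bsub>A\<^esub> b" by (auto simp: K_def)
    note abA = core_props(1)[OF mI ab(1) ab(1) A.one_closed] core_props(1)[OF nI ab(2) ab(2) A.one_closed]
    {
      fix y assume "y \<in> K"
      then obtain a' b' where ab': "a' \<in> core A m" "b' \<in> core A n" "y = a' \<oplus>\<^bsub>A\<^esub> b'" by (auto simp: K_def)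
      note abA' = core_props(1)[OF mI ab'(1) ab'(1) A.one_closed] core_props(1)[OF nI ab'(2) ab'(2) A.one_closed]
      have "x \<oplus>\<^bsub>A\<^esub> y = (a \<oplus>\<^bsub>A\<^esub> a') \<oplus>\<^bsub>A\<^esub> (b \<oplus>\<^bsub>A\<^esub> b')" using ab ab' abA abA' by (simp add: A.a_ac)
      moreover have "a \<oplus>\<^bsub>A\<^esub> a' \<in> core A m" by (rule core_props(2)[OF mI ab(1) ab'(1) A.one_closed])
      moreover have "b \<oplus>\<^bsub>A\<^esub> b' \<in> core A n" by (rule core_props(2)[OF nI ab(2) ab'(2) A.one_closed])
      ultimately show "x \<oplus>\<^bsub>A\<^esub> y \<in> K" unfolding K_def by blast
    next
      fix c assume c: "c \<in> carrier A"
      have "c \<otimes>\<^bsub>A\<^esub> x = c \<otimes>\<^bsub>A\<^esub> a \<oplus>\<^bsub>A\<^esub> c \<otimes>\<^bsub>A\<^esub> b" using ab abA c by (simp add: A.r_distr)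
      moreover have "c \<otimes>\<^bsub>A\<^esub> a \<in> core A m" by (rule core_props(3)[OF mI ab(1) ab(1) c])
      moreover have "c \<otimes>\<^bsub>A\<^esub> b \<in> core A n" by (rule core_props(3)[OF nI ab(2) ab(2) c])
      ultimately show "c \<otimes>\<^bsub>A\<^esub> x \<in> K" unfolding K_def by blast
    }
  qed
  ultimately obtain k where k: "max_left_ideal A k" "K \<subseteq> k" by (metis ex_max_left_ideal)
  have "core A m \<subseteq> K"
  proof
    fix a assume a: "a \<in> core A m"
    then have "a = a \<oplus>\<^bsub>A\<^esub> \<zero>\<^bsub>A\<^esub>" by (simp add: core_def)
    then show "a \<in> K" using a z unfolding K_def by blast
  qed
  moreover have "core A n \<subseteq> K"
  proof
    fix a assume a: "a \<in> core A n"
    then have "a = \<zero>\<^bsub>A\<^esub> \<oplus>\<^bsub>A\<^esub> a" by (simp add: core_def)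
    then show "a \<in> K" using a z unfolding K_def by blast
  qed
  ultimately have "similar A m k" "similar A n k"
    using similar_of_core_subset[OF m k(1)] similar_of_core_subset[OF n k(1)] k(2) by auto
  then show ?thesis using A.core_similar[OF m k(1)] A.core_similar[OF n k(1)] by simp
qed

text \<open>
  Every simple left module \<open>A / m\<close> embeds in \<open>A\<close>. For each primitive ideal \<open>I\<close> there is a minimal
  left ideal \<open>A t\<close> with \<open>t I = 0\<close>. Since homomorphisms between left ideals are right
  multiplications, \<open>I\<close> can be recovered from the annihilator of \<open>A t\<close>; so \<open>I \<mapsto> ann (A t)\<close> is an
  injective self-map of the finite set of primitive ideals, and therefore surjective.
\<close>

lemma selfinjective_simple_embeds:
  assumes A: "selfinjective A" and m: "max_left_ideal A m"
  shows "\<exists>t \<in> carrier A. t \<noteq> \<zero>\<^bsub>A\<^esub> \<and> (\<forall>a \<in> m. a \<otimes>\<^bsub>A\<^esub> t = \<zero>\<^bsub>A\<^esub>)"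
proof -
  note reg = A.regular_left_module
  have mI: "left_ideal m A" using m by (simp add: max_left_ideal_def)
  define lann where "lann t = residual A {\<zero>\<^bsub>A\<^esub>} t" for t
  define \<I> where "\<I> = core A ` {m. max_left_ideal A m}"
  have "\<forall>I \<in> \<I>. \<exists>t. t \<in> carrier A \<and> t \<noteq> \<zero>\<^bsub>A\<^esub> \<and> (\<forall>a \<in> I. t \<otimes>\<^bsub>A\<^esub> a = \<zero>\<^bsub>A\<^esub>) \<and> max_left_ideal A (lann t)"
    using ex_annihilated_by_core[OF A] by (auto simp: \<I>_def lann_def)
  then obtain \<tau> where \<tau>: "\<forall>I \<in> \<I>. \<tau> I \<in> carrier A \<and> \<tau> I \<noteq> \<zero>\<^bsub>A\<^esub> \<and> (\<forall>a \<in> I. \<tau> I \<otimes>\<^bsub>A\<^esub> a = \<zero>\<^bsub>A\<^esub>) \<and>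
      max_left_ideal A (lann (\<tau> I))"
    unfolding bchoice_iff by blast
  have inj: "inj_on (\<lambda>I. core A (lann (\<tau> I))) \<I>"
  proof (rule inj_onI)
    fix I J assume I: "I \<in> \<I>" and J: "J \<in> \<I>" and eq: "core A (lann (\<tau> I)) = core A (lann (\<tau> J))"
    obtain mi where mi: "max_left_ideal A mi" "I = core A mi" using I by (auto simp: \<I>_def)
    obtain mj where mj: "max_left_ideal A mj" "J = core A mj" using J by (auto simp: \<I>_def)
    have tI: "\<tau> I \<in> carrier A" "\<forall>a \<in> I. \<tau> I \<otimes>\<^bsub>A\<^esub> a = \<zero>\<^bsub>A\<^esub>" "max_left_ideal A (lann (\<tau> I))" using \<tau> I by auto
    have tJ: "\<tau> J \<in> carrier A" "\<forall>a \<in> J. \<tau> J \<otimes>\<^bsub>A\<^esub> a = \<zero>\<^bsub>A\<^esub>" "max_left_ideal A (lann (\<tau> J))" using \<tau> J by auto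
    have "similar A (lann (\<tau> I)) (lann (\<tau> J))"
      by (rule similar_of_core_subset[OF tI(3) tJ(3)]) (use eq A.core_subset in auto)
    then obtain x y where x: "x \<in> carrier A" "x \<notin> lann (\<tau> I)" and y: "y \<in> carrier A" "y \<notin> lann (\<tau> J)"
      and xy: "residual A (lann (\<tau> I)) x = residual A (lann (\<tau> J)) y" by (auto simp: similar_def)
    let ?v = "x \<otimes>\<^bsub>A\<^esub> \<tau> I" and ?u = "y \<otimes>\<^bsub>A\<^esub> \<tau> J"
    have v: "?v \<in> carrier A" and u: "?u \<in> carrier A" "?u \<noteq> \<zero>\<^bsub>A\<^esub>"
      using x y tI tJ by (auto simp: lann_def residual_def)
    have ker: "a \<otimes>\<^bsub>A\<^esub> ?v = \<zero>\<^bsub>A\<^esub> \<longleftrightarrow> a \<otimes>\<^bsub>A\<^esub> ?u = \<zero>\<^bsub>A\<^esub>" if a: "a \<in> carrier A" for a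
    proof -
      have "a \<in> residual A (lann (\<tau> I)) x \<longleftrightarrow> a \<in> residual A (lann (\<tau> J)) y" using xy by simp
      then show ?thesis using a x y tI tJ by (simp add: residual_def lann_def A.m_assoc)
    qed
    have inj: "injective_module A (regular_module A)" using A by (simp add: selfinjective_def)
    have f: "(\<lambda>a \<in> carrier A. a \<otimes>\<^bsub>A\<^esub> ?v) \<in> mod_hom A (regular_module A) (regular_module A)"
      using left_module.mod_hom_scale_right[OF reg, of ?v] v by simp
    have h: "(\<lambda>a \<in> carrier A. a \<otimes>\<^bsub>A\<^esub> ?u) \<in> mod_hom A (regular_module A) (regular_module A)"
      using left_module.mod_hom_scale_right[OF reg, of ?u] u by simp
    note fgr = fg_regular_module[OF A.ring_axioms]
    have "\<exists>k \<in> mod_hom A (regular_module A) (regular_module A). \<forall>a \<in> carrier (regular_module A).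
        k ((\<lambda>a \<in> carrier A. a \<otimes>\<^bsub>A\<^esub> ?v) a) = (\<lambda>a \<in> carrier A. a \<otimes>\<^bsub>A\<^esub> ?u) a"
      by (rule injective_extend[OF fgr fgr inj f h]) (use ker in simp)
    then obtain k where k0: "k \<in> mod_hom A (regular_module A) (regular_module A)"
      "\<forall>a \<in> carrier A. k (a \<otimes>\<^bsub>A\<^esub> ?v) = a \<otimes>\<^bsub>A\<^esub> ?u" by auto
    have k: "k \<in> mod_hom A (regular_module A) (regular_module A)" "k ?v = ?u"
      using k0 bspec[OF k0(2), of "\<one>\<^bsub>A\<^esub>"] u v by simp_all
    let ?b = "k \<one>\<^bsub>A\<^esub>"
    have b: "?b \<in> carrier A" using mod_hom_closed[OF k(1), of "\<one>\<^bsub>A\<^esub>"] by simp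
    have ub: "?u = ?v \<otimes>\<^bsub>A\<^esub> ?b" using regular_hom_eq[OF A.ring_axioms k(1) v] k(2) by simp
    have "?u \<otimes>\<^bsub>A\<^esub> a = \<zero>\<^bsub>A\<^esub>" if a: "a \<in> core A mi" for a
    proof -
      have miI: "left_ideal mi A" using mi by (simp add: max_left_ideal_def)
      have "?b \<otimes>\<^bsub>A\<^esub> (a \<otimes>\<^bsub>A\<^esub> c) \<in> mi" if "c \<in> carrier A" for c
        using submodule_smult[OF miI b, of "a \<otimes>\<^bsub>A\<^esub> c"] a that by (simp add: core_def)
      then have "?b \<otimes>\<^bsub>A\<^esub> a \<in> I" using a b mi by (simp add: core_def A.m_assoc)
      then have "\<tau> I \<otimes>\<^bsub>A\<^esub> (?b \<otimes>\<^bsub>A\<^esub> a) = \<zero>\<^bsub>A\<^esub>" using tI by simp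
      then show ?thesis using ub x tI b a by (simp add: A.m_assoc core_def)
    qed
    moreover have "?u \<otimes>\<^bsub>A\<^esub> a = \<zero>\<^bsub>A\<^esub>" if a: "a \<in> core A mj" for a
      using a y tJ mj by (auto simp: A.m_assoc core_def)
    ultimately show "I = J"
      using core_eq_of_common_annihilator[OF mi(1) mj(1) u] mi mj by simp
  qed
  have surj: "(\<lambda>I. core A (lann (\<tau> I))) ` \<I> = \<I>"
    by (rule endo_inj_surj[OF _ _ inj]) (use finite_cores \<tau> in \<open>auto simp: \<I>_def\<close>)
  have "core A m \<in> (\<lambda>I. core A (lann (\<tau> I))) ` \<I>" unfolding surj using m by (simp add: \<I>_def)
  then obtain I where I: "I \<in> \<I>" "core A m = core A (lann (\<tau> I))" by blast
  have tI: "\<tau> I \<in> carrier A" "max_left_ideal A (lann (\<tau> I))" using \<tau> I by auto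
  have "similar A (lann (\<tau> I)) m"
    by (rule similar_of_core_subset[OF tI(2) m]) (use I A.core_subset in auto)
  then obtain x y where x: "x \<in> carrier A" "x \<notin> lann (\<tau> I)" and y: "y \<in> carrier A" "y \<notin> m"
    and xy: "residual A (lann (\<tau> I)) x = residual A m y" by (auto simp: similar_def)
  have ker: "a \<otimes>\<^bsub>A\<^esub> (x \<otimes>\<^bsub>A\<^esub> \<tau> I) = \<zero>\<^bsub>A\<^esub> \<longleftrightarrow> a \<otimes>\<^bsub>A\<^esub> y \<in> m" if a: "a \<in> carrier A" for a
  proof -
    have "a \<in> residual A (lann (\<tau> I)) x \<longleftrightarrow> a \<in> residual A m y" using xy by simp
    then show ?thesis using a x y tI by (simp add: residual_def lann_def A.m_assoc)
  qed
  obtain c u where c: "c \<in> carrier A" "u \<in> m" "\<one>\<^bsub>A\<^esub> = c \<otimes>\<^bsub>A\<^esub> y \<oplus>\<^bsub>A\<^esub> u"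
    by (rule A.max_left_ideal_sum[OF m y])
  have uA: "u \<in> carrier A" using submodule_subset[OF mI] c by auto
  let ?t = "c \<otimes>\<^bsub>A\<^esub> (x \<otimes>\<^bsub>A\<^esub> \<tau> I)"
  have "?t \<noteq> \<zero>\<^bsub>A\<^esub>"
  proof
    assume "?t = \<zero>\<^bsub>A\<^esub>"
    then have "c \<otimes>\<^bsub>A\<^esub> y \<in> m" using ker c by simp
    then have "\<one>\<^bsub>A\<^esub> \<in> m" using submodule_add[OF mI _ c(2)] c(3) by simp
    then show False using m by (simp add: max_left_ideal_def)
  qed
  moreover have "a \<otimes>\<^bsub>A\<^esub> ?t = \<zero>\<^bsub>A\<^esub>" if a: "a \<in> m" for a
  proof -
    have aA: "a \<in> carrier A" using submodule_subset[OF mI] a by auto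
    have "a = a \<otimes>\<^bsub>A\<^esub> (c \<otimes>\<^bsub>A\<^esub> y \<oplus>\<^bsub>A\<^esub> u)" using aA by (simp add: c(3)[symmetric])
    then have "a = (a \<otimes>\<^bsub>A\<^esub> c) \<otimes>\<^bsub>A\<^esub> y \<oplus>\<^bsub>A\<^esub> a \<otimes>\<^bsub>A\<^esub> u" using aA c(1) y uA by (simp add: A.r_distr A.m_assoc)
    then have "(a \<otimes>\<^bsub>A\<^esub> c) \<otimes>\<^bsub>A\<^esub> y = a \<ominus>\<^bsub>A\<^esub> a \<otimes>\<^bsub>A\<^esub> u"
      using A.add_minus_cancel(1)[of "a \<otimes>\<^bsub>A\<^esub> u" "(a \<otimes>\<^bsub>A\<^esub> c) \<otimes>\<^bsub>A\<^esub> y"] aA c(1) y uA by (simp add: A.a_comm)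
    also have "\<dots> \<in> m" using A.left_ideal_minus[OF mI a] submodule_smult[OF mI aA c(2)] by simp
    finally have "(a \<otimes>\<^bsub>A\<^esub> c) \<otimes>\<^bsub>A\<^esub> (x \<otimes>\<^bsub>A\<^esub> \<tau> I) = \<zero>\<^bsub>A\<^esub>" using ker[of "a \<otimes>\<^bsub>A\<^esub> c"] aA c(1) by simp
    then show ?thesis using aA c(1) x tI by (simp add: A.m_assoc)
  qed
  ultimately show ?thesis using c(1) x tI by auto
qed

lemma selfinjective_separates:
  fixes X :: "('a, 'x) module"
  assumes A: "selfinjective A" and X: "fg_module A X" and K: "submodule K A X"
    and x: "x \<in> carrier X" "x \<notin> K"
  shows "\<exists>f \<in> mod_hom A X (regular_module A). (\<forall>k \<in> K. f k = \<zero>\<^bsub>A\<^esub>) \<and> f x \<noteq> \<zero>\<^bsub>A\<^esub>"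
proof -
  note reg = A.regular_left_module
  interpret X: left_module A X by (rule fg_moduleD[OF X])
  note KD = submoduleD[OF K]
  obtain Q :: "('a, 'x) module" and p where Q: "fg_module A Q" "p \<in> mod_hom A X Q"
    "p ` carrier X = carrier Q" "\<And>x. x \<in> carrier X \<Longrightarrow> p x = \<zero>\<^bsub>Q\<^esub> \<longleftrightarrow> x \<in> K"
    using quotient_module[OF X K] by metis
  note QM = fg_moduleD[OF Q(1)]
  let ?s = "\<lambda>a \<in> carrier A. a \<odot>\<^bsub>X\<^esub> x"
  have s: "?s \<in> mod_hom A (regular_module A) X" by (rule X.mod_hom_scale_right[OF x(1)])
  have "left_ideal {a \<in> carrier A. ?s a \<in> K} A"
    using vimage_submodule[OF reg X.left_module_axioms s K] by simp
  moreover have "\<one>\<^bsub>A\<^esub> \<notin> {a \<in> carrier A. ?s a \<in> K}" using x by simp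
  ultimately obtain m where m: "max_left_ideal A m" "{a \<in> carrier A. ?s a \<in> K} \<subseteq> m"
    by (rule ex_max_left_ideal)
  obtain t where t: "t \<in> carrier A" "t \<noteq> \<zero>\<^bsub>A\<^esub>" "\<forall>a \<in> m. a \<otimes>\<^bsub>A\<^esub> t = \<zero>\<^bsub>A\<^esub>"
    using selfinjective_simple_embeds[OF A m(1)] by blast
  let ?h = "\<lambda>a \<in> carrier A. a \<otimes>\<^bsub>A\<^esub> t"
  have h: "?h \<in> mod_hom A (regular_module A) (regular_module A)"
    using left_module.mod_hom_scale_right[OF reg, of t] t by simp
  have ps: "compose (carrier A) p ?s \<in> mod_hom A (regular_module A) Q"
    using mod_hom_compose[OF reg s Q(2)] by simp
  have inj: "injective_module A (regular_module A)" using A by (simp add: selfinjective_def)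
  have "\<exists>k \<in> mod_hom A Q (regular_module A). \<forall>a \<in> carrier (regular_module A).
      k (compose (carrier A) p ?s a) = ?h a"
  proof (rule injective_extend[OF fg_regular_module[OF A.ring_axioms] Q(1) inj ps h])
    fix a assume a: "a \<in> carrier (regular_module A)" "compose (carrier A) p ?s a = \<zero>\<^bsub>Q\<^esub>"
    then have "a \<in> {a \<in> carrier A. ?s a \<in> K}" using Q(4)[of "a \<odot>\<^bsub>X\<^esub> x"] x by (simp add: compose_def)
    then have "a \<in> m" using m(2) by blast
    then show "?h a = \<zero>\<^bsub>regular_module A\<^esub>" using t a by simp
  qed
  then obtain k where k: "k \<in> mod_hom A Q (regular_module A)"
      "\<forall>a \<in> carrier A. k (compose (carrier A) p ?s a) = ?h a" by auto
  show ?thesis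
  proof (intro bexI conjI ballI)
    show "compose (carrier X) k p \<in> mod_hom A X (regular_module A)"
      by (rule mod_hom_compose[OF X.left_module_axioms Q(2) k(1)])
    show "compose (carrier X) k p y = \<zero>\<^bsub>A\<^esub>" if "y \<in> K" for y
    proof -
      have "y \<in> carrier X" using KD(1) that by blast
      then show ?thesis using Q(4)[of y] that mod_hom_zero[OF QM reg k(1)] by (simp add: compose_def)
    qed
    show "compose (carrier X) k p x \<noteq> \<zero>\<^bsub>A\<^esub>"
      using bspec[OF k(2), of "\<one>\<^bsub>A\<^esub>"] x t by (simp add: compose_def)
  qed
qed

lemma selfinjective_finitely_separates:
  fixes X :: "('a, 'x) module"
  assumes A: "selfinjective A" and X: "fg_module A X" and K: "submodule K A X"
  shows "\<exists>F. finite F \<and> F \<subseteq> mod_hom A X (regular_module A) \<and> (\<forall>f \<in> F. \<forall>k \<in> K. f k = \<zero>\<^bsub>A\<^esub>) \<and>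
    (\<forall>x \<in> carrier X. (\<forall>f \<in> F. f x = \<zero>\<^bsub>A\<^esub>) \<longrightarrow> x \<in> K)"
proof -
  interpret X: left_module A X by (rule fg_moduleD[OF X])
  define \<K> where "\<K> F = {x \<in> carrier X. \<forall>f \<in> F. f x = \<zero>\<^bsub>A\<^esub>}" for F
  define good where "good F \<longleftrightarrow> finite F \<and> F \<subseteq> mod_hom A X (regular_module A) \<and> (\<forall>f \<in> F. \<forall>k \<in> K. f k = \<zero>\<^bsub>A\<^esub>)" for F
  have "submodule (\<K> F) A X" if "good F" for F
  proof -
    have F: "f \<zero>\<^bsub>X\<^esub> = \<zero>\<^bsub>A\<^esub>" "\<And>x y. x \<in> carrier X \<Longrightarrow> y \<in> carrier X \<Longrightarrow> f (x \<oplus>\<^bsub>X\<^esub> y) = f x \<oplus>\<^bsub>A\<^esub> f y"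
      "\<And>a x. a \<in> carrier A \<Longrightarrow> x \<in> carrier X \<Longrightarrow> f (a \<odot>\<^bsub>X\<^esub> x) = a \<otimes>\<^bsub>A\<^esub> f x" if "f \<in> F" for f
    proof -
      have f: "f \<in> mod_hom A X (regular_module A)" using that \<open>good F\<close> by (auto simp: good_def)
      show "f \<zero>\<^bsub>X\<^esub> = \<zero>\<^bsub>A\<^esub>" "\<And>x y. x \<in> carrier X \<Longrightarrow> y \<in> carrier X \<Longrightarrow> f (x \<oplus>\<^bsub>X\<^esub> y) = f x \<oplus>\<^bsub>A\<^esub> f y"
        "\<And>a x. a \<in> carrier A \<Longrightarrow> x \<in> carrier X \<Longrightarrow> f (a \<odot>\<^bsub>X\<^esub> x) = a \<otimes>\<^bsub>A\<^esub> f x"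
        using mod_hom_zero[OF X.left_module_axioms A.regular_left_module f] mod_homD[OF f] by simp_all
    qed
    show ?thesis
    proof (rule X.submoduleI)
      fix x y assume xy: "x \<in> \<K> F" "y \<in> \<K> F"
      have "f (x \<oplus>\<^bsub>X\<^esub> y) = \<zero>\<^bsub>A\<^esub>" if "f \<in> F" for f
      proof -
        have "x \<in> carrier X" "y \<in> carrier X" "f x = \<zero>\<^bsub>A\<^esub>" "f y = \<zero>\<^bsub>A\<^esub>"
          using xy that unfolding \<K>_def by blast+
        then show ?thesis using F(2)[OF that, of x y] by simp
      qed
      then show "x \<oplus>\<^bsub>X\<^esub> y \<in> \<K> F" using xy by (simp add: \<K>_def)
    qed (auto simp: \<K>_def F)
  qed
  then have "\<exists>L \<in> \<K> ` {F. good F}. \<forall>H \<in> \<K> ` {F. good F}. H \<subseteq> L \<longrightarrow> H = L"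
    by (intro minimal_submodule_artin[OF X]) (auto simp: good_def intro!: exI[of _ "{}"])
  then obtain F where F: "good F" "\<forall>H \<in> \<K> ` {F. good F}. H \<subseteq> \<K> F \<longrightarrow> H = \<K> F" by auto
  have "x \<in> K" if x: "x \<in> carrier X" "\<forall>f \<in> F. f x = \<zero>\<^bsub>A\<^esub>" for x
  proof (rule ccontr)
    assume "x \<notin> K"
    then obtain f where f: "f \<in> mod_hom A X (regular_module A)" "\<forall>k \<in> K. f k = \<zero>\<^bsub>A\<^esub>" "f x \<noteq> \<zero>\<^bsub>A\<^esub>"
      using selfinjective_separates[OF A X K x(1)] by blast
    then have "good (insert f F)" using F(1) by (auto simp: good_def)
    then have "\<K> (insert f F) \<in> \<K> ` {F. good F}" by blast
    moreover have "\<K> (insert f F) \<subseteq> \<K> F" by (auto simp: \<K>_def)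
    ultimately have "\<K> (insert f F) = \<K> F" by (rule F(2)[rule_format])
    moreover have "x \<in> \<K> F" using x by (simp add: \<K>_def)
    ultimately have "x \<in> \<K> (insert f F)" by simp
    then show False using f by (simp add: \<K>_def)
  qed
  then show ?thesis using F(1) unfolding good_def by blast
qed

end

section \<open>Dual bases of projective modules\<close>

definition free_module :: "('a, 'k) ring_scheme \<Rightarrow> nat \<Rightarrow> ('a, nat \<Rightarrow> 'a) module" where
  "free_module A n = \<lparr>carrier = {c. (\<forall>i. c i \<in> carrier A) \<and> (\<forall>i \<ge> n. c i = \<zero>\<^bsub>A\<^esub>)}, mult = undefined,
     one = undefined, zero = (\<lambda>i. \<zero>\<^bsub>A\<^esub>), add = (\<lambda>c d i. c i \<oplus>\<^bsub>A\<^esub> d i), smult = (\<lambda>a c i. a \<otimes>\<^bsub>A\<^esub> c i)\<rparr>"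

lemma (in ring) fg_free_module: "fg_module R (free_module R n)"
proof -
  let ?F = "free_module R n"
  have "abelian_group ?F"
  proof (rule abelian_groupI)
    fix c assume "c \<in> carrier ?F"
    then show "\<exists>d \<in> carrier ?F. d \<oplus>\<^bsub>?F\<^esub> c = \<zero>\<^bsub>?F\<^esub>"
      by (intro bexI[of _ "\<lambda>i. \<ominus> c i"]) (auto simp: free_module_def l_neg)
  qed (auto simp: free_module_def a_ac)
  then have mod: "left_module R ?F"
    by (intro left_module.intro left_module_axioms.intro ring_axioms)
      (auto simp: free_module_def l_distr r_distr m_assoc)
  define e where "e i = (\<lambda>j. if j = i then \<one> else \<zero>)" for i :: nat
  show ?thesis
  proof (rule fg_moduleI[OF mod, of "e ` {..<n}"])
    fix H assume H: "submodule H R ?F" "e ` {..<n} \<subseteq> H"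
    note HD = submoduleD[OF H(1)]
    have "c \<in> H" if "c \<in> carrier ?F" "\<forall>i \<ge> k. c i = \<zero>" "k \<le> n" for c k
      using that
    proof (induction k arbitrary: c)
      case 0
      then have "c = \<zero>\<^bsub>?F\<^esub>" by (auto simp: free_module_def)
      then show ?case using HD by simp
    next
      case (Suc k)
      let ?d = "\<lambda>i. if i = k then \<zero> else c i"
      have "?d \<in> H"
        by (rule Suc.IH) (use Suc.prems in \<open>auto simp: free_module_def not_less_eq_eq le_Suc_eq dest: le_neq_implies_less\<close>)
      moreover have "c k \<odot>\<^bsub>?F\<^esub> e k \<in> H"
        by (rule HD(4)) (use H(2) Suc.prems in \<open>auto simp: free_module_def\<close>)
      ultimately have "?d \<oplus>\<^bsub>?F\<^esub> c k \<odot>\<^bsub>?F\<^esub> e k \<in> H" by (rule HD(3))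
      moreover have "?d \<oplus>\<^bsub>?F\<^esub> c k \<odot>\<^bsub>?F\<^esub> e k = c"
        using Suc.prems by (auto simp: free_module_def e_def)
      ultimately show ?case by simp
    qed
    from this[of _ n] show "carrier ?F \<subseteq> H" by (auto simp: free_module_def)
  qed (auto simp: e_def free_module_def)
qed

lemma mod_hom_coordinates:
  assumes "left_module A X" "left_module A P" "\<And>i. i < n \<Longrightarrow> f i \<in> mod_hom A X (regular_module A)"
    "\<And>i. i < (n::nat) \<Longrightarrow> e i \<in> carrier P"
  shows "(\<lambda>x \<in> carrier X. finsum P (\<lambda>i. f i x \<odot>\<^bsub>P\<^esub> e i) {..<n}) \<in> mod_hom A X P"
proof -
  interpret P: left_module A P by (rule assms)
  note f = mod_homD[OF assms(3), simplified]
  show ?thesis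
  proof (rule mod_homI[OF assms(1)])
    fix x y assume "x \<in> carrier X" "y \<in> carrier X"
    then have "finsum P (\<lambda>i. f i (x \<oplus>\<^bsub>X\<^esub> y) \<odot>\<^bsub>P\<^esub> e i) {..<n}
        = finsum P (\<lambda>i. f i x \<odot>\<^bsub>P\<^esub> e i \<oplus>\<^bsub>P\<^esub> f i y \<odot>\<^bsub>P\<^esub> e i) {..<n}"
      by (intro P.X.finsum_cong') (auto simp: f assms(4) P.smult_l_distr)
    then show "finsum P (\<lambda>i. f i (x \<oplus>\<^bsub>X\<^esub> y) \<odot>\<^bsub>P\<^esub> e i) {..<n}
        = finsum P (\<lambda>i. f i x \<odot>\<^bsub>P\<^esub> e i) {..<n} \<oplus>\<^bsub>P\<^esub> finsum P (\<lambda>i. f i y \<odot>\<^bsub>P\<^esub> e i) {..<n}"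
      using \<open>x \<in> carrier X\<close> \<open>y \<in> carrier X\<close> by (simp add: P.X.finsum_addf Pi_iff f assms(4))
  next
    fix a x assume ax: "a \<in> carrier A" "x \<in> carrier X"
    have "(\<lambda>z \<in> carrier P. a \<odot>\<^bsub>P\<^esub> z) \<zero>\<^bsub>P\<^esub> = \<zero>\<^bsub>P\<^esub>" using ax by simp
    have "a \<odot>\<^bsub>P\<^esub> finsum P g I = finsum P (\<lambda>i. a \<odot>\<^bsub>P\<^esub> g i) I" if "finite I" "g \<in> I \<rightarrow> carrier P" for g and I :: "nat set"
      using that by (induction I rule: finite_induct)
        (auto simp: ax P.X.finsum_insert P.smult_r_distr Pi_iff)
    then have "a \<odot>\<^bsub>P\<^esub> finsum P (\<lambda>i. f i x \<odot>\<^bsub>P\<^esub> e i) {..<n} = finsum P (\<lambda>i. a \<odot>\<^bsub>P\<^esub> (f i x \<odot>\<^bsub>P\<^esub> e i)) {..<n}"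
      using ax by (simp add: Pi_iff f assms(4))
    also have "\<dots> = finsum P (\<lambda>i. f i (a \<odot>\<^bsub>X\<^esub> x) \<odot>\<^bsub>P\<^esub> e i) {..<n}"
      using ax by (intro P.X.finsum_cong') (auto simp: f assms(4) P.smult_assoc1)
    finally show "finsum P (\<lambda>i. f i (a \<odot>\<^bsub>X\<^esub> x) \<odot>\<^bsub>P\<^esub> e i) {..<n} = a \<odot>\<^bsub>P\<^esub> finsum P (\<lambda>i. f i x \<odot>\<^bsub>P\<^esub> e i) {..<n}" ..
  qed (auto simp: f assms(4) intro!: P.X.finsum_closed)
qed

lemma dual_basis:
  fixes A :: "('a, 'k) ring_scheme"
  assumes "projective_module A P"
  shows "\<exists>(n::nat) e f. (\<forall>i < n. e i \<in> carrier P \<and> f i \<in> mod_hom A P (regular_module A)) \<and>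
    (\<forall>p \<in> carrier P. finsum P (\<lambda>i. f i p \<odot>\<^bsub>P\<^esub> e i) {..<n} = p)"
proof -
  have P: "fg_module A P" using assms by (simp add: projective_module_def)
  interpret P: left_module A P by (rule fg_moduleD[OF P])
  note PM = P.left_module_axioms
  obtain S where S: "finite S" "S \<subseteq> carrier P" "\<And>H. \<lbrakk>submodule H A P; S \<subseteq> H\<rbrakk> \<Longrightarrow> H = carrier P"
    using fg_moduleE[OF P] by blast
  obtain n :: nat and e where e: "S = e ` {..<n}"
    using S(1) unfolding finite_conv_nat_seg_image by (auto simp: lessThan_def)
  have eP: "e i \<in> carrier P" if "i < n" for i using S(2) e that by auto
  let ?F = "free_module A n"
  note F = P.A.fg_free_module[of n]
  note FM = fg_moduleD[OF F]
  have FA: "c i \<in> carrier A" if "c \<in> carrier ?F" for c i using that by (simp add: free_module_def)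
  have pr: "(\<lambda>c \<in> carrier ?F. c i) \<in> mod_hom A ?F (regular_module A)" for i
    by (rule mod_homI[OF FM]) (auto simp: free_module_def)
  let ?g = "\<lambda>c \<in> carrier ?F. finsum P (\<lambda>i. (\<lambda>c \<in> carrier ?F. c i) c \<odot>\<^bsub>P\<^esub> e i) {..<n}"
  have g: "?g \<in> mod_hom A ?F P" by (rule mod_hom_coordinates[OF FM PM pr eP])
  have gsurj: "?g ` carrier ?F = carrier P"
  proof (rule S(3))
    show "submodule (?g ` carrier ?F) A P"
      by (rule image_submodule[OF FM PM g left_module.submodule_carrier[OF FM]])
    show "S \<subseteq> ?g ` carrier ?F"
    proof
      fix x assume "x \<in> S"
      then obtain k where k: "k < n" "x = e k" using e by auto
      let ?c = "\<lambda>j. if j = k then \<one>\<^bsub>A\<^esub> else \<zero>\<^bsub>A\<^esub>"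
      have c: "?c \<in> carrier ?F" using k by (auto simp: free_module_def)
      have gc: "?g ?c \<in> ?g ` carrier ?F" by (rule imageI[OF c])
      have "finsum P (\<lambda>i. ?c i \<odot>\<^bsub>P\<^esub> e i) {..<n} = finsum P (\<lambda>i. if k = i then e i else \<zero>\<^bsub>P\<^esub>) {..<n}"
        by (intro P.X.finsum_cong') (auto simp: eP)
      also have "\<dots> = e k" using k by (intro P.X.finsum_singleton) (auto simp: eP)
      finally have "?g ?c = x" using c k by simp
      then show "x \<in> ?g ` carrier ?F" using gc by (simp only:)
    qed
  qed
  obtain F' :: "'a fgmod" and a b where F': "fg_module A F'" "a \<in> mod_hom A ?F F'" "b \<in> mod_hom A F' ?F"
      "\<And>x. x \<in> carrier ?F \<Longrightarrow> b (a x) = x" "\<And>y. y \<in> carrier F' \<Longrightarrow> a (b y) = y"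
    using fg_module_rep[OF F] by metis
  obtain P' :: "'a fgmod" and s t where P': "fg_module A P'" "s \<in> mod_hom A P P'" "t \<in> mod_hom A P' P"
      "\<And>x. x \<in> carrier P \<Longrightarrow> t (s x) = x" "\<And>y. y \<in> carrier P' \<Longrightarrow> s (t y) = y"
    using fg_module_rep[OF P] by metis
  note F'M = fg_moduleD[OF F'(1)]
  have gb: "compose (carrier F') ?g b \<in> mod_hom A F' P" by (rule mod_hom_compose[OF F'M F'(3) g])
  let ?G = "compose (carrier F') s (compose (carrier F') ?g b)"
  have G: "?G \<in> mod_hom A F' P'" by (rule mod_hom_compose[OF F'M gb P'(2)])
  have Gsurj: "?G ` carrier F' = carrier P'"
  proof
    show "carrier P' \<subseteq> ?G ` carrier F'"
    proof
      fix y assume y: "y \<in> carrier P'"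
      then have "t y \<in> ?g ` carrier ?F" using mod_hom_closed[OF P'(3)] gsurj by simp
      then obtain c where c: "c \<in> carrier ?F" "t y = ?g c" by blast
      have ac: "a c \<in> carrier F'" using mod_hom_closed[OF F'(2)] c by simp
      have "?G (a c) = s (?g c)" using ac F'(4)[OF c(1)] by (simp add: compose_def)
      then have "?G (a c) = y" using c(2)[symmetric] P'(5)[OF y] by simp
      then show "y \<in> ?G ` carrier F'" using imageI[OF ac, of ?G] by (simp only:)
    qed
  qed (use mod_hom_closed[OF G] in auto)
  obtain k where k: "k \<in> mod_hom A P F'" "\<forall>p \<in> carrier P. ?G (k p) = s p"
    using assms F'(1) P'(1,2) G Gsurj unfolding projective_module_def by blast
  have bk: "compose (carrier P) b k \<in> mod_hom A P ?F" by (rule mod_hom_compose[OF PM k(1) F'(3)])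
  define f where "f i = compose (carrier P) (\<lambda>c \<in> carrier ?F. c i) (compose (carrier P) b k)" for i
  have f: "f i \<in> mod_hom A P (regular_module A)" for i
    unfolding f_def by (rule mod_hom_compose[OF PM bk pr])
  have "finsum P (\<lambda>i. f i p \<odot>\<^bsub>P\<^esub> e i) {..<n} = p" if p: "p \<in> carrier P" for p
  proof -
    have kp: "k p \<in> carrier F'" "b (k p) \<in> carrier ?F"
      using mod_hom_closed[OF k(1) p] mod_hom_closed[OF F'(3)] by auto
    have "finsum P (\<lambda>i. f i p \<odot>\<^bsub>P\<^esub> e i) {..<n} = ?g (b (k p))"
      using p kp by (simp add: f_def compose_def)
    also have "\<dots> = t (s (?g (b (k p))))" using P'(4) mod_hom_closed[OF g kp(2)] by simp
    also have "s (?g (b (k p))) = ?G (k p)" using kp by (simp only: compose_eq)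
    also have "?G (k p) = s p" using k(2) p by blast
    finally show ?thesis using P'(4)[OF p] by simp
  qed
  then show ?thesis using eP f by (intro exI[of _ n] exI[of _ e] exI[of _ f]) blast
qed

lemma (in artin_algebra) projective_imp_injective:
  assumes A: "selfinjective A" and P: "projective_module A P"
  shows "injective_module A P"
proof -
  have fg: "fg_module A P" using P by (simp add: projective_module_def)
  note PM = fg_moduleD[OF fg]
  obtain n :: nat and e f where *: "\<forall>i < n. e i \<in> carrier P \<and> f i \<in> mod_hom A P (regular_module A)"
    "\<forall>p \<in> carrier P. finsum P (\<lambda>i. f i p \<odot>\<^bsub>P\<^esub> e i) {..<n} = p"
    using dual_basis[OF P] by blast
  then have ef: "\<And>i. i < n \<Longrightarrow> e i \<in> carrier P"
    "\<And>i. i < n \<Longrightarrow> f i \<in> mod_hom A P (regular_module A)"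
    "\<And>p. p \<in> carrier P \<Longrightarrow> finsum P (\<lambda>i. f i p \<odot>\<^bsub>P\<^esub> e i) {..<n} = p" by auto
  show ?thesis
    unfolding injective_module_def
  proof (intro conjI allI impI ballI fg)
    fix X Y :: "'a fgmod" and i h
    assume XY: "fg_module A X \<and> fg_module A Y" and i: "i \<in> mod_hom A X Y" and h: "h \<in> mod_hom A X P"
      and inj: "inj_on i (carrier X)"
    note XM = fg_moduleD[OF conjunct1[OF XY]] and YM = fg_moduleD[OF conjunct2[OF XY]]
    have "\<exists>k \<in> mod_hom A Y (regular_module A). \<forall>x \<in> carrier X. k (i x) = compose (carrier X) (f j) h x"
      if "j < n" for j
      by (rule injective_moduleD[OF _ _ _ i inj mod_hom_compose[OF XM h ef(2)[OF that]]])
        (use A XY in \<open>auto simp: selfinjective_def\<close>)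
    then have "\<forall>j. \<exists>k. j < n \<longrightarrow> k \<in> mod_hom A Y (regular_module A) \<and> (\<forall>x \<in> carrier X. k (i x) = f j (h x))"
      by (auto simp: compose_def)
    then obtain k where k: "\<forall>j. j < n \<longrightarrow> k j \<in> mod_hom A Y (regular_module A) \<and>
        (\<forall>x \<in> carrier X. k j (i x) = f j (h x))" by metis
    show "\<exists>k \<in> mod_hom A Y P. \<forall>x \<in> carrier X. k (i x) = h x"
    proof (intro bexI ballI)
      show "(\<lambda>y \<in> carrier Y. finsum P (\<lambda>j. k j y \<odot>\<^bsub>P\<^esub> e j) {..<n}) \<in> mod_hom A Y P"
        by (rule mod_hom_coordinates[OF YM PM]) (use k ef in auto)
      fix x assume x: "x \<in> carrier X"
      interpret P: left_module A P by (rule PM)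
      have "finsum P (\<lambda>j. k j (i x) \<odot>\<^bsub>P\<^esub> e j) {..<n} = finsum P (\<lambda>j. f j (h x) \<odot>\<^bsub>P\<^esub> e j) {..<n}"
        using k x ef(1) mod_hom_closed[OF ef(2)] mod_hom_closed[OF h]
        by (intro P.X.finsum_cong') auto
      then show "(\<lambda>y \<in> carrier Y. finsum P (\<lambda>j. k j y \<odot>\<^bsub>P\<^esub> e j) {..<n}) (i x) = h x"
        using mod_hom_closed[OF i x] ef(3) mod_hom_closed[OF h x] by simp
    qed
  qed
qed

section \<open>Tensor products\<close>

lemma additive_map_finsum:
  assumes "abelian_group X" "abelian_group Z" "\<And>x. x \<in> carrier X \<Longrightarrow> h x \<in> carrier Z"
    and add: "\<And>x y. \<lbrakk>x \<in> carrier X; y \<in> carrier X\<rbrakk> \<Longrightarrow> h (x \<oplus>\<^bsub>X\<^esub> y) = h x \<oplus>\<^bsub>Z\<^esub> h y"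
    and "finite I" "\<And>i. i \<in> I \<Longrightarrow> g i \<in> carrier X"
  shows "h (finsum X g I) = finsum Z (\<lambda>i. h (g i)) I"
proof -
  interpret X: abelian_group X by (rule assms)
  interpret Z: abelian_group Z by (rule assms)
  have zero: "h \<zero>\<^bsub>X\<^esub> = \<zero>\<^bsub>Z\<^esub>"
    using add[of "\<zero>\<^bsub>X\<^esub>" "\<zero>\<^bsub>X\<^esub>"] assms(3)[of "\<zero>\<^bsub>X\<^esub>"] Z.add.l_cancel_one'[of "h \<zero>\<^bsub>X\<^esub>" "h \<zero>\<^bsub>X\<^esub>"] by simp
  show ?thesis
    using assms(5,6)
    by (induction I rule: finite_induct) (auto simp: zero add assms(3) Pi_iff X.finsum_insert Z.finsum_insert)
qed

definition tensor_class ::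
    "('a, 'm, 'b) bimodule \<Rightarrow> ('b, 'k) ring_scheme \<Rightarrow> ('b, 'y) module \<Rightarrow> (('m \<times> 'y) \<Rightarrow>\<^sub>0 int)
      \<Rightarrow> (('m \<times> 'y) \<Rightarrow>\<^sub>0 int) set" where
  "tensor_class M B Y c = (\<lambda>n. n + c) ` tensor_null M B Y"

definition pure ::
    "('a, 'm, 'b) bimodule \<Rightarrow> ('b, 'k) ring_scheme \<Rightarrow> ('b, 'y) module \<Rightarrow> 'm \<Rightarrow> 'y
      \<Rightarrow> (('m \<times> 'y) \<Rightarrow>\<^sub>0 int) set" where
  "pure M B Y m y = tensor_class M B Y (frag_of (m, y))"

lemma opposite_ring_simps [simp]:
  "carrier (opposite_ring B) = carrier B" "x \<oplus>\<^bsub>opposite_ring B\<^esub> y = x \<oplus>\<^bsub>B\<^esub> y"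
  "\<zero>\<^bsub>opposite_ring B\<^esub> = \<zero>\<^bsub>B\<^esub>" "\<one>\<^bsub>opposite_ring B\<^esub> = \<one>\<^bsub>B\<^esub>" "x \<otimes>\<^bsub>opposite_ring B\<^esub> y = y \<otimes>\<^bsub>B\<^esub> x"
  by (auto simp: opposite_ring_def)

lemma right_module_of_simps [simp]:
  "carrier (right_module_of M) = carrier M" "x \<oplus>\<^bsub>right_module_of M\<^esub> y = x \<oplus>\<^bsub>M\<^esub> y"
  "\<zero>\<^bsub>right_module_of M\<^esub> = \<zero>\<^bsub>M\<^esub>" "b \<odot>\<^bsub>right_module_of M\<^esub> x = x \<odot>\<^sub>r\<^bsub>M\<^esub> b"
  by (auto simp: right_module_of_def)

context bimodule
begin

lemma rsmult_closed [simp, intro]: "\<lbrakk>m \<in> carrier M; b \<in> carrier B\<rbrakk> \<Longrightarrow> m \<odot>\<^sub>r\<^bsub>M\<^esub> b \<in> carrier M"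
  using right.smult_closed[of b m] by simp

context
  fixes Y :: "('b, 'y) module"
  assumes Y: "left_module B Y"
begin

interpretation Y: left_module B Y by (rule Y)

lemma relators_subset: "tensor_relators M B Y \<subseteq> carrier (tensor_free M Y)"
proof
  fix r assume "r \<in> tensor_relators M B Y"
  then have "Poly_Mapping.keys r \<subseteq> carrier M \<times> carrier Y"
    unfolding tensor_relators_def
    by (elim UnE CollectE exE conjE) (auto dest!: subsetD[OF keys_diff] simp: keys_frag_of)
  then show "r \<in> carrier (tensor_free M Y)" by (simp add: tensor_free_def)
qed

lemma tensor_null_subgroup: "subgroup (tensor_null M B Y) (tensor_free M Y)"
  unfolding tensor_null_def
  by (rule group.generate_is_subgroup[OF _ relators_subset]) (simp add: tensor_free_def)

lemma tensor_null_zero: "0 \<in> tensor_null M B Y"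
  using subgroup.one_closed[OF tensor_null_subgroup] by (simp add: tensor_free_def)

lemma tensor_null_keys: "tensor_null M B Y \<subseteq> {c. Poly_Mapping.keys c \<subseteq> carrier M \<times> carrier Y}"
proof
  fix c assume "c \<in> tensor_null M B Y"
  then have "c \<in> carrier (tensor_free M Y)" using subgroup.subset[OF tensor_null_subgroup] by blast
  then show "c \<in> {c. Poly_Mapping.keys c \<subseteq> carrier M \<times> carrier Y}" by (simp add: tensor_free_def)
qed

lemma relator_keys:
  assumes "r \<in> tensor_relators M B Y" shows "Poly_Mapping.keys r \<subseteq> carrier M \<times> carrier Y"
proof -
  have "r \<in> carrier (tensor_free M Y)" using relators_subset assms by blast
  then show ?thesis by (simp add: tensor_free_def)
qed

lemma tensor_null_add: "\<lbrakk>c \<in> tensor_null M B Y; d \<in> tensor_null M B Y\<rbrakk> \<Longrightarrow> c + d \<in> tensor_null M B Y"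
  using subgroup.m_closed[OF tensor_null_subgroup] by (simp add: tensor_free_def)

lemma tensor_null_uminus: "c \<in> tensor_null M B Y \<Longrightarrow> - c \<in> tensor_null M B Y"
  using subgroup.m_inv_closed[OF tensor_null_subgroup, of c] tensor_null_keys by (auto simp: tensor_free_def)

lemma tensor_null_diff: "\<lbrakk>c \<in> tensor_null M B Y; d \<in> tensor_null M B Y\<rbrakk> \<Longrightarrow> c - d \<in> tensor_null M B Y"
  using tensor_null_add[OF _ tensor_null_uminus] by fastforce

lemma tensor_null_relator: "r \<in> tensor_relators M B Y \<Longrightarrow> r \<in> tensor_null M B Y"
  unfolding tensor_null_def by (rule generate.incl)

lemma tensor_null_induct:
  assumes "c \<in> tensor_null M B Y" "P 0" "\<And>r. r \<in> tensor_relators M B Y \<Longrightarrow> P r" "\<And>c d. \<lbrakk>P c; P d\<rbrakk> \<Longrightarrow> P (c - d)"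
  shows "P c"
  using assms(1) unfolding tensor_null_def
proof (induction rule: generate.induct)
  case (inv r)
  then have "Poly_Mapping.keys r \<subseteq> carrier M \<times> carrier Y"
    by (rule relator_keys)
  then show ?case using assms(4)[OF assms(2) assms(3)[OF inv]] by (simp add: tensor_free_def)
next
  case (eng c d)
  then show ?case using assms(4)[OF eng.IH(1) assms(4)[OF assms(2) eng.IH(2)]] by (simp add: tensor_free_def)
qed (use assms in \<open>auto simp: tensor_free_def\<close>)

lemma tensor_class_eq_iff: "tensor_class M B Y c = tensor_class M B Y d \<longleftrightarrow> c - d \<in> tensor_null M B Y"
proof
  assume eq: "tensor_class M B Y c = tensor_class M B Y d"
  have "0 + c \<in> tensor_class M B Y c" unfolding tensor_class_def by (rule imageI[OF tensor_null_zero])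
  then obtain n where "n \<in> tensor_null M B Y" "c = n + d" unfolding eq unfolding tensor_class_def by auto
  then show "c - d \<in> tensor_null M B Y" by simp
next
  assume cd: "c - d \<in> tensor_null M B Y"
  show "tensor_class M B Y c = tensor_class M B Y d"
    unfolding tensor_class_def
  proof (intro equalityI image_subsetI)
    fix n assume n: "n \<in> tensor_null M B Y"
    show "n + c \<in> (\<lambda>n. n + d) ` (tensor_null M B Y)"
      by (rule image_eqI[OF _ tensor_null_add[OF n cd]]) simp
    show "n + d \<in> (\<lambda>n. n + c) ` (tensor_null M B Y)"
      by (rule image_eqI[OF _ tensor_null_diff[OF n cd]]) simp
  qed
qed

lemma tensor_class_coset: "tensor_null M B Y #>\<^bsub>tensor_free M Y\<^esub> c = tensor_class M B Y c"
  by (auto simp: r_coset_def tensor_class_def tensor_free_def)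

lemma tensor_carrier: "carrier (tensor M B Y) = tensor_class M B Y ` {c. Poly_Mapping.keys c \<subseteq> carrier M \<times> carrier Y}"
  by (auto simp: tensor_def FactGroup_def RCOSETS_def tensor_class_coset)
    (auto simp: tensor_free_def)

lemma tensor_zero: "\<zero>\<^bsub>tensor M B Y\<^esub> = tensor_class M B Y 0"
  by (simp add: tensor_def FactGroup_def tensor_class_def)

lemma tensor_add: "tensor_class M B Y c \<oplus>\<^bsub>tensor M B Y\<^esub> tensor_class M B Y d = tensor_class M B Y (c + d)"
proof -
  have "tensor_class M B Y c \<oplus>\<^bsub>tensor M B Y\<^esub> tensor_class M B Y d = {x + c + (y + d) | x y. x \<in> tensor_null M B Y \<and> y \<in> tensor_null M B Y}"
    by (auto simp: tensor_def FactGroup_def set_mult_def tensor_class_def tensor_free_def)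
  also have "\<dots> = (\<lambda>n. n + (c + d)) ` (tensor_null M B Y)"
  proof (intro equalityI subsetI)
    fix z assume "z \<in> {x + c + (y + d) | x y. x \<in> tensor_null M B Y \<and> y \<in> tensor_null M B Y}"
    then obtain x y where "x \<in> tensor_null M B Y" "y \<in> tensor_null M B Y" "z = x + c + (y + d)" by blast
    then show "z \<in> (\<lambda>n. n + (c + d)) ` (tensor_null M B Y)"
      by (intro image_eqI[OF _ tensor_null_add[of x y]]) (auto simp: algebra_simps)
  next
    fix z assume "z \<in> (\<lambda>n. n + (c + d)) ` (tensor_null M B Y)"
    then obtain n where "n \<in> tensor_null M B Y" "z = n + (c + d)" by blast
    then have "z = n + c + (0 + d)" by (simp add: algebra_simps)
    then show "z \<in> {x + c + (y + d) | x y. x \<in> tensor_null M B Y \<and> y \<in> tensor_null M B Y}" using \<open>n \<in> tensor_null M B Y\<close> tensor_null_zero by blast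
  qed
  finally show ?thesis by (simp add: tensor_class_def)
qed

lemma pure_closed [simp, intro]: "\<lbrakk>m \<in> carrier M; y \<in> carrier Y\<rbrakk> \<Longrightarrow> pure M B Y m y \<in> carrier (tensor M B Y)"
  unfolding pure_def tensor_carrier by (rule imageI) (simp add: keys_frag_of)

end

lemma tensor_image_class:
  fixes Y :: "('b, 'y) module" and Z :: "('b, 'z) module"
  assumes Y: "left_module B Y" and Z: "left_module B Z"
    and h: "\<And>r. r \<in> tensor_relators M B Y \<Longrightarrow> frag_extend h r \<in> tensor_null M B Z"
  shows "tensor_null M B Z <#>\<^bsub>tensor_free M Z\<^esub> frag_extend h ` tensor_class M B Y c
      = tensor_class M B Z (frag_extend h c)"
proof -
  have hN: "frag_extend h n \<in> tensor_null M B Z" if "n \<in> tensor_null M B Y" for n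
    using that
    by (rule tensor_null_induct[OF Y])
      (auto simp: h frag_extend_diff tensor_null_diff[OF Z] tensor_null_zero[OF Z])
  have "tensor_null M B Z <#>\<^bsub>tensor_free M Z\<^esub> frag_extend h ` tensor_class M B Y c
      = {x + (frag_extend h n + frag_extend h c) | x n. x \<in> tensor_null M B Z \<and> n \<in> tensor_null M B Y}"
    by (auto simp: set_mult_def tensor_class_def tensor_free_def frag_extend_add)
  also have "\<dots> = (\<lambda>n. n + frag_extend h c) ` tensor_null M B Z"
  proof (intro equalityI subsetI)
    fix z assume "z \<in> {x + (frag_extend h n + frag_extend h c) | x n.
      x \<in> tensor_null M B Z \<and> n \<in> tensor_null M B Y}"
    then obtain x n where "x \<in> tensor_null M B Z" "n \<in> tensor_null M B Y"
      "z = x + (frag_extend h n + frag_extend h c)" by blast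
    then show "z \<in> (\<lambda>n. n + frag_extend h c) ` tensor_null M B Z"
      by (intro image_eqI[OF _ tensor_null_add[OF Z, of x "frag_extend h n"]]) (auto simp: hN algebra_simps)
  next
    fix z assume "z \<in> (\<lambda>n. n + frag_extend h c) ` tensor_null M B Z"
    then obtain x where "x \<in> tensor_null M B Z" "z = x + frag_extend h c" by blast
    then have "z = x + (frag_extend h 0 + frag_extend h c)" by simp
    then show "z \<in> {x + (frag_extend h n + frag_extend h c) | x n.
      x \<in> tensor_null M B Z \<and> n \<in> tensor_null M B Y}"
      using \<open>x \<in> tensor_null M B Z\<close> tensor_null_zero[OF Y] by blast
  qed
  finally show ?thesis by (simp add: tensor_class_def)
qed

lemma relatorsI:
  shows "\<lbrakk>m \<in> carrier M; m' \<in> carrier M; y \<in> carrier Y\<rbrakk> \<Longrightarrow>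
      frag_of (m \<oplus>\<^bsub>M\<^esub> m', y) - frag_of (m, y) - frag_of (m', y) \<in> tensor_relators M B Y"
    and "\<lbrakk>m \<in> carrier M; y \<in> carrier Y; y' \<in> carrier Y\<rbrakk> \<Longrightarrow>
      frag_of (m, y \<oplus>\<^bsub>Y\<^esub> y') - frag_of (m, y) - frag_of (m, y') \<in> tensor_relators M B Y"
    and "\<lbrakk>m \<in> carrier M; b \<in> carrier B; y \<in> carrier Y\<rbrakk> \<Longrightarrow>
      frag_of (m \<odot>\<^sub>r\<^bsub>M\<^esub> b, y) - frag_of (m, b \<odot>\<^bsub>Y\<^esub> y) \<in> tensor_relators M B Y"
  unfolding tensor_relators_def by blast+

lemma relatorsE:
  assumes "r \<in> tensor_relators M B Y"
  obtains m m' y where "m \<in> carrier M" "m' \<in> carrier M" "y \<in> carrier Y"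
      "r = frag_of (m \<oplus>\<^bsub>M\<^esub> m', y) - frag_of (m, y) - frag_of (m', y)"
  | m y y' where "m \<in> carrier M" "y \<in> carrier Y" "y' \<in> carrier Y"
      "r = frag_of (m, y \<oplus>\<^bsub>Y\<^esub> y') - frag_of (m, y) - frag_of (m, y')"
  | m b y where "m \<in> carrier M" "b \<in> carrier B" "y \<in> carrier Y"
      "r = frag_of (m \<odot>\<^sub>r\<^bsub>M\<^esub> b, y) - frag_of (m, b \<odot>\<^bsub>Y\<^esub> y)"
proof -
  from assms consider "\<exists>m m' y. m \<in> carrier M \<and> m' \<in> carrier M \<and> y \<in> carrier Y \<and>
      r = frag_of (m \<oplus>\<^bsub>M\<^esub> m', y) - frag_of (m, y) - frag_of (m', y)"
    | "\<exists>m y y'. m \<in> carrier M \<and> y \<in> carrier Y \<and> y' \<in> carrier Y \<and>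
      r = frag_of (m, y \<oplus>\<^bsub>Y\<^esub> y') - frag_of (m, y) - frag_of (m, y')"
    | "\<exists>m b y. m \<in> carrier M \<and> b \<in> carrier B \<and> y \<in> carrier Y \<and>
      r = frag_of (m \<odot>\<^sub>r\<^bsub>M\<^esub> b, y) - frag_of (m, b \<odot>\<^bsub>Y\<^esub> y)"
    unfolding tensor_relators_def Un_iff mem_Collect_eq by (elim disjE exE conjE) metis+
  then show thesis using that by cases (elim exE conjE, metis)+
qed

lemma tensor_smult:
  fixes Y :: "('b, 'y) module"
  assumes Y: "left_module B Y" and a: "a \<in> carrier A"
  shows "a \<odot>\<^bsub>tensor M B Y\<^esub> tensor_class M B Y c
    = tensor_class M B Y (frag_extend (\<lambda>(m, y). frag_of (a \<odot>\<^bsub>M\<^esub> m, y)) c)"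
proof -
  have "frag_extend (\<lambda>(m, y). frag_of (a \<odot>\<^bsub>M\<^esub> m, y)) r \<in> tensor_null M B Y"
    if "r \<in> tensor_relators M B Y" for r
    using that
  proof (cases rule: relatorsE)
    case (1 m m' y)
    have "frag_extend (\<lambda>(m, y). frag_of (a \<odot>\<^bsub>M\<^esub> m, y)) r
        = frag_of (a \<odot>\<^bsub>M\<^esub> m \<oplus>\<^bsub>M\<^esub> a \<odot>\<^bsub>M\<^esub> m', y) - frag_of (a \<odot>\<^bsub>M\<^esub> m, y) - frag_of (a \<odot>\<^bsub>M\<^esub> m', y)"
      using 1 a by (simp add: frag_extend_diff left.smult_r_distr)
    then show ?thesis using tensor_null_relator[OF Y relatorsI(1)] 1 a by simp
  next
    case (2 m y y')
    then have "frag_extend (\<lambda>(m, y). frag_of (a \<odot>\<^bsub>M\<^esub> m, y)) r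
        = frag_of (a \<odot>\<^bsub>M\<^esub> m, y \<oplus>\<^bsub>Y\<^esub> y') - frag_of (a \<odot>\<^bsub>M\<^esub> m, y) - frag_of (a \<odot>\<^bsub>M\<^esub> m, y')"
      by (simp add: frag_extend_diff)
    then show ?thesis using tensor_null_relator[OF Y relatorsI(2)] 2 a by simp
  next
    case (3 m b y)
    have "frag_extend (\<lambda>(m, y). frag_of (a \<odot>\<^bsub>M\<^esub> m, y)) r
        = frag_of ((a \<odot>\<^bsub>M\<^esub> m) \<odot>\<^sub>r\<^bsub>M\<^esub> b, y) - frag_of (a \<odot>\<^bsub>M\<^esub> m, b \<odot>\<^bsub>Y\<^esub> y)"
      using 3 a by (simp add: frag_extend_diff actions_commute)
    then show ?thesis using tensor_null_relator[OF Y relatorsI(3)] 3 a by simp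
  qed
  then show ?thesis by (simp add: tensor_def tensor_image_class[OF Y Y])
qed

lemma tensor_map_class:
  fixes Y :: "('b, 'y) module" and Z :: "('b, 'z) module"
  assumes Y: "left_module B Y" and Z: "left_module B Z" and f: "f \<in> mod_hom B Y Z"
    and c: "Poly_Mapping.keys c \<subseteq> carrier M \<times> carrier Y"
  shows "tensor_map M B Y Z f (tensor_class M B Y c)
    = tensor_class M B Z (frag_extend (\<lambda>(m, y). frag_of (m, f y)) c)"
proof -
  note f = mod_homD[OF f]
  have "frag_extend (\<lambda>(m, y). frag_of (m, f y)) r \<in> tensor_null M B Z"
    if "r \<in> tensor_relators M B Y" for r
    using that
  proof (cases rule: relatorsE)
    case (1 m m' y)
    then have "frag_extend (\<lambda>(m, y). frag_of (m, f y)) r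
        = frag_of (m \<oplus>\<^bsub>M\<^esub> m', f y) - frag_of (m, f y) - frag_of (m', f y)"
      by (simp add: frag_extend_diff)
    then show ?thesis using tensor_null_relator[OF Z relatorsI(1)] 1 f by simp
  next
    case (2 m y y')
    then have "frag_extend (\<lambda>(m, y). frag_of (m, f y)) r
        = frag_of (m, f y \<oplus>\<^bsub>Z\<^esub> f y') - frag_of (m, f y) - frag_of (m, f y')"
      by (simp add: frag_extend_diff f)
    then show ?thesis using tensor_null_relator[OF Z relatorsI(2)] 2 f by simp
  next
    case (3 m b y)
    then have "frag_extend (\<lambda>(m, y). frag_of (m, f y)) r
        = frag_of (m \<odot>\<^sub>r\<^bsub>M\<^esub> b, f y) - frag_of (m, b \<odot>\<^bsub>Z\<^esub> f y)"
      by (simp add: frag_extend_diff f)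
    then show ?thesis using tensor_null_relator[OF Z relatorsI(3)] 3 f by simp
  qed
  moreover have "tensor_class M B Y c \<in> carrier (tensor M B Y)"
    using c by (simp add: tensor_carrier[OF Y])
  ultimately show ?thesis by (simp add: tensor_map_def tensor_image_class[OF Y Z])
qed

lemma tensor_left_module:
  fixes Y :: "('b, 'y) module"
  assumes Y: "left_module B Y"
  shows "left_module A (tensor M B Y)"
proof -
  let ?T = "tensor M B Y" and ?cl = "tensor_class M B Y"
  let ?h = "\<lambda>a. frag_extend (\<lambda>(m, y). frag_of (a \<odot>\<^bsub>M\<^esub> m, y))"
  note simps = tensor_carrier[OF Y] tensor_zero[OF Y] tensor_add[OF Y] tensor_smult[OF Y]
    tensor_class_eq_iff[OF Y]
  have "abelian_group ?T"
  proof (rule abelian_groupI)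
    fix x y assume "x \<in> carrier ?T" "y \<in> carrier ?T"
    then show "x \<oplus>\<^bsub>?T\<^esub> y \<in> carrier ?T" by (auto simp: simps dest!: subsetD[OF keys_add])
  next
    fix x assume "x \<in> carrier ?T"
    then obtain c where "Poly_Mapping.keys c \<subseteq> carrier M \<times> carrier Y" "x = ?cl c" by (auto simp: simps)
    then show "\<exists>y \<in> carrier ?T. y \<oplus>\<^bsub>?T\<^esub> x = \<zero>\<^bsub>?T\<^esub>"
      by (intro bexI[of _ "?cl (- c)"]) (auto simp: simps tensor_null_zero[OF Y] keys_minus intro!: imageI)
  qed (auto simp: simps tensor_null_zero[OF Y] algebra_simps)
  moreover have ladd: "?h (a \<oplus>\<^bsub>A\<^esub> b) c - (?h a c + ?h b c) \<in> tensor_null M B Y"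
    if "a \<in> carrier A" "b \<in> carrier A" "Poly_Mapping.keys c \<subseteq> carrier M \<times> carrier Y" for a b c
    using that(3)
  proof (rule free_Abelian_group_induct)
    fix c d
    assume "?h (a \<oplus>\<^bsub>A\<^esub> b) c - (?h a c + ?h b c) \<in> tensor_null M B Y"
      "?h (a \<oplus>\<^bsub>A\<^esub> b) d - (?h a d + ?h b d) \<in> tensor_null M B Y"
    then have "(?h (a \<oplus>\<^bsub>A\<^esub> b) c - (?h a c + ?h b c)) - (?h (a \<oplus>\<^bsub>A\<^esub> b) d - (?h a d + ?h b d))
      \<in> tensor_null M B Y" by (rule tensor_null_diff[OF Y])
    then show "?h (a \<oplus>\<^bsub>A\<^esub> b) (c - d) - (?h a (c - d) + ?h b (c - d)) \<in> tensor_null M B Y"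
      by (simp add: frag_extend_diff algebra_simps)
  next
    fix my assume "my \<in> carrier M \<times> carrier Y"
    then obtain m y where my: "my = (m, y)" "m \<in> carrier M" "y \<in> carrier Y" by auto
    have "frag_of (a \<odot>\<^bsub>M\<^esub> m \<oplus>\<^bsub>M\<^esub> b \<odot>\<^bsub>M\<^esub> m, y) - frag_of (a \<odot>\<^bsub>M\<^esub> m, y) - frag_of (b \<odot>\<^bsub>M\<^esub> m, y) \<in> tensor_null M B Y"
      using my that by (intro tensor_null_relator[OF Y] relatorsI) auto
    then show "?h (a \<oplus>\<^bsub>A\<^esub> b) (frag_of my) - (?h a (frag_of my) + ?h b (frag_of my)) \<in> tensor_null M B Y"
      using my that by (simp add: left.smult_l_distr diff_diff_eq)
  qed (use tensor_null_zero[OF Y] in simp)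
  moreover have lmult: "?h (a \<otimes>\<^bsub>A\<^esub> b) c = ?h a (?h b c)"
    if "a \<in> carrier A" "b \<in> carrier A" "Poly_Mapping.keys c \<subseteq> carrier M \<times> carrier Y" for a b c
    using that(3)
    by (rule free_Abelian_group_induct) (use that in \<open>auto simp: frag_extend_diff left.smult_assoc1\<close>)
  moreover have lone: "?h \<one>\<^bsub>A\<^esub> c = c" if "Poly_Mapping.keys c \<subseteq> carrier M \<times> carrier Y" for c
    using that by (rule free_Abelian_group_induct) (auto simp: frag_extend_diff)
  moreover have lkeys: "Poly_Mapping.keys (?h a c) \<subseteq> carrier M \<times> carrier Y"
    if "a \<in> carrier A" "Poly_Mapping.keys c \<subseteq> carrier M \<times> carrier Y" for a c
    using that by (auto dest!: subsetD[OF keys_frag_extend] simp: keys_frag_of)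
  moreover have ex: "\<exists>c. Poly_Mapping.keys c \<subseteq> carrier M \<times> carrier Y \<and> x = ?cl c" if "x \<in> carrier ?T" for x
    using that by (auto simp: simps)
  ultimately show ?thesis
  proof (intro left_module.intro left_module_axioms.intro left.A.ring_axioms)
    fix a x assume a: "a \<in> carrier A" and "x \<in> carrier ?T"
    then obtain c where c: "Poly_Mapping.keys c \<subseteq> carrier M \<times> carrier Y" "x = ?cl c" using ex by blast
    show "a \<odot>\<^bsub>?T\<^esub> x \<in> carrier ?T"
      unfolding c tensor_smult[OF Y a] tensor_carrier[OF Y] by (rule imageI) (use lkeys a c in simp)
    fix b assume b: "b \<in> carrier A"
    show "(a \<oplus>\<^bsub>A\<^esub> b) \<odot>\<^bsub>?T\<^esub> x = a \<odot>\<^bsub>?T\<^esub> x \<oplus>\<^bsub>?T\<^esub> b \<odot>\<^bsub>?T\<^esub> x"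
      using ladd[OF a b c(1)] a b by (simp only: c simps left.A.a_closed)
    show "(a \<otimes>\<^bsub>A\<^esub> b) \<odot>\<^bsub>?T\<^esub> x = a \<odot>\<^bsub>?T\<^esub> (b \<odot>\<^bsub>?T\<^esub> x)"
      using lmult[OF a b c(1)] a b by (simp only: c tensor_smult[OF Y] left.A.m_closed)
  next
    fix a x y assume a: "a \<in> carrier A" and "x \<in> carrier ?T" "y \<in> carrier ?T"
    then obtain c c' where c: "x = ?cl c" "y = ?cl c'" using ex by blast
    show "a \<odot>\<^bsub>?T\<^esub> (x \<oplus>\<^bsub>?T\<^esub> y) = a \<odot>\<^bsub>?T\<^esub> x \<oplus>\<^bsub>?T\<^esub> a \<odot>\<^bsub>?T\<^esub> y"
      using a by (simp only: c tensor_add[OF Y] tensor_smult[OF Y] frag_extend_add)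
  next
    fix x assume "x \<in> carrier ?T"
    then obtain c where c: "Poly_Mapping.keys c \<subseteq> carrier M \<times> carrier Y" "x = ?cl c" using ex by blast
    show "\<one>\<^bsub>A\<^esub> \<odot>\<^bsub>?T\<^esub> x = x" unfolding c using lone[OF c(1)] by (simp only: tensor_smult[OF Y] left.A.one_closed)
  qed
qed

lemma tensor_induct [consumes 2, case_names zero pure minus]:
  fixes Y :: "('b, 'y) module"
  assumes Y: "left_module B Y" and t: "t \<in> carrier (tensor M B Y)"
    and "P \<zero>\<^bsub>tensor M B Y\<^esub>" "\<And>m y. \<lbrakk>m \<in> carrier M; y \<in> carrier Y\<rbrakk> \<Longrightarrow> P (pure M B Y m y)"
    and "\<And>s t. \<lbrakk>s \<in> carrier (tensor M B Y); t \<in> carrier (tensor M B Y); P s; P t\<rbrakk> \<Longrightarrow> P (s \<ominus>\<^bsub>tensor M B Y\<^esub> t)"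
  shows "P t"
proof -
  interpret T: left_module A "tensor M B Y" by (rule tensor_left_module[OF Y])
  obtain c where c: "Poly_Mapping.keys c \<subseteq> carrier M \<times> carrier Y" "t = tensor_class M B Y c"
    using t by (auto simp: tensor_carrier[OF Y])
  have "P (tensor_class M B Y c)" using c(1)
  proof (rule free_Abelian_group_induct)
    fix c d assume cd: "Poly_Mapping.keys c \<subseteq> carrier M \<times> carrier Y" "Poly_Mapping.keys d \<subseteq> carrier M \<times> carrier Y"
      "P (tensor_class M B Y c)" "P (tensor_class M B Y d)"
    have cl: "tensor_class M B Y e \<in> carrier (tensor M B Y)"
      if "Poly_Mapping.keys e \<subseteq> carrier M \<times> carrier Y" for e using that by (simp add: tensor_carrier[OF Y])
    have "Poly_Mapping.keys (c - d) \<subseteq> carrier M \<times> carrier Y" using cd by (auto dest!: subsetD[OF keys_diff])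
    then have "tensor_class M B Y c \<ominus>\<^bsub>tensor M B Y\<^esub> tensor_class M B Y d = tensor_class M B Y (c - d)"
      using T.X.add_minus_cancel(1)[of "tensor_class M B Y d" "tensor_class M B Y (c - d)"] cl cd
      by (simp add: tensor_add[OF Y])
    then show "P (tensor_class M B Y (c - d))" using assms(5)[of "tensor_class M B Y c" "tensor_class M B Y d"] cl cd by simp
  qed (use assms(3,4) in \<open>auto simp: tensor_zero[OF Y] pure_def\<close>)
  then show ?thesis using c by simp
qed

lemma pure_add_left:
  fixes Y :: "('b, 'y) module"
  assumes Y: "left_module B Y" and "m \<in> carrier M" "m' \<in> carrier M" "y \<in> carrier Y"
  shows "pure M B Y (m \<oplus>\<^bsub>M\<^esub> m') y = pure M B Y m y \<oplus>\<^bsub>tensor M B Y\<^esub> pure M B Y m' y"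
  using tensor_null_relator[OF Y relatorsI(1)[OF assms(2-4)]]
  by (simp add: pure_def tensor_add[OF Y] tensor_class_eq_iff[OF Y] diff_diff_eq)

lemma pure_add_right:
  fixes Y :: "('b, 'y) module"
  assumes Y: "left_module B Y" and "m \<in> carrier M" "y \<in> carrier Y" "y' \<in> carrier Y"
  shows "pure M B Y m (y \<oplus>\<^bsub>Y\<^esub> y') = pure M B Y m y \<oplus>\<^bsub>tensor M B Y\<^esub> pure M B Y m y'"
  using tensor_null_relator[OF Y relatorsI(2)[OF assms(2-4)]]
  by (simp add: pure_def tensor_add[OF Y] tensor_class_eq_iff[OF Y] diff_diff_eq)

lemma pure_balanced:
  fixes Y :: "('b, 'y) module"
  assumes Y: "left_module B Y" and "m \<in> carrier M" "b \<in> carrier B" "y \<in> carrier Y"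
  shows "pure M B Y (m \<odot>\<^sub>r\<^bsub>M\<^esub> b) y = pure M B Y m (b \<odot>\<^bsub>Y\<^esub> y)"
  using tensor_null_relator[OF Y relatorsI(3)[OF assms(2-4)]]
  by (simp add: pure_def tensor_add[OF Y] tensor_class_eq_iff[OF Y])

lemma smult_pure:
  fixes Y :: "('b, 'y) module"
  assumes Y: "left_module B Y" and "a \<in> carrier A"
  shows "a \<odot>\<^bsub>tensor M B Y\<^esub> pure M B Y m y = pure M B Y (a \<odot>\<^bsub>M\<^esub> m) y"
  by (simp add: pure_def tensor_smult[OF assms])

lemma tensor_universal:
  fixes Y :: "('b, 'y) module" and Z :: "('z, 'q) ring_scheme"
  assumes Y: "left_module B Y" and Z: "abelian_group Z"
    and cl: "\<And>m y. \<lbrakk>m \<in> carrier M; y \<in> carrier Y\<rbrakk> \<Longrightarrow> \<beta> m y \<in> carrier Z"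
    and l: "\<And>m m' y. \<lbrakk>m \<in> carrier M; m' \<in> carrier M; y \<in> carrier Y\<rbrakk> \<Longrightarrow> \<beta> (m \<oplus>\<^bsub>M\<^esub> m') y = \<beta> m y \<oplus>\<^bsub>Z\<^esub> \<beta> m' y"
    and r: "\<And>m y y'. \<lbrakk>m \<in> carrier M; y \<in> carrier Y; y' \<in> carrier Y\<rbrakk> \<Longrightarrow> \<beta> m (y \<oplus>\<^bsub>Y\<^esub> y') = \<beta> m y \<oplus>\<^bsub>Z\<^esub> \<beta> m y'"
    and b: "\<And>m b y. \<lbrakk>m \<in> carrier M; b \<in> carrier B; y \<in> carrier Y\<rbrakk> \<Longrightarrow> \<beta> (m \<odot>\<^sub>r\<^bsub>M\<^esub> b) y = \<beta> m (b \<odot>\<^bsub>Y\<^esub> y)"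
  shows "\<exists>h. h \<in> carrier (tensor M B Y) \<rightarrow>\<^sub>E carrier Z \<and>
    (\<forall>s \<in> carrier (tensor M B Y). \<forall>t \<in> carrier (tensor M B Y). h (s \<oplus>\<^bsub>tensor M B Y\<^esub> t) = h s \<oplus>\<^bsub>Z\<^esub> h t) \<and>
    (\<forall>m \<in> carrier M. \<forall>y \<in> carrier Y. h (pure M B Y m y) = \<beta> m y)"
proof -
  interpret Y: left_module B Y by (rule Y)
  interpret Z: abelian_group Z by (rule Z)
  let ?S = "carrier M \<times> carrier Y" and ?cl = "tensor_class M B Y"
  have im: "(\<lambda>(m, y). \<beta> m y) ` ?S \<subseteq> carrier (add_monoid Z)" using cl by auto
  have "\<exists>u \<in> hom (free_Abelian_group ?S) (add_monoid Z). \<forall>x \<in> ?S. u (frag_of x) = (\<lambda>(m, y). \<beta> m y) x"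
    by (rule comm_group.free_Abelian_group_universal[OF Z.a_comm_group im]) blast
  then obtain u where u: "u \<in> hom (free_Abelian_group ?S) (add_monoid Z)"
      "\<forall>x \<in> ?S. u (frag_of x) = (\<lambda>(m, y). \<beta> m y) x" by blast
  have uc: "u c \<in> carrier Z" if "Poly_Mapping.keys c \<subseteq> ?S" for c
    using hom_in_carrier[OF u(1), of c] that by simp
  have ua: "u (c + d) = u c \<oplus>\<^bsub>Z\<^esub> u d" if "Poly_Mapping.keys c \<subseteq> ?S" "Poly_Mapping.keys d \<subseteq> ?S" for c d
    using hom_mult[OF u(1), of c d] that by simp
  have ud: "u (c - d) = u c \<ominus>\<^bsub>Z\<^esub> u d" if "Poly_Mapping.keys c \<subseteq> ?S" "Poly_Mapping.keys d \<subseteq> ?S" for c d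
  proof -
    have k: "Poly_Mapping.keys (c - d) \<subseteq> ?S" using that by (auto dest!: subsetD[OF keys_diff])
    then have "u c = u d \<oplus>\<^bsub>Z\<^esub> u (c - d)" using ua[of d "c - d"] that by simp
    then show ?thesis using Z.add_minus_cancel(1)[of "u d" "u (c - d)"] uc that k by simp
  qed
  have up: "u (frag_of (m, y)) = \<beta> m y" if "m \<in> carrier M" "y \<in> carrier Y" for m y
    using u(2)[rule_format, of "(m, y)"] that by simp
  have u0: "u 0 = \<zero>\<^bsub>Z\<^esub>" using ud[of 0 0] uc[of 0] by (simp add: a_minus_def Z.r_neg)
  have uN: "Poly_Mapping.keys n \<subseteq> ?S \<and> u n = \<zero>\<^bsub>Z\<^esub>" if "n \<in> tensor_null M B Y" for n
    using that
  proof (rule tensor_null_induct[OF Y])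
    fix r assume r0: "r \<in> tensor_relators M B Y"
    have k: "Poly_Mapping.keys r \<subseteq> ?S"
      by (rule relator_keys[OF Y r0])
    have kd: "Poly_Mapping.keys (frag_of p - frag_of q) \<subseteq> ?S" if "p \<in> ?S" "q \<in> ?S" for p q :: "'m \<times> 'y"
      using that by (auto dest!: subsetD[OF keys_diff] simp: keys_frag_of)
    have "u r = \<zero>\<^bsub>Z\<^esub>" using r0
    proof (cases rule: relatorsE)
      case (1 m m' y)
      then show ?thesis using kd[of "(m \<oplus>\<^bsub>M\<^esub> m', y)" "(m, y)"] Z.add_minus_cancel(1)[of "\<beta> m y" "\<beta> m' y"]
        by (simp add: ud up keys_frag_of cl l Z.minus_eq_zero_iff)
    next
      case (2 m y y')
      then show ?thesis using kd[of "(m, y \<oplus>\<^bsub>Y\<^esub> y')" "(m, y)"] Z.add_minus_cancel(1)[of "\<beta> m y" "\<beta> m y'"]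
        by (simp add: ud up keys_frag_of cl r Z.minus_eq_zero_iff)
    next
      case (3 m c y)
      then show ?thesis by (simp add: ud up keys_frag_of cl b Z.minus_eq_zero_iff)
    qed
    then show "Poly_Mapping.keys r \<subseteq> ?S \<and> u r = \<zero>\<^bsub>Z\<^esub>" using k by simp
  next
    fix c d assume "Poly_Mapping.keys c \<subseteq> ?S \<and> u c = \<zero>\<^bsub>Z\<^esub>" "Poly_Mapping.keys d \<subseteq> ?S \<and> u d = \<zero>\<^bsub>Z\<^esub>"
    then show "Poly_Mapping.keys (c - d) \<subseteq> ?S \<and> u (c - d) = \<zero>\<^bsub>Z\<^esub>"
      by (auto simp: ud Z.minus_eq_zero_iff dest!: subsetD[OF keys_diff])
  qed (use u0 in auto)
  define h where "h = (\<lambda>C \<in> carrier (tensor M B Y). u (SOME c. Poly_Mapping.keys c \<subseteq> ?S \<and> C = ?cl c))"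
  have h: "h (?cl c) = u c" if c: "Poly_Mapping.keys c \<subseteq> ?S" for c
  proof -
    define d where "d = (SOME d. Poly_Mapping.keys d \<subseteq> ?S \<and> ?cl c = ?cl d)"
    have d: "Poly_Mapping.keys d \<subseteq> ?S \<and> ?cl c = ?cl d" unfolding d_def by (rule someI[of _ c]) (use c in simp)
    then have "u (c - d) = \<zero>\<^bsub>Z\<^esub>" using uN tensor_class_eq_iff[OF Y] by blast
    then have "u c = u d" using d c uc by (simp add: ud Z.minus_eq_zero_iff)
    moreover have "h (?cl c) = u d" using c by (simp add: h_def d_def tensor_carrier[OF Y])
    ultimately show ?thesis by simp
  qed
  show ?thesis
  proof (intro exI conjI ballI)
    show "h \<in> carrier (tensor M B Y) \<rightarrow>\<^sub>E carrier Z"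
    proof (rule PiE_I)
      fix t assume "t \<in> carrier (tensor M B Y)"
      then obtain c where "Poly_Mapping.keys c \<subseteq> ?S" "t = ?cl c" by (auto simp: tensor_carrier[OF Y])
      then show "h t \<in> carrier Z" using h uc by simp
    qed (simp add: h_def)
    fix s t assume "s \<in> carrier (tensor M B Y)" "t \<in> carrier (tensor M B Y)"
    then obtain c d where cd: "Poly_Mapping.keys c \<subseteq> ?S" "s = ?cl c" "Poly_Mapping.keys d \<subseteq> ?S" "t = ?cl d"
      by (auto simp: tensor_carrier[OF Y])
    then have "Poly_Mapping.keys (c + d) \<subseteq> ?S" by (auto dest!: subsetD[OF keys_add])
    then show "h (s \<oplus>\<^bsub>tensor M B Y\<^esub> t) = h s \<oplus>\<^bsub>Z\<^esub> h t" using cd by (simp add: tensor_add[OF Y] h ua)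
  next
    fix m y assume "m \<in> carrier M" "y \<in> carrier Y"
    then show "h (pure M B Y m y) = \<beta> m y" by (simp add: pure_def h keys_frag_of up)
  qed
qed

lemma tensor_map_hom:
  fixes Y :: "('b, 'y) module" and Z :: "('b, 'z) module"
  assumes Y: "left_module B Y" and Z: "left_module B Z" and f: "f \<in> mod_hom B Y Z"
  shows "tensor_map M B Y Z f \<in> mod_hom A (tensor M B Y) (tensor M B Z)"
proof -
  let ?h = "frag_extend (\<lambda>(m, y). frag_of (m, f y))" and ?g = "\<lambda>a. frag_extend (\<lambda>(m, y). frag_of (a \<odot>\<^bsub>M\<^esub> m, y))"
  have k: "Poly_Mapping.keys (?h c) \<subseteq> carrier M \<times> carrier Z"
    if "Poly_Mapping.keys c \<subseteq> carrier M \<times> carrier Y" for c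
    using that mod_hom_closed[OF f] by (auto dest!: subsetD[OF keys_frag_extend] simp: keys_frag_of)
  have ka: "Poly_Mapping.keys (?g a c) \<subseteq> carrier M \<times> carrier Y"
    if "a \<in> carrier A" "Poly_Mapping.keys c \<subseteq> carrier M \<times> carrier Y" for a c
    using that by (auto dest!: subsetD[OF keys_frag_extend] simp: keys_frag_of)
  have comm: "?h (?g a c) = ?g a (?h c)" if "Poly_Mapping.keys c \<subseteq> carrier M \<times> carrier Y" for a c
    using that by (rule free_Abelian_group_induct) (auto simp: frag_extend_diff)
  have kadd: "Poly_Mapping.keys (c + d) \<subseteq> carrier M \<times> carrier Y"
    if "Poly_Mapping.keys c \<subseteq> carrier M \<times> carrier Y" "Poly_Mapping.keys d \<subseteq> carrier M \<times> carrier Y" for c d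
    using that by (auto dest!: subsetD[OF keys_add])
  have "restrict (tensor_map M B Y Z f) (carrier (tensor M B Y)) \<in> mod_hom A (tensor M B Y) (tensor M B Z)"
    by (rule mod_homI[OF tensor_left_module[OF Y]])
      (auto simp: tensor_carrier[OF Y] tensor_carrier[OF Z] tensor_add[OF Y] tensor_add[OF Z]
        tensor_smult[OF Y] tensor_smult[OF Z] tensor_map_class[OF Y Z f] k ka kadd comm frag_extend_add)
  then show ?thesis by (simp add: tensor_map_def)
qed

lemma tensor_map_pure:
  fixes Y :: "('b, 'y) module" and Z :: "('b, 'z) module"
  assumes Y: "left_module B Y" and Z: "left_module B Z" and f: "f \<in> mod_hom B Y Z"
    and "m \<in> carrier M" "y \<in> carrier Y"
  shows "tensor_map M B Y Z f (pure M B Y m y) = pure M B Z m (f y)"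
  using assms by (simp add: pure_def tensor_map_class[OF Y Z f] keys_frag_of)

lemma fg_tensor:
  fixes Y :: "('b, 'y) module"
  assumes M: "fg_module A M" and Y: "fg_module B Y"
  shows "fg_module A (tensor M B Y)"
proof -
  note YM = fg_moduleD[OF Y]
  interpret Y: left_module B Y by (rule YM)
  interpret T: left_module A "tensor M B Y" by (rule tensor_left_module[OF YM])
  obtain S where S: "finite S" "S \<subseteq> carrier M" "\<And>H. \<lbrakk>submodule H A M; S \<subseteq> H\<rbrakk> \<Longrightarrow> H = carrier M"
    using fg_moduleE[OF M] by blast
  obtain U where U: "finite U" "U \<subseteq> carrier Y" "\<And>H. \<lbrakk>submodule H B Y; U \<subseteq> H\<rbrakk> \<Longrightarrow> H = carrier Y"
    using fg_moduleE[OF Y] by blast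
  show ?thesis
  proof (rule fg_moduleI[OF T.left_module_axioms, of "(\<lambda>(m, y). pure M B Y m y) ` (S \<times> U)"])
    fix H assume H: "submodule H A (tensor M B Y)" "(\<lambda>(m, y). pure M B Y m y) ` (S \<times> U) \<subseteq> H"
    note HD = submoduleD[OF H(1)]
    have zl: "pure M B Y \<zero>\<^bsub>M\<^esub> y = \<zero>\<^bsub>tensor M B Y\<^esub>" if "y \<in> carrier Y" for y
      using smult_pure[OF YM, of "\<zero>\<^bsub>A\<^esub>" "\<zero>\<^bsub>M\<^esub>" y] that by (simp add: pure_closed[OF YM])
    have zr: "pure M B Y m \<zero>\<^bsub>Y\<^esub> = \<zero>\<^bsub>tensor M B Y\<^esub>" if "m \<in> carrier M" for m
      using pure_add_right[OF YM that, of "\<zero>\<^bsub>Y\<^esub>" "\<zero>\<^bsub>Y\<^esub>"] T.X.add.l_cancel_one'[of "pure M B Y m \<zero>\<^bsub>Y\<^esub>" "pure M B Y m \<zero>\<^bsub>Y\<^esub>"]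
        that by (simp add: pure_closed[OF YM])
    have 1: "pure M B Y m y \<in> H" if m: "m \<in> carrier M" and y: "y \<in> U" for m y
    proof -
      have yY: "y \<in> carrier Y" using y U by blast
      have "submodule {m \<in> carrier M. pure M B Y m y \<in> H} A M"
        by (rule left.submoduleI)
          (use HD yY in \<open>auto simp: zl pure_add_left[OF YM] smult_pure[OF YM, symmetric]\<close>)
      then have "{m \<in> carrier M. pure M B Y m y \<in> H} = carrier M" by (rule S(3)) (use S H y in auto)
      then show ?thesis using m by blast
    qed
    have "submodule {y \<in> carrier Y. \<forall>m \<in> carrier M. pure M B Y m y \<in> H} B Y"
      by (rule Y.submoduleI)
        (use HD in \<open>auto simp: zr pure_add_right[OF YM] pure_balanced[OF YM, symmetric]\<close>)
    then have "{y \<in> carrier Y. \<forall>m \<in> carrier M. pure M B Y m y \<in> H} = carrier Y"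
      by (rule U(3)) (use U 1 in auto)
    then have 2: "pure M B Y m y \<in> H" if "m \<in> carrier M" "y \<in> carrier Y" for m y using that by blast
    show "carrier (tensor M B Y) \<subseteq> H"
    proof
      fix t assume "t \<in> carrier (tensor M B Y)"
      with YM show "t \<in> H" by (induction rule: tensor_induct) (use HD 2 in auto)
    qed
  next
    show "(\<lambda>(m, y). pure M B Y m y) ` (S \<times> U) \<subseteq> carrier (tensor M B Y)"
      using S U by (auto intro!: pure_closed[OF YM])
  qed (use S U in auto)
qed

end

text \<open>
  A bimodule that is projective as a right module, with a chosen dual basis \<open>e\<close>, \<open>\<epsilon>\<close>. The maps
  \<open>m \<otimes> y \<mapsto> \<epsilon> i m y\<close> are coordinates on \<open>M \<otimes> Y\<close>; all exactness properties of the functor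
  \<open>M \<otimes> -\<close> are read off from them.
\<close>

locale dual_basis_bimodule = bimodule A M B
  for A :: "('a, 'k) ring_scheme" and M :: "('a, 'm, 'b) bimodule" and B :: "('b, 'l) ring_scheme" +
  fixes d :: nat and e :: "nat \<Rightarrow> 'm" and \<epsilon> :: "nat \<Rightarrow> 'm \<Rightarrow> 'b"
  assumes e_closed: "i < d \<Longrightarrow> e i \<in> carrier M"
    and \<epsilon>_closed: "\<lbrakk>i < d; m \<in> carrier M\<rbrakk> \<Longrightarrow> \<epsilon> i m \<in> carrier B"
    and \<epsilon>_add: "\<lbrakk>i < d; m \<in> carrier M; m' \<in> carrier M\<rbrakk> \<Longrightarrow> \<epsilon> i (m \<oplus>\<^bsub>M\<^esub> m') = \<epsilon> i m \<oplus>\<^bsub>B\<^esub> \<epsilon> i m'"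
    and \<epsilon>_rsmult: "\<lbrakk>i < d; m \<in> carrier M; b \<in> carrier B\<rbrakk> \<Longrightarrow> \<epsilon> i (m \<odot>\<^sub>r\<^bsub>M\<^esub> b) = \<epsilon> i m \<otimes>\<^bsub>B\<^esub> b"
    and dual_basis_expansion: "m \<in> carrier M \<Longrightarrow> finsum M (\<lambda>i. e i \<odot>\<^sub>r\<^bsub>M\<^esub> \<epsilon> i m) {..<d} = m"
begin

definition coord :: "('b, 'y) module \<Rightarrow> nat \<Rightarrow> (('m \<times> 'y) \<Rightarrow>\<^sub>0 int) set \<Rightarrow> 'y" where
  "coord Y i = (SOME h. h \<in> carrier (tensor M B Y) \<rightarrow>\<^sub>E carrier Y \<and>
    (\<forall>s \<in> carrier (tensor M B Y). \<forall>t \<in> carrier (tensor M B Y). h (s \<oplus>\<^bsub>tensor M B Y\<^esub> t) = h s \<oplus>\<^bsub>Y\<^esub> h t) \<and>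
    (\<forall>m \<in> carrier M. \<forall>y \<in> carrier Y. h (pure M B Y m y) = \<epsilon> i m \<odot>\<^bsub>Y\<^esub> y))"

context
  fixes Y :: "('b, 'y) module"
  assumes Y: "left_module B Y"
begin

interpretation Y: left_module B Y by (rule Y)
interpretation T: left_module A "tensor M B Y" by (rule tensor_left_module[OF Y])

lemma
  assumes "i < d"
  shows coord_closed: "t \<in> carrier (tensor M B Y) \<Longrightarrow> coord Y i t \<in> carrier Y"
    and coord_add: "\<lbrakk>s \<in> carrier (tensor M B Y); t \<in> carrier (tensor M B Y)\<rbrakk> \<Longrightarrow>
      coord Y i (s \<oplus>\<^bsub>tensor M B Y\<^esub> t) = coord Y i s \<oplus>\<^bsub>Y\<^esub> coord Y i t"
    and coord_pure: "\<lbrakk>m \<in> carrier M; y \<in> carrier Y\<rbrakk> \<Longrightarrow> coord Y i (pure M B Y m y) = \<epsilon> i m \<odot>\<^bsub>Y\<^esub> y"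
proof -
  have "\<exists>h. h \<in> carrier (tensor M B Y) \<rightarrow>\<^sub>E carrier Y \<and>
    (\<forall>s \<in> carrier (tensor M B Y). \<forall>t \<in> carrier (tensor M B Y). h (s \<oplus>\<^bsub>tensor M B Y\<^esub> t) = h s \<oplus>\<^bsub>Y\<^esub> h t) \<and>
    (\<forall>m \<in> carrier M. \<forall>y \<in> carrier Y. h (pure M B Y m y) = \<epsilon> i m \<odot>\<^bsub>Y\<^esub> y)"
    by (rule tensor_universal[OF Y Y.X.abelian_group_axioms])
      (use assms in \<open>auto simp: \<epsilon>_closed \<epsilon>_add \<epsilon>_rsmult Y.smult_l_distr Y.smult_r_distr Y.smult_assoc1\<close>)
  from someI_ex[OF this, folded coord_def]
  show "t \<in> carrier (tensor M B Y) \<Longrightarrow> coord Y i t \<in> carrier Y"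
    "\<lbrakk>s \<in> carrier (tensor M B Y); t \<in> carrier (tensor M B Y)\<rbrakk> \<Longrightarrow>
      coord Y i (s \<oplus>\<^bsub>tensor M B Y\<^esub> t) = coord Y i s \<oplus>\<^bsub>Y\<^esub> coord Y i t"
    "\<lbrakk>m \<in> carrier M; y \<in> carrier Y\<rbrakk> \<Longrightarrow> coord Y i (pure M B Y m y) = \<epsilon> i m \<odot>\<^bsub>Y\<^esub> y"
    by auto
qed

lemma coord_zero:
  assumes "i < d" shows "coord Y i \<zero>\<^bsub>tensor M B Y\<^esub> = \<zero>\<^bsub>Y\<^esub>"
  using coord_add[OF assms, of "\<zero>\<^bsub>tensor M B Y\<^esub>" "\<zero>\<^bsub>tensor M B Y\<^esub>"] coord_closed[OF assms, of "\<zero>\<^bsub>tensor M B Y\<^esub>"]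
    Y.X.add.l_cancel_one'[of "coord Y i \<zero>\<^bsub>tensor M B Y\<^esub>" "coord Y i \<zero>\<^bsub>tensor M B Y\<^esub>"] by simp

lemma coord_minus:
  assumes "i < d" "s \<in> carrier (tensor M B Y)" "t \<in> carrier (tensor M B Y)"
  shows "coord Y i (s \<ominus>\<^bsub>tensor M B Y\<^esub> t) = coord Y i s \<ominus>\<^bsub>Y\<^esub> coord Y i t"
proof -
  have "coord Y i s = coord Y i (t \<oplus>\<^bsub>tensor M B Y\<^esub> (s \<ominus>\<^bsub>tensor M B Y\<^esub> t))"
    using assms by (simp add: T.X.add_minus_cancel)
  also have "\<dots> = coord Y i t \<oplus>\<^bsub>Y\<^esub> coord Y i (s \<ominus>\<^bsub>tensor M B Y\<^esub> t)"
    using assms by (intro coord_add) auto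
  finally show ?thesis
    using Y.X.add_minus_cancel(1)[of "coord Y i t" "coord Y i (s \<ominus>\<^bsub>tensor M B Y\<^esub> t)"] assms coord_closed by simp
qed

lemma tensor_expansion:
  assumes "t \<in> carrier (tensor M B Y)"
  shows "finsum (tensor M B Y) (\<lambda>i. pure M B Y (e i) (coord Y i t)) {..<d} = t"
  using Y assms
proof (induction rule: tensor_induct)
  case zero
  have "pure M B Y (e i) \<zero>\<^bsub>Y\<^esub> = \<zero>\<^bsub>tensor M B Y\<^esub>" if "i < d" for i
    using pure_add_right[OF Y, of "e i" "\<zero>\<^bsub>Y\<^esub>" "\<zero>\<^bsub>Y\<^esub>"] e_closed[OF that] pure_closed[OF Y]
      T.X.add.l_cancel_one'[of "pure M B Y (e i) \<zero>\<^bsub>Y\<^esub>" "pure M B Y (e i) \<zero>\<^bsub>Y\<^esub>"] by simp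
  then have "finsum (tensor M B Y) (\<lambda>i. pure M B Y (e i) (coord Y i \<zero>\<^bsub>tensor M B Y\<^esub>)) {..<d}
      = finsum (tensor M B Y) (\<lambda>i. \<zero>\<^bsub>tensor M B Y\<^esub>) {..<d}"
    by (intro T.X.finsum_cong') (auto simp: coord_zero)
  then show ?case by (simp add: T.X.finsum_zero)
next
  case (pure m y)
  have "finsum (tensor M B Y) (\<lambda>i. pure M B Y (e i) (coord Y i (pure M B Y m y))) {..<d}
      = finsum (tensor M B Y) (\<lambda>i. pure M B Y (e i \<odot>\<^sub>r\<^bsub>M\<^esub> \<epsilon> i m) y) {..<d}"
    using pure by (intro T.X.finsum_cong')
      (auto simp: coord_pure pure_balanced[OF Y] e_closed \<epsilon>_closed intro!: pure_closed[OF Y])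
  also have "\<dots> = pure M B Y (finsum M (\<lambda>i. e i \<odot>\<^sub>r\<^bsub>M\<^esub> \<epsilon> i m) {..<d}) y"
    using pure by (intro additive_map_finsum[symmetric] left.X.abelian_group_axioms T.X.abelian_group_axioms)
      (auto simp: pure_add_left[OF Y] e_closed \<epsilon>_closed intro!: pure_closed[OF Y])
  also have "\<dots> = pure M B Y m y" using pure by (simp add: dual_basis_expansion)
  finally show ?case .
next
  case (minus s t)
  have pm: "pure M B Y (e i) (y \<ominus>\<^bsub>Y\<^esub> z) \<oplus>\<^bsub>tensor M B Y\<^esub> pure M B Y (e i) z = pure M B Y (e i) y"
    if "i < d" "y \<in> carrier Y" "z \<in> carrier Y" for i y z
    using that pure_add_right[OF Y, of "e i" "y \<ominus>\<^bsub>Y\<^esub> z" z] by (simp add: e_closed Y.X.add_minus_cancel)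
  let ?E = "\<lambda>t. finsum (tensor M B Y) (\<lambda>i. pure M B Y (e i) (coord Y i t)) {..<d}"
  have cl: "(\<lambda>i. pure M B Y (e i) (coord Y i u)) \<in> {..<d} \<rightarrow> carrier (tensor M B Y)"
    if "u \<in> carrier (tensor M B Y)" for u
    using that by (auto intro!: pure_closed[OF Y] e_closed coord_closed)
  have st: "s \<ominus>\<^bsub>tensor M B Y\<^esub> t \<in> carrier (tensor M B Y)" using minus by simp
  have "?E (s \<ominus>\<^bsub>tensor M B Y\<^esub> t) \<oplus>\<^bsub>tensor M B Y\<^esub> ?E t
      = finsum (tensor M B Y) (\<lambda>i. pure M B Y (e i) (coord Y i (s \<ominus>\<^bsub>tensor M B Y\<^esub> t)) \<oplus>\<^bsub>tensor M B Y\<^esub>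
          pure M B Y (e i) (coord Y i t)) {..<d}"
    by (rule T.X.finsum_addf[symmetric]) (use cl minus st in auto)
  also have "\<dots> = ?E s"
    using cl[OF minus(1)] minus by (intro T.X.finsum_cong') (auto simp: coord_minus pm coord_closed)
  finally have "?E (s \<ominus>\<^bsub>tensor M B Y\<^esub> t) \<oplus>\<^bsub>tensor M B Y\<^esub> t = s" using minus by simp
  moreover have "?E (s \<ominus>\<^bsub>tensor M B Y\<^esub> t) \<in> carrier (tensor M B Y)" using cl[OF st] by simp
  ultimately show ?case
    using T.X.add_minus_cancel(1)[of t "?E (s \<ominus>\<^bsub>tensor M B Y\<^esub> t)"] minus by (simp add: T.X.a_comm)
qed

lemma tensor_eqI:
  assumes "s \<in> carrier (tensor M B Y)" "t \<in> carrier (tensor M B Y)" "\<And>i. i < d \<Longrightarrow> coord Y i s = coord Y i t"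
  shows "s = t"
proof -
  have "finsum (tensor M B Y) (\<lambda>i. pure M B Y (e i) (coord Y i s)) {..<d}
      = finsum (tensor M B Y) (\<lambda>i. pure M B Y (e i) (coord Y i t)) {..<d}"
    by (intro T.X.finsum_cong') (auto simp: assms intro!: pure_closed[OF Y] e_closed coord_closed)
  then show ?thesis using tensor_expansion assms by simp
qed

lemma tensor_zeroI:
  assumes "t \<in> carrier (tensor M B Y)" "\<And>i. i < d \<Longrightarrow> coord Y i t = \<zero>\<^bsub>Y\<^esub>"
  shows "t = \<zero>\<^bsub>tensor M B Y\<^esub>"
  using assms by (intro tensor_eqI) (auto simp: coord_zero)

end

context
  fixes Y :: "('b, 'y) module" and Z :: "('b, 'z) module" and f
  assumes Y: "left_module B Y" and Z: "left_module B Z" and f: "f \<in> mod_hom B Y Z"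
begin

interpretation Y: left_module B Y by (rule Y)
interpretation Z: left_module B Z by (rule Z)
interpretation TY: left_module A "tensor M B Y" by (rule tensor_left_module[OF Y])
interpretation TZ: left_module A "tensor M B Z" by (rule tensor_left_module[OF Z])

lemma coord_tensor_map:
  assumes "i < d" "t \<in> carrier (tensor M B Y)"
  shows "coord Z i (tensor_map M B Y Z f t) = f (coord Y i t)"
  using Y assms(2)
proof (induction rule: tensor_induct)
  case zero
  show ?case using assms(1) mod_hom_zero[OF TY.left_module_axioms TZ.left_module_axioms tensor_map_hom[OF Y Z f]]
      mod_hom_zero[OF Y Z f] by (simp add: coord_zero[OF Y] coord_zero[OF Z])
next
  case (pure m y)
  then show ?case using assms(1) f
    by (simp add: tensor_map_pure[OF Y Z f] coord_pure[OF Y] coord_pure[OF Z] \<epsilon>_closed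
        mod_hom_closed[OF f] mod_hom_smult[OF f])
next
  case (minus s t)
  then show ?case using assms(1) mod_hom_closed[OF tensor_map_hom[OF Y Z f]]
    by (simp add: mod_hom_minus[OF TY.left_module_axioms TZ.left_module_axioms tensor_map_hom[OF Y Z f]]
        coord_minus[OF Y] coord_minus[OF Z] mod_hom_minus[OF Y Z f] coord_closed[OF Y])
qed

lemma tensor_map_lift:
  assumes t: "t \<in> carrier (tensor M B Z)" "\<And>i. i < d \<Longrightarrow> coord Z i t \<in> f ` carrier Y"
  shows "\<exists>s \<in> carrier (tensor M B Y). tensor_map M B Y Z f s = t"
proof -
  have "\<forall>i. \<exists>y. i < d \<longrightarrow> y \<in> carrier Y \<and> f y = coord Z i t" using t(2) by (metis imageE)
  then obtain y where y: "\<forall>i < d. y i \<in> carrier Y \<and> f (y i) = coord Z i t" by metis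
  let ?s = "finsum (tensor M B Y) (\<lambda>i. pure M B Y (e i) (y i)) {..<d}"
  have cl: "(\<lambda>i. pure M B Y (e i) (y i)) \<in> {..<d} \<rightarrow> carrier (tensor M B Y)"
    using y by (auto intro!: pure_closed[OF Y] e_closed)
  have "tensor_map M B Y Z f ?s = finsum (tensor M B Z) (\<lambda>i. tensor_map M B Y Z f (pure M B Y (e i) (y i))) {..<d}"
    using cl by (intro mod_hom_finsum[OF TY.left_module_axioms TZ.left_module_axioms tensor_map_hom[OF Y Z f]]) auto
  also have "\<dots> = finsum (tensor M B Z) (\<lambda>i. pure M B Z (e i) (coord Z i t)) {..<d}"
    using y t(1) by (intro TZ.X.finsum_cong')
      (auto simp: tensor_map_pure[OF Y Z f] e_closed intro!: pure_closed[OF Z] coord_closed[OF Z])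
  also have "\<dots> = t" by (rule tensor_expansion[OF Z t(1)])
  finally show ?thesis using cl by (intro bexI[of _ ?s]) auto
qed

lemma tensor_map_surj:
  assumes "f ` carrier Y = carrier Z" "t \<in> carrier (tensor M B Z)"
  shows "\<exists>s \<in> carrier (tensor M B Y). tensor_map M B Y Z f s = t"
  by (rule tensor_map_lift[OF assms(2)]) (use assms coord_closed[OF Z] in auto)

lemma tensor_map_inj:
  assumes "inj_on f (carrier Y)" "t \<in> carrier (tensor M B Y)" "tensor_map M B Y Z f t = \<zero>\<^bsub>tensor M B Z\<^esub>"
  shows "t = \<zero>\<^bsub>tensor M B Y\<^esub>"
proof (rule tensor_zeroI[OF Y assms(2)])
  fix i assume i: "i < d"
  have "f (coord Y i t) = \<zero>\<^bsub>Z\<^esub>" using coord_tensor_map[OF i assms(2)] assms(3) coord_zero[OF Z i] by simp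
  then show "coord Y i t = \<zero>\<^bsub>Y\<^esub>"
    using assms(1) mod_hom_inj_iff[OF Y Z f] coord_closed[OF Y i assms(2)] by blast
qed

end

lemma tensor_map_comp:
  fixes X :: "('b, 'x) module" and Y :: "('b, 'y) module" and Z :: "('b, 'z) module"
  assumes mods: "left_module B X" "left_module B Y" "left_module B Z"
    and homs: "f \<in> mod_hom B X Y" "g \<in> mod_hom B Y Z" "h \<in> mod_hom B X Z"
    and gf: "\<And>x. x \<in> carrier X \<Longrightarrow> g (f x) = h x" and t: "t \<in> carrier (tensor M B X)"
  shows "tensor_map M B Y Z g (tensor_map M B X Y f t) = tensor_map M B X Z h t"
proof (rule tensor_eqI[OF mods(3)])
  have ft: "tensor_map M B X Y f t \<in> carrier (tensor M B Y)"
    using mod_hom_closed[OF tensor_map_hom[OF mods(1,2) homs(1)] t] .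
  show "tensor_map M B Y Z g (tensor_map M B X Y f t) \<in> carrier (tensor M B Z)"
    using mod_hom_closed[OF tensor_map_hom[OF mods(2,3) homs(2)] ft] .
  show "tensor_map M B X Z h t \<in> carrier (tensor M B Z)"
    using mod_hom_closed[OF tensor_map_hom[OF mods(1,3) homs(3)] t] .
  fix i assume "i < d"
  then show "coord Z i (tensor_map M B Y Z g (tensor_map M B X Y f t)) = coord Z i (tensor_map M B X Z h t)"
    using t ft coord_closed[OF mods(1)] gf
    by (simp add: coord_tensor_map[OF mods(2,3) homs(2)] coord_tensor_map[OF mods(1,2) homs(1)]
        coord_tensor_map[OF mods(1,3) homs(3)])
qed

lemma tensor_map_ident:
  fixes X :: "('b, 'x) module"
  assumes X: "left_module B X" and f: "f \<in> mod_hom B X X" "\<And>x. x \<in> carrier X \<Longrightarrow> f x = x"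
    and t: "t \<in> carrier (tensor M B X)"
  shows "tensor_map M B X X f t = t"
  using mod_hom_closed[OF tensor_map_hom[OF X X f(1)] t] t
  by (intro tensor_eqI[OF X]) (auto simp: coord_tensor_map[OF X X f(1)] f(2) coord_closed[OF X])

lemma tensor_map_zero:
  fixes X :: "('b, 'x) module" and Y :: "('b, 'y) module"
  assumes X: "left_module B X" and Y: "left_module B Y" and f: "f \<in> mod_hom B X Y" "\<And>x. x \<in> carrier X \<Longrightarrow> f x = \<zero>\<^bsub>Y\<^esub>"
    and t: "t \<in> carrier (tensor M B X)"
  shows "tensor_map M B X Y f t = \<zero>\<^bsub>tensor M B Y\<^esub>"
  using mod_hom_closed[OF tensor_map_hom[OF X Y f(1)] t] t
  by (intro tensor_zeroI[OF Y]) (auto simp: coord_tensor_map[OF X Y f(1)] f(2) coord_closed[OF X])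

lemma tensor_map_plus:
  fixes X :: "('b, 'x) module" and Y :: "('b, 'y) module"
  assumes X: "left_module B X" and Y: "left_module B Y"
    and homs: "f \<in> mod_hom B X Y" "g \<in> mod_hom B X Y" "h \<in> mod_hom B X Y"
    and h: "\<And>x. x \<in> carrier X \<Longrightarrow> h x = f x \<oplus>\<^bsub>Y\<^esub> g x" and t: "t \<in> carrier (tensor M B X)"
  shows "tensor_map M B X Y h t = tensor_map M B X Y f t \<oplus>\<^bsub>tensor M B Y\<^esub> tensor_map M B X Y g t"
proof (rule tensor_eqI[OF Y])
  interpret TY: left_module A "tensor M B Y" by (rule tensor_left_module[OF Y])
  note cl = homs[THEN tensor_map_hom[OF X Y], THEN mod_hom_closed, OF t]
  show "tensor_map M B X Y h t \<in> carrier (tensor M B Y)" by (rule cl)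
  show "tensor_map M B X Y f t \<oplus>\<^bsub>tensor M B Y\<^esub> tensor_map M B X Y g t \<in> carrier (tensor M B Y)"
    using cl by simp
  fix i assume "i < d"
  then show "coord Y i (tensor_map M B X Y h t)
      = coord Y i (tensor_map M B X Y f t \<oplus>\<^bsub>tensor M B Y\<^esub> tensor_map M B X Y g t)"
    using t cl by (simp add: coord_add[OF Y] homs[THEN coord_tensor_map[OF X Y]] h coord_closed[OF X])
qed

lemma tensor_map_cancel:
  fixes X :: "('b, 'x) module" and Y :: "('b, 'y) module"
  assumes "left_module B X" "left_module B Y" "f \<in> mod_hom B X Y" "g \<in> mod_hom B Y X"
    "\<And>x. x \<in> carrier X \<Longrightarrow> g (f x) = x" "t \<in> carrier (tensor M B X)"
  shows "tensor_map M B Y X g (tensor_map M B X Y f t) = t"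
  using tensor_map_comp[OF assms(1,2,1,3,4) mod_hom_id[OF assms(1)] _ assms(6)] assms(5,6)
    tensor_map_ident[OF assms(1) mod_hom_id[OF assms(1)] _ assms(6)] by simp

lemma tensor_map_kill:
  fixes X :: "('b, 'x) module" and Y :: "('b, 'y) module" and Z :: "('b, 'z) module"
  assumes "left_module B X" "left_module B Y" "left_module B Z" "f \<in> mod_hom B X Y" "g \<in> mod_hom B Y Z"
    "\<And>x. x \<in> carrier X \<Longrightarrow> g (f x) = \<zero>\<^bsub>Z\<^esub>" "t \<in> carrier (tensor M B X)"
  shows "tensor_map M B Y Z g (tensor_map M B X Y f t) = \<zero>\<^bsub>tensor M B Z\<^esub>"
  using tensor_map_comp[OF assms(1-5) mod_hom_const_zero[OF assms(1,3)] _ assms(7)] assms(6,7)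
    tensor_map_zero[OF assms(1,3) mod_hom_const_zero[OF assms(1,3)] _ assms(7)] by simp

end

section \<open>Additive and exact categories\<close>

context preadditive_category
begin

lemma comp_one_left:
  assumes "X \<in> Ob" "Y \<in> Ob" "Z \<in> Ob" "f \<in> carrier (Hom X Y)"
  shows "Comp X Y Z \<one>\<^bsub>Hom Y Z\<^esub> f = \<one>\<^bsub>Hom X Z\<^esub>"
proof -
  interpret YZ: comm_group "Hom Y Z" by (rule hom_group) (use assms in auto)
  interpret XZ: comm_group "Hom X Z" by (rule hom_group) (use assms in auto)
  show ?thesis
    using comp_add_left[OF assms YZ.one_closed YZ.one_closed] comp_closed[OF assms YZ.one_closed]
      XZ.l_cancel_one'[of "Comp X Y Z \<one>\<^bsub>Hom Y Z\<^esub> f" "Comp X Y Z \<one>\<^bsub>Hom Y Z\<^esub> f"] by simp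
qed

lemma comp_one_right:
  assumes "X \<in> Ob" "Y \<in> Ob" "Z \<in> Ob" "g \<in> carrier (Hom Y Z)"
  shows "Comp X Y Z g \<one>\<^bsub>Hom X Y\<^esub> = \<one>\<^bsub>Hom X Z\<^esub>"
proof -
  interpret XY: comm_group "Hom X Y" by (rule hom_group) (use assms in auto)
  interpret XZ: comm_group "Hom X Z" by (rule hom_group) (use assms in auto)
  show ?thesis
    using comp_add_right[OF assms(1-3) XY.one_closed XY.one_closed assms(4)]
      comp_closed[OF assms(1-3) XY.one_closed assms(4)]
      XZ.l_cancel_one'[of "Comp X Y Z g \<one>\<^bsub>Hom X Y\<^esub>" "Comp X Y Z g \<one>\<^bsub>Hom X Y\<^esub>"] by simp
qed

lemma comp_inv_right:
  assumes "X \<in> Ob" "Y \<in> Ob" "Z \<in> Ob" "f \<in> carrier (Hom X Y)" "g \<in> carrier (Hom Y Z)"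
  shows "Comp X Y Z g (inv\<^bsub>Hom X Y\<^esub> f) = inv\<^bsub>Hom X Z\<^esub> (Comp X Y Z g f)"
proof -
  interpret XY: comm_group "Hom X Y" by (rule hom_group) (use assms in auto)
  interpret XZ: comm_group "Hom X Z" by (rule hom_group) (use assms in auto)
  have "Comp X Y Z g (inv\<^bsub>Hom X Y\<^esub> f \<otimes>\<^bsub>Hom X Y\<^esub> f) = \<one>\<^bsub>Hom X Z\<^esub>"
    using assms by (simp add: comp_one_right)
  then have "Comp X Y Z g (inv\<^bsub>Hom X Y\<^esub> f) \<otimes>\<^bsub>Hom X Z\<^esub> Comp X Y Z g f = \<one>\<^bsub>Hom X Z\<^esub>"
    using comp_add_right[OF assms(1-3) _ assms(4,5), of "inv\<^bsub>Hom X Y\<^esub> f"] assms(4) by simp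
  then show ?thesis using assms comp_closed[OF assms(1-3)] by (simp add: XZ.inv_equality)
qed

lemma comp_inv_left:
  assumes "X \<in> Ob" "Y \<in> Ob" "Z \<in> Ob" "f \<in> carrier (Hom X Y)" "g \<in> carrier (Hom Y Z)"
  shows "Comp X Y Z (inv\<^bsub>Hom Y Z\<^esub> g) f = inv\<^bsub>Hom X Z\<^esub> (Comp X Y Z g f)"
proof -
  interpret YZ: comm_group "Hom Y Z" by (rule hom_group) (use assms in auto)
  interpret XZ: comm_group "Hom X Z" by (rule hom_group) (use assms in auto)
  have "Comp X Y Z (inv\<^bsub>Hom Y Z\<^esub> g \<otimes>\<^bsub>Hom Y Z\<^esub> g) f = \<one>\<^bsub>Hom X Z\<^esub>"
    using assms by (simp add: comp_one_left)
  then have "Comp X Y Z (inv\<^bsub>Hom Y Z\<^esub> g) f \<otimes>\<^bsub>Hom X Z\<^esub> Comp X Y Z g f = \<one>\<^bsub>Hom X Z\<^esub>"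
    using comp_add_left[OF assms(1-4) _ assms(5), of "inv\<^bsub>Hom Y Z\<^esub> g"] assms(5) by simp
  then show ?thesis using assms comp_closed[OF assms(1-3)] by (simp add: XZ.inv_equality)
qed

definition is_biproduct :: "'o \<Rightarrow> 'o \<Rightarrow> 'o \<Rightarrow> 'f \<Rightarrow> 'f \<Rightarrow> 'f \<Rightarrow> 'f \<Rightarrow> bool" where
  "is_biproduct X Y P i j p q \<longleftrightarrow> X \<in> Ob \<and> Y \<in> Ob \<and> P \<in> Ob \<and>
     i \<in> carrier (Hom X P) \<and> j \<in> carrier (Hom Y P) \<and> p \<in> carrier (Hom P X) \<and> q \<in> carrier (Hom P Y) \<and>
     Comp X P X p i = Id X \<and> Comp Y P Y q j = Id Y \<and>
     Comp X P Y q i = \<one>\<^bsub>Hom X Y\<^esub> \<and> Comp Y P X p j = \<one>\<^bsub>Hom Y X\<^esub> \<and>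
     Comp P X P i p \<otimes>\<^bsub>Hom P P\<^esub> Comp P Y P j q = Id P"

lemma biproduct_copair:
  assumes P: "is_biproduct X Y P i j p q" and W: "W \<in> Ob"
    and v: "v \<in> carrier (Hom X W)" and w: "w \<in> carrier (Hom Y W)"
  defines "g \<equiv> Comp P X W v p \<otimes>\<^bsub>Hom P W\<^esub> Comp P Y W w q"
  shows "g \<in> carrier (Hom P W)" "Comp X P W g i = v" "Comp Y P W g j = w"
    and "\<And>h. \<lbrakk>h \<in> carrier (Hom P W); Comp X P W h i = v; Comp Y P W h j = w\<rbrakk> \<Longrightarrow> h = g"
proof -
  have O: "X \<in> Ob" "Y \<in> Ob" "P \<in> Ob" and H: "i \<in> carrier (Hom X P)" "j \<in> carrier (Hom Y P)"
    "p \<in> carrier (Hom P X)" "q \<in> carrier (Hom P Y)"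
    and E: "Comp X P X p i = Id X" "Comp Y P Y q j = Id Y" "Comp X P Y q i = \<one>\<^bsub>Hom X Y\<^esub>"
    "Comp Y P X p j = \<one>\<^bsub>Hom Y X\<^esub>" "Comp P X P i p \<otimes>\<^bsub>Hom P P\<^esub> Comp P Y P j q = Id P"
    using P by (auto simp: is_biproduct_def)
  interpret PW: comm_group "Hom P W" by (rule hom_group) (use O W in auto)
  interpret XW: comm_group "Hom X W" by (rule hom_group) (use O W in auto)
  interpret YW: comm_group "Hom Y W" by (rule hom_group) (use O W in auto)
  have vp: "Comp P X W v p \<in> carrier (Hom P W)" using O W H v by (intro comp_closed)
  have wq: "Comp P Y W w q \<in> carrier (Hom P W)" using O W H w by (intro comp_closed)
  show g: "g \<in> carrier (Hom P W)" using vp wq by (simp add: g_def)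
  show "Comp X P W g i = v"
    using O W H E v w vp wq by (simp add: g_def comp_add_left comp_assoc[symmetric] comp_id_right comp_one_right)
  show "Comp Y P W g j = w"
    using O W H E v w vp wq by (simp add: g_def comp_add_left comp_assoc[symmetric] comp_id_right comp_one_right)
  fix h assume h: "h \<in> carrier (Hom P W)" "Comp X P W h i = v" "Comp Y P W h j = w"
  have "h = Comp P P W h (Comp P X P i p \<otimes>\<^bsub>Hom P P\<^esub> Comp P Y P j q)"
    using h O W by (simp add: E comp_id_right)
  also have "\<dots> = Comp P P W h (Comp P X P i p) \<otimes>\<^bsub>Hom P W\<^esub> Comp P P W h (Comp P Y P j q)"
    using O W H h by (intro comp_add_right comp_closed)
  also have "\<dots> = g" using O W H h by (simp add: g_def comp_assoc)
  finally show "h = g" .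
qed

lemma biproduct_pair:
  assumes P: "is_biproduct X Y P i j p q" and W: "W \<in> Ob"
    and v: "v \<in> carrier (Hom W X)" and w: "w \<in> carrier (Hom W Y)"
  defines "g \<equiv> Comp W X P i v \<otimes>\<^bsub>Hom W P\<^esub> Comp W Y P j w"
  shows "g \<in> carrier (Hom W P)" "Comp W P X p g = v" "Comp W P Y q g = w"
    and "\<And>h. \<lbrakk>h \<in> carrier (Hom W P); Comp W P X p h = v; Comp W P Y q h = w\<rbrakk> \<Longrightarrow> h = g"
proof -
  have O: "X \<in> Ob" "Y \<in> Ob" "P \<in> Ob" and H: "i \<in> carrier (Hom X P)" "j \<in> carrier (Hom Y P)"
    "p \<in> carrier (Hom P X)" "q \<in> carrier (Hom P Y)"
    and E: "Comp X P X p i = Id X" "Comp Y P Y q j = Id Y" "Comp X P Y q i = \<one>\<^bsub>Hom X Y\<^esub>"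
    "Comp Y P X p j = \<one>\<^bsub>Hom Y X\<^esub>" "Comp P X P i p \<otimes>\<^bsub>Hom P P\<^esub> Comp P Y P j q = Id P"
    using P by (auto simp: is_biproduct_def)
  interpret WP: comm_group "Hom W P" by (rule hom_group) (use O W in auto)
  interpret WX: comm_group "Hom W X" by (rule hom_group) (use O W in auto)
  interpret WY: comm_group "Hom W Y" by (rule hom_group) (use O W in auto)
  have iv: "Comp W X P i v \<in> carrier (Hom W P)" using O W H v by (intro comp_closed)
  have jw: "Comp W Y P j w \<in> carrier (Hom W P)" using O W H w by (intro comp_closed)
  show g: "g \<in> carrier (Hom W P)" using iv jw by (simp add: g_def)
  show "Comp W P X p g = v"
    using O W H E v w iv jw by (simp add: g_def comp_add_right comp_assoc comp_id_left comp_one_left)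
  show "Comp W P Y q g = w"
    using O W H E v w iv jw by (simp add: g_def comp_add_right comp_assoc comp_id_left comp_one_left)
  fix h assume h: "h \<in> carrier (Hom W P)" "Comp W P X p h = v" "Comp W P Y q h = w"
  have "h = Comp W P P (Comp P X P i p \<otimes>\<^bsub>Hom P P\<^esub> Comp P Y P j q) h"
    using h O W by (simp add: E comp_id_left)
  also have "\<dots> = Comp W P P (Comp P X P i p) h \<otimes>\<^bsub>Hom W P\<^esub> Comp W P P (Comp P Y P j q) h"
    using O W H h by (intro comp_add_left comp_closed)
  also have "\<dots> = g" using O W H h by (simp add: g_def comp_assoc[symmetric])
  finally show "h = g" .
qed

lemma pushout_of_cokernel:
  assumes P: "is_biproduct Y X' P iY iX pY pX" and O: "X \<in> Ob" "Q \<in> Ob"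
    and i: "i \<in> carrier (Hom X Y)" and f: "f \<in> carrier (Hom X X')" and c: "c \<in> carrier (Hom P Q)"
    and coker: "is_cokernel X (Comp X Y P iY i \<otimes>\<^bsub>Hom X P\<^esub> inv\<^bsub>Hom X P\<^esub> Comp X X' P iX f) P c Q"
  shows "is_pushout X Y X' Q i f (Comp Y P Q c iY) (Comp X' P Q c iX)"
proof -
  have O: "X \<in> Ob" "Y \<in> Ob" "X' \<in> Ob" "P \<in> Ob" "Q \<in> Ob" and H: "iY \<in> carrier (Hom Y P)" "iX \<in> carrier (Hom X' P)"
    using P O by (auto simp: is_biproduct_def)
  interpret XP: comm_group "Hom X P" by (rule hom_group) (use O in auto)
  let ?a = "Comp X Y P iY i" and ?b = "Comp X X' P iX f"
  let ?d = "?a \<otimes>\<^bsub>Hom X P\<^esub> inv\<^bsub>Hom X P\<^esub> ?b"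
  have ab: "?a \<in> carrier (Hom X P)" "?b \<in> carrier (Hom X P)" using O H i f by (intro comp_closed; simp)+
  have kill: "Comp X P W g ?d = \<one>\<^bsub>Hom X W\<^esub> \<longleftrightarrow> Comp X Y W (Comp Y P W g iY) i = Comp X X' W (Comp X' P W g iX) f"
    if "W \<in> Ob" "g \<in> carrier (Hom P W)" for W g
  proof -
    interpret XW: comm_group "Hom X W" by (rule hom_group) (use O that in auto)
    have "Comp X P W g ?d = Comp X P W g ?a \<otimes>\<^bsub>Hom X W\<^esub> inv\<^bsub>Hom X W\<^esub> (Comp X P W g ?b)"
      using O ab that by (simp add: comp_add_right comp_inv_right)
    moreover have "Comp X P W g ?a \<in> carrier (Hom X W)" "Comp X P W g ?b \<in> carrier (Hom X W)"
      using comp_closed[OF O(1,4) that(1) ab(1) that(2)] comp_closed[OF O(1,4) that(1) ab(2) that(2)] by auto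
    ultimately have "Comp X P W g ?d = \<one>\<^bsub>Hom X W\<^esub> \<longleftrightarrow> Comp X P W g ?a = Comp X P W g ?b"
      by (metis XW.inv_closed XW.inv_equality XW.inv_inv XW.r_inv)
    then show ?thesis using O H i f that by (simp add: comp_assoc)
  qed
  show ?thesis
    unfolding is_pushout_def
  proof (intro conjI ballI impI)
    show "Comp Y P Q c iY \<in> carrier (Hom Y Q)" "Comp X' P Q c iX \<in> carrier (Hom X' Q)"
      using O H c by (intro comp_closed; simp)+
    show "Comp X Y Q (Comp Y P Q c iY) i = Comp X X' Q (Comp X' P Q c iX) f"
      using kill[OF O(5) c] coker by (simp add: is_cokernel_def)
    fix W v w assume W: "W \<in> Ob" and v: "v \<in> carrier (Hom Y W)" and w: "w \<in> carrier (Hom X' W)"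
      and vw: "Comp X Y W v i = Comp X X' W w f"
    define g where "g = Comp P Y W v pY \<otimes>\<^bsub>Hom P W\<^esub> Comp P X' W w pX"
    note g = biproduct_copair[OF P W v w, folded g_def]
    have "Comp X P W g ?d = \<one>\<^bsub>Hom X W\<^esub>" using kill[OF W g(1)] g(2,3) vw by simp
    then have ex: "\<exists>!h. h \<in> carrier (Hom Q W) \<and> Comp P Q W h c = g"
      using coker W g(1) by (simp add: is_cokernel_def)
    have eq: "(Comp Y Q W h (Comp Y P Q c iY) = v \<and> Comp X' Q W h (Comp X' P Q c iX) = w) \<longleftrightarrow> Comp P Q W h c = g"
      if h: "h \<in> carrier (Hom Q W)" for h
    proof -
      have hc: "Comp P Q W h c \<in> carrier (Hom P W)" using O W c h by (intro comp_closed)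
      have "Comp Y Q W h (Comp Y P Q c iY) = Comp Y P W (Comp P Q W h c) iY"
        "Comp X' Q W h (Comp X' P Q c iX) = Comp X' P W (Comp P Q W h c) iX"
        using O W H c h by (simp_all add: comp_assoc)
      then show ?thesis using g(2,3) g(4)[OF hc] by auto
    qed
    show "\<exists>!h. h \<in> carrier (Hom Q W) \<and> Comp Y Q W h (Comp Y P Q c iY) = v \<and> Comp X' Q W h (Comp X' P Q c iX) = w"
      using ex eq by (metis (no_types, lifting))
  qed
qed

lemma pullback_of_kernel:
  assumes P: "is_biproduct Y Z' P iY iZ pY pZ" and O: "Z \<in> Ob" "Q \<in> Ob"
    and p: "p \<in> carrier (Hom Y Z)" and f: "f \<in> carrier (Hom Z' Z)" and k: "k \<in> carrier (Hom Q P)"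
    and ker: "is_kernel Q k P (Comp P Y Z p pY \<otimes>\<^bsub>Hom P Z\<^esub> inv\<^bsub>Hom P Z\<^esub> Comp P Z' Z f pZ) Z"
  shows "is_pullback Y Z Z' Q p f (Comp Q P Y pY k) (Comp Q P Z' pZ k)"
proof -
  have O: "Z \<in> Ob" "Y \<in> Ob" "Z' \<in> Ob" "P \<in> Ob" "Q \<in> Ob" and H: "pY \<in> carrier (Hom P Y)" "pZ \<in> carrier (Hom P Z')"
    using P O by (auto simp: is_biproduct_def)
  interpret PZ: comm_group "Hom P Z" by (rule hom_group) (use O in auto)
  let ?a = "Comp P Y Z p pY" and ?b = "Comp P Z' Z f pZ"
  let ?d = "?a \<otimes>\<^bsub>Hom P Z\<^esub> inv\<^bsub>Hom P Z\<^esub> ?b"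
  have ab: "?a \<in> carrier (Hom P Z)" "?b \<in> carrier (Hom P Z)" using O H p f by (intro comp_closed; simp)+
  have kill: "Comp W P Z ?d g = \<one>\<^bsub>Hom W Z\<^esub> \<longleftrightarrow> Comp W Y Z p (Comp W P Y pY g) = Comp W Z' Z f (Comp W P Z' pZ g)"
    if "W \<in> Ob" "g \<in> carrier (Hom W P)" for W g
  proof -
    interpret WZ: comm_group "Hom W Z" by (rule hom_group) (use O that in auto)
    have "Comp W P Z ?d g = Comp W P Z ?a g \<otimes>\<^bsub>Hom W Z\<^esub> inv\<^bsub>Hom W Z\<^esub> (Comp W P Z ?b g)"
      using O ab that by (simp add: comp_add_left comp_inv_left)
    moreover have "Comp W P Z ?a g \<in> carrier (Hom W Z)" "Comp W P Z ?b g \<in> carrier (Hom W Z)"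
      using comp_closed[OF that(1) O(4,1) that(2) ab(1)] comp_closed[OF that(1) O(4,1) that(2) ab(2)] by auto
    ultimately have "Comp W P Z ?d g = \<one>\<^bsub>Hom W Z\<^esub> \<longleftrightarrow> Comp W P Z ?a g = Comp W P Z ?b g"
      by (metis WZ.inv_closed WZ.inv_equality WZ.inv_inv WZ.r_inv)
    then show ?thesis using O H p f that by (simp add: comp_assoc)
  qed
  show ?thesis
    unfolding is_pullback_def
  proof (intro conjI ballI impI)
    show "Comp Q P Y pY k \<in> carrier (Hom Q Y)" "Comp Q P Z' pZ k \<in> carrier (Hom Q Z')"
      using O H k by (intro comp_closed; simp)+
    show "Comp Q Y Z p (Comp Q P Y pY k) = Comp Q Z' Z f (Comp Q P Z' pZ k)"
      using kill[OF O(5) k] ker by (simp add: is_kernel_def)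
    fix W v w assume W: "W \<in> Ob" and v: "v \<in> carrier (Hom W Y)" and w: "w \<in> carrier (Hom W Z')"
      and vw: "Comp W Y Z p v = Comp W Z' Z f w"
    define g where "g = Comp W Y P iY v \<otimes>\<^bsub>Hom W P\<^esub> Comp W Z' P iZ w"
    note g = biproduct_pair[OF P W v w, folded g_def]
    have "Comp W P Z ?d g = \<one>\<^bsub>Hom W Z\<^esub>" using kill[OF W g(1)] g(2,3) vw by simp
    then have ex: "\<exists>!h. h \<in> carrier (Hom W Q) \<and> Comp W Q P k h = g"
      using ker W g(1) by (simp add: is_kernel_def)
    have eq: "(Comp W Q Y (Comp Q P Y pY k) h = v \<and> Comp W Q Z' (Comp Q P Z' pZ k) h = w) \<longleftrightarrow> Comp W Q P k h = g"
      if h: "h \<in> carrier (Hom W Q)" for h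
    proof -
      have kh: "Comp W Q P k h \<in> carrier (Hom W P)" using O W k h by (intro comp_closed)
      have "Comp W Q Y (Comp Q P Y pY k) h = Comp W P Y pY (Comp W Q P k h)"
        "Comp W Q Z' (Comp Q P Z' pZ k) h = Comp W P Z' pZ (Comp W Q P k h)"
        using O W H k h by (simp_all add: comp_assoc)
      then show ?thesis using g(2,3) g(4)[OF kh] by auto
    qed
    show "\<exists>!h. h \<in> carrier (Hom W Q) \<and> Comp W Q Y (Comp Q P Y pY k) h = v \<and> Comp W Q Z' (Comp Q P Z' pZ k) h = w"
      using ex eq by (metis (no_types, lifting))
  qed
qed

end

lemma (in additive_category) ex_biproduct:
  assumes "X \<in> Ob" "Y \<in> Ob"
  shows "\<exists>P i j p q. is_biproduct X Y P i j p q"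
  using biproducts[OF assms] assms unfolding is_biproduct_def by blast

context category_with_conflations
begin

lemma projective_retract:
  assumes Q: "projective_object Q" and P: "P \<in> Ob" and r: "r \<in> carrier (Hom Q P)" and s: "s \<in> carrier (Hom P Q)"
    and rs: "Comp P Q P r s = Id P"
    and defl: "\<And>Y Z p. deflation Y Z p \<Longrightarrow> Y \<in> Ob \<and> Z \<in> Ob \<and> p \<in> carrier (Hom Y Z)"
  shows "projective_object P"
  unfolding projective_object_def
proof (intro conjI allI impI ballI P)
  fix Y Z p h assume p: "deflation Y Z p" and h: "h \<in> carrier (Hom P Z)"
  have O: "Y \<in> Ob" "Z \<in> Ob" "p \<in> carrier (Hom Y Z)" "Q \<in> Ob"
    using defl[OF p] Q by (auto simp: projective_object_def)
  have "Comp Q P Z h r \<in> carrier (Hom Q Z)" using O P h r by (intro comp_closed)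
  then obtain k where k: "k \<in> carrier (Hom Q Y)" "Comp Q Y Z p k = Comp Q P Z h r"
    using Q p unfolding projective_object_def by blast
  have "Comp P Y Z p (Comp P Q Y k s) = Comp P Q Z (Comp Q P Z h r) s"
    using O P s k by (simp add: comp_assoc)
  also have "\<dots> = h" using O P h r s rs by (simp add: comp_assoc[symmetric] comp_id_right)
  finally show "\<exists>k \<in> carrier (Hom P Y). Comp P Y Z p k = h"
    using O P s k by (intro bexI[of _ "Comp P Q Y k s"] comp_closed)
qed

lemma injective_retract:
  assumes Q: "injective_object Q" and P: "P \<in> Ob" and r: "r \<in> carrier (Hom Q P)" and s: "s \<in> carrier (Hom P Q)"
    and rs: "Comp P Q P r s = Id P"
    and infl: "\<And>X Y i. inflation X Y i \<Longrightarrow> X \<in> Ob \<and> Y \<in> Ob \<and> i \<in> carrier (Hom X Y)"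
  shows "injective_object P"
  unfolding injective_object_def
proof (intro conjI allI impI ballI P)
  fix X Y i h assume i: "inflation X Y i" and h: "h \<in> carrier (Hom X P)"
  have O: "X \<in> Ob" "Y \<in> Ob" "i \<in> carrier (Hom X Y)" "Q \<in> Ob"
    using infl[OF i] Q by (auto simp: injective_object_def)
  have "Comp X P Q s h \<in> carrier (Hom X Q)" using O P h s by (intro comp_closed)
  then obtain k where k: "k \<in> carrier (Hom Y Q)" "Comp X Y Q k i = Comp X P Q s h"
    using Q i unfolding injective_object_def by blast
  have "Comp X Y P (Comp Y Q P r k) i = Comp X Q P r (Comp X P Q s h)"
    using O P r k by (simp add: comp_assoc[symmetric])
  also have "\<dots> = h" using O P h r s rs by (simp add: comp_assoc comp_id_left)
  finally show "\<exists>k \<in> carrier (Hom Y P). Comp X Y P k i = h"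
    using O P r k by (intro bexI[of _ "Comp Y Q P r k"] comp_closed)
qed

lemma projective_biproduct:
  assumes P: "is_biproduct X Y P i j p q" and X: "projective_object X" and Y: "projective_object Y"
    and defl: "\<And>Y Z p. deflation Y Z p \<Longrightarrow> Y \<in> Ob \<and> Z \<in> Ob \<and> p \<in> carrier (Hom Y Z)"
  shows "projective_object P"
  unfolding projective_object_def
proof (intro conjI allI impI ballI)
  show PO: "P \<in> Ob" using P by (simp add: is_biproduct_def)
  fix V W r h assume r: "deflation V W r" and h: "h \<in> carrier (Hom P W)"
  have O: "V \<in> Ob" "W \<in> Ob" "r \<in> carrier (Hom V W)" "X \<in> Ob" "Y \<in> Ob"
      "i \<in> carrier (Hom X P)" "j \<in> carrier (Hom Y P)"
    using defl[OF r] P by (auto simp: is_biproduct_def)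
  have hi: "Comp X P W h i \<in> carrier (Hom X W)" "Comp Y P W h j \<in> carrier (Hom Y W)"
    using O PO h by (intro comp_closed; simp)+
  obtain k where k: "k \<in> carrier (Hom X V)" "Comp X V W r k = Comp X P W h i"
    using X r hi unfolding projective_object_def by blast
  obtain l where l: "l \<in> carrier (Hom Y V)" "Comp Y V W r l = Comp Y P W h j"
    using Y r hi unfolding projective_object_def by blast
  define g where "g = Comp P X V k p \<otimes>\<^bsub>Hom P V\<^esub> Comp P Y V l q"
  note g = biproduct_copair[OF P O(1) k(1) l(1), folded g_def]
  have rg: "Comp P V W r g \<in> carrier (Hom P W)" using O PO g(1) by (intro comp_closed)
  have "Comp X P W (Comp P V W r g) i = Comp X P W h i" "Comp Y P W (Comp P V W r g) j = Comp Y P W h j"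
    using comp_assoc[OF O(4) PO O(1,2,6) g(1) O(3)] comp_assoc[OF O(5) PO O(1,2,7) g(1) O(3)]
    unfolding g(2,3) k(2) l(2) by simp_all
  then have "Comp P V W r g = h"
    using biproduct_copair(4)[OF P O(2) hi rg] biproduct_copair(4)[OF P O(2) hi h] by simp
  then show "\<exists>k \<in> carrier (Hom P V). Comp P V W r k = h" using g(1) by blast
qed

lemma injective_biproduct:
  assumes P: "is_biproduct X Y P i j p q" and X: "injective_object X" and Y: "injective_object Y"
    and infl: "\<And>X Y i. inflation X Y i \<Longrightarrow> X \<in> Ob \<and> Y \<in> Ob \<and> i \<in> carrier (Hom X Y)"
  shows "injective_object P"
  unfolding injective_object_def
proof (intro conjI allI impI ballI)
  show PO: "P \<in> Ob" using P by (simp add: is_biproduct_def)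
  fix V W r h assume r: "inflation V W r" and h: "h \<in> carrier (Hom V P)"
  have O: "V \<in> Ob" "W \<in> Ob" "r \<in> carrier (Hom V W)" "X \<in> Ob" "Y \<in> Ob"
      "p \<in> carrier (Hom P X)" "q \<in> carrier (Hom P Y)"
    using infl[OF r] P by (auto simp: is_biproduct_def)
  have hi: "Comp V P X p h \<in> carrier (Hom V X)" "Comp V P Y q h \<in> carrier (Hom V Y)"
    using O PO h by (intro comp_closed; simp)+
  obtain k where k: "k \<in> carrier (Hom W X)" "Comp V W X k r = Comp V P X p h"
    using X r hi unfolding injective_object_def by blast
  obtain l where l: "l \<in> carrier (Hom W Y)" "Comp V W Y l r = Comp V P Y q h"
    using Y r hi unfolding injective_object_def by blast
  define g where "g = Comp W X P i k \<otimes>\<^bsub>Hom W P\<^esub> Comp W Y P j l"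
  note g = biproduct_pair[OF P O(2) k(1) l(1), folded g_def]
  have gr: "Comp V W P g r \<in> carrier (Hom V P)" using O PO g(1) by (intro comp_closed)
  have "Comp V P X p (Comp V W P g r) = Comp V P X p h" "Comp V P Y q (Comp V W P g r) = Comp V P Y q h"
    using comp_assoc[OF O(1,2) PO O(4,3) g(1) O(6)] comp_assoc[OF O(1,2) PO O(5,3) g(1) O(7)]
    unfolding g(2,3) k(2) l(2) by simp_all
  then have "Comp V W P g r = h"
    using biproduct_pair(4)[OF P O(1) hi gr] biproduct_pair(4)[OF P O(1) hi h] by simp
  then show "\<exists>k \<in> carrier (Hom W P). Comp V W P k r = h" using g(1) by blast
qed

lemma finite_cover:
  assumes "finite F" "\<And>Q g. (Q, g) \<in> F \<Longrightarrow> \<Q> Q \<and> g \<in> carrier (Hom Q T)" and T: "T \<in> Ob"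
    and \<Q>: "\<And>Q. \<Q> Q \<Longrightarrow> Q \<in> Ob" "\<Q> Q0"
    and closed: "\<And>X Y P i j p q. \<lbrakk>is_biproduct X Y P i j p q; \<Q> X; \<Q> Y\<rbrakk> \<Longrightarrow> \<Q> P"
  shows "\<exists>Q g. \<Q> Q \<and> g \<in> carrier (Hom Q T) \<and> (\<forall>(Q', g') \<in> F. \<exists>u \<in> carrier (Hom Q' Q). Comp Q' Q T g u = g')"
  using assms(1,2)
proof (induction F rule: finite_induct)
  case empty
  interpret comm_group "Hom Q0 T" by (rule hom_group) (use T \<Q> in auto)
  show ?case using \<Q>(2) by blast
next
  case (insert Qg F)
  obtain Q' g' where Qg: "Qg = (Q', g')" by fastforce
  have "\<exists>Q g. \<Q> Q \<and> g \<in> carrier (Hom Q T) \<and> (\<forall>(Q', g') \<in> F. \<exists>u \<in> carrier (Hom Q' Q). Comp Q' Q T g u = g')"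
    by (rule insert.IH) (rule insert.prems, simp)
  then obtain Q g where Q: "\<Q> Q" "g \<in> carrier (Hom Q T)"
    "\<forall>(Q', g') \<in> F. \<exists>u \<in> carrier (Hom Q' Q). Comp Q' Q T g u = g'" by blast
  have Q': "\<Q> Q'" "g' \<in> carrier (Hom Q' T)" using insert.prems[of Q' g'] Qg by auto
  obtain P i j p q where P: "is_biproduct Q Q' P i j p q"
    using ex_biproduct[of Q Q'] \<Q> Q(1) Q'(1) by blast
  have O: "Q \<in> Ob" "Q' \<in> Ob" "P \<in> Ob" "i \<in> carrier (Hom Q P)" "j \<in> carrier (Hom Q' P)"
    using P by (auto simp: is_biproduct_def)
  define h where "h = Comp P Q T g p \<otimes>\<^bsub>Hom P T\<^esub> Comp P Q' T g' q"
  note h = biproduct_copair[OF P T Q(2) Q'(2), folded h_def]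
  have "\<exists>u \<in> carrier (Hom V P). Comp V P T h u = v" if V: "(V, v) \<in> insert Qg F" for V v
  proof (cases "(V, v) = Qg")
    case True
    then show ?thesis using Qg h(3) O by auto
  next
    case False
    then obtain u where u: "u \<in> carrier (Hom V Q)" "Comp V Q T g u = v" using Q(3) V by auto
    have VO: "V \<in> Ob" using insert.prems[OF V] \<Q> by blast
    have "Comp V P T h (Comp V Q P i u) = v"
      using comp_assoc[OF VO O(1) O(3) T u(1) O(4) h(1)] h(2) u(2) by simp
    then show ?thesis using comp_closed[OF VO O(1) O(3) u(1) O(4)] by blast
  qed
  then show ?case using closed[OF P Q(1) Q'(1)] h(1) by (intro exI[of _ P] exI[of _ h]) auto
qed

lemma finite_cocover:
  assumes "finite F" "\<And>Q g. (Q, g) \<in> F \<Longrightarrow> \<Q> Q \<and> g \<in> carrier (Hom T Q)" and T: "T \<in> Ob"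
    and \<Q>: "\<And>Q. \<Q> Q \<Longrightarrow> Q \<in> Ob" "\<Q> Q0"
    and closed: "\<And>X Y P i j p q. \<lbrakk>is_biproduct X Y P i j p q; \<Q> X; \<Q> Y\<rbrakk> \<Longrightarrow> \<Q> P"
  shows "\<exists>Q g. \<Q> Q \<and> g \<in> carrier (Hom T Q) \<and> (\<forall>(Q', g') \<in> F. \<exists>u \<in> carrier (Hom Q Q'). Comp T Q Q' u g = g')"
  using assms(1,2)
proof (induction F rule: finite_induct)
  case empty
  interpret comm_group "Hom T Q0" by (rule hom_group) (use T \<Q> in auto)
  show ?case using \<Q>(2) by blast
next
  case (insert Qg F)
  obtain Q' g' where Qg: "Qg = (Q', g')" by fastforce
  have "\<exists>Q g. \<Q> Q \<and> g \<in> carrier (Hom T Q) \<and> (\<forall>(Q', g') \<in> F. \<exists>u \<in> carrier (Hom Q Q'). Comp T Q Q' u g = g')"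
    by (rule insert.IH) (rule insert.prems, simp)
  then obtain Q g where Q: "\<Q> Q" "g \<in> carrier (Hom T Q)"
    "\<forall>(Q', g') \<in> F. \<exists>u \<in> carrier (Hom Q Q'). Comp T Q Q' u g = g'" by blast
  have Q': "\<Q> Q'" "g' \<in> carrier (Hom T Q')" using insert.prems[of Q' g'] Qg by auto
  obtain P i j p q where P: "is_biproduct Q Q' P i j p q"
    using ex_biproduct[of Q Q'] \<Q> Q(1) Q'(1) by blast
  have O: "Q \<in> Ob" "Q' \<in> Ob" "P \<in> Ob" "p \<in> carrier (Hom P Q)" "q \<in> carrier (Hom P Q')"
    using P by (auto simp: is_biproduct_def)
  define h where "h = Comp T Q P i g \<otimes>\<^bsub>Hom T P\<^esub> Comp T Q' P j g'"
  note h = biproduct_pair[OF P T Q(2) Q'(2), folded h_def]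
  have "\<exists>u \<in> carrier (Hom P V). Comp T P V u h = v" if V: "(V, v) \<in> insert Qg F" for V v
  proof (cases "(V, v) = Qg")
    case True
    then show ?thesis using Qg h(3) O by auto
  next
    case False
    then obtain u where u: "u \<in> carrier (Hom Q V)" "Comp T Q V u g = v" using Q(3) V by auto
    have VO: "V \<in> Ob" using insert.prems[OF V] \<Q> by blast
    have "Comp T P V (Comp P Q V u p) h = v"
      using comp_assoc[OF T O(3) O(1) VO h(1) O(4) u(1)] h(2) u(2) by simp
    then show ?thesis using comp_closed[OF O(3) O(1) VO O(4) u(1)] by blast
  qed
  then show ?case using closed[OF P Q(1) Q'(1)] h(1) by (intro exI[of _ P] exI[of _ h]) auto
qed

end

section \<open>Short exact sequences of modules\<close>

lemma short_exact_transport: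
  assumes ex: "short_exact X f Y g Z"
    and a: "bij_betw a (carrier X) (carrier X')" and b: "bij_betw b (carrier Y) (carrier Y')"
    and c: "bij_betw c (carrier Z) (carrier Z')"
    and f': "\<And>x. x \<in> carrier X \<Longrightarrow> f' (a x) = b (f x)" and g': "\<And>y. y \<in> carrier Y \<Longrightarrow> g' (b y) = c (g y)"
    and fY: "\<And>x. x \<in> carrier X \<Longrightarrow> f x \<in> carrier Y" and c0: "c \<zero>\<^bsub>Z\<^esub> = \<zero>\<^bsub>Z'\<^esub>" "\<zero>\<^bsub>Z\<^esub> \<in> carrier Z"
  shows "short_exact X' f' Y' g' Z'"
proof -
  have inj: "inj_on f (carrier X)" and surj: "g ` carrier Y = carrier Z"
    and im: "f ` carrier X = {y \<in> carrier Y. g y = \<zero>\<^bsub>Z\<^esub>}" using ex by (auto simp: short_exact_def)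
  have X': "carrier X' = a ` carrier X" and Y': "carrier Y' = b ` carrier Y" and Z': "carrier Z' = c ` carrier Z"
    using a b c by (auto simp: bij_betw_def)
  have ci: "inj_on c (carrier Z)" and bi: "inj_on b (carrier Y)" using b c by (auto simp: bij_betw_def)
  have "inj_on f' (carrier X')"
    unfolding X'
  proof (rule inj_onI, clarsimp)
    fix x y assume xy: "x \<in> carrier X" "y \<in> carrier X" "f' (a x) = f' (a y)"
    then have "f x = f y" using inj_onD[OF bi, of "f x" "f y"] f' fY by simp
    then show "a x = a y" using inj_onD[OF inj] xy by blast
  qed
  moreover have "g' ` carrier Y' = carrier Z'"
    unfolding Y' Z' image_image surj[symmetric] by (rule image_cong) (simp_all add: g')
  moreover have "f' ` carrier X' = {y \<in> carrier Y'. g' y = \<zero>\<^bsub>Z'\<^esub>}"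
  proof -
    have "f' ` carrier X' = b ` f ` carrier X"
      unfolding X' image_image by (rule image_cong) (simp_all add: f')
    also have "\<dots> = b ` {y \<in> carrier Y. g y = \<zero>\<^bsub>Z\<^esub>}" by (simp only: im)
    also have "\<dots> = {y \<in> carrier Y'. g' y = \<zero>\<^bsub>Z'\<^esub>}"
    proof -
      have "g' (b y) = \<zero>\<^bsub>Z'\<^esub> \<longleftrightarrow> g y = \<zero>\<^bsub>Z\<^esub>" if "y \<in> carrier Y" for y
      proof -
        have "g y \<in> carrier Z" using surj that by blast
        then have "c (g y) = c \<zero>\<^bsub>Z\<^esub> \<longleftrightarrow> g y = \<zero>\<^bsub>Z\<^esub>" using inj_on_eq_iff[OF ci] c0(2) by simp
        then show ?thesis using g'[OF that] c0(1) by simp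
      qed
      then show ?thesis unfolding Y' by auto
    qed
    finally show ?thesis .
  qed
  ultimately show ?thesis unfolding short_exact_def by blast
qed

lemma short_exact_pushout:
  assumes mods: "left_module A X" "left_module A Y" "left_module A Z" "left_module A X'"
      "left_module A P" "left_module A Q"
    and ex: "short_exact X i Y p Z"
    and homs: "i \<in> mod_hom A X Y" "p \<in> mod_hom A Y Z" "f \<in> mod_hom A X X'"
      "iY \<in> mod_hom A Y P" "iX \<in> mod_hom A X' P" "pY \<in> mod_hom A P Y" "pX \<in> mod_hom A P X'"
      "c \<in> mod_hom A P Q" "p' \<in> mod_hom A Q Z"
    and bip: "\<And>y. y \<in> carrier Y \<Longrightarrow> pY (iY y) = y" "\<And>x. x \<in> carrier X' \<Longrightarrow> pX (iX x) = x"
      "\<And>x. x \<in> carrier X' \<Longrightarrow> pY (iX x) = \<zero>\<^bsub>Y\<^esub>"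
      "\<And>w. w \<in> carrier P \<Longrightarrow> iY (pY w) \<oplus>\<^bsub>P\<^esub> iX (pX w) = w"
    and c: "c ` carrier P = carrier Q"
      "\<And>w. \<lbrakk>w \<in> carrier P; c w = \<zero>\<^bsub>Q\<^esub>\<rbrakk> \<Longrightarrow> \<exists>x \<in> carrier X. w = iY (i x) \<ominus>\<^bsub>P\<^esub> iX (f x)"
      "\<And>x. x \<in> carrier X \<Longrightarrow> c (iY (i x) \<ominus>\<^bsub>P\<^esub> iX (f x)) = \<zero>\<^bsub>Q\<^esub>"
    and p': "\<And>w. w \<in> carrier P \<Longrightarrow> p' (c w) = p (pY w)"
    and j: "\<And>x. x \<in> carrier X' \<Longrightarrow> j x = c (iX x)"
  shows "short_exact X' j Q p' Z"
proof -
  interpret X: left_module A X by (rule mods)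
  interpret Y: left_module A Y by (rule mods)
  interpret X': left_module A X' by (rule mods)
  interpret P: left_module A P by (rule mods)
  interpret Q: left_module A Q by (rule mods)
  have inj: "inj_on i (carrier X)" and surj: "p ` carrier Y = carrier Z"
    and im: "i ` carrier X = {y \<in> carrier Y. p y = \<zero>\<^bsub>Z\<^esub>}" using ex by (auto simp: short_exact_def)
  note cl = homs[THEN mod_hom_closed]
  have iXj: "c (iX x) \<in> carrier Q" if "x \<in> carrier X'" for x
    by (rule mod_hom_closed[OF homs(8) mod_hom_closed[OF homs(5) that]])
  have j0: "x = \<zero>\<^bsub>X'\<^esub>" if x: "x \<in> carrier X'" "c (iX x) = \<zero>\<^bsub>Q\<^esub>" for x
  proof -
    obtain z where z: "z \<in> carrier X" "iX x = iY (i z) \<ominus>\<^bsub>P\<^esub> iX (f z)" using c(2)[OF mod_hom_closed[OF homs(5) x(1)] x(2)] by blast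
    have "pY (iX x) = pY (iY (i z)) \<ominus>\<^bsub>Y\<^esub> pY (iX (f z))"
      using z cl by (simp add: mod_hom_minus[OF mods(5,2) homs(6)])
    moreover have "pY (iX x) = \<zero>\<^bsub>Y\<^esub>" "pY (iY (i z)) = i z" "pY (iX (f z)) = \<zero>\<^bsub>Y\<^esub>" "i z \<in> carrier Y"
      using z(1) x(1) cl bip by auto
    ultimately have "i z = \<zero>\<^bsub>Y\<^esub>" by (metis Y.X.minus_eq_zero_iff Y.X.zero_closed)
    then have "z = \<zero>\<^bsub>X\<^esub>" using mod_hom_inj_iff[OF mods(1,2) homs(1)] inj z by blast
    then have "iX x = \<zero>\<^bsub>P\<^esub>" using z
      by (simp add: mod_hom_zero[OF mods(1,2) homs(1)] mod_hom_zero[OF mods(2,5) homs(4)]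
          mod_hom_zero[OF mods(1,4) homs(3)] mod_hom_zero[OF mods(4,5) homs(5)] a_minus_def)
    then have "pX (iX x) = \<zero>\<^bsub>X'\<^esub>" by (simp add: mod_hom_zero[OF mods(5,4) homs(7)])
    then show ?thesis using bip x by simp
  qed
  have "inj_on j (carrier X')"
  proof (rule inj_onI)
    fix x y assume xy: "x \<in> carrier X'" "y \<in> carrier X'" "j x = j y"
    then have "c (iX (x \<ominus>\<^bsub>X'\<^esub> y)) = \<zero>\<^bsub>Q\<^esub>"
      using cl iXj by (simp add: j mod_hom_minus[OF mods(4,5) homs(5)] mod_hom_minus[OF mods(5,6) homs(8)] Q.X.minus_eq_zero_iff)
    then have "x \<ominus>\<^bsub>X'\<^esub> y = \<zero>\<^bsub>X'\<^esub>" using j0 xy by simp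
    then show "x = y" using xy by (simp add: X'.X.minus_eq_zero_iff)
  qed
  moreover have "p' ` carrier Q = carrier Z"
  proof -
    have "p' ` carrier Q = (\<lambda>w. p (pY w)) ` carrier P"
      unfolding c(1)[symmetric] image_image by (rule image_cong) (simp_all add: p')
    also have "\<dots> = p ` (pY ` carrier P)" by (simp add: image_image)
    also have "pY ` carrier P = carrier Y"
    proof
      show "carrier Y \<subseteq> pY ` carrier P"
      proof
        fix y assume y: "y \<in> carrier Y"
        show "y \<in> pY ` carrier P" by (rule image_eqI[of _ _ "iY y"]) (use y bip cl in auto)
      qed
    qed (use mod_hom_closed[OF homs(6)] in auto)
    finally show ?thesis using surj by simp
  qed
  moreover have "j ` carrier X' = {q \<in> carrier Q. p' q = \<zero>\<^bsub>Z\<^esub>}"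
  proof (intro equalityI subsetI)
    fix q assume "q \<in> j ` carrier X'"
    then obtain x where x: "x \<in> carrier X'" "q = c (iX x)" using j by auto
    have "p' q = p \<zero>\<^bsub>Y\<^esub>" using x p'[of "iX x"] bip cl by simp
    then show "q \<in> {q \<in> carrier Q. p' q = \<zero>\<^bsub>Z\<^esub>}"
      using x iXj by (simp add: mod_hom_zero[OF mods(2,3) homs(2)])
  next
    fix q assume q: "q \<in> {q \<in> carrier Q. p' q = \<zero>\<^bsub>Z\<^esub>}"
    then obtain w where w: "w \<in> carrier P" "q = c w" using c(1) by blast
    then have "p (pY w) = \<zero>\<^bsub>Z\<^esub>" using q p' by simp
    then have "pY w \<in> i ` carrier X" using im w cl by simp
    then obtain x where x: "x \<in> carrier X" "pY w = i x" by blast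
    let ?d = "iY (i x) \<ominus>\<^bsub>P\<^esub> iX (f x)"
    have d: "iY (i x) \<in> carrier P" "iX (f x) \<in> carrier P" using x cl by auto
    have fx: "f x \<in> carrier X'" using x cl by auto
    have w': "w = ?d \<oplus>\<^bsub>P\<^esub> iX (f x \<oplus>\<^bsub>X'\<^esub> pX w)"
    proof -
      have px: "pX w \<in> carrier X'" "iX (pX w) \<in> carrier P" using w cl by auto
      have "?d \<oplus>\<^bsub>P\<^esub> iX (f x \<oplus>\<^bsub>X'\<^esub> pX w) = (?d \<oplus>\<^bsub>P\<^esub> iX (f x)) \<oplus>\<^bsub>P\<^esub> iX (pX w)"
        using d px fx by (simp add: mod_hom_add[OF homs(5)] P.X.a_assoc)
      also have "\<dots> = iY (pY w) \<oplus>\<^bsub>P\<^esub> iX (pX w)" using d x by (simp add: P.X.add_minus_cancel)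
      finally show ?thesis using bip(4)[OF w(1)] by simp
    qed
    have px: "f x \<oplus>\<^bsub>X'\<^esub> pX w \<in> carrier X'" using w fx cl by auto
    have "q = c (?d \<oplus>\<^bsub>P\<^esub> iX (f x \<oplus>\<^bsub>X'\<^esub> pX w))" using w w' by simp
    also have "\<dots> = c ?d \<oplus>\<^bsub>Q\<^esub> c (iX (f x \<oplus>\<^bsub>X'\<^esub> pX w))"
      using d px cl by (intro mod_hom_add[OF homs(8)]) auto
    also have "\<dots> = j (f x \<oplus>\<^bsub>X'\<^esub> pX w)" using c(3)[OF x(1)] px iXj j by simp
    finally show "q \<in> j ` carrier X'" using px by blast
  qed
  ultimately show ?thesis unfolding short_exact_def by blast
qed

section \<open>The monomorphism category\<close>

locale mono_category = artA: artin_algebra R A + artB: artin_algebra R B + dual_basis_bimodule A M B d e \<epsilon>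
  for R :: "'r ring" and A :: "('r, 'a) module" and B :: "('r, 'b) module"
    and M :: "('a, 'm, 'b) bimodule" and d e \<epsilon> +
  assumes fg_M: "fg_module A M"
begin

abbreviation "Obs \<equiv> mono_objects A M B"
abbreviation "Mor \<equiv> triple_hom A M B"
abbreviation "TT T \<equiv> tensor M B (lower T)"
abbreviation "tm T T' g \<equiv> tensor_map M B (lower T) (lower T') g"

lemma obD:
  assumes "T \<in> Obs"
  shows ob_fg_upper: "fg_module A (upper T)" and ob_fg_lower: "fg_module B (lower T)"
    and ob_upper: "left_module A (upper T)" and ob_lower: "left_module B (lower T)"
    and ob_tensor: "left_module A (TT T)" and ob_struct: "struct T \<in> mod_hom A (TT T) (upper T)"
    and ob_inj: "inj_on (struct T) (carrier (TT T))"
    and ob_mono: "\<lbrakk>t \<in> carrier (TT T); struct T t = \<zero>\<^bsub>upper T\<^esub>\<rbrakk> \<Longrightarrow> t = \<zero>\<^bsub>TT T\<^esub>"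
proof -
  show *: "fg_module A (upper T)" "fg_module B (lower T)" "struct T \<in> mod_hom A (TT T) (upper T)"
    "inj_on (struct T) (carrier (TT T))" using assms by (auto simp: mono_objects_def)
  show **: "left_module A (upper T)" "left_module B (lower T)" using *(1,2) by (auto dest: fg_moduleD)
  show T: "left_module A (TT T)" by (rule tensor_left_module[OF **(2)])
  show "t = \<zero>\<^bsub>TT T\<^esub>" if "t \<in> carrier (TT T)" "struct T t = \<zero>\<^bsub>upper T\<^esub>"
    using *(4) that unfolding mod_hom_inj_iff[OF T **(1) *(3)] by blast
qed

lemma obI:
  assumes "fg_module A (upper T)" "fg_module B (lower T)" "struct T \<in> mod_hom A (TT T) (upper T)"
    and "\<And>t. \<lbrakk>t \<in> carrier (TT T); struct T t = \<zero>\<^bsub>upper T\<^esub>\<rbrakk> \<Longrightarrow> t = \<zero>\<^bsub>TT T\<^esub>"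
  shows "T \<in> Obs"
proof -
  have "inj_on (struct T) (carrier (TT T))"
    using assms(4) unfolding mod_hom_inj_iff[OF tensor_left_module[OF fg_moduleD[OF assms(2)]]
      fg_moduleD[OF assms(1)] assms(3)] by blast
  then show ?thesis using assms by (auto simp: mono_objects_def)
qed

lemma homD:
  assumes "f \<in> carrier (Mor T T')"
  shows hom_fst: "fst f \<in> mod_hom A (upper T) (upper T')" and hom_snd: "snd f \<in> mod_hom B (lower T) (lower T')"
    and hom_comm: "t \<in> carrier (TT T) \<Longrightarrow> fst f (struct T t) = struct T' (tm T T' (snd f) t)"
  using assms by (auto simp: triple_hom_def)

lemma homI:
  assumes "f1 \<in> mod_hom A (upper T) (upper T')" "f2 \<in> mod_hom B (lower T) (lower T')"
    and "\<And>t. t \<in> carrier (TT T) \<Longrightarrow> f1 (struct T t) = struct T' (tm T T' f2 t)"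
  shows "(f1, f2) \<in> carrier (Mor T T')"
  using assms by (auto simp: triple_hom_def)

lemma hom_fst_closed: "\<lbrakk>f \<in> carrier (Mor T T'); x \<in> carrier (upper T)\<rbrakk> \<Longrightarrow> fst f x \<in> carrier (upper T')"
  by (rule mod_hom_closed[OF hom_fst])

lemma hom_snd_closed: "\<lbrakk>f \<in> carrier (Mor T T'); y \<in> carrier (lower T)\<rbrakk> \<Longrightarrow> snd f y \<in> carrier (lower T')"
  by (rule mod_hom_closed[OF hom_snd])

lemma hom_eqI:
  assumes "f \<in> carrier (Mor T T')" "g \<in> carrier (Mor T T')"
    and "\<And>x. x \<in> carrier (upper T) \<Longrightarrow> fst f x = fst g x" "\<And>y. y \<in> carrier (lower T) \<Longrightarrow> snd f y = snd g y"
  shows "f = g"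
  by (rule prod_eqI)
    (rule mod_hom_eqI[OF hom_fst[OF assms(1)] hom_fst[OF assms(2)] assms(3)],
      simp, rule mod_hom_eqI[OF hom_snd[OF assms(1)] hom_snd[OF assms(2)] assms(4)])

lemma comp_fst [simp]: "x \<in> carrier (upper T) \<Longrightarrow> fst (triple_comp T T' T'' g f) x = fst g (fst f x)"
  and comp_snd [simp]: "y \<in> carrier (lower T) \<Longrightarrow> snd (triple_comp T T' T'' g f) y = snd g (snd f y)"
  and id_fst [simp]: "x \<in> carrier (upper T) \<Longrightarrow> fst (triple_id T) x = x"
  and id_snd [simp]: "y \<in> carrier (lower T) \<Longrightarrow> snd (triple_id T) y = y"
  by (simp_all add: triple_comp_def triple_id_def compose_eq)

lemma mult_fst [simp]: "x \<in> carrier (upper T) \<Longrightarrow> fst (f \<otimes>\<^bsub>Mor T T'\<^esub> g) x = fst f x \<oplus>\<^bsub>upper T'\<^esub> fst g x"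
  and mult_snd [simp]: "y \<in> carrier (lower T) \<Longrightarrow> snd (f \<otimes>\<^bsub>Mor T T'\<^esub> g) y = snd f y \<oplus>\<^bsub>lower T'\<^esub> snd g y"
  and one_fst [simp]: "x \<in> carrier (upper T) \<Longrightarrow> fst \<one>\<^bsub>Mor T T'\<^esub> x = \<zero>\<^bsub>upper T'\<^esub>"
  and one_snd [simp]: "y \<in> carrier (lower T) \<Longrightarrow> snd \<one>\<^bsub>Mor T T'\<^esub> y = \<zero>\<^bsub>lower T'\<^esub>"
  by (simp_all add: triple_hom_def case_prod_beta)

lemma tensor_map_closed:
  assumes "T \<in> Obs" "T' \<in> Obs" "g \<in> mod_hom B (lower T) (lower T')" "t \<in> carrier (TT T)"
  shows "tm T T' g t \<in> carrier (TT T')"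
  by (rule mod_hom_closed[OF tensor_map_hom[OF ob_lower[OF assms(1)] ob_lower[OF assms(2)] assms(3)] assms(4)])

lemma struct_closed: "\<lbrakk>T \<in> Obs; t \<in> carrier (TT T)\<rbrakk> \<Longrightarrow> struct T t \<in> carrier (upper T)"
  by (rule mod_hom_closed[OF ob_struct])

lemma comp_hom:
  assumes O: "T \<in> Obs" "T' \<in> Obs" "T'' \<in> Obs" and f: "f \<in> carrier (Mor T T')" and g: "g \<in> carrier (Mor T' T'')"
  shows "triple_comp T T' T'' g f \<in> carrier (Mor T T'')"
  unfolding triple_comp_def
proof (rule homI)
  show 1: "compose (carrier (upper T)) (fst g) (fst f) \<in> mod_hom A (upper T) (upper T'')"
    by (rule mod_hom_compose[OF ob_upper[OF O(1)] hom_fst[OF f] hom_fst[OF g]])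
  show 2: "compose (carrier (lower T)) (snd g) (snd f) \<in> mod_hom B (lower T) (lower T'')"
    by (rule mod_hom_compose[OF ob_lower[OF O(1)] hom_snd[OF f] hom_snd[OF g]])
  fix t assume t: "t \<in> carrier (TT T)"
  have "tm T' T'' (snd g) (tm T T' (snd f) t) = tm T T'' (compose (carrier (lower T)) (snd g) (snd f)) t"
    by (rule tensor_map_comp[OF O[THEN ob_lower] hom_snd[OF f] hom_snd[OF g] 2 _ t]) (simp add: compose_eq)
  then show "compose (carrier (upper T)) (fst g) (fst f) (struct T t)
      = struct T'' (tm T T'' (compose (carrier (lower T)) (snd g) (snd f)) t)"
    using t by (simp add: compose_eq struct_closed[OF O(1)] hom_comm[OF f] hom_comm[OF g]
        tensor_map_closed[OF O(1,2) hom_snd[OF f]])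
qed

lemma id_hom:
  assumes "T \<in> Obs" shows "triple_id T \<in> carrier (Mor T T)"
  unfolding triple_id_def
proof (rule homI)
  show 2: "(\<lambda>y \<in> carrier (lower T). y) \<in> mod_hom B (lower T) (lower T)" by (rule mod_hom_id[OF ob_lower[OF assms]])
  fix t assume t: "t \<in> carrier (TT T)"
  have "tm T T (\<lambda>y \<in> carrier (lower T). y) t = t" by (rule tensor_map_ident[OF ob_lower[OF assms] 2 _ t]) simp
  then show "(\<lambda>x \<in> carrier (upper T). x) (struct T t) = struct T (tm T T (\<lambda>y \<in> carrier (lower T). y) t)"
    using struct_closed[OF assms t] by simp
qed (rule mod_hom_id[OF ob_upper[OF assms]])

lemma mult_hom:
  assumes O: "T \<in> Obs" "T' \<in> Obs" and f: "f \<in> carrier (Mor T T')" and g: "g \<in> carrier (Mor T T')"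
  shows "f \<otimes>\<^bsub>Mor T T'\<^esub> g \<in> carrier (Mor T T')"
proof -
  let ?f1 = "\<lambda>x \<in> carrier (upper T). fst f x \<oplus>\<^bsub>upper T'\<^esub> fst g x"
    and ?f2 = "\<lambda>y \<in> carrier (lower T). snd f y \<oplus>\<^bsub>lower T'\<^esub> snd g y"
  have "(?f1, ?f2) \<in> carrier (Mor T T')"
  proof (rule homI)
    show "?f1 \<in> mod_hom A (upper T) (upper T')"
      by (rule mod_hom_plus[OF O[THEN ob_upper] hom_fst[OF f] hom_fst[OF g]])
    show 2: "?f2 \<in> mod_hom B (lower T) (lower T')"
      by (rule mod_hom_plus[OF O[THEN ob_lower] hom_snd[OF f] hom_snd[OF g]])
    fix t assume t: "t \<in> carrier (TT T)"
    have "tm T T' ?f2 t = tm T T' (snd f) t \<oplus>\<^bsub>TT T'\<^esub> tm T T' (snd g) t"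
      by (rule tensor_map_plus[OF O[THEN ob_lower] hom_snd[OF f] hom_snd[OF g] 2 _ t]) simp
    then show "?f1 (struct T t) = struct T' (tm T T' ?f2 t)"
      using t by (simp add: struct_closed[OF O(1)] hom_comm[OF f] hom_comm[OF g]
          mod_hom_add[OF ob_struct[OF O(2)]] tensor_map_closed[OF O hom_snd[OF f]] tensor_map_closed[OF O hom_snd[OF g]])
  qed
  then show ?thesis by (simp add: triple_hom_def case_prod_beta)
qed

lemma one_hom:
  assumes O: "T \<in> Obs" "T' \<in> Obs" shows "\<one>\<^bsub>Mor T T'\<^esub> \<in> carrier (Mor T T')"
proof -
  have "(\<lambda>x \<in> carrier (upper T). \<zero>\<^bsub>upper T'\<^esub>, \<lambda>y \<in> carrier (lower T). \<zero>\<^bsub>lower T'\<^esub>) \<in> carrier (Mor T T')"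
  proof (rule homI)
    show 2: "(\<lambda>y \<in> carrier (lower T). \<zero>\<^bsub>lower T'\<^esub>) \<in> mod_hom B (lower T) (lower T')"
      by (rule mod_hom_const_zero[OF O[THEN ob_lower]])
    fix t assume t: "t \<in> carrier (TT T)"
    have "tm T T' (\<lambda>y \<in> carrier (lower T). \<zero>\<^bsub>lower T'\<^esub>) t = \<zero>\<^bsub>TT T'\<^esub>"
      by (rule tensor_map_zero[OF O[THEN ob_lower] 2 _ t]) simp
    then show "(\<lambda>x \<in> carrier (upper T). \<zero>\<^bsub>upper T'\<^esub>) (struct T t) = struct T' (tm T T' (\<lambda>y \<in> carrier (lower T). \<zero>\<^bsub>lower T'\<^esub>) t)"
      using struct_closed[OF O(1) t] mod_hom_zero[OF ob_tensor[OF O(2)] ob_upper[OF O(2)] ob_struct[OF O(2)]] by simp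
  qed (rule mod_hom_const_zero[OF O[THEN ob_upper]])
  then show ?thesis by (simp add: triple_hom_def)
qed

lemma neg_hom:
  assumes O: "T \<in> Obs" "T' \<in> Obs" and f: "f \<in> carrier (Mor T T')"
  shows "(\<lambda>x \<in> carrier (upper T). \<ominus>\<^bsub>upper T'\<^esub> fst f x, \<lambda>y \<in> carrier (lower T). \<ominus>\<^bsub>lower T'\<^esub> snd f y) \<in> carrier (Mor T T')"
    (is "(?f1, ?f2) \<in> _")
proof (rule homI)
  interpret T': left_module A "upper T'" by (rule ob_upper[OF O(2)])
  interpret L': left_module B "lower T'" by (rule ob_lower[OF O(2)])
  interpret TT': left_module A "TT T'" by (rule ob_tensor[OF O(2)])
  show "?f1 \<in> mod_hom A (upper T) (upper T')" by (rule mod_hom_neg[OF O[THEN ob_upper] hom_fst[OF f]])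
  show 2: "?f2 \<in> mod_hom B (lower T) (lower T')" by (rule mod_hom_neg[OF O[THEN ob_lower] hom_snd[OF f]])
  fix t assume t: "t \<in> carrier (TT T)"
  note cl = tensor_map_closed[OF O hom_snd[OF f] t] tensor_map_closed[OF O 2 t]
  have z: "(\<lambda>y \<in> carrier (lower T). \<zero>\<^bsub>lower T'\<^esub>) \<in> mod_hom B (lower T) (lower T')"
    by (rule mod_hom_const_zero[OF O[THEN ob_lower]])
  have "tm T T' (\<lambda>y \<in> carrier (lower T). \<zero>\<^bsub>lower T'\<^esub>) t = tm T T' ?f2 t \<oplus>\<^bsub>TT T'\<^esub> tm T T' (snd f) t"
    by (rule tensor_map_plus[OF O[THEN ob_lower] 2 hom_snd[OF f] z _ t])
      (simp add: L'.X.l_neg hom_snd_closed[OF f])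
  moreover have "tm T T' (\<lambda>y \<in> carrier (lower T). \<zero>\<^bsub>lower T'\<^esub>) t = \<zero>\<^bsub>TT T'\<^esub>"
    by (rule tensor_map_zero[OF O[THEN ob_lower] z _ t]) simp
  ultimately have "tm T T' ?f2 t = \<ominus>\<^bsub>TT T'\<^esub> tm T T' (snd f) t"
    using cl TT'.X.minus_equality by simp
  then show "?f1 (struct T t) = struct T' (tm T T' ?f2 t)"
    using t cl by (simp add: struct_closed[OF O(1)] hom_comm[OF f]
        mod_hom_uminus[OF ob_tensor[OF O(2)] ob_upper[OF O(2)] ob_struct[OF O(2)]])
qed

lemma mor_comm_group:
  assumes O: "T \<in> Obs" "T' \<in> Obs" shows "comm_group (Mor T T')"
proof -
  interpret U: left_module A "upper T'" by (rule ob_upper[OF O(2)])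
  interpret L: left_module B "lower T'" by (rule ob_lower[OF O(2)])
  note cl = mult_hom[OF O] one_hom[OF O] hom_fst_closed[of _ T T'] hom_snd_closed[of _ T T']
  show ?thesis
  proof (rule comm_groupI)
    fix f assume f: "f \<in> carrier (Mor T T')"
    show "\<one>\<^bsub>Mor T T'\<^esub> \<otimes>\<^bsub>Mor T T'\<^esub> f = f"
      by (rule hom_eqI[of _ T T']) (use f cl in auto)
    let ?n = "(\<lambda>x \<in> carrier (upper T). \<ominus>\<^bsub>upper T'\<^esub> fst f x, \<lambda>y \<in> carrier (lower T). \<ominus>\<^bsub>lower T'\<^esub> snd f y)"
    have n: "?n \<in> carrier (Mor T T')" by (rule neg_hom[OF O f])
    have "?n \<otimes>\<^bsub>Mor T T'\<^esub> f = \<one>\<^bsub>Mor T T'\<^esub>"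
    proof (rule hom_eqI[of _ T T'])
      show "?n \<otimes>\<^bsub>Mor T T'\<^esub> f \<in> carrier (Mor T T')" by (rule mult_hom[OF O n f])
    qed (use f cl in \<open>simp_all add: U.X.l_neg L.X.l_neg\<close>)
    then show "\<exists>g \<in> carrier (Mor T T'). g \<otimes>\<^bsub>Mor T T'\<^esub> f = \<one>\<^bsub>Mor T T'\<^esub>" using n by blast
  next
    fix f g assume fg: "f \<in> carrier (Mor T T')" "g \<in> carrier (Mor T T')"
    show "f \<otimes>\<^bsub>Mor T T'\<^esub> g = g \<otimes>\<^bsub>Mor T T'\<^esub> f"
      by (rule hom_eqI[of _ T T']) (use fg cl in \<open>auto simp: U.X.a_comm L.X.a_comm\<close>)
    fix h assume h: "h \<in> carrier (Mor T T')"
    show "f \<otimes>\<^bsub>Mor T T'\<^esub> g \<otimes>\<^bsub>Mor T T'\<^esub> h = f \<otimes>\<^bsub>Mor T T'\<^esub> (g \<otimes>\<^bsub>Mor T T'\<^esub> h)"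
      by (rule hom_eqI[of _ T T']) (use fg h cl in \<open>auto simp: U.X.a_assoc L.X.a_assoc\<close>)
  qed (use cl in auto)
qed

definition top_triple :: "'a fgmod \<Rightarrow> ('a, 'm, 'b) triple" where
  "top_triple X = \<lparr>upper = X, lower = zero_module {}, struct = \<lambda>t \<in> carrier (tensor M B (zero_module {})). \<zero>\<^bsub>X\<^esub>\<rparr>"

lemma top_simps [simp]: "upper (top_triple X) = X" "lower (top_triple X) = zero_module {}"
  by (simp_all add: top_triple_def)

lemma tensor_zero_module:
  assumes "t \<in> carrier (tensor M B (zero_module {}))"
  shows "t = \<zero>\<^bsub>tensor M B (zero_module {})\<^esub>"
  using coord_closed[OF fg_moduleD[OF fg_zero_module[OF artB.A.ring_axioms]] _ assms]
  by (intro tensor_zeroI[OF fg_moduleD[OF fg_zero_module[OF artB.A.ring_axioms]] assms]) auto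

lemma top_ob:
  assumes "fg_module A X" shows "top_triple X \<in> Obs"
proof (rule obI)
  show "fg_module B (lower (top_triple X))" by (simp add: fg_zero_module[OF artB.A.ring_axioms])
  then have "left_module A (TT (top_triple X))" by (intro tensor_left_module fg_moduleD)
  from mod_hom_const_zero[OF this fg_moduleD[OF assms]]
  show "struct (top_triple X) \<in> mod_hom A (TT (top_triple X)) (upper (top_triple X))" by (simp add: top_triple_def)
  show "t = \<zero>\<^bsub>TT (top_triple X)\<^esub>" if "t \<in> carrier (TT (top_triple X))" for t using tensor_zero_module that by simp
qed (simp add: assms)

lemma top_homI:
  assumes T: "T \<in> Obs" and X: "fg_module A X" and f: "f \<in> mod_hom A X (upper T)"
  shows "(f, \<lambda>y \<in> {{}}. \<zero>\<^bsub>lower T\<^esub>) \<in> carrier (Mor (top_triple X) T)"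
proof (rule homI)
  note O = top_ob[OF X]
  have "(\<lambda>y \<in> carrier (lower (top_triple X)). \<zero>\<^bsub>lower T\<^esub>) \<in> mod_hom B (lower (top_triple X)) (lower T)"
    by (rule mod_hom_const_zero[OF ob_lower[OF O] ob_lower[OF T]])
  then show 2: "(\<lambda>y \<in> {{}}. \<zero>\<^bsub>lower T\<^esub>) \<in> mod_hom B (lower (top_triple X)) (lower T)" by simp
  fix t assume "t \<in> carrier (TT (top_triple X))"
  then have t: "t = \<zero>\<^bsub>TT (top_triple X)\<^esub>" using tensor_zero_module by simp
  show "f (struct (top_triple X) t) = struct T (tm (top_triple X) T (\<lambda>y \<in> {{}}. \<zero>\<^bsub>lower T\<^esub>) t)"
    unfolding t mod_hom_zero[OF ob_tensor[OF O] ob_upper[OF O] ob_struct[OF O]]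
      mod_hom_zero[OF ob_tensor[OF O] ob_tensor[OF T] tensor_map_hom[OF ob_lower[OF O] ob_lower[OF T] 2]]
      mod_hom_zero[OF ob_tensor[OF T] ob_upper[OF T] ob_struct[OF T]]
    using mod_hom_zero[OF fg_moduleD[OF X] ob_upper[OF T] f] by simp
qed (use f in simp)

lemma to_top_homI:
  assumes T: "T \<in> Obs" and X: "fg_module A X" and f: "f \<in> mod_hom A (upper T) X"
    and kill: "\<And>t. t \<in> carrier (TT T) \<Longrightarrow> f (struct T t) = \<zero>\<^bsub>X\<^esub>"
  shows "(f, \<lambda>y \<in> carrier (lower T). {}) \<in> carrier (Mor T (top_triple X))"
proof (rule homI)
  note O = top_ob[OF X]
  show 2: "(\<lambda>y \<in> carrier (lower T). {}) \<in> mod_hom B (lower T) (lower (top_triple X))"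
    using mod_hom_const_zero[OF ob_lower[OF T] ob_lower[OF O]] by simp
  fix t assume t: "t \<in> carrier (TT T)"
  have "tm T (top_triple X) (\<lambda>y \<in> carrier (lower T). {}) t = \<zero>\<^bsub>TT (top_triple X)\<^esub>"
    using tensor_zero_module tensor_map_closed[OF T O 2 t] by simp
  then show "f (struct T t) = struct (top_triple X) (tm T (top_triple X) (\<lambda>y \<in> carrier (lower T). {}) t)"
    using kill[OF t] mod_hom_zero[OF ob_tensor[OF O] ob_upper[OF O] ob_struct[OF O]] by simp
qed (use f in simp)

lemma ex_zero_object:
  "\<exists>Z \<in> Obs. \<forall>X \<in> Obs. (\<exists>!f. f \<in> carrier (Mor X Z)) \<and> (\<exists>!f. f \<in> carrier (Mor Z X))"
proof (intro bexI ballI conjI)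
  let ?Z = "top_triple (zero_module {})"
  show Z: "?Z \<in> Obs" by (rule top_ob[OF fg_zero_module[OF artA.A.ring_axioms]])
  fix X assume X: "X \<in> Obs"
  show "\<exists>!f. f \<in> carrier (Mor X ?Z)"
  proof (rule ex1I[of _ "\<one>\<^bsub>Mor X ?Z\<^esub>"])
    show "\<one>\<^bsub>Mor X ?Z\<^esub> \<in> carrier (Mor X ?Z)" by (rule one_hom[OF X Z])
    fix f assume f: "f \<in> carrier (Mor X ?Z)"
    show "f = \<one>\<^bsub>Mor X ?Z\<^esub>"
      by (rule hom_eqI[OF f one_hom[OF X Z]]) (use hom_fst_closed[OF f] hom_snd_closed[OF f] in auto)
  qed
  show "\<exists>!f. f \<in> carrier (Mor ?Z X)"
  proof (rule ex1I[of _ "\<one>\<^bsub>Mor ?Z X\<^esub>"])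
    show "\<one>\<^bsub>Mor ?Z X\<^esub> \<in> carrier (Mor ?Z X)" by (rule one_hom[OF Z X])
    fix f assume f: "f \<in> carrier (Mor ?Z X)"
    show "f = \<one>\<^bsub>Mor ?Z X\<^esub>"
      by (rule hom_eqI[OF f one_hom[OF Z X]])
        (use mod_hom_zero[OF ob_upper[OF Z] ob_upper[OF X] hom_fst[OF f]]
          mod_hom_zero[OF ob_lower[OF Z] ob_lower[OF X] hom_snd[OF f]] in auto)
  qed
qed

lemma ex_biproduct_triple:
  assumes T: "T \<in> Obs" and T': "T' \<in> Obs"
  shows "\<exists>P \<in> Obs. \<exists>i \<in> carrier (Mor T P). \<exists>j \<in> carrier (Mor T' P).
    \<exists>p \<in> carrier (Mor P T). \<exists>q \<in> carrier (Mor P T').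
      triple_comp T P T p i = triple_id T \<and> triple_comp T' P T' q j = triple_id T' \<and>
      triple_comp T P T' q i = \<one>\<^bsub>Mor T T'\<^esub> \<and> triple_comp T' P T p j = \<one>\<^bsub>Mor T' T\<^esub> \<and>
      triple_comp P T P i p \<otimes>\<^bsub>Mor P P\<^esub> triple_comp P T' P j q = triple_id P"
proof -
  obtain P1 :: "'a fgmod" and i1 j1 p1 q1 where P1: "fg_module A P1"
    "i1 \<in> mod_hom A (upper T) P1" "j1 \<in> mod_hom A (upper T') P1" "p1 \<in> mod_hom A P1 (upper T)" "q1 \<in> mod_hom A P1 (upper T')"
    "\<And>x. x \<in> carrier (upper T) \<Longrightarrow> p1 (i1 x) = x" "\<And>y. y \<in> carrier (upper T') \<Longrightarrow> q1 (j1 y) = y"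
    "\<And>x. x \<in> carrier (upper T) \<Longrightarrow> q1 (i1 x) = \<zero>\<^bsub>upper T'\<^esub>" "\<And>y. y \<in> carrier (upper T') \<Longrightarrow> p1 (j1 y) = \<zero>\<^bsub>upper T\<^esub>"
    "\<And>z. z \<in> carrier P1 \<Longrightarrow> i1 (p1 z) \<oplus>\<^bsub>P1\<^esub> j1 (q1 z) = z"
    by (rule fg_biproduct[OF ob_fg_upper[OF T] ob_fg_upper[OF T']]) simp
  obtain P2 :: "'b fgmod" and i2 j2 p2 q2 where P2: "fg_module B P2"
    "i2 \<in> mod_hom B (lower T) P2" "j2 \<in> mod_hom B (lower T') P2" "p2 \<in> mod_hom B P2 (lower T)" "q2 \<in> mod_hom B P2 (lower T')"
    "\<And>x. x \<in> carrier (lower T) \<Longrightarrow> p2 (i2 x) = x" "\<And>y. y \<in> carrier (lower T') \<Longrightarrow> q2 (j2 y) = y"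
    "\<And>x. x \<in> carrier (lower T) \<Longrightarrow> q2 (i2 x) = \<zero>\<^bsub>lower T'\<^esub>" "\<And>y. y \<in> carrier (lower T') \<Longrightarrow> p2 (j2 y) = \<zero>\<^bsub>lower T\<^esub>"
    "\<And>z. z \<in> carrier P2 \<Longrightarrow> i2 (p2 z) \<oplus>\<^bsub>P2\<^esub> j2 (q2 z) = z"
    by (rule fg_biproduct[OF ob_fg_lower[OF T] ob_fg_lower[OF T']]) simp
  interpret U: left_module A "upper T" by (rule ob_upper[OF T])
  interpret U': left_module A "upper T'" by (rule ob_upper[OF T'])
  interpret L: left_module B "lower T" by (rule ob_lower[OF T])
  interpret L': left_module B "lower T'" by (rule ob_lower[OF T'])
  interpret P1: left_module A P1 by (rule fg_moduleD[OF P1(1)])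
  interpret P2: left_module B P2 by (rule fg_moduleD[OF P2(1)])
  note UM = U.left_module_axioms and UM' = U'.left_module_axioms and LM = L.left_module_axioms
    and LM' = L'.left_module_axioms and P1M = P1.left_module_axioms and P2M = P2.left_module_axioms
  note TP = tensor_left_module[OF P2M]
  define a where "a = compose (carrier (tensor M B P2)) (struct T) (tensor_map M B P2 (lower T) p2)"
  define b where "b = compose (carrier (tensor M B P2)) (struct T') (tensor_map M B P2 (lower T') q2)"
  have a: "a \<in> mod_hom A (tensor M B P2) (upper T)" unfolding a_def
    by (rule mod_hom_compose[OF TP tensor_map_hom[OF P2M LM P2(4)] ob_struct[OF T]])
  have b: "b \<in> mod_hom A (tensor M B P2) (upper T')" unfolding b_def
    by (rule mod_hom_compose[OF TP tensor_map_hom[OF P2M LM' P2(5)] ob_struct[OF T']])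
  define \<phi> where "\<phi> = (\<lambda>t \<in> carrier (tensor M B P2). compose (carrier (tensor M B P2)) i1 a t \<oplus>\<^bsub>P1\<^esub> compose (carrier (tensor M B P2)) j1 b t)"
  have \<phi>: "\<phi> \<in> mod_hom A (tensor M B P2) P1" unfolding \<phi>_def
    by (rule mod_hom_plus[OF TP P1M mod_hom_compose[OF TP a P1(2)] mod_hom_compose[OF TP b P1(3)]])
  have \<phi>_eq: "\<phi> t = i1 (a t) \<oplus>\<^bsub>P1\<^esub> j1 (b t)" if "t \<in> carrier (tensor M B P2)" for t
    using that by (simp add: \<phi>_def compose_eq)
  have p\<phi>: "p1 (\<phi> t) = a t" "q1 (\<phi> t) = b t" if t: "t \<in> carrier (tensor M B P2)" for t
    using mod_hom_closed[OF a t] mod_hom_closed[OF b t] mod_hom_closed[OF P1(2)] mod_hom_closed[OF P1(3)]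
    by (simp_all add: \<phi>_eq[OF t] mod_hom_add[OF P1(4)] mod_hom_add[OF P1(5)] P1(6-9))
  have a_eq: "a t = struct T (tensor_map M B P2 (lower T) p2 t)" and b_eq: "b t = struct T' (tensor_map M B P2 (lower T') q2 t)"
    if "t \<in> carrier (tensor M B P2)" for t using that by (simp_all add: a_def b_def compose_eq)
  define P :: "('a, 'm, 'b) triple" where "P = \<lparr>upper = P1, lower = P2, struct = \<phi>\<rparr>"
  have Ps [simp]: "upper P = P1" "lower P = P2" "struct P = \<phi>" by (simp_all add: P_def)
  have P: "P \<in> Obs"
  proof (rule obI)
    fix t assume t: "t \<in> carrier (TT P)" "struct P t = \<zero>\<^bsub>upper P\<^esub>"
    then have tP: "t \<in> carrier (tensor M B P2)" by simp
    have "a t = \<zero>\<^bsub>upper T\<^esub>" "b t = \<zero>\<^bsub>upper T'\<^esub>"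
      using p\<phi>[OF tP] t(2) mod_hom_zero[OF P1M UM P1(4)] mod_hom_zero[OF P1M UM' P1(5)] by simp_all
    then have 1: "tensor_map M B P2 (lower T) p2 t = \<zero>\<^bsub>TT T\<^esub>" "tensor_map M B P2 (lower T') q2 t = \<zero>\<^bsub>TT T'\<^esub>"
      using ob_mono[OF T mod_hom_closed[OF tensor_map_hom[OF P2M LM P2(4)] tP]]
        ob_mono[OF T' mod_hom_closed[OF tensor_map_hom[OF P2M LM' P2(5)] tP]] a_eq[OF tP] b_eq[OF tP] by simp_all
    have "t = \<zero>\<^bsub>tensor M B P2\<^esub>"
    proof (rule tensor_zeroI[OF P2M tP])
      fix k assume k: "k < d"
      have "p2 (coord P2 k t) = \<zero>\<^bsub>lower T\<^esub>" "q2 (coord P2 k t) = \<zero>\<^bsub>lower T'\<^esub>"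
        using coord_tensor_map[OF P2M LM P2(4) k tP] coord_tensor_map[OF P2M LM' P2(5) k tP] 1
          coord_zero[OF LM k] coord_zero[OF LM' k] by simp_all
      then show "coord P2 k t = \<zero>\<^bsub>P2\<^esub>"
        using P2(10)[OF coord_closed[OF P2M k tP]] mod_hom_zero[OF LM P2M P2(2)] mod_hom_zero[OF LM' P2M P2(3)] by simp
    qed
    then show "t = \<zero>\<^bsub>TT P\<^esub>" by simp
  qed (use P1(1) P2(1) \<phi> in simp_all)
  have i: "(i1, i2) \<in> carrier (Mor T P)"
  proof (rule homI)
    fix t assume t: "t \<in> carrier (TT T)"
    have c: "tensor_map M B (lower T) P2 i2 t \<in> carrier (tensor M B P2)"
      by (rule mod_hom_closed[OF tensor_map_hom[OF LM P2M P2(2)] t])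
    have "a (tensor_map M B (lower T) P2 i2 t) = struct T t" "b (tensor_map M B (lower T) P2 i2 t) = \<zero>\<^bsub>upper T'\<^esub>"
      using tensor_map_cancel[OF LM P2M P2(2,4,6) t] tensor_map_kill[OF LM P2M LM' P2(2,5,8) t]
        mod_hom_zero[OF ob_tensor[OF T'] UM' ob_struct[OF T']] by (simp_all add: a_eq[OF c] b_eq[OF c])
    then show "i1 (struct T t) = struct P (tm T P i2 t)"
      using mod_hom_zero[OF UM' P1M P1(3)] mod_hom_closed[OF P1(2) struct_closed[OF T t]] by (simp add: \<phi>_eq[OF c])
  qed (use P1 P2 in simp_all)
  have j: "(j1, j2) \<in> carrier (Mor T' P)"
  proof (rule homI)
    fix t assume t: "t \<in> carrier (TT T')"
    have c: "tensor_map M B (lower T') P2 j2 t \<in> carrier (tensor M B P2)"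
      by (rule mod_hom_closed[OF tensor_map_hom[OF LM' P2M P2(3)] t])
    have "b (tensor_map M B (lower T') P2 j2 t) = struct T' t" "a (tensor_map M B (lower T') P2 j2 t) = \<zero>\<^bsub>upper T\<^esub>"
      using tensor_map_cancel[OF LM' P2M P2(3,5,7) t] tensor_map_kill[OF LM' P2M LM P2(3,4,9) t]
        mod_hom_zero[OF ob_tensor[OF T] UM ob_struct[OF T]] by (simp_all add: a_eq[OF c] b_eq[OF c])
    then show "j1 (struct T' t) = struct P (tm T' P j2 t)"
      using mod_hom_zero[OF UM P1M P1(2)] mod_hom_closed[OF P1(3) struct_closed[OF T' t]] by (simp add: \<phi>_eq[OF c])
  qed (use P1 P2 in simp_all)
  have p: "(p1, p2) \<in> carrier (Mor P T)" by (rule homI) (use P1(4) P2(4) p\<phi> a_eq in simp_all)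
  have q: "(q1, q2) \<in> carrier (Mor P T')" by (rule homI) (use P1(5) P2(5) p\<phi> b_eq in simp_all)
  note homs = i j p q
  show ?thesis
  proof (intro bexI conjI)
    show "triple_comp T P T (p1, p2) (i1, i2) = triple_id T"
      by (rule hom_eqI[OF comp_hom[OF T P T i p] id_hom[OF T]]) (simp_all add: P1 P2)
    show "triple_comp T' P T' (q1, q2) (j1, j2) = triple_id T'"
      by (rule hom_eqI[OF comp_hom[OF T' P T' j q] id_hom[OF T']]) (simp_all add: P1 P2)
    show "triple_comp T P T' (q1, q2) (i1, i2) = \<one>\<^bsub>Mor T T'\<^esub>"
      by (rule hom_eqI[OF comp_hom[OF T P T' i q] one_hom[OF T T']]) (simp_all add: P1 P2)
    show "triple_comp T' P T (p1, p2) (j1, j2) = \<one>\<^bsub>Mor T' T\<^esub>"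
      by (rule hom_eqI[OF comp_hom[OF T' P T j p] one_hom[OF T' T]]) (simp_all add: P1 P2)
    show "triple_comp P T P (i1, i2) (p1, p2) \<otimes>\<^bsub>Mor P P\<^esub> triple_comp P T' P (j1, j2) (q1, q2) = triple_id P"
      by (rule hom_eqI[OF mult_hom[OF P P comp_hom[OF P T P p i] comp_hom[OF P T' P q j]] id_hom[OF P]])
        (simp_all add: P1(10) P2(10))
  qed (use P homs in auto)
qed

sublocale category_with_conflations "mono_objects A M B" "triple_hom A M B" triple_comp triple_id "mono_conflation A M B"
proof (intro category_with_conflations.intro additive_category.intro preadditive_category.intro additive_category_axioms.intro)
  fix X Y Z W f g h f' g'
  show "\<lbrakk>X \<in> Obs; Y \<in> Obs\<rbrakk> \<Longrightarrow> comm_group (Mor X Y)" by (rule mor_comm_group)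
  show "X \<in> Obs \<Longrightarrow> triple_id X \<in> carrier (Mor X X)" by (rule id_hom)
  show "\<lbrakk>X \<in> Obs; Y \<in> Obs; Z \<in> Obs; f \<in> carrier (Mor X Y); g \<in> carrier (Mor Y Z)\<rbrakk> \<Longrightarrow>
      triple_comp X Y Z g f \<in> carrier (Mor X Z)" by (rule comp_hom)
  show "\<lbrakk>X \<in> Obs; Y \<in> Obs; f \<in> carrier (Mor X Y)\<rbrakk> \<Longrightarrow> triple_comp X X Y f (triple_id X) = f"
    by (rule hom_eqI[of _ X Y]) (auto intro: comp_hom id_hom)
  show "\<lbrakk>X \<in> Obs; Y \<in> Obs; f \<in> carrier (Mor X Y)\<rbrakk> \<Longrightarrow> triple_comp X Y Y (triple_id Y) f = f"
    by (rule hom_eqI[of _ X Y]) (auto intro: comp_hom id_hom simp: hom_fst_closed hom_snd_closed)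
  show "triple_comp W Y Z h (triple_comp W X Y g f) = triple_comp W X Z (triple_comp X Y Z h g) f"
    if "W \<in> Obs" "X \<in> Obs" "Y \<in> Obs" "Z \<in> Obs" "f \<in> carrier (Mor W X)" "g \<in> carrier (Mor X Y)" "h \<in> carrier (Mor Y Z)"
    by (rule hom_eqI[of _ W Z]) (use that in \<open>auto intro!: comp_hom simp: hom_fst_closed hom_snd_closed\<close>)
  show "triple_comp X Y Z (g \<otimes>\<^bsub>Mor Y Z\<^esub> g') f = triple_comp X Y Z g f \<otimes>\<^bsub>Mor X Z\<^esub> triple_comp X Y Z g' f"
    if "X \<in> Obs" "Y \<in> Obs" "Z \<in> Obs" "f \<in> carrier (Mor X Y)" "g \<in> carrier (Mor Y Z)" "g' \<in> carrier (Mor Y Z)"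
    by (rule hom_eqI[of _ X Z])
      (use that in \<open>auto intro!: comp_hom mult_hom simp: hom_fst_closed[of f X Y] hom_snd_closed[of f X Y]\<close>)
  show "triple_comp X Y Z g (f \<otimes>\<^bsub>Mor X Y\<^esub> f') = triple_comp X Y Z g f \<otimes>\<^bsub>Mor X Z\<^esub> triple_comp X Y Z g f'"
    if "X \<in> Obs" "Y \<in> Obs" "Z \<in> Obs" "f \<in> carrier (Mor X Y)" "f' \<in> carrier (Mor X Y)" "g \<in> carrier (Mor Y Z)"
    by (rule hom_eqI[of _ X Z])
      (use that in \<open>auto intro!: comp_hom mult_hom simp: hom_fst_closed[of _ X Y] hom_snd_closed[of _ X Y]
        mod_hom_add[OF hom_fst[of g Y Z]] mod_hom_add[OF hom_snd[of g Y Z]]\<close>)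
qed (rule ex_zero_object, rule ex_biproduct_triple)

lemma biproduct_elem:
  assumes "is_biproduct X Y P i j p q"
  shows "x \<in> carrier (upper X) \<Longrightarrow> fst p (fst i x) = x" "y \<in> carrier (upper Y) \<Longrightarrow> fst q (fst j y) = y"
    and "x \<in> carrier (upper X) \<Longrightarrow> fst q (fst i x) = \<zero>\<^bsub>upper Y\<^esub>" "y \<in> carrier (upper Y) \<Longrightarrow> fst p (fst j y) = \<zero>\<^bsub>upper X\<^esub>"
    and "z \<in> carrier (upper P) \<Longrightarrow> fst i (fst p z) \<oplus>\<^bsub>upper P\<^esub> fst j (fst q z) = z"
    and "u \<in> carrier (lower X) \<Longrightarrow> snd p (snd i u) = u" "v \<in> carrier (lower Y) \<Longrightarrow> snd q (snd j v) = v"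
    and "u \<in> carrier (lower X) \<Longrightarrow> snd q (snd i u) = \<zero>\<^bsub>lower Y\<^esub>" "v \<in> carrier (lower Y) \<Longrightarrow> snd p (snd j v) = \<zero>\<^bsub>lower X\<^esub>"
    and "w \<in> carrier (lower P) \<Longrightarrow> snd i (snd p w) \<oplus>\<^bsub>lower P\<^esub> snd j (snd q w) = w"
proof -
  note E = assms[unfolded is_biproduct_def]
  have e: "triple_comp X P X p i = triple_id X" "triple_comp Y P Y q j = triple_id Y"
    "triple_comp X P Y q i = \<one>\<^bsub>Mor X Y\<^esub>" "triple_comp Y P X p j = \<one>\<^bsub>Mor Y X\<^esub>"
    "triple_comp P X P i p \<otimes>\<^bsub>Mor P P\<^esub> triple_comp P Y P j q = triple_id P" using E by auto
  show "x \<in> carrier (upper X) \<Longrightarrow> fst p (fst i x) = x" "u \<in> carrier (lower X) \<Longrightarrow> snd p (snd i u) = u"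
    using fun_cong[OF arg_cong[OF e(1), of fst], of x] fun_cong[OF arg_cong[OF e(1), of snd], of u] by simp_all
  show "y \<in> carrier (upper Y) \<Longrightarrow> fst q (fst j y) = y" "v \<in> carrier (lower Y) \<Longrightarrow> snd q (snd j v) = v"
    using fun_cong[OF arg_cong[OF e(2), of fst], of y] fun_cong[OF arg_cong[OF e(2), of snd], of v] by simp_all
  show "x \<in> carrier (upper X) \<Longrightarrow> fst q (fst i x) = \<zero>\<^bsub>upper Y\<^esub>" "u \<in> carrier (lower X) \<Longrightarrow> snd q (snd i u) = \<zero>\<^bsub>lower Y\<^esub>"
    using fun_cong[OF arg_cong[OF e(3), of fst], of x] fun_cong[OF arg_cong[OF e(3), of snd], of u] by simp_all
  show "y \<in> carrier (upper Y) \<Longrightarrow> fst p (fst j y) = \<zero>\<^bsub>upper X\<^esub>" "v \<in> carrier (lower Y) \<Longrightarrow> snd p (snd j v) = \<zero>\<^bsub>lower X\<^esub>"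
    using fun_cong[OF arg_cong[OF e(4), of fst], of y] fun_cong[OF arg_cong[OF e(4), of snd], of v] by simp_all
  show "z \<in> carrier (upper P) \<Longrightarrow> fst i (fst p z) \<oplus>\<^bsub>upper P\<^esub> fst j (fst q z) = z"
    "w \<in> carrier (lower P) \<Longrightarrow> snd i (snd p w) \<oplus>\<^bsub>lower P\<^esub> snd j (snd q w) = w"
    using fun_cong[OF arg_cong[OF e(5), of fst], of z] fun_cong[OF arg_cong[OF e(5), of snd], of w] by simp_all
qed

lemma inv_elem:
  assumes O: "X \<in> Obs" "Y \<in> Obs" and f: "f \<in> carrier (Mor X Y)"
  shows "x \<in> carrier (upper X) \<Longrightarrow> fst (inv\<^bsub>Mor X Y\<^esub> f) x = \<ominus>\<^bsub>upper Y\<^esub> fst f x"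
    and "y \<in> carrier (lower X) \<Longrightarrow> snd (inv\<^bsub>Mor X Y\<^esub> f) y = \<ominus>\<^bsub>lower Y\<^esub> snd f y"
proof -
  interpret U: left_module A "upper Y" by (rule ob_upper[OF O(2)])
  interpret L: left_module B "lower Y" by (rule ob_lower[OF O(2)])
  interpret G: comm_group "Mor X Y" by (rule mor_comm_group[OF O])
  let ?n = "(\<lambda>x \<in> carrier (upper X). \<ominus>\<^bsub>upper Y\<^esub> fst f x, \<lambda>y \<in> carrier (lower X). \<ominus>\<^bsub>lower Y\<^esub> snd f y)"
  note n = neg_hom[OF O f]
  have "?n \<otimes>\<^bsub>Mor X Y\<^esub> f = \<one>\<^bsub>Mor X Y\<^esub>"
    by (rule hom_eqI[OF mult_hom[OF O n f] one_hom[OF O]])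
      (simp_all add: U.X.l_neg L.X.l_neg hom_fst_closed[OF f] hom_snd_closed[OF f])
  then have "inv\<^bsub>Mor X Y\<^esub> f = ?n" using f n by (rule G.inv_equality)
  then show "x \<in> carrier (upper X) \<Longrightarrow> fst (inv\<^bsub>Mor X Y\<^esub> f) x = \<ominus>\<^bsub>upper Y\<^esub> fst f x"
    "y \<in> carrier (lower X) \<Longrightarrow> snd (inv\<^bsub>Mor X Y\<^esub> f) y = \<ominus>\<^bsub>lower Y\<^esub> snd f y" by simp_all
qed

end

context mono_category
begin

lemma comp_eqD:
  assumes "triple_comp X Y Z g f = h"
  shows "x \<in> carrier (upper X) \<Longrightarrow> fst g (fst f x) = fst h x" "y \<in> carrier (lower X) \<Longrightarrow> snd g (snd f y) = snd h y"
  using fun_cong[OF arg_cong[OF assms, of fst], of x] fun_cong[OF arg_cong[OF assms, of snd], of y] by simp_all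

lemma triple_lift:
  assumes O: "X \<in> Obs" "Y \<in> Obs" "W \<in> Obs" and i: "i \<in> carrier (Mor X Y)"
    and inj: "inj_on (fst i) (carrier (upper X))" "inj_on (snd i) (carrier (lower X))"
    and f: "f \<in> carrier (Mor W Y)" and im: "fst f ` carrier (upper W) \<subseteq> fst i ` carrier (upper X)"
      "snd f ` carrier (lower W) \<subseteq> snd i ` carrier (lower X)"
  shows "\<exists>!k. k \<in> carrier (Mor W X) \<and> triple_comp W X Y i k = f"
proof -
  obtain k1 where k1: "k1 \<in> mod_hom A (upper W) (upper X)" "\<And>x. x \<in> carrier (upper W) \<Longrightarrow> fst i (k1 x) = fst f x"
    using factor_through_inj[OF O(3,1,2)[THEN ob_upper] hom_fst[OF i] inj(1) hom_fst[OF f] im(1)] by metis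
  obtain k2 where k2: "k2 \<in> mod_hom B (lower W) (lower X)" "\<And>y. y \<in> carrier (lower W) \<Longrightarrow> snd i (k2 y) = snd f y"
    using factor_through_inj[OF O(3,1,2)[THEN ob_lower] hom_snd[OF i] inj(2) hom_snd[OF f] im(2)] by metis
  have k: "(k1, k2) \<in> carrier (Mor W X)"
  proof (rule homI[OF k1(1) k2(1)])
    fix t assume t: "t \<in> carrier (TT W)"
    have c: "tm W X k2 t \<in> carrier (TT X)" by (rule tensor_map_closed[OF O(3,1) k2(1) t])
    have "fst i (k1 (struct W t)) = struct Y (tm W Y (snd f) t)"
      using k1(2) struct_closed[OF O(3) t] hom_comm[OF f t] by simp
    also have "tm W Y (snd f) t = tm X Y (snd i) (tm W X k2 t)"
      by (rule tensor_map_comp[OF O(3,1,2)[THEN ob_lower] k2(1) hom_snd[OF i] hom_snd[OF f] k2(2) t, symmetric])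
    also have "struct Y \<dots> = fst i (struct X (tm W X k2 t))" using hom_comm[OF i c] by simp
    finally show "k1 (struct W t) = struct X (tm W X k2 t)"
      by (rule inj_onD[OF inj(1)]) (use mod_hom_closed[OF k1(1) struct_closed[OF O(3) t]] struct_closed[OF O(1) c] in auto)
  qed
  show ?thesis
  proof (rule ex1I[of _ "(k1, k2)"], intro conjI k)
    show "triple_comp W X Y i (k1, k2) = f"
      by (rule hom_eqI[OF comp_hom[OF O(3,1,2) k i] f]) (simp_all add: k1 k2)
    fix l assume "l \<in> carrier (Mor W X) \<and> triple_comp W X Y i l = f"
    then have l: "l \<in> carrier (Mor W X)" "triple_comp W X Y i l = f" by auto
    show "l = (k1, k2)"
    proof (rule hom_eqI[OF l(1) k])
      fix x assume x: "x \<in> carrier (upper W)"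
      show "fst l x = fst (k1, k2) x"
        by (rule inj_onD[OF inj(1)])
          (use x comp_eqD(1)[OF l(2) x] k1(2)[OF x] hom_fst_closed[OF l(1) x] mod_hom_closed[OF k1(1) x] in auto)
    next
      fix y assume y: "y \<in> carrier (lower W)"
      show "snd l y = snd (k1, k2) y"
        by (rule inj_onD[OF inj(2)])
          (use y comp_eqD(2)[OF l(2) y] k2(2)[OF y] hom_snd_closed[OF l(1) y] mod_hom_closed[OF k2(1) y] in auto)
    qed
  qed
qed

lemma triple_factor:
  assumes O: "Y \<in> Obs" "Z \<in> Obs" "W \<in> Obs" and p: "p \<in> carrier (Mor Y Z)"
    and surj: "fst p ` carrier (upper Y) = carrier (upper Z)" "snd p ` carrier (lower Y) = carrier (lower Z)"
    and f: "f \<in> carrier (Mor Y W)"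
    and ker: "\<And>x. \<lbrakk>x \<in> carrier (upper Y); fst p x = \<zero>\<^bsub>upper Z\<^esub>\<rbrakk> \<Longrightarrow> fst f x = \<zero>\<^bsub>upper W\<^esub>"
      "\<And>y. \<lbrakk>y \<in> carrier (lower Y); snd p y = \<zero>\<^bsub>lower Z\<^esub>\<rbrakk> \<Longrightarrow> snd f y = \<zero>\<^bsub>lower W\<^esub>"
  shows "\<exists>!k. k \<in> carrier (Mor Z W) \<and> triple_comp Y Z W k p = f"
proof -
  obtain k1 where k1: "k1 \<in> mod_hom A (upper Z) (upper W)" "\<And>x. x \<in> carrier (upper Y) \<Longrightarrow> k1 (fst p x) = fst f x"
    using factor_through_surj[OF O[THEN ob_upper] hom_fst[OF p] surj(1) hom_fst[OF f] ker(1)] by metis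
  obtain k2 where k2: "k2 \<in> mod_hom B (lower Z) (lower W)" "\<And>y. y \<in> carrier (lower Y) \<Longrightarrow> k2 (snd p y) = snd f y"
    using factor_through_surj[OF O[THEN ob_lower] hom_snd[OF p] surj(2) hom_snd[OF f] ker(2)] by metis
  have k: "(k1, k2) \<in> carrier (Mor Z W)"
  proof (rule homI[OF k1(1) k2(1)])
    fix t assume "t \<in> carrier (TT Z)"
    then obtain s where s: "s \<in> carrier (TT Y)" "tm Y Z (snd p) s = t"
      using tensor_map_surj[OF O(1,2)[THEN ob_lower] hom_snd[OF p] surj(2)] by blast
    have "k1 (struct Z t) = k1 (fst p (struct Y s))" using hom_comm[OF p s(1)] s(2) by simp
    also have "\<dots> = struct W (tm Y W (snd f) s)" using k1(2) struct_closed[OF O(1) s(1)] hom_comm[OF f s(1)] by simp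
    also have "tm Y W (snd f) s = tm Z W k2 t"
      unfolding s(2)[symmetric]
      by (rule tensor_map_comp[OF O[THEN ob_lower] hom_snd[OF p] k2(1) hom_snd[OF f] k2(2) s(1), symmetric])
    finally show "k1 (struct Z t) = struct W (tm Z W k2 t)" .
  qed
  show ?thesis
  proof (rule ex1I[of _ "(k1, k2)"], intro conjI k)
    show "triple_comp Y Z W (k1, k2) p = f"
      by (rule hom_eqI[OF comp_hom[OF O p k] f]) (simp_all add: k1 k2)
    fix l assume "l \<in> carrier (Mor Z W) \<and> triple_comp Y Z W l p = f"
    then have l: "l \<in> carrier (Mor Z W)" "triple_comp Y Z W l p = f" by auto
    show "l = (k1, k2)"
    proof (rule hom_eqI[OF l(1) k])
      fix x assume "x \<in> carrier (upper Z)"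
      then obtain y where "y \<in> carrier (upper Y)" "x = fst p y" using surj(1) by blast
      then show "fst l x = fst (k1, k2) x" using comp_eqD(1)[OF l(2)] k1(2) by simp
    next
      fix x assume "x \<in> carrier (lower Z)"
      then obtain y where "y \<in> carrier (lower Y)" "x = snd p y" using surj(2) by blast
      then show "snd l x = snd (k1, k2) x" using comp_eqD(2)[OF l(2)] k2(2) by simp
    qed
  qed
qed

lemma conflD:
  assumes "mono_conflation A M B X i Y p Z"
  shows confl_obs: "X \<in> Obs" "Y \<in> Obs" "Z \<in> Obs" and confl_homs: "i \<in> carrier (Mor X Y)" "p \<in> carrier (Mor Y Z)"
    and confl_inj: "inj_on (fst i) (carrier (upper X))" "inj_on (snd i) (carrier (lower X))"
    and confl_surj: "fst p ` carrier (upper Y) = carrier (upper Z)" "snd p ` carrier (lower Y) = carrier (lower Z)"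
    and confl_exact: "fst i ` carrier (upper X) = {x \<in> carrier (upper Y). fst p x = \<zero>\<^bsub>upper Z\<^esub>}"
      "snd i ` carrier (lower X) = {y \<in> carrier (lower Y). snd p y = \<zero>\<^bsub>lower Z\<^esub>}"
  using assms unfolding mono_conflation_def short_exact_def by - (elim conjE, assumption)+

lemma kernel_triple:
  assumes O: "T \<in> Obs" "T' \<in> Obs" and g: "g \<in> carrier (Mor T T')"
  shows "\<exists>K \<in> Obs. \<exists>i \<in> carrier (Mor K T). inj_on (fst i) (carrier (upper K)) \<and> inj_on (snd i) (carrier (lower K)) \<and>
    fst i ` carrier (upper K) = {x \<in> carrier (upper T). fst g x = \<zero>\<^bsub>upper T'\<^esub>} \<and>
    snd i ` carrier (lower K) = {y \<in> carrier (lower T). snd g y = \<zero>\<^bsub>lower T'\<^esub>}"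
proof -
  let ?K1 = "{x \<in> carrier (upper T). fst g x = \<zero>\<^bsub>upper T'\<^esub>}" and ?K2 = "{y \<in> carrier (lower T). snd g y = \<zero>\<^bsub>lower T'\<^esub>}"
  let ?U = "upper T\<lparr>carrier := ?K1\<rparr>" and ?L = "lower T\<lparr>carrier := ?K2\<rparr>"
  have s1: "submodule ?K1 A (upper T)" by (rule kernel_submodule[OF O[THEN ob_upper] hom_fst[OF g]])
  have s2: "submodule ?K2 B (lower T)" by (rule kernel_submodule[OF O[THEN ob_lower] hom_snd[OF g]])
  have U: "fg_module A ?U" by (rule artA.submodule_fg[OF ob_fg_upper[OF O(1)] s1])
  have L: "fg_module B ?L" by (rule artB.submodule_fg[OF ob_fg_lower[OF O(1)] s2])
  note LM = fg_moduleD[OF L] and TM = ob_lower[OF O(1)]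
  let ?i1 = "\<lambda>x \<in> ?K1. x" and ?i2 = "\<lambda>y \<in> ?K2. y"
  have i1: "?i1 \<in> mod_hom A ?U (upper T)" by (rule submodule_inclusion[OF ob_upper[OF O(1)] s1])
  have i2: "?i2 \<in> mod_hom B ?L (lower T)" by (rule submodule_inclusion[OF TM s2])
  let ?\<phi> = "compose (carrier (tensor M B ?L)) (struct T) (tensor_map M B ?L (lower T) ?i2)"
  have \<phi>0: "?\<phi> \<in> mod_hom A (tensor M B ?L) (upper T)"
    by (rule mod_hom_compose[OF tensor_left_module[OF LM] tensor_map_hom[OF LM TM i2] ob_struct[OF O(1)]])
  have tc: "tensor_map M B ?L (lower T) ?i2 t \<in> carrier (TT T)" if "t \<in> carrier (tensor M B ?L)" for t
    by (rule mod_hom_closed[OF tensor_map_hom[OF LM TM i2] that])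
  have \<phi>K: "?\<phi> ` carrier (tensor M B ?L) \<subseteq> ?K1"
  proof (rule image_subsetI)
    fix t assume t: "t \<in> carrier (tensor M B ?L)"
    have "tm T T' (snd g) (tensor_map M B ?L (lower T) ?i2 t) = \<zero>\<^bsub>TT T'\<^esub>"
      by (rule tensor_map_kill[OF LM O[THEN ob_lower] i2 hom_snd[OF g] _ t]) simp
    then have "fst g (struct T (tensor_map M B ?L (lower T) ?i2 t)) = \<zero>\<^bsub>upper T'\<^esub>"
      using hom_comm[OF g tc[OF t]] mod_hom_zero[OF ob_tensor[OF O(2)] ob_upper[OF O(2)] ob_struct[OF O(2)]] by simp
    then show "?\<phi> t \<in> ?K1" using t struct_closed[OF O(1) tc[OF t]] by (simp add: compose_eq)
  qed
  define K :: "('a, 'm, 'b) triple" where "K = \<lparr>upper = ?U, lower = ?L, struct = ?\<phi>\<rparr>"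
  have Ks [simp]: "upper K = ?U" "lower K = ?L" "struct K = ?\<phi>" by (simp_all add: K_def)
  have K: "K \<in> Obs"
  proof (rule obI)
    show "struct K \<in> mod_hom A (TT K) (upper K)" using mod_hom_corestrict[OF \<phi>0 \<phi>K] by simp
    fix t assume t: "t \<in> carrier (TT K)" "struct K t = \<zero>\<^bsub>upper K\<^esub>"
    then have tL: "t \<in> carrier (tensor M B ?L)" by simp
    have "struct T (tensor_map M B ?L (lower T) ?i2 t) = \<zero>\<^bsub>upper T\<^esub>" using t by (simp add: compose_eq)
    then have "tensor_map M B ?L (lower T) ?i2 t = \<zero>\<^bsub>TT T\<^esub>" using ob_mono[OF O(1) tc[OF tL]] by simp
    then have "t = \<zero>\<^bsub>tensor M B ?L\<^esub>" by (intro tensor_map_inj[OF LM TM i2 _ tL]) (simp_all add: inj_on_def)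
    then show "t = \<zero>\<^bsub>TT K\<^esub>" by simp
  qed (use U L in simp_all)
  have i: "(?i1, ?i2) \<in> carrier (Mor K T)"
  proof (rule homI)
    fix t assume "t \<in> carrier (TT K)"
    then have t: "t \<in> carrier (tensor M B ?L)" by simp
    have "?\<phi> t \<in> ?K1" using \<phi>K t by blast
    then have "?i1 (?\<phi> t) = ?\<phi> t" by (rule restrict_apply')
    then show "?i1 (struct K t) = struct T (tm K T ?i2 t)" using t by (simp add: compose_eq)
  qed (use i1 i2 in simp_all)
  show ?thesis
    by (rule bexI[OF _ K], rule bexI[OF _ i]) (auto simp: inj_on_def)
qed

definition pure_mono :: "('a, 'm, 'b) triple \<Rightarrow> ('a, 'm, 'b) triple \<Rightarrow> ('a, 'b) triple_mor \<Rightarrow> bool" where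
  "pure_mono S T f \<longleftrightarrow> S \<in> Obs \<and> T \<in> Obs \<and> f \<in> carrier (Mor S T) \<and>
     inj_on (fst f) (carrier (upper S)) \<and> inj_on (snd f) (carrier (lower S)) \<and>
     (\<forall>x \<in> carrier (upper S). \<forall>t \<in> carrier (TT T). fst f x = struct T t \<longrightarrow>
        (\<exists>s \<in> carrier (TT S). tm S T (snd f) s = t))"

lemma cokernel_triple:
  assumes "pure_mono S T f"
  shows "\<exists>Q p. mono_conflation A M B S f T p Q"
proof -
  have O: "S \<in> Obs" "T \<in> Obs" and f: "f \<in> carrier (Mor S T)"
    and inj: "inj_on (fst f) (carrier (upper S))" "inj_on (snd f) (carrier (lower S))"
    and pure: "\<forall>x \<in> carrier (upper S). \<forall>t \<in> carrier (TT T). fst f x = struct T t \<longrightarrow>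
        (\<exists>s \<in> carrier (TT S). tm S T (snd f) s = t)"
    using assms by (auto simp: pure_mono_def)
  let ?K1 = "fst f ` carrier (upper S)" and ?K2 = "snd f ` carrier (lower S)"
  have s1: "submodule ?K1 A (upper T)"
    by (rule image_submodule[OF O[THEN ob_upper] hom_fst[OF f] left_module.submodule_carrier[OF ob_upper[OF O(1)]]])
  have s2: "submodule ?K2 B (lower T)"
    by (rule image_submodule[OF O[THEN ob_lower] hom_snd[OF f] left_module.submodule_carrier[OF ob_lower[OF O(1)]]])
  obtain Q1 :: "'a fgmod" and p1 where Q1: "fg_module A Q1" "p1 \<in> mod_hom A (upper T) Q1"
    "p1 ` carrier (upper T) = carrier Q1" "\<And>x. x \<in> carrier (upper T) \<Longrightarrow> p1 x = \<zero>\<^bsub>Q1\<^esub> \<longleftrightarrow> x \<in> ?K1"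
    using quotient_module[OF ob_fg_upper[OF O(2)] s1] by metis
  obtain Q2 :: "'b fgmod" and p2 where Q2: "fg_module B Q2" "p2 \<in> mod_hom B (lower T) Q2"
    "p2 ` carrier (lower T) = carrier Q2" "\<And>y. y \<in> carrier (lower T) \<Longrightarrow> p2 y = \<zero>\<^bsub>Q2\<^esub> \<longleftrightarrow> y \<in> ?K2"
    using quotient_module[OF ob_fg_lower[OF O(2)] s2] by metis
  note Q1M = fg_moduleD[OF Q1(1)] and Q2M = fg_moduleD[OF Q2(1)] and LM = ob_lower[OF O(2)]
  note TQ = tensor_left_module[OF Q2M]
  let ?t2 = "tensor_map M B (lower T) Q2 p2"
  have t2: "?t2 \<in> mod_hom A (TT T) (tensor M B Q2)" by (rule tensor_map_hom[OF LM Q2M Q2(2)])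
  have t2s: "?t2 ` carrier (TT T) = carrier (tensor M B Q2)"
    using mod_hom_closed[OF t2] tensor_map_surj[OF LM Q2M Q2(2,3)] by (auto simp: image_iff)
  let ?h = "compose (carrier (TT T)) p1 (struct T)"
  have h: "?h \<in> mod_hom A (TT T) Q1" by (rule mod_hom_compose[OF ob_tensor[OF O(2)] ob_struct[OF O(2)] Q1(2)])
  have lift: "\<exists>s \<in> carrier (TT S). tm S T (snd f) s = t" if t: "t \<in> carrier (TT T)" "?t2 t = \<zero>\<^bsub>tensor M B Q2\<^esub>" for t
  proof (rule tensor_map_lift[OF O[THEN ob_lower] hom_snd[OF f] t(1)])
    fix i assume i: "i < d"
    have "p2 (coord (lower T) i t) = \<zero>\<^bsub>Q2\<^esub>"
      using coord_tensor_map[OF LM Q2M Q2(2) i t(1)] t(2) coord_zero[OF Q2M i] by simp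
    then show "coord (lower T) i t \<in> ?K2" using Q2(4)[OF coord_closed[OF LM i t(1)]] by simp
  qed
  have ker: "?h t = \<zero>\<^bsub>Q1\<^esub>" if t: "t \<in> carrier (TT T)" "?t2 t = \<zero>\<^bsub>tensor M B Q2\<^esub>" for t
  proof -
    obtain s where s: "s \<in> carrier (TT S)" "tm S T (snd f) s = t" using lift[OF t] by blast
    then have "struct T t = fst f (struct S s)" using hom_comm[OF f s(1)] by simp
    then have "struct T t \<in> ?K1" using struct_closed[OF O(1) s(1)] by simp
    then show ?thesis using Q1(4)[OF struct_closed[OF O(2) t(1)]] t by (simp add: compose_eq)
  qed
  obtain \<phi> where \<phi>: "\<phi> \<in> mod_hom A (tensor M B Q2) Q1" "\<And>t. t \<in> carrier (TT T) \<Longrightarrow> \<phi> (?t2 t) = ?h t"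
    using factor_through_surj[OF ob_tensor[OF O(2)] TQ Q1M t2 t2s h ker] by metis
  define Q :: "('a, 'm, 'b) triple" where "Q = \<lparr>upper = Q1, lower = Q2, struct = \<phi>\<rparr>"
  have Qs [simp]: "upper Q = Q1" "lower Q = Q2" "struct Q = \<phi>" by (simp_all add: Q_def)
  have Q: "Q \<in> Obs"
  proof (rule obI)
    fix u assume u: "u \<in> carrier (TT Q)" "struct Q u = \<zero>\<^bsub>upper Q\<^esub>"
    then have "u \<in> ?t2 ` carrier (TT T)" unfolding t2s by simp
    then obtain t where t: "t \<in> carrier (TT T)" "u = ?t2 t" by blast
    have "p1 (struct T t) = \<zero>\<^bsub>Q1\<^esub>" using u(2) t \<phi>(2)[OF t(1)] by (simp add: compose_eq)
    then have "struct T t \<in> ?K1" using Q1(4)[OF struct_closed[OF O(2) t(1)]] by simp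
    then obtain x where x: "x \<in> carrier (upper S)" "fst f x = struct T t" by force
    then obtain s where s: "s \<in> carrier (TT S)" "tm S T (snd f) s = t" using pure t(1) by blast
    have "?t2 (tm S T (snd f) s) = \<zero>\<^bsub>tensor M B Q2\<^esub>"
      by (rule tensor_map_kill[OF O[THEN ob_lower] Q2M hom_snd[OF f] Q2(2) _ s(1)])
        (use Q2(4) hom_snd_closed[OF f] in auto)
    then show "u = \<zero>\<^bsub>TT Q\<^esub>" using t(2) s(2) by simp
  qed (use Q1(1) Q2(1) \<phi>(1) in simp_all)
  have p: "(p1, p2) \<in> carrier (Mor T Q)"
    by (rule homI) (use Q1(2) Q2(2) \<phi>(2) in \<open>simp_all add: compose_eq\<close>)
  have "?K1 = {x \<in> carrier (upper T). p1 x = \<zero>\<^bsub>Q1\<^esub>}"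
  proof (intro equalityI subsetI)
    fix x assume "x \<in> ?K1"
    then show "x \<in> {x \<in> carrier (upper T). p1 x = \<zero>\<^bsub>Q1\<^esub>}"
      unfolding mem_Collect_eq using Q1(4)[of x] subsetD[OF submodule_subset[OF s1], of x] by metis
  next
    fix x assume "x \<in> {x \<in> carrier (upper T). p1 x = \<zero>\<^bsub>Q1\<^esub>}"
    then show "x \<in> ?K1" unfolding mem_Collect_eq using Q1(4)[of x] by metis
  qed
  moreover have "?K2 = {x \<in> carrier (lower T). p2 x = \<zero>\<^bsub>Q2\<^esub>}"
  proof (intro equalityI subsetI)
    fix x assume "x \<in> ?K2"
    then show "x \<in> {x \<in> carrier (lower T). p2 x = \<zero>\<^bsub>Q2\<^esub>}"
      unfolding mem_Collect_eq using Q2(4)[of x] subsetD[OF submodule_subset[OF s2], of x] by metis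
  next
    fix x assume "x \<in> {x \<in> carrier (lower T). p2 x = \<zero>\<^bsub>Q2\<^esub>}"
    then show "x \<in> ?K2" unfolding mem_Collect_eq using Q2(4)[of x] by metis
  qed
  ultimately have "mono_conflation A M B S f T (p1, p2) Q"
    unfolding mono_conflation_def short_exact_def fst_conv snd_conv Qs
    using O Q f p inj Q1(3) Q2(3) by (intro conjI)
  then show ?thesis by blast
qed

lemma inflation_iff: "inflation S T f \<longleftrightarrow> pure_mono S T f"
proof
  assume "inflation S T f"
  then obtain p Z where c: "mono_conflation A M B S f T p Z" unfolding inflation_def by blast
  note O = confl_obs[OF c] and H = confl_homs[OF c]
  have "\<exists>s \<in> carrier (TT S). tm S T (snd f) s = t"
    if x: "x \<in> carrier (upper S)" and t: "t \<in> carrier (TT T)" and eq: "fst f x = struct T t" for x t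
  proof (rule tensor_map_lift[OF O(1,2)[THEN ob_lower] hom_snd[OF H(1)] t])
    have "fst f x \<in> {x \<in> carrier (upper T). fst p x = \<zero>\<^bsub>upper Z\<^esub>}" unfolding confl_exact(1)[OF c, symmetric] using x by simp
    then have "struct Z (tm T Z (snd p) t) = \<zero>\<^bsub>upper Z\<^esub>" using hom_comm[OF H(2) t] eq by simp
    then have z: "tm T Z (snd p) t = \<zero>\<^bsub>TT Z\<^esub>" by (rule ob_mono[OF O(3) tensor_map_closed[OF O(2,3) hom_snd[OF H(2)] t]])
    fix i assume i: "i < d"
    have "snd p (coord (lower T) i t) = \<zero>\<^bsub>lower Z\<^esub>"
      using coord_tensor_map[OF O(2,3)[THEN ob_lower] hom_snd[OF H(2)] i t] z coord_zero[OF ob_lower[OF O(3)] i] by simp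
    then show "coord (lower T) i t \<in> snd f ` carrier (lower S)"
      unfolding confl_exact(2)[OF c] using coord_closed[OF ob_lower[OF O(2)] i t] by simp
  qed
  then show "pure_mono S T f" unfolding pure_mono_def using O H confl_inj[OF c] by blast
next
  assume "pure_mono S T f"
  then show "inflation S T f" using cokernel_triple unfolding inflation_def by blast
qed

lemma deflation_iff:
  "deflation T Z p \<longleftrightarrow> T \<in> Obs \<and> Z \<in> Obs \<and> p \<in> carrier (Mor T Z) \<and>
    fst p ` carrier (upper T) = carrier (upper Z) \<and> snd p ` carrier (lower T) = carrier (lower Z)" (is "_ \<longleftrightarrow> ?rhs")
proof
  assume "deflation T Z p"
  then obtain i X where c: "mono_conflation A M B X i T p Z" unfolding deflation_def by blast
  show ?rhs using confl_obs[OF c] confl_homs[OF c] confl_surj[OF c] by blast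
next
  assume r: ?rhs
  then have O: "T \<in> Obs" "Z \<in> Obs" "p \<in> carrier (Mor T Z)" by auto
  obtain K where K: "K \<in> Obs" "\<exists>i \<in> carrier (Mor K T). inj_on (fst i) (carrier (upper K)) \<and>
    inj_on (snd i) (carrier (lower K)) \<and> fst i ` carrier (upper K) = {x \<in> carrier (upper T). fst p x = \<zero>\<^bsub>upper Z\<^esub>} \<and>
    snd i ` carrier (lower K) = {y \<in> carrier (lower T). snd p y = \<zero>\<^bsub>lower Z\<^esub>}"
    by (rule bexE[OF kernel_triple[OF O]])
  obtain i where i: "i \<in> carrier (Mor K T)" "inj_on (fst i) (carrier (upper K)) \<and>
    inj_on (snd i) (carrier (lower K)) \<and> fst i ` carrier (upper K) = {x \<in> carrier (upper T). fst p x = \<zero>\<^bsub>upper Z\<^esub>} \<and>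
    snd i ` carrier (lower K) = {y \<in> carrier (lower T). snd p y = \<zero>\<^bsub>lower Z\<^esub>}"
    by (rule bexE[OF K(2)])
  have "mono_conflation A M B K i T p Z"
    unfolding mono_conflation_def short_exact_def using r K(1) i by (intro conjI) (elim conjE, assumption)+
  then show "deflation T Z p" unfolding deflation_def by blast
qed

lemma inflation_right_factor:
  assumes O: "X \<in> Obs" "Y \<in> Obs" "Z \<in> Obs" and f: "f \<in> carrier (Mor X Y)" and g: "g \<in> carrier (Mor Y Z)"
    and gf: "inflation X Z (triple_comp X Y Z g f)"
  shows "inflation X Y f"
  unfolding inflation_iff pure_mono_def
proof (intro conjI ballI impI O f)
  let ?h = "triple_comp X Y Z g f"
  have P: "pure_mono X Z ?h" using gf by (simp add: inflation_iff)
  then have h: "?h \<in> carrier (Mor X Z)" and inj: "inj_on (fst ?h) (carrier (upper X))" "inj_on (snd ?h) (carrier (lower X))"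
    by (auto simp: pure_mono_def)
  show "inj_on (fst f) (carrier (upper X))"
  proof (rule inj_onI)
    fix x y assume xy: "x \<in> carrier (upper X)" "y \<in> carrier (upper X)" "fst f x = fst f y"
    show "x = y" by (rule inj_onD[OF inj(1)]) (use xy in simp_all)
  qed
  show "inj_on (snd f) (carrier (lower X))"
  proof (rule inj_onI)
    fix x y assume xy: "x \<in> carrier (lower X)" "y \<in> carrier (lower X)" "snd f x = snd f y"
    show "x = y" by (rule inj_onD[OF inj(2)]) (use xy in simp_all)
  qed
  fix x t assume x: "x \<in> carrier (upper X)" and t: "t \<in> carrier (TT Y)" and eq: "fst f x = struct Y t"
  have gt: "tm Y Z (snd g) t \<in> carrier (TT Z)" by (rule tensor_map_closed[OF O(2,3) hom_snd[OF g] t])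
  have "fst ?h x = struct Z (tm Y Z (snd g) t)" using x eq hom_comm[OF g t] by simp
  then obtain s where s: "s \<in> carrier (TT X)" "tm X Z (snd ?h) s = tm Y Z (snd g) t"
    using P x gt unfolding pure_mono_def by blast
  have "fst ?h x = fst ?h (struct X s)" using hom_comm[OF h s(1)] s(2) x eq hom_comm[OF g t] by simp
  then have "x = struct X s" by (rule inj_onD[OF inj(1)]) (use x struct_closed[OF O(1) s(1)] in auto)
  then have "struct Y t = struct Y (tm X Y (snd f) s)" using eq hom_comm[OF f s(1)] by simp
  then have "t = tm X Y (snd f) s"
    by (rule inj_onD[OF ob_inj[OF O(2)]]) (use t tensor_map_closed[OF O(1,2) hom_snd[OF f] s(1)] in auto)
  then show "\<exists>s \<in> carrier (TT X). tm X Y (snd f) s = t" using s(1) by blast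
qed

lemma kernel_cokernel:
  assumes c: "mono_conflation A M B X i Y p Z"
  shows "is_kernel X i Y p Z" "is_cokernel X i Y p Z"
proof -
  note O = confl_obs[OF c] and H = confl_homs[OF c]
  have zero: "fst p (fst i x) = \<zero>\<^bsub>upper Z\<^esub>" if "x \<in> carrier (upper X)" for x
  proof -
    have "fst i x \<in> {x \<in> carrier (upper Y). fst p x = \<zero>\<^bsub>upper Z\<^esub>}" unfolding confl_exact(1)[OF c, symmetric] using that by simp
    then show ?thesis by simp
  qed
  have zero': "snd p (snd i x) = \<zero>\<^bsub>lower Z\<^esub>" if "x \<in> carrier (lower X)" for x
  proof -
    have "snd i x \<in> {x \<in> carrier (lower Y). snd p x = \<zero>\<^bsub>lower Z\<^esub>}" unfolding confl_exact(2)[OF c, symmetric] using that by simp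
    then show ?thesis by simp
  qed
  have pi: "triple_comp X Y Z p i = \<one>\<^bsub>Mor X Z\<^esub>"
    by (rule hom_eqI[OF comp_hom[OF O H] one_hom[OF O(1,3)]]) (simp_all add: zero zero')
  show "is_kernel X i Y p Z"
    unfolding is_kernel_def
  proof (intro conjI pi ballI impI)
    fix W f assume W: "W \<in> Obs" and f: "f \<in> carrier (Mor W Y)" and pf: "triple_comp W Y Z p f = \<one>\<^bsub>Mor W Z\<^esub>"
    show "\<exists>!g. g \<in> carrier (Mor W X) \<and> triple_comp W X Y i g = f"
    proof (rule triple_lift[OF O(1,2) W H(1) confl_inj[OF c] f])
      show "fst f ` carrier (upper W) \<subseteq> fst i ` carrier (upper X)"
        unfolding confl_exact(1)[OF c] using comp_eqD(1)[OF pf] hom_fst_closed[OF f] by auto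
      show "snd f ` carrier (lower W) \<subseteq> snd i ` carrier (lower X)"
        unfolding confl_exact(2)[OF c] using comp_eqD(2)[OF pf] hom_snd_closed[OF f] by auto
    qed
  qed
  show "is_cokernel X i Y p Z"
    unfolding is_cokernel_def
  proof (intro conjI pi ballI impI)
    fix W f assume W: "W \<in> Obs" and f: "f \<in> carrier (Mor Y W)" and fi: "triple_comp X Y W f i = \<one>\<^bsub>Mor X W\<^esub>"
    show "\<exists>!g. g \<in> carrier (Mor Z W) \<and> triple_comp Y Z W g p = f"
    proof (rule triple_factor[OF O(2,3) W H(2) confl_surj[OF c] f])
      fix x assume "x \<in> carrier (upper Y)" "fst p x = \<zero>\<^bsub>upper Z\<^esub>"
      then have "x \<in> fst i ` carrier (upper X)" unfolding confl_exact(1)[OF c] by simp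
      then show "fst f x = \<zero>\<^bsub>upper W\<^esub>" using comp_eqD(1)[OF fi] by auto
    next
      fix x assume "x \<in> carrier (lower Y)" "snd p x = \<zero>\<^bsub>lower Z\<^esub>"
      then have "x \<in> snd i ` carrier (lower X)" unfolding confl_exact(2)[OF c] by simp
      then show "snd f x = \<zero>\<^bsub>lower W\<^esub>" using comp_eqD(2)[OF fi] by auto
    qed
  qed
qed

lemma iso_bij:
  assumes O: "X \<in> Obs" "Y \<in> Obs" and "iso X Y a"
  shows "a \<in> carrier (Mor X Y)" "bij_betw (fst a) (carrier (upper X)) (carrier (upper Y))"
    "bij_betw (snd a) (carrier (lower X)) (carrier (lower Y))"
proof -
  show a: "a \<in> carrier (Mor X Y)" using assms(3) by (simp add: iso_def)
  obtain b where b: "b \<in> carrier (Mor Y X)" "triple_comp X Y X b a = triple_id X" "triple_comp Y X Y a b = triple_id Y"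
    using assms(3) by (auto simp: iso_def)
  show "bij_betw (fst a) (carrier (upper X)) (carrier (upper Y))"
    by (rule bij_betw_byWitness[of _ "fst b"])
      (use comp_eqD(1)[OF b(2)] comp_eqD(1)[OF b(3)] hom_fst_closed[OF a] hom_fst_closed[OF b(1)] in auto)
  show "bij_betw (snd a) (carrier (lower X)) (carrier (lower Y))"
    by (rule bij_betw_byWitness[of _ "snd b"])
      (use comp_eqD(2)[OF b(2)] comp_eqD(2)[OF b(3)] hom_snd_closed[OF a] hom_snd_closed[OF b(1)] in auto)
qed

lemma conflation_iso:
  assumes c: "mono_conflation A M B X i Y p Z" and O': "X' \<in> Obs" "Y' \<in> Obs" "Z' \<in> Obs"
    and isos: "iso X X' a" "iso Y Y' b" "iso Z Z' g"
    and i': "i' \<in> carrier (Mor X' Y')" and p': "p' \<in> carrier (Mor Y' Z')"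
    and e1: "triple_comp X X' Y' i' a = triple_comp X Y Y' b i" and e2: "triple_comp Y Y' Z' p' b = triple_comp Y Z Z' g p"
  shows "mono_conflation A M B X' i' Y' p' Z'"
proof -
  note O = confl_obs[OF c] and H = confl_homs[OF c]
  note a = iso_bij[OF O(1) O'(1) isos(1)] and b = iso_bij[OF O(2) O'(2) isos(2)] and g = iso_bij[OF O(3) O'(3) isos(3)]
  have ex: "short_exact (upper X) (fst i) (upper Y) (fst p) (upper Z)" "short_exact (lower X) (snd i) (lower Y) (snd p) (lower Z)"
    using c by (auto simp: mono_conflation_def)
  have "\<zero>\<^bsub>upper Z\<^esub> \<in> carrier (upper Z)" "\<zero>\<^bsub>lower Z\<^esub> \<in> carrier (lower Z)"
    using left_module.submodule_zero[OF ob_upper[OF O(3)]] left_module.submodule_zero[OF ob_lower[OF O(3)]]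
    by (auto dest: submodule_subset)
  note z = this mod_hom_zero[OF ob_upper[OF O(3)] ob_upper[OF O'(3)] hom_fst[OF g(1)]]
    mod_hom_zero[OF ob_lower[OF O(3)] ob_lower[OF O'(3)] hom_snd[OF g(1)]]
  have "short_exact (upper X') (fst i') (upper Y') (fst p') (upper Z')"
    by (rule short_exact_transport[OF ex(1) a(2) b(2) g(2)])
      (use comp_eqD(1)[OF e1] comp_eqD(1)[OF e2] hom_fst_closed[OF H(1)] z in auto)
  moreover have "short_exact (lower X') (snd i') (lower Y') (snd p') (lower Z')"
    by (rule short_exact_transport[OF ex(2) a(3) b(3) g(3)])
      (use comp_eqD(2)[OF e1] comp_eqD(2)[OF e2] hom_snd_closed[OF H(1)] z in auto)
  ultimately show ?thesis unfolding mono_conflation_def using O' i' p' by blast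
qed

lemma inflation_triple_id: "X \<in> Obs \<Longrightarrow> inflation X X (triple_id X)"
proof -
  assume X: "X \<in> Obs"
  have "tm X X (snd (triple_id X)) t = t" if "t \<in> carrier (TT X)" for t
    by (rule tensor_map_ident[OF ob_lower[OF X] hom_snd[OF id_hom[OF X]] _ that]) simp
  then show ?thesis unfolding inflation_iff pure_mono_def using X id_hom[OF X] by (auto simp: inj_on_def)
qed

lemma inflation_comp_triple:
  assumes "inflation X Y i" "inflation Y Z j"
  shows "inflation X Z (triple_comp X Y Z j i)"
proof -
  have i: "pure_mono X Y i" and j: "pure_mono Y Z j" using assms by (auto simp: inflation_iff)
  have O: "X \<in> Obs" "Y \<in> Obs" "Z \<in> Obs" and H: "i \<in> carrier (Mor X Y)" "j \<in> carrier (Mor Y Z)"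
    and inj: "inj_on (fst i) (carrier (upper X))" "inj_on (snd i) (carrier (lower X))"
      "inj_on (fst j) (carrier (upper Y))" "inj_on (snd j) (carrier (lower Y))"
    using i j by (auto simp: pure_mono_def)
  let ?h = "triple_comp X Y Z j i"
  show ?thesis
    unfolding inflation_iff pure_mono_def
  proof (intro conjI O comp_hom[OF O H] ballI impI)
    show "inj_on (fst ?h) (carrier (upper X))"
      using inj(1,3) hom_fst_closed[OF H(1)] unfolding inj_on_def by simp
    show "inj_on (snd ?h) (carrier (lower X))"
      using inj(2,4) hom_snd_closed[OF H(1)] unfolding inj_on_def by simp
    fix x t assume x: "x \<in> carrier (upper X)" and t: "t \<in> carrier (TT Z)" and eq: "fst ?h x = struct Z t"
    then have "fst j (fst i x) = struct Z t" by simp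
    then obtain s where s: "s \<in> carrier (TT Y)" "tm Y Z (snd j) s = t"
      using j t hom_fst_closed[OF H(1) x] unfolding pure_mono_def by blast
    have "fst j (fst i x) = fst j (struct Y s)" using eq x hom_comm[OF H(2) s(1)] s(2) by simp
    then have "fst i x = struct Y s"
      by (rule inj_onD[OF inj(3)]) (use hom_fst_closed[OF H(1) x] struct_closed[OF O(2) s(1)] in auto)
    then obtain r where r: "r \<in> carrier (TT X)" "tm X Y (snd i) r = s"
      using i x s(1) unfolding pure_mono_def by blast
    have "tm X Z (snd ?h) r = tm Y Z (snd j) (tm X Y (snd i) r)"
      by (rule tensor_map_comp[OF O[THEN ob_lower] hom_snd[OF H(1)] hom_snd[OF H(2)] hom_snd[OF comp_hom[OF O H]] _ r(1), symmetric])
        simp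
    then show "\<exists>s \<in> carrier (TT X). tm X Z (snd ?h) s = t" using r s(2) by blast
  qed
qed

lemma pushout_triple:
  assumes i: "inflation X Y i" and X': "X' \<in> Obs" and f: "f \<in> carrier (Mor X X')"
  shows "\<exists>Q \<in> Obs. \<exists>u j. is_pushout X Y X' Q i f u j \<and> inflation X' Q j"
proof -
  obtain p Z where c: "mono_conflation A M B X i Y p Z" using i unfolding inflation_def by blast
  note O = confl_obs[OF c] and H = confl_homs[OF c]
  obtain P iY iX pY pX where P: "is_biproduct Y X' P iY iX pY pX" using ex_biproduct[OF O(2) X'] by blast
  then have PO: "P \<in> Obs" and bh: "iY \<in> carrier (Mor Y P)" "iX \<in> carrier (Mor X' P)" "pY \<in> carrier (Mor P Y)" "pX \<in> carrier (Mor P X')"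
    by (auto simp: is_biproduct_def)
  note be = biproduct_elem[OF P]
  interpret G: comm_group "Mor X P" by (rule mor_comm_group[OF O(1) PO])
  let ?a = "triple_comp X Y P iY i" and ?b = "triple_comp X X' P iX f"
  have a: "?a \<in> carrier (Mor X P)" by (rule comp_hom[OF O(1,2) PO H(1) bh(1)])
  have b: "?b \<in> carrier (Mor X P)" by (rule comp_hom[OF O(1) X' PO f bh(2)])
  define dd where "dd = ?a \<otimes>\<^bsub>Mor X P\<^esub> inv\<^bsub>Mor X P\<^esub> ?b"
  have dd: "dd \<in> carrier (Mor X P)" using a b by (simp add: dd_def)
  have d1: "fst dd x = fst iY (fst i x) \<ominus>\<^bsub>upper P\<^esub> fst iX (fst f x)" if "x \<in> carrier (upper X)" for x
    using that inv_elem(1)[OF O(1) PO b that] by (simp add: dd_def a_minus_def)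
  have d2: "snd dd y = snd iY (snd i y) \<ominus>\<^bsub>lower P\<^esub> snd iX (snd f y)" if "y \<in> carrier (lower X)" for y
    using that inv_elem(2)[OF O(1) PO b that] by (simp add: dd_def a_minus_def)
  interpret UY: left_module A "upper Y" by (rule ob_upper[OF O(2)])
  interpret LY: left_module B "lower Y" by (rule ob_lower[OF O(2)])
  have "triple_comp X P Y pY dd = i"
  proof (rule hom_eqI[OF comp_hom[OF O(1) PO O(2) dd bh(3)] H(1)])
    fix x assume x: "x \<in> carrier (upper X)"
    show "fst (triple_comp X P Y pY dd) x = fst i x"
      using x hom_fst_closed[OF H(1) x] hom_fst_closed[OF f x] hom_fst_closed[OF bh(1)] hom_fst_closed[OF bh(2)]
      by (simp add: d1 mod_hom_minus[OF ob_upper[OF PO] ob_upper[OF O(2)] hom_fst[OF bh(3)]] be) (simp add: a_minus_def)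
  next
    fix x assume x: "x \<in> carrier (lower X)"
    show "snd (triple_comp X P Y pY dd) x = snd i x"
      using x hom_snd_closed[OF H(1) x] hom_snd_closed[OF f x] hom_snd_closed[OF bh(1)] hom_snd_closed[OF bh(2)]
      by (simp add: d2 mod_hom_minus[OF ob_lower[OF PO] ob_lower[OF O(2)] hom_snd[OF bh(3)]] be) (simp add: a_minus_def)
  qed
  then have "inflation X P dd" using inflation_right_factor[OF O(1) PO O(2) dd bh(3)] i by simp
  then obtain q Q where q: "mono_conflation A M B X dd P q Q" unfolding inflation_def by blast
  note QO = confl_obs(3)[OF q] and qh = confl_homs(2)[OF q]
  let ?j = "triple_comp X' P Q q iX"
  have j: "?j \<in> carrier (Mor X' Q)" by (rule comp_hom[OF X' PO QO bh(2) qh])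
  have po: "is_pushout X Y X' Q i f (triple_comp Y P Q q iY) ?j"
    using pushout_of_cokernel[OF P O(1) QO H(1) f qh] kernel_cokernel(2)[OF q] by (simp add: dd_def)
  let ?w = "triple_comp P Y Z p pY"
  have w: "?w \<in> carrier (Mor P Z)" by (rule comp_hom[OF PO O(2,3) bh(3) H(2)])
  have "triple_comp X P Z ?w dd = \<one>\<^bsub>Mor X Z\<^esub>"
    using comp_assoc[OF O(1) PO O(2,3) dd bh(3) H(2)] \<open>triple_comp X P Y pY dd = i\<close> kernel_cokernel(1)[OF c]
    by (simp add: is_kernel_def)
  then have "\<exists>!p'. p' \<in> carrier (Mor Q Z) \<and> triple_comp P Q Z p' q = ?w"
    using kernel_cokernel(2)[OF q] O(3) w unfolding is_cokernel_def by blast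
  then obtain p' where p': "p' \<in> carrier (Mor Q Z)" "triple_comp P Q Z p' q = ?w" by blast
  have ex: "short_exact (upper X) (fst i) (upper Y) (fst p) (upper Z)" "short_exact (lower X) (snd i) (lower Y) (snd p) (lower Z)"
    using c by (auto simp: mono_conflation_def)
  have "short_exact (upper X') (fst ?j) (upper Q) (fst p') (upper Z)"
  proof (rule short_exact_pushout[OF ob_upper[OF O(1)] ob_upper[OF O(2)] ob_upper[OF O(3)] ob_upper[OF X'] ob_upper[OF PO]
        ob_upper[OF QO] ex(1) hom_fst[OF H(1)] hom_fst[OF H(2)] hom_fst[OF f] hom_fst[OF bh(1)] hom_fst[OF bh(2)]
        hom_fst[OF bh(3)] hom_fst[OF bh(4)] hom_fst[OF qh] hom_fst[OF p'(1)] be(1,2,4,5) confl_surj(1)[OF q]])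
    fix z assume "z \<in> carrier (upper P)" "fst q z = \<zero>\<^bsub>upper Q\<^esub>"
    then have "z \<in> fst dd ` carrier (upper X)" unfolding confl_exact(1)[OF q] by simp
    then show "\<exists>x \<in> carrier (upper X). z = fst iY (fst i x) \<ominus>\<^bsub>upper P\<^esub> fst iX (fst f x)" using d1 by auto
  next
    fix x assume x: "x \<in> carrier (upper X)"
    have "fst dd x \<in> fst dd ` carrier (upper X)" using x by simp
    then show "fst q (fst iY (fst i x) \<ominus>\<^bsub>upper P\<^esub> fst iX (fst f x)) = \<zero>\<^bsub>upper Q\<^esub>"
      unfolding confl_exact(1)[OF q] using d1[OF x] by simp
  next
    fix z assume "z \<in> carrier (upper P)"
    then show "fst p' (fst q z) = fst p (fst pY z)" using comp_eqD(1)[OF p'(2)] by simp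
  qed simp_all
  moreover have "short_exact (lower X') (snd ?j) (lower Q) (snd p') (lower Z)"
  proof (rule short_exact_pushout[OF ob_lower[OF O(1)] ob_lower[OF O(2)] ob_lower[OF O(3)] ob_lower[OF X'] ob_lower[OF PO]
        ob_lower[OF QO] ex(2) hom_snd[OF H(1)] hom_snd[OF H(2)] hom_snd[OF f] hom_snd[OF bh(1)] hom_snd[OF bh(2)]
        hom_snd[OF bh(3)] hom_snd[OF bh(4)] hom_snd[OF qh] hom_snd[OF p'(1)] be(6,7,9,10) confl_surj(2)[OF q]])
    fix z assume "z \<in> carrier (lower P)" "snd q z = \<zero>\<^bsub>lower Q\<^esub>"
    then have "z \<in> snd dd ` carrier (lower X)" unfolding confl_exact(2)[OF q] by simp
    then show "\<exists>x \<in> carrier (lower X). z = snd iY (snd i x) \<ominus>\<^bsub>lower P\<^esub> snd iX (snd f x)" using d2 by auto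
  next
    fix x assume x: "x \<in> carrier (lower X)"
    have "snd dd x \<in> snd dd ` carrier (lower X)" using x by simp
    then show "snd q (snd iY (snd i x) \<ominus>\<^bsub>lower P\<^esub> snd iX (snd f x)) = \<zero>\<^bsub>lower Q\<^esub>"
      unfolding confl_exact(2)[OF q] using d2[OF x] by simp
  next
    fix z assume "z \<in> carrier (lower P)"
    then show "snd p' (snd q z) = snd p (snd pY z)" using comp_eqD(2)[OF p'(2)] by simp
  qed simp_all
  ultimately have "mono_conflation A M B X' ?j Q p' Z"
    unfolding mono_conflation_def using X' QO O(3) j p'(1) by blast
  then have "inflation X' Q ?j" unfolding inflation_def by blast
  then show ?thesis using QO po by blast
qed

lemma pullback_triple:
  assumes p: "deflation Y Z p" and Z': "Z' \<in> Obs" and f: "f \<in> carrier (Mor Z' Z)"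
  shows "\<exists>Q \<in> Obs. \<exists>u q. is_pullback Y Z Z' Q p f u q \<and> deflation Q Z' q"
proof -
  have O: "Y \<in> Obs" "Z \<in> Obs" and ph: "p \<in> carrier (Mor Y Z)"
    and surj: "fst p ` carrier (upper Y) = carrier (upper Z)" "snd p ` carrier (lower Y) = carrier (lower Z)"
    using p by (auto simp: deflation_iff)
  obtain P iY iZ pY pZ where P: "is_biproduct Y Z' P iY iZ pY pZ" using ex_biproduct[OF O(1) Z'] by blast
  then have PO: "P \<in> Obs" and bh: "iY \<in> carrier (Mor Y P)" "iZ \<in> carrier (Mor Z' P)" "pY \<in> carrier (Mor P Y)" "pZ \<in> carrier (Mor P Z')"
    by (auto simp: is_biproduct_def)
  note be = biproduct_elem[OF P]
  interpret G: comm_group "Mor P Z" by (rule mor_comm_group[OF PO O(2)])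
  let ?a = "triple_comp P Y Z p pY" and ?b = "triple_comp P Z' Z f pZ"
  have a: "?a \<in> carrier (Mor P Z)" by (rule comp_hom[OF PO O bh(3) ph])
  have b: "?b \<in> carrier (Mor P Z)" by (rule comp_hom[OF PO Z' O(2) bh(4) f])
  define dd where "dd = ?a \<otimes>\<^bsub>Mor P Z\<^esub> inv\<^bsub>Mor P Z\<^esub> ?b"
  have dd: "dd \<in> carrier (Mor P Z)" using a b by (simp add: dd_def)
  interpret UZ: left_module A "upper Z" by (rule ob_upper[OF O(2)])
  interpret LZ: left_module B "lower Z" by (rule ob_lower[OF O(2)])
  interpret UZ': left_module A "upper Z'" by (rule ob_upper[OF Z'])
  interpret LZ': left_module B "lower Z'" by (rule ob_lower[OF Z'])
  interpret UY: left_module A "upper Y" by (rule ob_upper[OF O(1)])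
  interpret LY: left_module B "lower Y" by (rule ob_lower[OF O(1)])
  interpret UP: left_module A "upper P" by (rule ob_upper[OF PO])
  interpret LP: left_module B "lower P" by (rule ob_lower[OF PO])
  have d1: "fst dd x = fst p (fst pY x) \<ominus>\<^bsub>upper Z\<^esub> fst f (fst pZ x)" if "x \<in> carrier (upper P)" for x
    using that inv_elem(1)[OF PO O(2) b that] by (simp add: dd_def a_minus_def)
  have d2: "snd dd y = snd p (snd pY y) \<ominus>\<^bsub>lower Z\<^esub> snd f (snd pZ y)" if "y \<in> carrier (lower P)" for y
    using that inv_elem(2)[OF PO O(2) b that] by (simp add: dd_def a_minus_def)
  have e1: "fst dd (fst iY y \<oplus>\<^bsub>upper P\<^esub> fst iZ z) = fst p y \<ominus>\<^bsub>upper Z\<^esub> fst f z"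
    if "y \<in> carrier (upper Y)" "z \<in> carrier (upper Z')" for y z
    using that hom_fst_closed[OF bh(1)] hom_fst_closed[OF bh(2)]
    by (simp add: d1 mod_hom_add[OF hom_fst[OF bh(3)]] mod_hom_add[OF hom_fst[OF bh(4)]] be)
  have e2: "snd dd (snd iY y \<oplus>\<^bsub>lower P\<^esub> snd iZ z) = snd p y \<ominus>\<^bsub>lower Z\<^esub> snd f z"
    if "y \<in> carrier (lower Y)" "z \<in> carrier (lower Z')" for y z
    using that hom_snd_closed[OF bh(1)] hom_snd_closed[OF bh(2)]
    by (simp add: d2 mod_hom_add[OF hom_snd[OF bh(3)]] mod_hom_add[OF hom_snd[OF bh(4)]] be)
  have "deflation P Z dd"
    unfolding deflation_iff
  proof (intro conjI PO O(2) dd)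
    show "fst dd ` carrier (upper P) = carrier (upper Z)"
    proof
      show "carrier (upper Z) \<subseteq> fst dd ` carrier (upper P)"
      proof
        fix z assume "z \<in> carrier (upper Z)"
        then have "z \<in> fst p ` carrier (upper Y)" using surj by simp
        then obtain y where y: "y \<in> carrier (upper Y)" "z = fst p y" by blast
        have "fst dd (fst iY y \<oplus>\<^bsub>upper P\<^esub> fst iZ \<zero>\<^bsub>upper Z'\<^esub>) = z"
          using e1[OF y(1), of "\<zero>\<^bsub>upper Z'\<^esub>"] y hom_fst_closed[OF ph y(1)]
          by (simp add: mod_hom_zero[OF ob_upper[OF Z'] ob_upper[OF O(2)] hom_fst[OF f]] a_minus_def)
        moreover have "fst iY y \<oplus>\<^bsub>upper P\<^esub> fst iZ \<zero>\<^bsub>upper Z'\<^esub> \<in> carrier (upper P)"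
          using hom_fst_closed[OF bh(1) y(1)] hom_fst_closed[OF bh(2)] by simp
        ultimately show "z \<in> fst dd ` carrier (upper P)" by (intro image_eqI[OF sym])
      qed
    qed (use hom_fst_closed[OF dd] in auto)
    show "snd dd ` carrier (lower P) = carrier (lower Z)"
    proof
      show "carrier (lower Z) \<subseteq> snd dd ` carrier (lower P)"
      proof
        fix z assume "z \<in> carrier (lower Z)"
        then have "z \<in> snd p ` carrier (lower Y)" using surj by simp
        then obtain y where y: "y \<in> carrier (lower Y)" "z = snd p y" by blast
        have "snd dd (snd iY y \<oplus>\<^bsub>lower P\<^esub> snd iZ \<zero>\<^bsub>lower Z'\<^esub>) = z"
          using e2[OF y(1), of "\<zero>\<^bsub>lower Z'\<^esub>"] y hom_snd_closed[OF ph y(1)]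
          by (simp add: mod_hom_zero[OF ob_lower[OF Z'] ob_lower[OF O(2)] hom_snd[OF f]] a_minus_def)
        moreover have "snd iY y \<oplus>\<^bsub>lower P\<^esub> snd iZ \<zero>\<^bsub>lower Z'\<^esub> \<in> carrier (lower P)"
          using hom_snd_closed[OF bh(1) y(1)] hom_snd_closed[OF bh(2)] by simp
        ultimately show "z \<in> snd dd ` carrier (lower P)" by (intro image_eqI[OF sym])
      qed
    qed (use hom_snd_closed[OF dd] in auto)
  qed
  then obtain k Q where k: "mono_conflation A M B Q k P dd Z" unfolding deflation_def by blast
  note QO = confl_obs(1)[OF k] and kh = confl_homs(1)[OF k]
  let ?q = "triple_comp Q P Z' pZ k"
  have q: "?q \<in> carrier (Mor Q Z')" by (rule comp_hom[OF QO PO Z' kh bh(4)])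
  have pb: "is_pullback Y Z Z' Q p f (triple_comp Q P Y pY k) ?q"
    using pullback_of_kernel[OF P O(2) QO ph f kh] kernel_cokernel(1)[OF k] by (simp add: dd_def)
  have "deflation Q Z' ?q"
    unfolding deflation_iff
  proof (intro conjI QO Z' q)
    show "fst ?q ` carrier (upper Q) = carrier (upper Z')"
    proof
      show "carrier (upper Z') \<subseteq> fst ?q ` carrier (upper Q)"
      proof
        fix z assume z: "z \<in> carrier (upper Z')"
        have fz: "fst f z \<in> carrier (upper Z)" by (rule hom_fst_closed[OF f z])
        then have "fst f z \<in> fst p ` carrier (upper Y)" using surj by simp
        then obtain y where y: "y \<in> carrier (upper Y)" "fst f z = fst p y" by blast
        let ?w = "fst iY y \<oplus>\<^bsub>upper P\<^esub> fst iZ z"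
        have cl: "fst iY y \<in> carrier (upper P)" "fst iZ z \<in> carrier (upper P)"
          by (rule hom_fst_closed[OF bh(1) y(1)], rule hom_fst_closed[OF bh(2) z])
        have "fst dd ?w = \<zero>\<^bsub>upper Z\<^esub>" using e1[OF y(1) z] y(2) fz by (simp add: UZ.X.minus_eq_zero_iff)
        then have "?w \<in> fst k ` carrier (upper Q)" unfolding confl_exact(1)[OF k] using cl by simp
        then obtain r where r: "r \<in> carrier (upper Q)" "?w = fst k r" by blast
        have "fst ?q r = fst pZ ?w" using r by simp
        also have "\<dots> = z" using cl z y(1) by (simp add: mod_hom_add[OF hom_fst[OF bh(4)]] be)
        finally show "z \<in> fst ?q ` carrier (upper Q)" using r(1) by (intro image_eqI[OF sym])
      qed
    qed (use hom_fst_closed[OF q] in auto)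
    show "snd ?q ` carrier (lower Q) = carrier (lower Z')"
    proof
      show "carrier (lower Z') \<subseteq> snd ?q ` carrier (lower Q)"
      proof
        fix z assume z: "z \<in> carrier (lower Z')"
        have fz: "snd f z \<in> carrier (lower Z)" by (rule hom_snd_closed[OF f z])
        then have "snd f z \<in> snd p ` carrier (lower Y)" using surj by simp
        then obtain y where y: "y \<in> carrier (lower Y)" "snd f z = snd p y" by blast
        let ?w = "snd iY y \<oplus>\<^bsub>lower P\<^esub> snd iZ z"
        have cl: "snd iY y \<in> carrier (lower P)" "snd iZ z \<in> carrier (lower P)"
          by (rule hom_snd_closed[OF bh(1) y(1)], rule hom_snd_closed[OF bh(2) z])
        have "snd dd ?w = \<zero>\<^bsub>lower Z\<^esub>" using e2[OF y(1) z] y(2) fz by (simp add: LZ.X.minus_eq_zero_iff)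
        then have "?w \<in> snd k ` carrier (lower Q)" unfolding confl_exact(2)[OF k] using cl by simp
        then obtain r where r: "r \<in> carrier (lower Q)" "?w = snd k r" by blast
        have "snd ?q r = snd pZ ?w" using r by simp
        also have "\<dots> = z" using cl z y(1) by (simp add: mod_hom_add[OF hom_snd[OF bh(4)]] be)
        finally show "z \<in> snd ?q ` carrier (lower Q)" using r(1) by (intro image_eqI[OF sym])
      qed
    qed (use hom_snd_closed[OF q] in auto)
  qed
  then show ?thesis using QO pb by blast
qed

lemma mono_exact_category:
  "exact_category (mono_objects A M B) (triple_hom A M B) triple_comp triple_id (mono_conflation A M B)"
proof (intro exact_category.intro exact_category_axioms.intro)
  show "category_with_conflations (mono_objects A M B) (triple_hom A M B) triple_comp triple_id"
    by (rule category_with_conflations_axioms)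
next
  fix X i Y p Z assume c: "mono_conflation A M B X i Y p Z"
  then show "X \<in> Obs \<and> Y \<in> Obs \<and> Z \<in> Obs \<and> i \<in> carrier (Mor X Y) \<and> p \<in> carrier (Mor Y Z) \<and>
      is_kernel X i Y p Z \<and> is_cokernel X i Y p Z"
    using confl_obs[OF c] confl_homs[OF c] kernel_cokernel[OF c] by blast
next
  show "\<lbrakk>deflation X Y p; deflation Y Z q\<rbrakk> \<Longrightarrow> deflation X Z (triple_comp X Y Z q p)" for X Y Z p q
  proof -
    assume p: "deflation X Y p" and q: "deflation Y Z q"
    then have "fst (triple_comp X Y Z q p) ` carrier (upper X) = fst q ` fst p ` carrier (upper X)"
      "snd (triple_comp X Y Z q p) ` carrier (lower X) = snd q ` snd p ` carrier (lower X)"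
      unfolding image_image by (auto intro!: image_cong)
    then show ?thesis using p q comp_hom[of X Y Z p q] unfolding deflation_iff by simp
  qed
  show "X \<in> Obs \<Longrightarrow> deflation X X (triple_id X)" for X
    unfolding deflation_iff using id_hom[of X] by (auto simp: image_iff)
qed (fact conflation_iso inflation_triple_id inflation_comp_triple pushout_triple pullback_triple)+

end

section \<open>Projective and injective objects\<close>

lemma projective_moduleD:
  fixes X Y :: "'a fgmod"
  assumes "projective_module A P" "fg_module A X" "fg_module A Y" "g \<in> mod_hom A X Y" "h \<in> mod_hom A P Y"
    "g ` carrier X = carrier Y"
  shows "\<exists>k \<in> mod_hom A P X. \<forall>p \<in> carrier P. g (k p) = h p"
  using assms unfolding projective_module_def by blast

lemma projective_module_retract:
  assumes E: "projective_module A E" and F: "fg_module A F"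
    and f: "f \<in> mod_hom A E F" and g: "g \<in> mod_hom A F E" and fg: "\<And>y. y \<in> carrier F \<Longrightarrow> f (g y) = y"
  shows "projective_module A F"
  unfolding projective_module_def
proof (intro conjI allI impI ballI F)
  note FM = fg_moduleD[OF F]
  have EM: "left_module A E" using E by (simp add: projective_module_def fg_module_def)
  fix X Y :: "'a fgmod" and p h
  assume XY: "fg_module A X \<and> fg_module A Y" and p: "p \<in> mod_hom A X Y" and h: "h \<in> mod_hom A F Y"
    and surj: "p ` carrier X = carrier Y"
  have "\<exists>k \<in> mod_hom A E X. \<forall>x \<in> carrier E. p (k x) = compose (carrier E) h f x"
    by (rule projective_moduleD[OF E _ _ p mod_hom_compose[OF EM f h] surj]) (use XY in auto)
  then obtain k where k: "k \<in> mod_hom A E X" "\<forall>x \<in> carrier E. p (k x) = compose (carrier E) h f x" by blast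
  show "\<exists>k \<in> mod_hom A F X. \<forall>x \<in> carrier F. p (k x) = h x"
  proof (intro bexI ballI)
    show "compose (carrier F) k g \<in> mod_hom A F X" by (rule mod_hom_compose[OF FM g k(1)])
    fix y assume y: "y \<in> carrier F"
    then show "p (compose (carrier F) k g y) = h y"
      using k(2) mod_hom_closed[OF g y] fg[OF y] by (simp add: compose_eq)
  qed
qed

lemma (in ring) projective_regular_module: "projective_module R (regular_module R)"
  unfolding projective_module_def
proof (intro conjI allI impI ballI fg_regular_module ring_axioms)
  fix X Y :: "'a fgmod" and p h
  assume XY: "fg_module R X \<and> fg_module R Y" and p: "p \<in> mod_hom R X Y"
    and h: "h \<in> mod_hom R (regular_module R) Y" and surj: "p ` carrier X = carrier Y"
  interpret X: left_module R X by (rule fg_moduleD[OF conjunct1[OF XY]])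
  have "h \<one> \<in> carrier Y" using mod_hom_closed[OF h, of \<one>] by simp
  then have "h \<one> \<in> p ` carrier X" using surj by simp
  then obtain x where x: "x \<in> carrier X" "h \<one> = p x" by blast
  show "\<exists>k \<in> mod_hom R (regular_module R) X. \<forall>a \<in> carrier (regular_module R). p (k a) = h a"
  proof (intro bexI ballI)
    show "(\<lambda>a \<in> carrier R. a \<odot>\<^bsub>X\<^esub> x) \<in> mod_hom R (regular_module R) X" by (rule X.mod_hom_scale_right[OF x(1)])
    fix a assume "a \<in> carrier (regular_module R)"
    then show "p ((\<lambda>a \<in> carrier R. a \<odot>\<^bsub>X\<^esub> x) a) = h a"
      using mod_hom_smult[OF p, of a x] x regular_hom_eq[OF ring_axioms h, of a] by simp
  qed
qed

lemma injective_zero_module: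
  assumes "ring A" shows "injective_module A (zero_module z)"
  unfolding injective_module_def
proof (intro conjI allI impI ballI fg_zero_module assms)
  fix X Y :: "'a fgmod" and i h
  assume XY: "fg_module A X \<and> fg_module A Y" and i: "i \<in> mod_hom A X Y" and h: "h \<in> mod_hom A X (zero_module z)"
  show "\<exists>k \<in> mod_hom A Y (zero_module z). \<forall>x \<in> carrier X. k (i x) = h x"
  proof (intro bexI ballI)
    show "(\<lambda>y \<in> carrier Y. z) \<in> mod_hom A Y (zero_module z)"
      by (rule mod_homI[OF fg_moduleD[OF conjunct2[OF XY]]]) auto
    show "(\<lambda>y \<in> carrier Y. z) (i x) = h x" if "x \<in> carrier X" for x
      using that mod_hom_closed[OF i that] mod_hom_closed[OF h that] by simp
  qed
qed

lemma mod_hom_copair: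
  assumes "left_module A X" "left_module A Y" "left_module A Z" "f \<in> mod_hom A X Z" "g \<in> mod_hom A Y Z"
    and "left_module A (dsum X Y)"
  shows "(\<lambda>z \<in> carrier (dsum X Y). f (fst z) \<oplus>\<^bsub>Z\<^esub> g (snd z)) \<in> mod_hom A (dsum X Y) Z"
proof -
  interpret Z: left_module A Z by (rule assms)
  note f = mod_homD[OF assms(4)] and g = mod_homD[OF assms(5)]
  show ?thesis
    by (rule mod_homI[OF assms(6)]) (auto simp: f g Z.smult_r_distr Z.X.a_ac)
qed

context mono_category
begin

definition induced :: "('a, 'm, 'b) triple \<Rightarrow> bool" where
  "induced T \<longleftrightarrow> T \<in> Obs \<and> struct T ` carrier (TT T) = carrier (upper T)"

lemma ex_induced:
  assumes X: "fg_module B X"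
  shows "\<exists>T. induced T \<and> lower T = X"
proof -
  note XM = fg_moduleD[OF X]
  obtain U :: "'a fgmod" and s t where U: "fg_module A U" "s \<in> mod_hom A (tensor M B X) U" "t \<in> mod_hom A U (tensor M B X)"
    "\<And>x. x \<in> carrier (tensor M B X) \<Longrightarrow> t (s x) = x" "\<And>y. y \<in> carrier U \<Longrightarrow> s (t y) = y"
    using fg_module_rep[OF fg_tensor[OF fg_M X]] by metis
  define T :: "('a, 'm, 'b) triple" where "T = \<lparr>upper = U, lower = X, struct = s\<rparr>"
  have Ts [simp]: "upper T = U" "lower T = X" "struct T = s" by (simp_all add: T_def)
  have "T \<in> Obs"
  proof (rule obI)
    fix c assume c: "c \<in> carrier (TT T)" "struct T c = \<zero>\<^bsub>upper T\<^esub>"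
    have "c = t (s c)" using U(4)[of c] c(1) by simp
    also have "\<dots> = t \<zero>\<^bsub>U\<^esub>" using c(2) by simp
    also have "\<dots> = \<zero>\<^bsub>TT T\<^esub>" using mod_hom_zero[OF fg_moduleD[OF U(1)] tensor_left_module[OF XM] U(3)] by simp
    finally show "c = \<zero>\<^bsub>TT T\<^esub>" .
  qed (use U X in simp_all)
  moreover have "s ` carrier (tensor M B X) = carrier U"
  proof
    show "carrier U \<subseteq> s ` carrier (tensor M B X)"
      using U(5) mod_hom_closed[OF U(3)] by (intro subsetI image_eqI[OF sym]) auto
  qed (use mod_hom_closed[OF U(2)] in auto)
  ultimately show ?thesis unfolding induced_def by (intro exI[of _ T]) simp
qed

lemma induced_hom:
  assumes S: "induced S" and T: "T \<in> Obs" and h: "h \<in> mod_hom B (lower S) (lower T)"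
  shows "\<exists>f \<in> carrier (Mor S T). snd f = h"
proof -
  have SO: "S \<in> Obs" and surj: "struct S ` carrier (TT S) = carrier (upper S)" using S by (auto simp: induced_def)
  have tmh: "tm S T h \<in> mod_hom A (TT S) (TT T)" by (rule tensor_map_hom[OF ob_lower[OF SO] ob_lower[OF T] h])
  have c: "compose (carrier (TT S)) (struct T) (tm S T h) \<in> mod_hom A (TT S) (upper T)"
    by (rule mod_hom_compose[OF ob_tensor[OF SO] tmh ob_struct[OF T]])
  have "compose (carrier (TT S)) (struct T) (tm S T h) t = \<zero>\<^bsub>upper T\<^esub>"
    if "t \<in> carrier (TT S)" "struct S t = \<zero>\<^bsub>upper S\<^esub>" for t
    using ob_mono[OF SO that] that(1) mod_hom_zero[OF ob_tensor[OF SO] ob_tensor[OF T] tmh]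
      mod_hom_zero[OF ob_tensor[OF T] ob_upper[OF T] ob_struct[OF T]] by (simp add: compose_eq)
  then obtain k where k: "k \<in> mod_hom A (upper S) (upper T)"
    "\<And>t. t \<in> carrier (TT S) \<Longrightarrow> k (struct S t) = compose (carrier (TT S)) (struct T) (tm S T h) t"
    using factor_through_surj[OF ob_tensor[OF SO] ob_upper[OF SO] ob_upper[OF T] ob_struct[OF SO] surj c] by metis
  have "(k, h) \<in> carrier (Mor S T)" by (rule homI[OF k(1) h]) (simp add: k(2) compose_eq)
  then show ?thesis by (intro bexI[of _ "(k, h)"]) auto
qed

lemma induced_inflation:
  assumes S: "induced S" and T: "induced T" and f: "f \<in> carrier (Mor S T)"
    and inj: "inj_on (snd f) (carrier (lower S))"
  shows "inflation S T f"
proof -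
  have SO: "S \<in> Obs" and surj: "struct S ` carrier (TT S) = carrier (upper S)" using S by (auto simp: induced_def)
  have TO: "T \<in> Obs" using T by (simp add: induced_def)
  have pure: "\<exists>s \<in> carrier (TT S). tm S T (snd f) s = t \<and> x = struct S s"
    if x: "x \<in> carrier (upper S)" and t: "t \<in> carrier (TT T)" and eq: "fst f x = struct T t" for x t
  proof -
    obtain s where s: "s \<in> carrier (TT S)" "x = struct S s" using x surj by blast
    have "struct T (tm S T (snd f) s) = struct T t" using hom_comm[OF f s(1)] eq s(2) by simp
    then have "tm S T (snd f) s = t"
      by (rule inj_onD[OF ob_inj[OF TO]]) (use t tensor_map_closed[OF SO TO hom_snd[OF f] s(1)] in auto)
    then show ?thesis using s by blast
  qed
  have "x = \<zero>\<^bsub>upper S\<^esub>" if x: "x \<in> carrier (upper S)" and eq: "fst f x = \<zero>\<^bsub>upper T\<^esub>" for x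
  proof -
    interpret TT: left_module A "TT T" by (rule ob_tensor[OF TO])
    have "fst f x = struct T \<zero>\<^bsub>TT T\<^esub>" using eq mod_hom_zero[OF ob_tensor[OF TO] ob_upper[OF TO] ob_struct[OF TO]] by simp
    then obtain s where s: "s \<in> carrier (TT S)" "tm S T (snd f) s = \<zero>\<^bsub>TT T\<^esub>" "x = struct S s"
      using pure[OF x TT.X.zero_closed] by blast
    then have "s = \<zero>\<^bsub>TT S\<^esub>" by (intro tensor_map_inj[OF ob_lower[OF SO] ob_lower[OF TO] hom_snd[OF f] inj])
    then show ?thesis using s(3) mod_hom_zero[OF ob_tensor[OF SO] ob_upper[OF SO] ob_struct[OF SO]] by simp
  qed
  then have "inj_on (fst f) (carrier (upper S))"
    unfolding mod_hom_inj_iff[OF ob_upper[OF SO] ob_upper[OF TO] hom_fst[OF f]] by blast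
  then show ?thesis unfolding inflation_iff pure_mono_def using SO TO f inj pure by blast
qed

lemma injective_objectI:
  assumes T: "T \<in> Obs" and U: "injective_module A (upper T)" and L: "injective_module B (lower T)"
  shows "injective_object T"
  unfolding injective_object_def
proof (intro conjI allI impI ballI T)
  fix X Y i h assume infl: "inflation X Y i" and h: "h \<in> carrier (Mor X T)"
  have pm: "pure_mono X Y i" using infl by (simp add: inflation_iff)
  then have O: "X \<in> Obs" "Y \<in> Obs" and i: "i \<in> carrier (Mor X Y)"
    and inj: "inj_on (fst i) (carrier (upper X))" "inj_on (snd i) (carrier (lower X))"
    by (auto simp: pure_mono_def)
  interpret UX: left_module A "upper X" by (rule ob_upper[OF O(1)])
  interpret UY: left_module A "upper Y" by (rule ob_upper[OF O(2)])
  interpret UT: left_module A "upper T" by (rule ob_upper[OF T])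
  interpret TY: left_module A "TT Y" by (rule ob_tensor[OF O(2)])
  have "\<exists>k \<in> mod_hom B (lower Y) (lower T). \<forall>y \<in> carrier (lower X). k (snd i y) = snd h y"
  proof (rule injective_extend[OF ob_fg_lower[OF O(1)] ob_fg_lower[OF O(2)] L hom_snd[OF i] hom_snd[OF h]])
    fix y assume "y \<in> carrier (lower X)" "snd i y = \<zero>\<^bsub>lower Y\<^esub>"
    then have "y = \<zero>\<^bsub>lower X\<^esub>"
      using inj(2) unfolding mod_hom_inj_iff[OF ob_lower[OF O(1)] ob_lower[OF O(2)] hom_snd[OF i]] by blast
    then show "snd h y = \<zero>\<^bsub>lower T\<^esub>" using mod_hom_zero[OF ob_lower[OF O(1)] ob_lower[OF T] hom_snd[OF h]] by simp
  qed
  then obtain k2 where k2: "k2 \<in> mod_hom B (lower Y) (lower T)" "\<forall>y \<in> carrier (lower X). k2 (snd i y) = snd h y" by blast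
  have tmk: "tm Y T k2 \<in> mod_hom A (TT Y) (TT T)" by (rule tensor_map_hom[OF ob_lower[OF O(2)] ob_lower[OF T] k2(1)])
  let ?g = "compose (carrier (TT Y)) (struct T) (tm Y T k2)"
  have g: "?g \<in> mod_hom A (TT Y) (upper T)" by (rule mod_hom_compose[OF ob_tensor[OF O(2)] tmk ob_struct[OF T]])
  let ?D = "dsum (upper X) (TT Y)"
  have D: "fg_module A ?D" by (rule fg_dsum[OF ob_fg_upper[OF O(1)] fg_tensor[OF fg_M ob_fg_lower[OF O(2)]]])
  let ?F = "\<lambda>z \<in> carrier ?D. fst i (fst z) \<oplus>\<^bsub>upper Y\<^esub> struct Y (snd z)"
  let ?H = "\<lambda>z \<in> carrier ?D. fst h (fst z) \<oplus>\<^bsub>upper T\<^esub> ?g (snd z)"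
  have F: "?F \<in> mod_hom A ?D (upper Y)"
    by (rule mod_hom_copair[OF ob_upper[OF O(1)] ob_tensor[OF O(2)] ob_upper[OF O(2)] hom_fst[OF i] ob_struct[OF O(2)] fg_moduleD[OF D]])
  have H: "?H \<in> mod_hom A ?D (upper T)"
    by (rule mod_hom_copair[OF ob_upper[OF O(1)] ob_tensor[OF O(2)] ob_upper[OF T] hom_fst[OF h] g fg_moduleD[OF D]])
  have "\<exists>k \<in> mod_hom A (upper Y) (upper T). \<forall>z \<in> carrier ?D. k (?F z) = ?H z"
  proof (rule injective_extend[OF D ob_fg_upper[OF O(2)] U F H])
    fix z assume z: "z \<in> carrier ?D" "?F z = \<zero>\<^bsub>upper Y\<^esub>"
    obtain x t where xt: "z = (x, t)" "x \<in> carrier (upper X)" "t \<in> carrier (TT Y)" using z(1) by auto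
    have sum: "fst i x \<oplus>\<^bsub>upper Y\<^esub> struct Y t = \<zero>\<^bsub>upper Y\<^esub>" using z xt by simp
    have nt: "\<ominus>\<^bsub>TT Y\<^esub> t \<in> carrier (TT Y)" using xt by simp
    have "fst i x = \<ominus>\<^bsub>upper Y\<^esub> struct Y t"
      using UY.X.minus_equality[OF sum struct_closed[OF O(2) xt(3)] hom_fst_closed[OF i xt(2)]] by simp
    also have "\<dots> = struct Y (\<ominus>\<^bsub>TT Y\<^esub> t)"
      using mod_hom_uminus[OF ob_tensor[OF O(2)] ob_upper[OF O(2)] ob_struct[OF O(2)] xt(3)] by simp
    finally have ix: "fst i x = struct Y (\<ominus>\<^bsub>TT Y\<^esub> t)" .
    then obtain s where s: "s \<in> carrier (TT X)" "tm X Y (snd i) s = \<ominus>\<^bsub>TT Y\<^esub> t"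
      using pm xt(2) nt unfolding pure_mono_def by blast
    have "fst i x = fst i (struct X s)" using hom_comm[OF i s(1)] s(2) ix by simp
    then have x: "x = struct X s" by (rule inj_onD[OF inj(1)]) (use xt struct_closed[OF O(1) s(1)] in auto)
    have "fst h x = struct T (tm X T (snd h) s)" using hom_comm[OF h s(1)] x by simp
    also have "tm X T (snd h) s = tm Y T k2 (\<ominus>\<^bsub>TT Y\<^esub> t)"
      unfolding s(2)[symmetric]
      by (rule tensor_map_comp[OF ob_lower[OF O(1)] ob_lower[OF O(2)] ob_lower[OF T] hom_snd[OF i] k2(1) hom_snd[OF h] _ s(1), symmetric])
        (use k2(2) in simp)
    also have "struct T \<dots> = ?g (\<ominus>\<^bsub>TT Y\<^esub> t)" using nt by (simp add: compose_eq)
    also have "\<dots> = \<ominus>\<^bsub>upper T\<^esub> ?g t" by (rule mod_hom_uminus[OF ob_tensor[OF O(2)] ob_upper[OF T] g xt(3)])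
    finally show "?H z = \<zero>\<^bsub>upper T\<^esub>" using xt mod_hom_closed[OF g xt(3)] by (simp add: UT.X.l_neg)
  qed
  then obtain k1 where k1: "k1 \<in> mod_hom A (upper Y) (upper T)" "\<forall>z \<in> carrier ?D. k1 (?F z) = ?H z" by blast
  have k1i: "k1 (fst i x) = fst h x" if x: "x \<in> carrier (upper X)" for x
    using bspec[OF k1(2), of "(x, \<zero>\<^bsub>TT Y\<^esub>)"] x hom_fst_closed[OF i x] hom_fst_closed[OF h x]
      mod_hom_zero[OF ob_tensor[OF O(2)] ob_upper[OF O(2)] ob_struct[OF O(2)]]
      mod_hom_zero[OF ob_tensor[OF O(2)] ob_upper[OF T] g] by simp
  have k1s: "k1 (struct Y t) = ?g t" if t: "t \<in> carrier (TT Y)" for t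
    using bspec[OF k1(2), of "(\<zero>\<^bsub>upper X\<^esub>, t)"] t struct_closed[OF O(2) t] mod_hom_closed[OF g t]
      mod_hom_zero[OF ob_upper[OF O(1)] ob_upper[OF O(2)] hom_fst[OF i]]
      mod_hom_zero[OF ob_upper[OF O(1)] ob_upper[OF T] hom_fst[OF h]] by simp
  have k: "(k1, k2) \<in> carrier (Mor Y T)" by (rule homI[OF k1(1) k2(1)]) (simp add: k1s compose_eq)
  have "triple_comp X Y T (k1, k2) i = h"
    by (rule hom_eqI[OF comp_hom[OF O T i k] h]) (use k1i k2(2) in simp_all)
  then show "\<exists>k \<in> carrier (Mor Y T). triple_comp X Y T k i = h" using k by blast
qed

lemma injective_object_upper:
  assumes T: "injective_object T"
  shows "injective_module A (upper T)"
  unfolding injective_module_def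
proof (intro conjI allI impI ballI)
  have TO: "T \<in> Obs" using T by (simp add: injective_object_def)
  then show "fg_module A (upper T)" by (rule ob_fg_upper)
  fix X Y :: "'a fgmod" and i h
  assume XY: "fg_module A X \<and> fg_module A Y" and i: "i \<in> mod_hom A X Y" and h: "h \<in> mod_hom A X (upper T)"
    and inj: "inj_on i (carrier X)"
  then have X: "fg_module A X" and Y: "fg_module A Y" by auto
  note XO = top_ob[OF X] and YO = top_ob[OF Y]
  let ?i = "(i, \<lambda>y \<in> {{}}. \<zero>\<^bsub>lower (top_triple Y)\<^esub>)"
  have iM: "?i \<in> carrier (Mor (top_triple X) (top_triple Y))" by (rule top_homI[OF YO X]) (simp add: i)
  have "inflation (top_triple X) (top_triple Y) ?i"
    unfolding inflation_iff pure_mono_def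
  proof (intro conjI XO YO iM ballI impI)
    fix x t assume "t \<in> carrier (TT (top_triple Y))"
    then have t: "t = \<zero>\<^bsub>TT (top_triple Y)\<^esub>" using tensor_zero_module by simp
    interpret TX: left_module A "TT (top_triple X)" by (rule ob_tensor[OF XO])
    have "tm (top_triple X) (top_triple Y) (snd ?i) \<zero>\<^bsub>TT (top_triple X)\<^esub> = t"
      unfolding t by (rule mod_hom_zero[OF ob_tensor[OF XO] ob_tensor[OF YO] tensor_map_hom[OF ob_lower[OF XO] ob_lower[OF YO] hom_snd[OF iM]]])
    then show "\<exists>s \<in> carrier (TT (top_triple X)). tm (top_triple X) (top_triple Y) (snd ?i) s = t"
      using TX.X.zero_closed by blast
  qed (use inj in \<open>simp_all add: inj_on_def\<close>)
  then have "\<exists>k \<in> carrier (Mor (top_triple Y) T). triple_comp (top_triple X) (top_triple Y) T k ?i = (h, \<lambda>y \<in> {{}}. \<zero>\<^bsub>lower T\<^esub>)"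
    using T top_homI[OF TO X h] unfolding injective_object_def by blast
  then obtain k where k: "k \<in> carrier (Mor (top_triple Y) T)"
    "triple_comp (top_triple X) (top_triple Y) T k ?i = (h, \<lambda>y \<in> {{}}. \<zero>\<^bsub>lower T\<^esub>)" by blast
  show "\<exists>k \<in> mod_hom A Y (upper T). \<forall>x \<in> carrier X. k (i x) = h x"
    using hom_fst[OF k(1)] comp_eqD(1)[OF k(2)] by (intro bexI[of _ "fst k"]) auto
qed

lemma injective_object_lower:
  assumes T: "injective_object T"
  shows "injective_module B (lower T)"
  unfolding injective_module_def
proof (intro conjI allI impI ballI)
  have TO: "T \<in> Obs" using T by (simp add: injective_object_def)
  then show "fg_module B (lower T)" by (rule ob_fg_lower)
  fix X Y :: "'b fgmod" and i h
  assume XY: "fg_module B X \<and> fg_module B Y" and i: "i \<in> mod_hom B X Y" and h: "h \<in> mod_hom B X (lower T)"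
    and inj: "inj_on i (carrier X)"
  obtain S where S: "induced S" "lower S = X" using ex_induced XY by blast
  obtain S' where S': "induced S'" "lower S' = Y" using ex_induced XY by blast
  have O: "S \<in> Obs" "S' \<in> Obs" using S S' by (auto simp: induced_def)
  have "\<exists>f \<in> carrier (Mor S S'). snd f = i" by (rule induced_hom[OF S(1) O(2)]) (simp add: S S' i)
  then obtain f where f: "f \<in> carrier (Mor S S')" "snd f = i" by blast
  have "\<exists>g \<in> carrier (Mor S T). snd g = h" by (rule induced_hom[OF S(1) TO]) (simp add: S h)
  then obtain g where g: "g \<in> carrier (Mor S T)" "snd g = h" by blast
  have "inflation S S' f" by (rule induced_inflation[OF S(1) S'(1) f(1)]) (simp add: f S inj)
  then obtain k where k: "k \<in> carrier (Mor S' T)" "triple_comp S S' T k f = g"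
    using T g(1) unfolding injective_object_def by blast
  show "\<exists>k \<in> mod_hom B Y (lower T). \<forall>x \<in> carrier X. k (i x) = h x"
    using hom_snd[OF k(1)] comp_eqD(2)[OF k(2)] f g S S' by (intro bexI[of _ "snd k"]) auto
qed

lemma projective_top:
  assumes X: "projective_module A X"
  shows "projective_object (top_triple X)"
  unfolding projective_object_def
proof (intro conjI allI impI ballI)
  have fg: "fg_module A X" using X by (simp add: projective_module_def)
  show O: "top_triple X \<in> Obs" by (rule top_ob[OF fg])
  fix Y Z p h assume p: "deflation Y Z p" and h: "h \<in> carrier (Mor (top_triple X) Z)"
  then have YZ: "Y \<in> Obs" "Z \<in> Obs" "p \<in> carrier (Mor Y Z)" "fst p ` carrier (upper Y) = carrier (upper Z)"
    by (auto simp: deflation_iff)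
  have hX: "fst h \<in> mod_hom A X (upper Z)" using hom_fst[OF h] by simp
  obtain k where k: "k \<in> mod_hom A X (upper Y)" "\<forall>x \<in> carrier X. fst p (k x) = fst h x"
    using projective_moduleD[OF X ob_fg_upper[OF YZ(1)] ob_fg_upper[OF YZ(2)] hom_fst[OF YZ(3)] hX YZ(4)] by blast
  let ?k = "(k, \<lambda>y \<in> {{}}. \<zero>\<^bsub>lower Y\<^esub>)"
  have kM: "?k \<in> carrier (Mor (top_triple X) Y)" by (rule top_homI[OF YZ(1) fg k(1)])
  have "triple_comp (top_triple X) Y Z p ?k = h"
    by (rule hom_eqI[OF comp_hom[OF O YZ(1,2) kM YZ(3)] h])
      (use k(2) mod_hom_zero[OF ob_lower[OF YZ(1)] ob_lower[OF YZ(2)] hom_snd[OF YZ(3)]]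
        mod_hom_zero[OF ob_lower[OF O] ob_lower[OF YZ(2)] hom_snd[OF h]] in simp_all)
  then show "\<exists>k \<in> carrier (Mor (top_triple X) Y). triple_comp (top_triple X) Y Z p k = h" using kM by blast
qed

lemma projective_of_top:
  assumes X: "fg_module A X" and P: "projective_object (top_triple X)"
  shows "projective_module A X"
  unfolding projective_module_def
proof (intro conjI allI impI ballI X)
  fix Y Z :: "'a fgmod" and g h
  assume YZ: "fg_module A Y \<and> fg_module A Z" and g: "g \<in> mod_hom A Y Z" and h: "h \<in> mod_hom A X Z"
    and surj: "g ` carrier Y = carrier Z"
  then have Y: "fg_module A Y" and Z: "fg_module A Z" by auto
  note YO = top_ob[OF Y] and ZO = top_ob[OF Z]
  let ?g = "(g, \<lambda>y \<in> {{}}. \<zero>\<^bsub>lower (top_triple Z)\<^esub>)" and ?h = "(h, \<lambda>y \<in> {{}}. \<zero>\<^bsub>lower (top_triple Z)\<^esub>)"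
  have gM: "?g \<in> carrier (Mor (top_triple Y) (top_triple Z))" by (rule top_homI[OF ZO Y]) (simp add: g)
  have hM: "?h \<in> carrier (Mor (top_triple X) (top_triple Z))" by (rule top_homI[OF ZO X]) (simp add: h)
  have "deflation (top_triple Y) (top_triple Z) ?g" unfolding deflation_iff using YO ZO gM surj by simp
  then obtain k where k: "k \<in> carrier (Mor (top_triple X) (top_triple Y))"
    "triple_comp (top_triple X) (top_triple Y) (top_triple Z) ?g k = ?h"
    using P hM unfolding projective_object_def by blast
  show "\<exists>k \<in> mod_hom A X Y. \<forall>x \<in> carrier X. g (k x) = h x"
    using hom_fst[OF k(1)] comp_eqD(1)[OF k(2)] by (intro bexI[of _ "fst k"]) auto
qed

lemma projective_induced:
  assumes S: "induced S" and L: "projective_module B (lower S)"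
  shows "projective_object S"
  unfolding projective_object_def
proof (intro conjI allI impI ballI)
  show O: "S \<in> Obs" using S by (simp add: induced_def)
  have surj: "struct S ` carrier (TT S) = carrier (upper S)" using S by (simp add: induced_def)
  fix Y Z p h assume p: "deflation Y Z p" and h: "h \<in> carrier (Mor S Z)"
  then have YZ: "Y \<in> Obs" "Z \<in> Obs" "p \<in> carrier (Mor Y Z)" "snd p ` carrier (lower Y) = carrier (lower Z)"
    by (auto simp: deflation_iff)
  obtain k2 where k2: "k2 \<in> mod_hom B (lower S) (lower Y)" "\<forall>y \<in> carrier (lower S). snd p (k2 y) = snd h y"
    using projective_moduleD[OF L ob_fg_lower[OF YZ(1)] ob_fg_lower[OF YZ(2)] hom_snd[OF YZ(3)] hom_snd[OF h] YZ(4)] by blast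
  obtain k where k: "k \<in> carrier (Mor S Y)" "snd k = k2" using induced_hom[OF S YZ(1) k2(1)] by blast
  have pk: "triple_comp S Y Z p k \<in> carrier (Mor S Z)" by (rule comp_hom[OF O YZ(1,2) k(1) YZ(3)])
  have low: "snd (triple_comp S Y Z p k) y = snd h y" if "y \<in> carrier (lower S)" for y using that k2 k by simp
  have "triple_comp S Y Z p k = h"
  proof (rule hom_eqI[OF pk h _ low])
    fix x assume "x \<in> carrier (upper S)"
    then obtain t where t: "t \<in> carrier (TT S)" "x = struct S t" using surj by blast
    have "snd (triple_comp S Y Z p k) = snd h" by (rule mod_hom_eqI[OF hom_snd[OF pk] hom_snd[OF h] low])
    then show "fst (triple_comp S Y Z p k) x = fst h x" using hom_comm[OF pk t(1)] hom_comm[OF h t(1)] t(2) by simp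
  qed
  then show "\<exists>k \<in> carrier (Mor S Y). triple_comp S Y Z p k = h" using k(1) by blast
qed

lemma induced_regular_upper:
  assumes S: "induced S" and \<sigma>: "\<sigma> \<in> mod_hom B (regular_module B) (lower S)" and \<tau>: "\<tau> \<in> mod_hom B (lower S) (regular_module B)"
    and \<tau>\<sigma>: "\<And>b. b \<in> carrier B \<Longrightarrow> \<tau> (\<sigma> b) = b" and \<sigma>\<tau>: "\<And>y. y \<in> carrier (lower S) \<Longrightarrow> \<sigma> (\<tau> y) = y"
  shows "\<exists>f \<in> mod_hom A M (upper S). \<exists>g \<in> mod_hom A (upper S) M.
    (\<forall>m \<in> carrier M. g (f m) = m) \<and> (\<forall>x \<in> carrier (upper S). f (g x) = x)"
proof -
  have O: "S \<in> Obs" and surj: "struct S ` carrier (TT S) = carrier (upper S)" using S by (auto simp: induced_def)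
  note LM = ob_lower[OF O] and TM = ob_tensor[OF O] and MM = left.left_module_axioms
  interpret L: left_module B "lower S" by (rule LM)
  interpret T: left_module A "TT S" by (rule TM)
  have \<tau>c: "\<tau> y \<in> carrier B" if "y \<in> carrier (lower S)" for y using mod_hom_closed[OF \<tau> that] by simp
  have one: "\<sigma> \<one>\<^bsub>B\<^esub> \<in> carrier (lower S)" using mod_hom_closed[OF \<sigma>, of "\<one>\<^bsub>B\<^esub>"] by simp
  have \<sigma>b: "b \<odot>\<^bsub>lower S\<^esub> \<sigma> \<one>\<^bsub>B\<^esub> = \<sigma> b" if "b \<in> carrier B" for b
    using regular_hom_eq[OF artB.A.ring_axioms \<sigma> that] by simp
  have rdist: "m \<odot>\<^sub>r\<^bsub>M\<^esub> (b \<oplus>\<^bsub>B\<^esub> c) = m \<odot>\<^sub>r\<^bsub>M\<^esub> b \<oplus>\<^bsub>M\<^esub> m \<odot>\<^sub>r\<^bsub>M\<^esub> c" "(m \<odot>\<^sub>r\<^bsub>M\<^esub> b) \<odot>\<^sub>r\<^bsub>M\<^esub> c = m \<odot>\<^sub>r\<^bsub>M\<^esub> (b \<otimes>\<^bsub>B\<^esub> c)"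
    if "m \<in> carrier M" "b \<in> carrier B" "c \<in> carrier B" for m b c
    using that right.smult_l_distr[of b c m] right.smult_assoc1[of c b m] by simp_all
  have rdist': "(m \<oplus>\<^bsub>M\<^esub> m') \<odot>\<^sub>r\<^bsub>M\<^esub> b = m \<odot>\<^sub>r\<^bsub>M\<^esub> b \<oplus>\<^bsub>M\<^esub> m' \<odot>\<^sub>r\<^bsub>M\<^esub> b" if "m \<in> carrier M" "m' \<in> carrier M" "b \<in> carrier B" for m m' b
    using that right.smult_r_distr[of b m m'] by simp
  have "\<exists>h. h \<in> carrier (TT S) \<rightarrow>\<^sub>E carrier M \<and>
    (\<forall>s \<in> carrier (TT S). \<forall>t \<in> carrier (TT S). h (s \<oplus>\<^bsub>TT S\<^esub> t) = h s \<oplus>\<^bsub>M\<^esub> h t) \<and>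
    (\<forall>m \<in> carrier M. \<forall>y \<in> carrier (lower S). h (pure M B (lower S) m y) = m \<odot>\<^sub>r\<^bsub>M\<^esub> \<tau> y)"
    by (rule tensor_universal[OF LM left.X.abelian_group_axioms])
      (use \<tau>c mod_hom_add[OF \<tau>] mod_hom_smult[OF \<tau>] in \<open>auto simp: rdist rdist'\<close>)
  then obtain \<mu> where \<mu>: "\<mu> \<in> carrier (TT S) \<rightarrow>\<^sub>E carrier M"
    "\<forall>s \<in> carrier (TT S). \<forall>t \<in> carrier (TT S). \<mu> (s \<oplus>\<^bsub>TT S\<^esub> t) = \<mu> s \<oplus>\<^bsub>M\<^esub> \<mu> t"
    "\<forall>m \<in> carrier M. \<forall>y \<in> carrier (lower S). \<mu> (pure M B (lower S) m y) = m \<odot>\<^sub>r\<^bsub>M\<^esub> \<tau> y" by blast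
  have \<mu>c: "\<mu> t \<in> carrier M" if "t \<in> carrier (TT S)" for t using \<mu>(1) that by auto
  have \<mu>0: "\<mu> \<zero>\<^bsub>TT S\<^esub> = \<zero>\<^bsub>M\<^esub>"
    using \<mu>(2) \<mu>c[of "\<zero>\<^bsub>TT S\<^esub>"] left.X.add.l_cancel_one'[of "\<mu> \<zero>\<^bsub>TT S\<^esub>" "\<mu> \<zero>\<^bsub>TT S\<^esub>"] by force
  have \<mu>m: "\<mu> (s \<ominus>\<^bsub>TT S\<^esub> t) = \<mu> s \<ominus>\<^bsub>M\<^esub> \<mu> t" if st: "s \<in> carrier (TT S)" "t \<in> carrier (TT S)" for s t
  proof -
    have "\<mu> s = \<mu> t \<oplus>\<^bsub>M\<^esub> \<mu> (s \<ominus>\<^bsub>TT S\<^esub> t)"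
      using \<mu>(2)[rule_format, of t "s \<ominus>\<^bsub>TT S\<^esub> t"] st by (simp add: T.X.add_minus_cancel)
    then show ?thesis using left.X.add_minus_cancel(1)[of "\<mu> t" "\<mu> (s \<ominus>\<^bsub>TT S\<^esub> t)"] st \<mu>c by simp
  qed
  have \<mu>s: "\<mu> (a \<odot>\<^bsub>TT S\<^esub> t) = a \<odot>\<^bsub>M\<^esub> \<mu> t" if a: "a \<in> carrier A" and t: "t \<in> carrier (TT S)" for a t
    using LM t
  proof (induction rule: tensor_induct)
    case (pure m y)
    then show ?case using a \<mu>(3) by (simp add: smult_pure[OF LM a] actions_commute \<tau>c)
  next
    case (minus s t)
    then show ?case using a by (simp add: T.smult_minus_right \<mu>m \<mu>c left.smult_minus_right)
  qed (use a \<mu>0 in simp)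
  have \<mu>h: "\<mu> \<in> mod_hom A (TT S) M" using \<mu>(1,2) \<mu>s by (simp add: mod_hom_def)
  let ?f0 = "\<lambda>m. pure M B (lower S) m (\<sigma> \<one>\<^bsub>B\<^esub>)"
  have f0: "(\<lambda>m \<in> carrier M. ?f0 m) \<in> mod_hom A M (TT S)"
    by (rule mod_homI[OF MM]) (auto simp: pure_add_left[OF LM] smult_pure[OF LM] one intro!: pure_closed[OF LM])
  have f0\<mu>: "?f0 (\<mu> t) = t" if t: "t \<in> carrier (TT S)" for t
    using LM t
  proof (induction rule: tensor_induct)
    case zero
    show ?case using mod_hom_zero[OF MM TM f0] \<mu>0 by simp
  next
    case (pure m y)
    then show ?case using \<mu>(3) pure_balanced[OF LM pure(1) \<tau>c[OF pure(2)] one] \<sigma>b[OF \<tau>c[OF pure(2)]] \<sigma>\<tau> by simp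
  next
    case (minus s t)
    have "?f0 (\<mu> s \<ominus>\<^bsub>M\<^esub> \<mu> t) = ?f0 (\<mu> s) \<ominus>\<^bsub>TT S\<^esub> ?f0 (\<mu> t)"
      using mod_hom_minus[OF MM TM f0 \<mu>c[OF minus(1)] \<mu>c[OF minus(2)]] \<mu>c[OF minus(1)] \<mu>c[OF minus(2)] by simp
    then show ?case using minus by (simp add: \<mu>m)
  qed
  have bij: "bij_betw (struct S) (carrier (TT S)) (carrier (upper S))"
    using ob_inj[OF O] surj by (simp add: bij_betw_def)
  obtain r where r: "r \<in> mod_hom A (upper S) (TT S)" "\<And>t. t \<in> carrier (TT S) \<Longrightarrow> r (struct S t) = t"
    "\<And>x. x \<in> carrier (upper S) \<Longrightarrow> struct S (r x) = x"
    using mod_hom_inverse[OF TM ob_upper[OF O] ob_struct[OF O] bij] by metis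
  show ?thesis
  proof (intro bexI conjI ballI)
    show "compose (carrier M) (struct S) (\<lambda>m \<in> carrier M. ?f0 m) \<in> mod_hom A M (upper S)"
      by (rule mod_hom_compose[OF MM f0 ob_struct[OF O]])
    show "compose (carrier (upper S)) \<mu> r \<in> mod_hom A (upper S) M"
      by (rule mod_hom_compose[OF ob_upper[OF O] r(1) \<mu>h])
    fix m assume m: "m \<in> carrier M"
    have c: "?f0 m \<in> carrier (TT S)" by (rule pure_closed[OF LM m one])
    have "\<mu> (?f0 m) = m" using \<mu>(3) m one \<tau>\<sigma>[of "\<one>\<^bsub>B\<^esub>"] right.smult_one[of m] m by simp
    then show "compose (carrier (upper S)) \<mu> r (compose (carrier M) (struct S) (\<lambda>m \<in> carrier M. ?f0 m) m) = m"
      using m c by (simp add: compose_eq struct_closed[OF O] r(2))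
  next
    fix x assume x: "x \<in> carrier (upper S)"
    have rx: "r x \<in> carrier (TT S)" by (rule mod_hom_closed[OF r(1) x])
    show "compose (carrier M) (struct S) (\<lambda>m \<in> carrier M. ?f0 m) (compose (carrier (upper S)) \<mu> r x) = x"
      using x rx \<mu>c[OF rx] by (simp add: compose_eq f0\<mu> r(3))
  qed
qed

lemma frobenius_imp:
  assumes F: "frobenius_category (mono_objects A M B) (triple_hom A M B) triple_comp triple_id (mono_conflation A M B)"
  shows "selfinjective A \<and> selfinjective B \<and> projective_module A M"
proof -
  note iff = frobenius_category.projective_iff_injective[OF F]
  obtain A' :: "'a fgmod" and a b where A': "fg_module A A'" "a \<in> mod_hom A (regular_module A) A'" "b \<in> mod_hom A A' (regular_module A)"
    "\<And>x. x \<in> carrier (regular_module A) \<Longrightarrow> b (a x) = x" "\<And>y. y \<in> carrier A' \<Longrightarrow> a (b y) = y"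
    using fg_module_rep[OF fg_regular_module[OF artA.A.ring_axioms]] by metis
  obtain B' :: "'b fgmod" and \<sigma> \<tau> where B': "fg_module B B'" "\<sigma> \<in> mod_hom B (regular_module B) B'" "\<tau> \<in> mod_hom B B' (regular_module B)"
    "\<And>x. x \<in> carrier (regular_module B) \<Longrightarrow> \<tau> (\<sigma> x) = x" "\<And>y. y \<in> carrier B' \<Longrightarrow> \<sigma> (\<tau> y) = y"
    using fg_module_rep[OF fg_regular_module[OF artB.A.ring_axioms]] by metis
  have "projective_module A A'"
    by (rule projective_module_retract[OF artA.A.projective_regular_module A'(1,2,3,5)])
  then have "injective_object (top_triple A')" using projective_top iff by blast
  then have "injective_module A A'" using injective_object_upper by fastforce
  then have 1: "selfinjective A" unfolding selfinjective_def
    by (rule injective_module_retract[OF _ fg_regular_module[OF artA.A.ring_axioms] A'(3,2,4)])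
  obtain S where S: "induced S" "lower S = B'" using ex_induced[OF B'(1)] by blast
  have "projective_module B B'"
    by (rule projective_module_retract[OF artB.A.projective_regular_module B'(1,2,3,5)])
  then have inj: "injective_object S" using projective_induced[OF S(1)] S(2) iff by simp
  then have "injective_module B B'" using injective_object_lower S(2) by fastforce
  then have 2: "selfinjective B" unfolding selfinjective_def
    by (rule injective_module_retract[OF _ fg_regular_module[OF artB.A.ring_axioms] B'(3,2,4)])
  have SO: "S \<in> Obs" using S by (simp add: induced_def)
  have "injective_object (top_triple (upper S))"
    by (rule injective_objectI[OF top_ob[OF ob_fg_upper[OF SO]]])
      (simp_all add: injective_object_upper[OF inj] injective_zero_module[OF artB.A.ring_axioms])
  then have pr: "projective_module A (upper S)" using projective_of_top[OF ob_fg_upper[OF SO]] iff by blast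
  have "\<exists>f \<in> mod_hom A M (upper S). \<exists>g \<in> mod_hom A (upper S) M.
    (\<forall>m \<in> carrier M. g (f m) = m) \<and> (\<forall>x \<in> carrier (upper S). f (g x) = x)"
    by (rule induced_regular_upper[OF S(1), of \<sigma> \<tau>]) (use B' S(2) in simp_all)
  then obtain f g where fg: "f \<in> mod_hom A M (upper S)" "g \<in> mod_hom A (upper S) M" "\<forall>m \<in> carrier M. g (f m) = m" by blast
  have "projective_module A M" by (rule projective_module_retract[OF pr fg_M fg(2,1)]) (use fg(3) in simp)
  with 1 2 show ?thesis by simp
qed

lemma frobenius_if:
  assumes A: "selfinjective A" and B: "selfinjective B" and M: "projective_module A M"
  shows "frobenius_category (mono_objects A M B) (triple_hom A M B) triple_comp triple_id (mono_conflation A M B)"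
proof -
  obtain A' :: "'a fgmod" and a b where A': "fg_module A A'" "a \<in> mod_hom A (regular_module A) A'" "b \<in> mod_hom A A' (regular_module A)"
    "\<And>x. x \<in> carrier (regular_module A) \<Longrightarrow> b (a x) = x" "\<And>y. y \<in> carrier A' \<Longrightarrow> a (b y) = y"
    using fg_module_rep[OF fg_regular_module[OF artA.A.ring_axioms]] by metis
  obtain B' :: "'b fgmod" and \<sigma> \<tau> where B': "fg_module B B'" "\<sigma> \<in> mod_hom B (regular_module B) B'" "\<tau> \<in> mod_hom B B' (regular_module B)"
    "\<And>x. x \<in> carrier (regular_module B) \<Longrightarrow> \<tau> (\<sigma> x) = x" "\<And>y. y \<in> carrier B' \<Longrightarrow> \<sigma> (\<tau> y) = y"
    using fg_module_rep[OF fg_regular_module[OF artB.A.ring_axioms]] by metis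
  obtain S where S: "induced S" "lower S = B'" using ex_induced[OF B'(1)] by blast
  have SO: "S \<in> Obs" using S by (simp add: induced_def)
  let ?A = "top_triple A'"
  have AO: "?A \<in> Obs" by (rule top_ob[OF A'(1)])
  define good where "good Q \<longleftrightarrow> projective_object Q \<and> injective_object Q" for Q
  have infl: "X \<in> Obs \<and> Y \<in> Obs \<and> i \<in> carrier (Mor X Y)" if "inflation X Y i" for X Y i
    using that by (simp add: inflation_iff pure_mono_def)
  have defl: "Y \<in> Obs \<and> Z \<in> Obs \<and> p \<in> carrier (Mor Y Z)" if "deflation Y Z p" for Y Z p
    using that by (simp add: deflation_iff)
  have regA: "injective_module A (regular_module A)" and regB: "injective_module B (regular_module B)"
    using A B by (simp_all add: selfinjective_def)
  have "injective_module A A'" by (rule injective_module_retract[OF regA A'(1,2,3,5)])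
  then have "injective_object ?A"
    by (intro injective_objectI[OF AO]) (simp_all add: injective_zero_module[OF artB.A.ring_axioms])
  moreover have "projective_object ?A"
    by (rule projective_top[OF projective_module_retract[OF artA.A.projective_regular_module A'(1,2,3,5)]])
  ultimately have goodA: "good ?A" by (simp add: good_def)
  have "\<exists>f \<in> mod_hom A M (upper S). \<exists>g \<in> mod_hom A (upper S) M.
    (\<forall>m \<in> carrier M. g (f m) = m) \<and> (\<forall>x \<in> carrier (upper S). f (g x) = x)"
    by (rule induced_regular_upper[OF S(1), of \<sigma> \<tau>]) (use B' S(2) in simp_all)
  then obtain f g where fg: "f \<in> mod_hom A M (upper S)" "g \<in> mod_hom A (upper S) M"
    "\<forall>x \<in> carrier (upper S). f (g x) = x" by blast
  have injU: "injective_module A (upper S)"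
    by (rule injective_module_retract[OF artA.projective_imp_injective[OF A M] ob_fg_upper[OF SO] fg(1,2)])
      (use fg(3) in simp)
  have "injective_module B B'" by (rule injective_module_retract[OF regB B'(1,2,3,5)])
  then have "injective_object S" by (intro injective_objectI[OF SO injU]) (simp add: S(2))
  moreover have "projective_object S"
    by (rule projective_induced[OF S(1)])
      (simp add: S(2) projective_module_retract[OF artB.A.projective_regular_module B'(1,2,3,5)])
  ultimately have goodS: "good S" by (simp add: good_def)
  have good_ob: "Q \<in> Obs" if "good Q" for Q using that by (simp add: good_def projective_object_def)
  have good_sum: "good P" if "is_biproduct X Y P i j p q" "good X" "good Y" for X Y P i j p q
    using that projective_biproduct[OF that(1) _ _ defl] injective_biproduct[OF that(1) _ _ infl]
    unfolding good_def by blast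
  have cover: "\<exists>Q g. good Q \<and> deflation Q T g" if T: "T \<in> Obs" for T
  proof -
    obtain G where G: "finite G" "G \<subseteq> carrier (upper T)" "\<And>H. \<lbrakk>submodule H A (upper T); G \<subseteq> H\<rbrakk> \<Longrightarrow> H = carrier (upper T)"
      using fg_moduleE[OF ob_fg_upper[OF T]] by blast
    obtain H where H: "finite H" "H \<subseteq> carrier (lower T)" "\<And>K. \<lbrakk>submodule K B (lower T); H \<subseteq> K\<rbrakk> \<Longrightarrow> K = carrier (lower T)"
      using fg_moduleE[OF ob_fg_lower[OF T]] by blast
    have "\<exists>f \<in> carrier (Mor ?A T). \<exists>z \<in> carrier (upper ?A). fst f z = x" if x: "x \<in> carrier (upper T)" for x
    proof -
      interpret U: left_module A "upper T" by (rule ob_upper[OF T])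
      let ?s = "compose (carrier A') (\<lambda>c \<in> carrier A. c \<odot>\<^bsub>upper T\<^esub> x) b"
      have s: "?s \<in> mod_hom A A' (upper T)"
        by (rule mod_hom_compose[OF fg_moduleD[OF A'(1)] A'(3) U.mod_hom_scale_right[OF x]])
      have a1: "a \<one>\<^bsub>A\<^esub> \<in> carrier A'" using mod_hom_closed[OF A'(2), of "\<one>\<^bsub>A\<^esub>"] by simp
      have "?s (a \<one>\<^bsub>A\<^esub>) = x" using a1 x A'(4)[of "\<one>\<^bsub>A\<^esub>"] by (simp add: compose_eq)
      then show ?thesis using top_homI[OF T A'(1) s] a1 by (intro bexI[of _ "(?s, \<lambda>y \<in> {{}}. \<zero>\<^bsub>lower T\<^esub>)"] bexI[of _ "a \<one>\<^bsub>A\<^esub>"]) auto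
    qed
    then have "\<forall>x \<in> G. \<exists>f. f \<in> carrier (Mor ?A T) \<and> (\<exists>z \<in> carrier (upper ?A). fst f z = x)" using G(2) by blast
    then obtain u where u: "\<forall>x \<in> G. u x \<in> carrier (Mor ?A T) \<and> (\<exists>z \<in> carrier (upper ?A). fst (u x) z = x)"
      unfolding bchoice_iff by blast
    have "\<exists>f \<in> carrier (Mor S T). \<exists>z \<in> carrier (lower S). snd f z = y" if y: "y \<in> carrier (lower T)" for y
    proof -
      interpret L: left_module B "lower T" by (rule ob_lower[OF T])
      let ?s = "compose (carrier B') (\<lambda>c \<in> carrier B. c \<odot>\<^bsub>lower T\<^esub> y) \<tau>"
      have s: "?s \<in> mod_hom B (lower S) (lower T)"
        unfolding S(2) by (rule mod_hom_compose[OF fg_moduleD[OF B'(1)] B'(3) L.mod_hom_scale_right[OF y]])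
      have b1: "\<sigma> \<one>\<^bsub>B\<^esub> \<in> carrier B'" using mod_hom_closed[OF B'(2), of "\<one>\<^bsub>B\<^esub>"] by simp
      have e: "?s (\<sigma> \<one>\<^bsub>B\<^esub>) = y" using b1 y B'(4)[of "\<one>\<^bsub>B\<^esub>"] by (simp add: compose_eq)
      obtain f where "f \<in> carrier (Mor S T)" "snd f = ?s" using induced_hom[OF S(1) T s] by blast
      then show ?thesis using e b1 S(2) by (intro bexI[of _ f] bexI[of _ "\<sigma> \<one>\<^bsub>B\<^esub>"]) auto
    qed
    then have "\<forall>y \<in> H. \<exists>f. f \<in> carrier (Mor S T) \<and> (\<exists>z \<in> carrier (lower S). snd f z = y)" using H(2) by blast
    then obtain v where v: "\<forall>y \<in> H. v y \<in> carrier (Mor S T) \<and> (\<exists>z \<in> carrier (lower S). snd (v y) z = y)"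
      unfolding bchoice_iff by blast
    let ?F = "(\<lambda>x. (?A, u x)) ` G \<union> (\<lambda>y. (S, v y)) ` H"
    have "\<exists>Q g. good Q \<and> g \<in> carrier (Mor Q T) \<and> (\<forall>(Q', g') \<in> ?F. \<exists>w \<in> carrier (Mor Q' Q). triple_comp Q' Q T g w = g')"
    proof (rule finite_cover[where ?Q0.0 = ?A])
      show "good Q \<and> g \<in> carrier (Mor Q T)" if "(Q, g) \<in> ?F" for Q g using that goodA goodS u v by auto
    qed (use G H T goodA good_ob good_sum in auto)
    then obtain Q g where Q: "good Q" "g \<in> carrier (Mor Q T)"
      "\<forall>(Q', g') \<in> ?F. \<exists>w \<in> carrier (Mor Q' Q). triple_comp Q' Q T g w = g'" by blast
    note QO = good_ob[OF Q(1)]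
    have "fst g ` carrier (upper Q) = carrier (upper T)"
    proof (rule G(3)[OF image_submodule[OF ob_upper[OF QO] ob_upper[OF T] hom_fst[OF Q(2)]
            left_module.submodule_carrier[OF ob_upper[OF QO]]]], rule subsetI)
      fix x assume x: "x \<in> G"
      obtain z where z: "z \<in> carrier (upper ?A)" "fst (u x) z = x" using u x by blast
      have mem: "(?A, u x) \<in> ?F" using x by blast
      obtain w where w: "w \<in> carrier (Mor ?A Q)" "triple_comp ?A Q T g w = u x" using bspec[OF Q(3) mem] unfolding prod.case by (rule bexE)
      have "x = fst g (fst w z)" using comp_eqD(1)[OF w(2) z(1)] z(2) by simp
      then show "x \<in> fst g ` carrier (upper Q)" using hom_fst_closed[OF w(1) z(1)] by (rule image_eqI)
    qed
    moreover have "snd g ` carrier (lower Q) = carrier (lower T)"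
    proof (rule H(3)[OF image_submodule[OF ob_lower[OF QO] ob_lower[OF T] hom_snd[OF Q(2)]
            left_module.submodule_carrier[OF ob_lower[OF QO]]]], rule subsetI)
      fix y assume y: "y \<in> H"
      obtain z where z: "z \<in> carrier (lower S)" "snd (v y) z = y" using v y by blast
      have mem: "(S, v y) \<in> ?F" using y by blast
      obtain w where w: "w \<in> carrier (Mor S Q)" "triple_comp S Q T g w = v y" using bspec[OF Q(3) mem] unfolding prod.case by (rule bexE)
      have "y = snd g (snd w z)" using comp_eqD(2)[OF w(2) z(1)] z(2) by simp
      then show "y \<in> snd g ` carrier (lower Q)" using hom_snd_closed[OF w(1) z(1)] by (rule image_eqI)
    qed
    ultimately have "deflation Q T g" unfolding deflation_iff using QO T Q(2) by blast
    then show ?thesis using Q(1) by blast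
  qed
  have cocover: "\<exists>Q g. good Q \<and> inflation T Q g" if T: "T \<in> Obs" for T
  proof -
    let ?K = "struct T ` carrier (TT T)"
    interpret UT: left_module A "upper T" by (rule ob_upper[OF T])
    interpret LT: left_module B "lower T" by (rule ob_lower[OF T])
    have K: "submodule ?K A (upper T)"
      by (rule image_submodule[OF ob_tensor[OF T] ob_upper[OF T] ob_struct[OF T] left_module.submodule_carrier[OF ob_tensor[OF T]]])
    obtain F1 where F1: "finite F1" "F1 \<subseteq> mod_hom A (upper T) (regular_module A)" "\<forall>f \<in> F1. \<forall>k \<in> ?K. f k = \<zero>\<^bsub>A\<^esub>"
      "\<forall>x \<in> carrier (upper T). (\<forall>f \<in> F1. f x = \<zero>\<^bsub>A\<^esub>) \<longrightarrow> x \<in> ?K"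
      using artA.selfinjective_finitely_separates[OF A ob_fg_upper[OF T] K] by blast
    obtain F2 where F2: "finite F2" "F2 \<subseteq> mod_hom B (lower T) (regular_module B)"
      "\<forall>y \<in> carrier (lower T). (\<forall>f \<in> F2. f y = \<zero>\<^bsub>B\<^esub>) \<longrightarrow> y \<in> {\<zero>\<^bsub>lower T\<^esub>}"
      using artB.selfinjective_finitely_separates[OF B ob_fg_lower[OF T] LT.submodule_zero] by blast
    define u where "u f = (compose (carrier (upper T)) a f, \<lambda>y \<in> carrier (lower T). {} :: (nat \<Rightarrow> 'b) set)" for f
    have u: "u f \<in> carrier (Mor T ?A)" if f: "f \<in> F1" for f
      unfolding u_def
    proof (rule to_top_homI[OF T A'(1)])
      have fh: "f \<in> mod_hom A (upper T) (regular_module A)" using F1(2) f by blast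
      show "compose (carrier (upper T)) a f \<in> mod_hom A (upper T) A'"
        by (rule mod_hom_compose[OF ob_upper[OF T] fh A'(2)])
      fix t assume t: "t \<in> carrier (TT T)"
      have "f (struct T t) = \<zero>\<^bsub>A\<^esub>" using F1(3) f t by blast
      then show "compose (carrier (upper T)) a f (struct T t) = \<zero>\<^bsub>A'\<^esub>"
        using struct_closed[OF T t] mod_hom_zero[OF artA.A.regular_left_module fg_moduleD[OF A'(1)] A'(2)]
        by (simp add: compose_eq)
    qed
    have "\<exists>h \<in> carrier (Mor T S). snd h = compose (carrier (lower T)) \<sigma> f" if f: "f \<in> F2" for f
    proof -
      have fh: "f \<in> mod_hom B (lower T) (regular_module B)" using F2(2) f by blast
      let ?h = "compose (carrier (lower T)) \<sigma> f"
      have h: "?h \<in> mod_hom B (lower T) (lower S)"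
        unfolding S(2) by (rule mod_hom_compose[OF ob_lower[OF T] fh B'(2)])
      have tmh: "tm T S ?h \<in> mod_hom A (TT T) (TT S)" by (rule tensor_map_hom[OF ob_lower[OF T] ob_lower[OF SO] h])
      have c: "compose (carrier (TT T)) (struct S) (tm T S ?h) \<in> mod_hom A (TT T) (upper S)"
        by (rule mod_hom_compose[OF ob_tensor[OF T] tmh ob_struct[OF SO]])
      have "\<exists>k \<in> mod_hom A (upper T) (upper S). \<forall>t \<in> carrier (TT T). k (struct T t) = compose (carrier (TT T)) (struct S) (tm T S ?h) t"
      proof (rule injective_extend[OF fg_tensor[OF fg_M ob_fg_lower[OF T]] ob_fg_upper[OF T] injU ob_struct[OF T] c])
        fix t assume t: "t \<in> carrier (TT T)" "struct T t = \<zero>\<^bsub>upper T\<^esub>"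
        then have "t = \<zero>\<^bsub>TT T\<^esub>" by (rule ob_mono[OF T])
        then show "compose (carrier (TT T)) (struct S) (tm T S ?h) t = \<zero>\<^bsub>upper S\<^esub>"
          using mod_hom_zero[OF ob_tensor[OF T] ob_upper[OF SO] c] by simp
      qed
      then obtain k where k: "k \<in> mod_hom A (upper T) (upper S)"
        "\<forall>t \<in> carrier (TT T). k (struct T t) = compose (carrier (TT T)) (struct S) (tm T S ?h) t" by blast
      have "(k, ?h) \<in> carrier (Mor T S)" by (rule homI[OF k(1) h]) (use k(2) in \<open>simp add: compose_eq\<close>)
      then show ?thesis by (intro bexI[of _ "(k, ?h)"]) auto
    qed
    then have "\<forall>f \<in> F2. \<exists>h. h \<in> carrier (Mor T S) \<and> snd h = compose (carrier (lower T)) \<sigma> f" by blast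
    then obtain v where v: "\<forall>f \<in> F2. v f \<in> carrier (Mor T S) \<and> snd (v f) = compose (carrier (lower T)) \<sigma> f"
      unfolding bchoice_iff by blast
    let ?F = "(\<lambda>f. (?A, u f)) ` F1 \<union> (\<lambda>f. (S, v f)) ` F2"
    have "\<exists>Q g. good Q \<and> g \<in> carrier (Mor T Q) \<and> (\<forall>(Q', g') \<in> ?F. \<exists>w \<in> carrier (Mor Q Q'). triple_comp T Q Q' w g = g')"
    proof (rule finite_cocover[where ?Q0.0 = ?A])
      show "good Q \<and> g \<in> carrier (Mor T Q)" if "(Q, g) \<in> ?F" for Q g using that goodA goodS u v by auto
    qed (use F1 F2 T goodA good_ob good_sum in auto)
    then obtain Q g where Q: "good Q" "g \<in> carrier (Mor T Q)"
      "\<forall>(Q', g') \<in> ?F. \<exists>w \<in> carrier (Mor Q Q'). triple_comp T Q Q' w g = g'" by blast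
    note QO = good_ob[OF Q(1)] and gc = hom_fst_closed[OF Q(2)] hom_snd_closed[OF Q(2)]
    have low: "y = \<zero>\<^bsub>lower T\<^esub>" if y: "y \<in> carrier (lower T)" "snd g y = \<zero>\<^bsub>lower Q\<^esub>" for y
    proof -
      have "f y = \<zero>\<^bsub>B\<^esub>" if f: "f \<in> F2" for f
      proof -
        have mem: "(S, v f) \<in> ?F" using f by blast
        obtain w where w: "w \<in> carrier (Mor Q S)" "triple_comp T Q S w g = v f" using bspec[OF Q(3) mem] unfolding prod.case by (rule bexE)
        have "snd (v f) y = snd w \<zero>\<^bsub>lower Q\<^esub>" using comp_eqD(2)[OF w(2) y(1)] y(2) by simp
        also have "\<dots> = \<zero>\<^bsub>B'\<^esub>" using mod_hom_zero[OF ob_lower[OF QO] ob_lower[OF SO] hom_snd[OF w(1)]] S(2) by simp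
        finally have "\<sigma> (f y) = \<zero>\<^bsub>B'\<^esub>" using v f y(1) by (simp add: compose_eq)
        then have "\<tau> (\<sigma> (f y)) = \<zero>\<^bsub>B\<^esub>" using mod_hom_zero[OF fg_moduleD[OF B'(1)] artB.A.regular_left_module B'(3)] by simp
        moreover have "f y \<in> carrier B" using mod_hom_closed[OF subsetD[OF F2(2) f] y(1)] by simp
        ultimately show ?thesis using B'(4)[of "f y"] by simp
      qed
      then show ?thesis using F2(3) y(1) by blast
    qed
    then have inj2: "inj_on (snd g) (carrier (lower T))"
      unfolding mod_hom_inj_iff[OF ob_lower[OF T] ob_lower[OF QO] hom_snd[OF Q(2)]] by blast
    have pure: "\<exists>s \<in> carrier (TT T). tm T Q (snd g) s = t \<and> x = struct T s"
      if x: "x \<in> carrier (upper T)" and t: "t \<in> carrier (TT Q)" and eq: "fst g x = struct Q t" for x t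
    proof -
      have "f x = \<zero>\<^bsub>A\<^esub>" if f: "f \<in> F1" for f
      proof -
        have mem: "(?A, u f) \<in> ?F" using f by blast
        obtain w where w: "w \<in> carrier (Mor Q ?A)" "triple_comp T Q ?A w g = u f" using bspec[OF Q(3) mem] unfolding prod.case by (rule bexE)
        have "tm Q ?A (snd w) t = \<zero>\<^bsub>TT ?A\<^esub>"
          using tensor_zero_module tensor_map_closed[OF QO AO hom_snd[OF w(1)] t] by simp
        then have "fst (u f) x = struct ?A \<zero>\<^bsub>TT ?A\<^esub>"
          using comp_eqD(1)[OF w(2) x] eq hom_comm[OF w(1) t] by simp
        also have "\<dots> = \<zero>\<^bsub>A'\<^esub>" using mod_hom_zero[OF ob_tensor[OF AO] ob_upper[OF AO] ob_struct[OF AO]] by simp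
        finally have "a (f x) = \<zero>\<^bsub>A'\<^esub>" using x by (simp add: u_def compose_eq)
        then have "b (a (f x)) = \<zero>\<^bsub>A\<^esub>" using mod_hom_zero[OF fg_moduleD[OF A'(1)] artA.A.regular_left_module A'(3)] by simp
        moreover have "f x \<in> carrier A" using mod_hom_closed[OF subsetD[OF F1(2) f] x] by simp
        ultimately show ?thesis using A'(4)[of "f x"] by simp
      qed
      then have "x \<in> ?K" using F1(4) x by blast
      then obtain s where s: "s \<in> carrier (TT T)" "x = struct T s" by blast
      have "struct Q (tm T Q (snd g) s) = struct Q t" using hom_comm[OF Q(2) s(1)] eq s(2) by simp
      then have "tm T Q (snd g) s = t"
        by (rule inj_onD[OF ob_inj[OF QO]]) (use t tensor_map_closed[OF T QO hom_snd[OF Q(2)] s(1)] in auto)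
      then show ?thesis using s by blast
    qed
    have "x = \<zero>\<^bsub>upper T\<^esub>" if x: "x \<in> carrier (upper T)" and eq: "fst g x = \<zero>\<^bsub>upper Q\<^esub>" for x
    proof -
      interpret TQ: left_module A "TT Q" by (rule ob_tensor[OF QO])
      have "fst g x = struct Q \<zero>\<^bsub>TT Q\<^esub>" using eq mod_hom_zero[OF ob_tensor[OF QO] ob_upper[OF QO] ob_struct[OF QO]] by simp
      then obtain s where s: "s \<in> carrier (TT T)" "tm T Q (snd g) s = \<zero>\<^bsub>TT Q\<^esub>" "x = struct T s"
        using pure[OF x TQ.X.zero_closed] by blast
      then have "s = \<zero>\<^bsub>TT T\<^esub>" by (intro tensor_map_inj[OF ob_lower[OF T] ob_lower[OF QO] hom_snd[OF Q(2)] inj2])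
      then show ?thesis using s(3) mod_hom_zero[OF ob_tensor[OF T] ob_upper[OF T] ob_struct[OF T]] by simp
    qed
    then have "inj_on (fst g) (carrier (upper T))"
      unfolding mod_hom_inj_iff[OF ob_upper[OF T] ob_upper[OF QO] hom_fst[OF Q(2)]] by blast
    then have "inflation T Q g" unfolding inflation_iff pure_mono_def using T QO Q(2) inj2 pure by blast
    then show ?thesis using Q(1) by blast
  qed
  show ?thesis
  proof (intro frobenius_category.intro frobenius_category_axioms.intro mono_exact_category)
    fix X assume X: "X \<in> Obs"
    show "\<exists>P p. projective_object P \<and> deflation P X p" using cover[OF X] unfolding good_def by blast
    show "\<exists>E i. injective_object E \<and> inflation X E i" using cocover[OF X] unfolding good_def by blast
  next
    fix X
    show "projective_object X \<longleftrightarrow> injective_object X"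
    proof
      assume P: "projective_object X"
      then have X: "X \<in> Obs" by (simp add: projective_object_def)
      obtain Q g where Q: "good Q" "deflation Q X g" using cover[OF X] by blast
      obtain s where s: "s \<in> carrier (Mor X Q)" "triple_comp X Q X g s = triple_id X"
        using P Q(2) id_hom[OF X] unfolding projective_object_def by blast
      show "injective_object X"
        by (rule injective_retract[OF _ X _ s infl]) (use Q defl[OF Q(2)] in \<open>auto simp: good_def\<close>)
    next
      assume E: "injective_object X"
      then have X: "X \<in> Obs" by (simp add: injective_object_def)
      obtain Q g where Q: "good Q" "inflation X Q g" using cocover[OF X] by blast
      obtain r where r: "r \<in> carrier (Mor Q X)" "triple_comp X Q X r g = triple_id X"
        using E Q(2) id_hom[OF X] unfolding injective_object_def by blast
      show "projective_object X"
        by (rule projective_retract[OF _ X r(1) _ r(2) defl]) (use Q infl[OF Q(2)] in \<open>auto simp: good_def\<close>)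
    qed
  qed
qed

end

lemma fg_bimodule_of_triangular:
  fixes A :: "('r, 'a) module" and B :: "('r, 'b) module" and M :: "('a, 'm, 'b) bimodule"
  assumes A: "artin_algebra R A" and B: "artin_algebra R B" and M: "bimodule A M B"
    and T: "artin_algebra R (triangular_algebra A M B)"
  shows "fg_module A M"
proof -
  interpret A: artin_algebra R A by (rule A)
  interpret B: artin_algebra R B by (rule B)
  interpret M: bimodule A M B by (rule M)
  interpret T: artin_algebra R "triangular_algebra A M B" by (rule T)
  interpret TM: left_module R "triangular_algebra A M B" by (rule T.left_module_over_base)
  let ?T = "triangular_algebra A M B"
  have Ts [simp]: "carrier ?T = carrier A \<times> carrier M \<times> carrier B" "\<zero>\<^bsub>?T\<^esub> = (\<zero>\<^bsub>A\<^esub>, \<zero>\<^bsub>M\<^esub>, \<zero>\<^bsub>B\<^esub>)"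
    "(a, m, b) \<oplus>\<^bsub>?T\<^esub> (a', m', b') = (a \<oplus>\<^bsub>A\<^esub> a', m \<oplus>\<^bsub>M\<^esub> m', b \<oplus>\<^bsub>B\<^esub> b')"
    "r \<odot>\<^bsub>?T\<^esub> (a, m, b) = (r \<odot>\<^bsub>A\<^esub> a, (r \<odot>\<^bsub>A\<^esub> \<one>\<^bsub>A\<^esub>) \<odot>\<^bsub>M\<^esub> m, r \<odot>\<^bsub>B\<^esub> b)" for a m b a' m' b' r
    by (simp_all add: triangular_algebra_def)
  obtain S where S: "finite S" "S \<subseteq> carrier ?T" "\<forall>H. submodule H R ?T \<and> S \<subseteq> H \<longrightarrow> H = carrier ?T"
    using T.finitely_generated unfolding finitely_generated_def by blast
  show ?thesis
  proof (rule fg_moduleI[OF M.left.left_module_axioms, of "(\<lambda>x. fst (snd x)) ` S"])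
    fix H assume H: "submodule H A M" "(\<lambda>x. fst (snd x)) ` S \<subseteq> H"
    note HD = submoduleD[OF H(1)]
    have "submodule (carrier A \<times> H \<times> carrier B) R ?T"
      by (rule TM.submoduleI) (use HD in auto)
    moreover have "S \<subseteq> carrier A \<times> H \<times> carrier B" using S(2) H(2) by force
    ultimately have eq: "carrier A \<times> H \<times> carrier B = carrier ?T" using S(3) by blast
    show "carrier M \<subseteq> H"
    proof
      fix m assume "m \<in> carrier M"
      then have "(\<zero>\<^bsub>A\<^esub>, m, \<zero>\<^bsub>B\<^esub>) \<in> carrier A \<times> H \<times> carrier B" unfolding eq by simp
      then show "m \<in> H" by simp
    qed
  qed (use S in auto)
qed

theorem corollary2p3:
  fixes R :: "'r ring"
    and A :: "('r, 'a) module"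
    and B :: "('r, 'b) module"
    and M :: "('a, 'm, 'b) bimodule"
  assumes "artin_algebra R A"
    and "artin_algebra R B"
    and "bimodule A M B"
    and "artin_algebra R (triangular_algebra A M B)"
    and "projective_module (opposite_ring B) (right_module_of M)"
  shows "frobenius_category (mono_objects A M B) (triple_hom A M B) triple_comp triple_id
           (mono_conflation A M B)
         \<longleftrightarrow> selfinjective A \<and> selfinjective B \<and> projective_module A M"
proof -
  interpret M: bimodule A M B by (rule assms(3))
  obtain n :: nat and e f where ef:
    "\<forall>i < n. e i \<in> carrier (right_module_of M) \<and>
       f i \<in> mod_hom (opposite_ring B) (right_module_of M) (regular_module (opposite_ring B))"
    "\<forall>p \<in> carrier (right_module_of M). finsum (right_module_of M) (\<lambda>i. f i p \<odot>\<^bsub>right_module_of M\<^esub> e i) {..<n} = p"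
    using dual_basis[OF assms(5)] by blast
  have f: "f i \<in> mod_hom (opposite_ring B) (right_module_of M) (regular_module (opposite_ring B))" if "i < n" for i
    using ef(1) that by blast
  have "dual_basis_bimodule A M B n e f"
  proof (intro dual_basis_bimodule.intro dual_basis_bimodule_axioms.intro assms(3))
    fix m assume m: "m \<in> carrier M"
    let ?g = "\<lambda>i. f i m \<odot>\<^bsub>right_module_of M\<^esub> e i"
    have "finsum (right_module_of M) ?g {..<n} = finsum M ?g {..<n}"
    proof (rule additive_map_finsum[where h = "\<lambda>x. x"])
      show "?g i \<in> carrier (right_module_of M)" if "i \<in> {..<n}" for i
        using ef(1) mod_hom_closed[OF f[of i], of m] that m by (intro M.right.smult_closed) auto
    qed (auto simp: M.right.X.abelian_group_axioms M.left.X.abelian_group_axioms)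
    then show "finsum M (\<lambda>i. e i \<odot>\<^sub>r\<^bsub>M\<^esub> f i m) {..<n} = m" using ef(2) m by simp
  next
    fix i m assume i: "i < n" and m: "m \<in> carrier M"
    show "f i m \<in> carrier B" using mod_hom_closed[OF f[OF i], of m] m by simp
    show "f i (m \<oplus>\<^bsub>M\<^esub> m') = f i m \<oplus>\<^bsub>B\<^esub> f i m'" if "m' \<in> carrier M" for m'
      using mod_hom_add[OF f[OF i], of m m'] m that by simp
    show "f i (m \<odot>\<^sub>r\<^bsub>M\<^esub> b) = f i m \<otimes>\<^bsub>B\<^esub> b" if "b \<in> carrier B" for b
      using mod_hom_smult[OF f[OF i], of b m] m that by simp
  qed (use ef in simp)
  then interpret mono_category R A B M n e f
    using fg_bimodule_of_triangular[OF assms(1-4)] assms(1,2)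
    by (intro mono_category.intro mono_category_axioms.intro)
  show ?thesis using frobenius_imp frobenius_if by blast
qed

end
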